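(* For every integer $n\geq 1$, the $(3,1)$-polygraph $\Sigma^{\mathrm{styl,coh}}(n)$ (defined in the context) is a finite coherent presentation of the stylic monoid $\mathrm{Styl}_n$. After identifying each generator $r_x$ ($x\in[n]$) with the letter $x$, its underlying $2$-polygraph is the letter presentation $\Sigma^{\mathrm{styl}}(n)$, whose generating $1$-cells are the letters of $[n]$ and whose generating $2$-cells are $\eta_x\colon xx\Rightarrow x$ ($x\in[n]$), $\kappa_{x,y,z}\colon zxy\Rightarrow xzy$ ($x\leq y<z$) and $\lambda_{x,y,z}\colon yzx\Rightarrow yxz$ ($x<y\leq z$). Its generating $3$-cells form an effectively computable finite homotopy basis of the track $2$-category $\Sigma^{\mathrm{styl}}(n)_2^\top$.
   Context: **Rows and $N$-tableaux.** Fix $n\geq1$, $[n]=\{1<2<\cdots<n\}$. For a word $w$ over $[n]$, $\ell(w)$ is its length and $\mathrm{supp}(w)$ its set of letters. A row is a nonempty strictly increasing word over $[n]$, identified with its support; $\mathcal R_n$ is the set of rows, and $\overline{\mathcal R}_n$ the set of rows of length $\geq2$. For rows $u,v$, $u\triangleleft v$ means $\mathrm{supp}(u)\subseteq\mathrm{supp}(v)$ and $\min(v)<\min(u)$. An $N$-tableau $T$ is a finite sequence of rows $u_k,\dots,u_1$ (top to bottom) with $u_{i+1}\triangleleft u_i$ for all $i$; $\mathcal R(T):=r_{u_k}\cdots r_{u_1}$ is its row-generator reading. Right $N$-insertion of a letter $x$: insert $x$ in the bottom row $u_1$, i.e. replace $u_1$ by the row with support $\mathrm{supp}(u_1)\cup\{x\}$;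 if $u_1$ has a letter $>x$, the smallest such letter $y$ is bumped (it also stays in the row) and is inserted in the same way into the next row above, and so on; a letter bumped from the top row creates a new top row consisting of that letter. For a word $w$, $N(w)$ is obtained by inserting its letters from left to right starting from the empty tableau (inserting $x$ in the empty tableau gives the one-row tableau $x$). For rows $u,v$, $N(uv)$ has at most two rows. **Polygraphs.** A $2$-polygraph $\Sigma=(\Sigma_1,\Sigma_2)$ is a set $\Sigma_1$ together with a set $\Sigma_2$ of $2$-cells $\beta\colon u\Rightarrow v$ between words of $\Sigma_1^*$; it presents the quotient $\overline\Sigma$ of $\Sigma_1^*$ by the congruence generated by $\Sigma_2$. $\Sigma_2^*$ (resp. $\Sigma_2^\top$) is the free $2$-category (resp. free $(2,1)$-category, called track $2$-category) on $\Sigma$; $0$-composition is written by juxtaposition, $1$-composition by $\star_1$. A $(3,1)$-polygraph $(\Sigma,\Sigma_3)$ is a $2$-polygraph with a set $\Sigma_3$ of generating $3$-cells $A\colon f\Rrightarrow g$ between parallel $2$-cells $f,g$ of $\Sigma_2^\top$. $\Sigma_3$ is a homotopy basis of $\Sigma_2^\top$ if every pair of parallel $2$-cells $(f,g)$ of $\Sigma_2^\top$ is filled by a $3$-cell $f\Rrightarrow g$ of the free $(3,1)$-category generated by $(\Sigma,\Sigma_3)$. $(\Sigma,\Sigma_3)$ is a coherent presentation of a monoid $M$ if $\Sigma$ presents $M$ and $\Sigma_3$ is a homotopy basis of $\Sigma_2^\top$; it is finite if all generating sets are finite. The stylic monoid $\mathrm{Styl}_n$ is the monoid presented by $\Sigma^{\mathrm{styl}}(n)$.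 **Row presentation.** $\Sigma^{\mathrm{row}}(n)$ has generating $1$-cells $r_u$, $u\in\mathcal R_n$, and generating $2$-cells $\alpha_{u,v}\colon r_ur_v\Rightarrow\mathcal R(N(uv))$ for all rows $u,v$ with $u\not\triangleleft v$. It is known to be convergent and to present $\mathrm{Styl}_n$, with irreducible words the $\mathcal R(T)$, $T$ an $N$-tableau. For a word $w$ in the $r_u$, $\Lambda_w\colon w\Rightarrow\widehat w$ is the leftmost normalization path to its normal form $\widehat w$ (always rewrite the leftmost reducible adjacent pair). $\mathfrak C_n=\{(u,v,t)\in\mathcal R_n^3\mid u\not\triangleleft v,\ v\not\triangleleft t\}$. For a row $u$ with $\ell(u)\ge2$, $\partial u$ is $u$ with its first letter removed; $\mathfrak S_n=\{(u,v,t)\in\mathfrak C_n\mid \ell(u)\geq2,\ \partial u\not\triangleleft v\}$; $\mathfrak T^{(1)}_n=\mathfrak C_n\setminus\mathfrak S_n$. For $\tau=(u,v,t)\in\mathfrak C_n$ put $L_\tau=(\alpha_{u,v}1_{r_t})\star_1\Lambda_{\mathcal R(N(uv))r_t}$ and $R_\tau=(1_{r_u}\alpha_{v,t})\star_1\Lambda_{r_u\mathcal R(N(vt))}$, two paths from $r_ur_vr_t$ to its normal form. **Selected row cells.** A pair $(\tau,\beta)$, with $\tau\in\mathfrak T_n^{(1)}$ and $\beta=\alpha_{p,q}$, is eligible if $\beta$ occurs in $L_\tau$ or $R_\tau$ as a rewriting step with source exactly $r_pr_q$ (empty context), and this is the only occurrence of $\beta$ in $L_\tau$ and $R_\tau$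 together (occurrences in any context counted). For an eligible pair, let $U$ be the one of $L_\tau,R_\tau$ containing $\beta$, $V$ the other, write $U=f\star_1\beta\star_1g$ and put $S_{\tau,\beta}=f^{-1}\star_1V\star_1g^{-1}$. A dependency of $(\tau,\beta)$ is a generating row $2$-cell occurring, itself or its inverse, in the expression $S_{\tau,\beta}$. Order the cells $\alpha_{u,v}$ lexicographically by $(\ell(u)+\ell(v),\ell(u),u,v)$ (rows compared lexicographically, a proper prefix being smaller), triples lexicographically by their three rows, and eligible pairs lexicographically by $(\beta,\tau)$. Scan the eligible pairs in increasing order, keeping $(\tau,\beta)$ iff neither $\tau$ nor $\beta$ occurs in an already kept pair. Let $\mathcal B_n^{\mathrm{match}}$ be the set of $\beta$ in kept pairs, $\tau_\beta$ the triple kept with $\beta$, $S_\beta=S_{\tau_\beta,\beta}$. Let $G$ be the directed graph on $\mathcal B_n^{\mathrm{match}}$ with an edge $\beta'\to\beta$ iff $\beta'$ is a dependency of $(\tau_\beta,\beta)$. Scan $\mathcal B_n^{\mathrm{match}}$ in increasing order, keeping $\beta$ iff the subgraph of $G$ induced by the already kept vertices and $\beta$ is acyclic; the kept set is $\mathcal B_n^{\mathrm{acyc}}$. **Reduced row presentation.** Let $\Sigma^{\mathrm{row,red}}(n)$ have generating $1$-cells $r_u$ ($u\in\mathcal R_n$) and generating $2$-cells $\Sigma^{\mathrm{row}}_2(n)\setminus\mathcal B_n^{\mathrm{acyc}}$. Let $\mathsf{Red}_n\colon\Sigma^{\mathrm{row}}(n)_2^\top\to\Sigma^{\mathrm{row,red}}(n)_2^\top$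 be the $2$-functor fixing $1$-cells and surviving row cells, with $\mathsf{Red}_n(\beta)=\mathsf{Red}_n(S_\beta)$ for $\beta\in\mathcal B_n^{\mathrm{acyc}}$ (well defined by acyclicity). The generating $3$-cells of $\Sigma^{\mathrm{row,red}}(n)$ are $\mathcal X_\tau\colon\mathsf{Red}_n(L_\tau)\Rrightarrow\mathsf{Red}_n(R_\tau)$ for $\tau\in\mathfrak T_n^{(1)}\setminus\{\tau_\beta\mid\beta\in\mathcal B_n^{\mathrm{acyc}}\}$. **Pre-row presentation.** $\Sigma^{\mathrm{prerow}}(n)$ has generating $1$-cells $r_u$, $u\in\mathcal R_n$, and generating $2$-cells $\eta^r_x\colon r_xr_x\Rightarrow r_x$; $\kappa^r_{x,y,z}\colon r_zr_xr_y\Rightarrow r_xr_zr_y$ ($x\le y<z$); $\lambda^r_{x,y,z}\colon r_yr_zr_x\Rightarrow r_yr_xr_z$ ($x<y\le z$); and $\gamma_u\colon r_{x_1}\cdots r_{x_k}\Rightarrow r_u$ for $u=x_1\cdots x_k\in\overline{\mathcal R}_n$. For words $U,V$ in the letter generators $r_x$ representing the same element of $\mathrm{Styl}_n$, $\Pi_{U,V}\colon U\Rightarrow V$ is the shortest path made of applications of $\eta^r,\kappa^r,\lambda^r$ and their inverses, and the lexicographically least among the shortest ones, elementary steps being ordered first by position from left to right, then by $\eta^r\prec\kappa^r\prec\lambda^r\prec(\eta^r)^{-1}\prec(\kappa^r)^{-1}\prec(\lambda^r)^{-1}$, then lexicographically by parameters. For $w=r_{u_1}\cdots r_{u_k}$,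 $\mathrm{flat}(w)$ is obtained by replacing each $r_{u_i}$, $u_i=x_1\cdots x_p$, by $r_{x_1}\cdots r_{x_p}$, and $E_w\colon w\Rightarrow\mathrm{flat}(w)$ is the $0$-composite of the cells $\gamma_{u_i}^{-1}$ (identity if $\ell(u_i)=1$). For rows $u\not\triangleleft v$, with $s=r_ur_v$ and $t=\mathcal R(N(uv))$, put $P_{u,v}=E_s\star_1\Pi_{\mathrm{flat}(s),\mathrm{flat}(t)}\star_1E_t^{-1}$. **Transport.** For a generating $2$-cell $\delta\colon s\Rightarrow t$ of $\Sigma^{\mathrm{prerow}}(n)$ put $Q_\delta=\mathsf{Red}_n(\Lambda_s\star_1\Lambda_t^{-1})$. Let $\mathcal E_n$ be the $2$-functor, to $\Sigma^{\mathrm{prerow}}(n)_2^\top$, fixing $1$-cells and pre-row $2$-cells and sending every surviving row cell $\alpha_{u,v}$ to $P_{u,v}$. $\Sigma^{\mathrm{prerow,coh}}(n)$ is the $(3,1)$-polygraph over $\Sigma^{\mathrm{prerow}}(n)$ with generating $3$-cells $A^{\mathrm{prerow}}\colon\mathcal E_n(f)\Rrightarrow\mathcal E_n(g)$ for each generating $3$-cell $A\colon f\Rrightarrow g$ of $\Sigma^{\mathrm{row,red}}(n)$, and $B^{\mathrm{prerow}}_\delta\colon\mathcal E_n(Q_\delta)\Rrightarrow\delta$ for each generating $2$-cell $\delta$ of $\Sigma^{\mathrm{prerow}}(n)$. **The letter presentation.** $\Sigma^{\mathrm{styl,coh}}(n)$ is obtained from $\Sigma^{\mathrm{prerow,coh}}(n)$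 by removing all $r_u$ and $\gamma_u$ with $u\in\overline{\mathcal R}_n$, and keeping all generating $3$-cells with boundaries transformed by the $2$-functor sending $r_u$ to $r_{x_1}\cdots r_{x_k}$ and $\gamma_u$ to the identity for $u=x_1\cdots x_k\in\overline{\mathcal R}_n$, and fixing all other generators. "Effectively computable" means that there is an algorithm which, given $n$, lists the generating $3$-cells with their boundaries. *)

theory Defs
  imports
    "HOL-Algebra.Group"
    "HOL-Library.Nat_Bijection"
    "HOL-Library.Product_Lexorder"
    "HOL-Library.List_Lexorder"
begin

section \<open>Polygraphs\<close>

text \<open>Words over the generating 1-cells are lists. The boundary maps of generating cells are
  total functions of which only the values on the generating sets matter.\<close>

record ('a, 'b) polygraph2 =
  gen1 :: "'a set"
  gen2 :: "'b set"
  src2 :: "'b \<Rightarrow> 'a list"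
  tgt2 :: "'b \<Rightarrow> 'a list"

definition is_polygraph2 :: "('a, 'b) polygraph2 \<Rightarrow> bool" where
  "is_polygraph2 P \<longleftrightarrow>
     (\<forall>\<beta>\<in>gen2 P. src2 P \<beta> \<in> lists (gen1 P) \<and> tgt2 P \<beta> \<in> lists (gen1 P))"

definition polygraph2_iso ::
    "('a \<Rightarrow> 'c) \<Rightarrow> ('b \<Rightarrow> 'd) \<Rightarrow> ('a, 'b) polygraph2 \<Rightarrow> ('c, 'd) polygraph2 \<Rightarrow> bool" where
  "polygraph2_iso f g P Q \<longleftrightarrow>
     bij_betw f (gen1 P) (gen1 Q) \<and> bij_betw g (gen2 P) (gen2 Q) \<and>
     (\<forall>\<beta>\<in>gen2 P. src2 Q (g \<beta>) = map f (src2 P \<beta>) \<and> tgt2 Q (g \<beta>) = map f (tgt2 P \<beta>))"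

inductive word_cong :: "('a, 'b) polygraph2 \<Rightarrow> 'a list \<Rightarrow> 'a list \<Rightarrow> bool" for P where
  cell: "\<beta> \<in> gen2 P \<Longrightarrow> word_cong P (src2 P \<beta>) (tgt2 P \<beta>)"
| refl: "u \<in> lists (gen1 P) \<Longrightarrow> word_cong P u u"
| sym: "word_cong P u v \<Longrightarrow> word_cong P v u"
| trans: "word_cong P u v \<Longrightarrow> word_cong P v w \<Longrightarrow> word_cong P u w"
| append: "word_cong P u u' \<Longrightarrow> word_cong P v v' \<Longrightarrow> word_cong P (u @ v) (u' @ v')"

definition presented_monoid :: "('a, 'b) polygraph2 \<Rightarrow> 'a list set monoid" where
  "presented_monoid P =
     (let R = {(u, v). word_cong P u v} in
      \<lparr>carrier = lists (gen1 P) // R,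
       mult = (\<lambda>A B. \<Union>u\<in>A. \<Union>v\<in>B. R `` {u @ v}),
       one = R `` {[]}\<rparr>)"

definition presents :: "('a, 'b) polygraph2 \<Rightarrow> ('m, 'k) monoid_scheme \<Rightarrow> bool" where
  "presents P M \<longleftrightarrow> presented_monoid P \<cong> M"

subsection \<open>The track 2-category\<close>

text \<open>\<open>Step w \<beta> e w'\<close> is the whiskered generator \<open>w \<beta> w'\<close> if \<open>e\<close> holds, and \<open>w \<beta>\<inverse> w'\<close> otherwise.
  A formal 2-cell is its source word together with a list of consecutive steps (the source is
  needed for identities). The 2-cells of the free (2,1)-category are the classes of formal 2-cells
  under cancellation of inverse steps and exchange of steps at disjoint positions.\<close>

datatype ('a, 'b) step =
  Step (lctx: "'a list") (gen: "'b") (fwd: bool) (rctx: "'a list")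

type_synonym ('a, 'b) zigzag = "'a list \<times> ('a, 'b) step list"

definition cell_src :: "('a, 'b) polygraph2 \<Rightarrow> 'b \<Rightarrow> bool \<Rightarrow> 'a list" where
  "cell_src P \<beta> e = (if e then src2 P \<beta> else tgt2 P \<beta>)"

definition cell_tgt :: "('a, 'b) polygraph2 \<Rightarrow> 'b \<Rightarrow> bool \<Rightarrow> 'a list" where
  "cell_tgt P \<beta> e = (if e then tgt2 P \<beta> else src2 P \<beta>)"

fun step_src :: "('a, 'b) polygraph2 \<Rightarrow> ('a, 'b) step \<Rightarrow> 'a list" where
  "step_src P (Step w \<beta> e w') = w @ cell_src P \<beta> e @ w'"

fun step_tgt :: "('a, 'b) polygraph2 \<Rightarrow> ('a, 'b) step \<Rightarrow> 'a list" where
  "step_tgt P (Step w \<beta> e w') = w @ cell_tgt P \<beta> e @ w'"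

fun is_step :: "('a, 'b) polygraph2 \<Rightarrow> ('a, 'b) step \<Rightarrow> bool" where
  "is_step P (Step w \<beta> e w') \<longleftrightarrow>
     \<beta> \<in> gen2 P \<and> w \<in> lists (gen1 P) \<and> w' \<in> lists (gen1 P)"

fun inv_step :: "('a, 'b) step \<Rightarrow> ('a, 'b) step" where
  "inv_step (Step w \<beta> e w') = Step w \<beta> (\<not> e) w'"

fun whisker :: "'a list \<Rightarrow> 'a list \<Rightarrow> ('a, 'b) step \<Rightarrow> ('a, 'b) step" where
  "whisker l r (Step w \<beta> e w') = Step (l @ w) \<beta> e (w' @ r)"

definition inv_steps :: "('a, 'b) step list \<Rightarrow> ('a, 'b) step list" where
  "inv_steps p = rev (map inv_step p)"

fun path :: "('a, 'b) polygraph2 \<Rightarrow> 'a list \<Rightarrow> ('a, 'b) step list \<Rightarrow> 'a list \<Rightarrow> bool" where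
  "path P u [] v \<longleftrightarrow> u \<in> lists (gen1 P) \<and> u = v"
| "path P u (s # p) v \<longleftrightarrow> is_step P s \<and> step_src P s = u \<and> path P (step_tgt P s) p v"

fun zz_src :: "('a, 'b) zigzag \<Rightarrow> 'a list" where
  "zz_src (u, p) = u"

fun zz_tgt :: "('a, 'b) polygraph2 \<Rightarrow> ('a, 'b) zigzag \<Rightarrow> 'a list" where
  "zz_tgt P (u, p) = (if p = [] then u else step_tgt P (last p))"

fun is_zigzag :: "('a, 'b) polygraph2 \<Rightarrow> ('a, 'b) zigzag \<Rightarrow> bool" where
  "is_zigzag P (u, p) \<longleftrightarrow> (\<exists>v. path P u p v)"

definition parallel :: "('a, 'b) polygraph2 \<Rightarrow> ('a, 'b) zigzag \<Rightarrow> ('a, 'b) zigzag \<Rightarrow> bool" where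
  "parallel P f g \<longleftrightarrow> zz_src f = zz_src g \<and> zz_tgt P f = zz_tgt P g"

fun zz_comp0 :: "('a, 'b) polygraph2 \<Rightarrow> ('a, 'b) zigzag \<Rightarrow> ('a, 'b) zigzag \<Rightarrow> ('a, 'b) zigzag" where
  "zz_comp0 P (u, p) (v, q) =
     (u @ v, map (whisker [] v) p @ map (whisker (zz_tgt P (u, p)) []) q)"

fun zz_comp1 :: "('a, 'b) zigzag \<Rightarrow> ('a, 'b) zigzag \<Rightarrow> ('a, 'b) zigzag" where
  "zz_comp1 (u, p) (v, q) = (u, p @ q)"

inductive zz_eq :: "('a, 'b) polygraph2 \<Rightarrow> ('a, 'b) zigzag \<Rightarrow> ('a, 'b) zigzag \<Rightarrow> bool" for P where
  refl: "is_zigzag P f \<Longrightarrow> zz_eq P f f"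
| sym: "zz_eq P f g \<Longrightarrow> zz_eq P g f"
| trans: "zz_eq P f g \<Longrightarrow> zz_eq P g h \<Longrightarrow> zz_eq P f h"
| cancel: "is_zigzag P (u, p @ [s, inv_step s] @ q) \<Longrightarrow>
    zz_eq P (u, p @ [s, inv_step s] @ q) (u, p @ q)"
| exchange: "is_zigzag P
      (u, p @ [Step w \<alpha> d (m @ cell_src P \<beta> e @ w'), Step (w @ cell_tgt P \<alpha> d @ m) \<beta> e w'] @ q) \<Longrightarrow>
    zz_eq P
      (u, p @ [Step w \<alpha> d (m @ cell_src P \<beta> e @ w'), Step (w @ cell_tgt P \<alpha> d @ m) \<beta> e w'] @ q)
      (u, p @ [Step (w @ cell_src P \<alpha> d @ m) \<beta> e w', Step w \<alpha> d (m @ cell_tgt P \<beta> e @ w')] @ q)"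

definition track2 :: "('a, 'b) polygraph2 \<Rightarrow> ('a, 'b) zigzag \<Rightarrow> ('a, 'b) zigzag set" where
  "track2 P f = {g. zz_eq P f g}"

text \<open>The 2-functor determined by a map \<open>F\<^sub>1\<close> from generating 1-cells to words and a map \<open>F\<^sub>2\<close> from
  generating 2-cells to formal 2-cells (given by their steps), on formal 2-cells.\<close>

definition map_word :: "('a \<Rightarrow> 'c list) \<Rightarrow> 'a list \<Rightarrow> 'c list" where
  "map_word F\<^sub>1 w = concat (map F\<^sub>1 w)"

fun map_step :: "('a \<Rightarrow> 'c list) \<Rightarrow> ('b \<Rightarrow> ('c, 'd) step list) \<Rightarrow> ('a, 'b) step \<Rightarrow> ('c, 'd) step list"
  where
  "map_step F\<^sub>1 F\<^sub>2 (Step w \<beta> e w') =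
     map (whisker (map_word F\<^sub>1 w) (map_word F\<^sub>1 w')) (if e then F\<^sub>2 \<beta> else inv_steps (F\<^sub>2 \<beta>))"

definition map_steps ::
    "('a \<Rightarrow> 'c list) \<Rightarrow> ('b \<Rightarrow> ('c, 'd) step list) \<Rightarrow> ('a, 'b) step list \<Rightarrow> ('c, 'd) step list" where
  "map_steps F\<^sub>1 F\<^sub>2 p = concat (map (map_step F\<^sub>1 F\<^sub>2) p)"

fun map_zigzag ::
    "('a \<Rightarrow> 'c list) \<Rightarrow> ('b \<Rightarrow> ('c, 'd) step list) \<Rightarrow> ('a, 'b) zigzag \<Rightarrow> ('c, 'd) zigzag" where
  "map_zigzag F\<^sub>1 F\<^sub>2 (u, p) = (map_word F\<^sub>1 u, map_steps F\<^sub>1 F\<^sub>2 p)"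

subsection \<open>(3,1)-polygraphs and the free (3,1)-category\<close>

text \<open>The boundary of a generating 3-cell is given by representatives of 2-cells of the track
  2-category.\<close>

record ('a, 'b, 'c) polygraph31 =
  base :: "('a, 'b) polygraph2"
  gen3 :: "'c set"
  src3 :: "'c \<Rightarrow> ('a, 'b) zigzag"
  tgt3 :: "'c \<Rightarrow> ('a, 'b) zigzag"

definition is_polygraph31 :: "('a, 'b, 'c) polygraph31 \<Rightarrow> bool" where
  "is_polygraph31 Q \<longleftrightarrow> is_polygraph2 (base Q) \<and>
     (\<forall>A\<in>gen3 Q. is_zigzag (base Q) (src3 Q A) \<and> is_zigzag (base Q) (tgt3 Q A) \<and>
        parallel (base Q) (src3 Q A) (tgt3 Q A))"

text \<open>3-cells of the free (3,1)-category are the classes of well-formed formal composites under the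
  axioms of a (3,1)-category. \<open>Comp i\<close> stands for the \<open>i\<close>-composition (\<open>i \<le> 2\<close>), \<open>Inv3\<close> for the
  inverse with respect to 2-composition; inverses of 3-cells for 1-composition are then
  expressible, since 2-cells are invertible.\<close>

datatype ('a, 'b, 'c) expr3 =
  Gen3 'c
| Unit3 "('a, 'b) zigzag"
| Inv3 "('a, 'b, 'c) expr3"
| Comp nat "('a, 'b, 'c) expr3" "('a, 'b, 'c) expr3"

definition comp2cells ::
    "('a, 'b) polygraph2 \<Rightarrow> nat \<Rightarrow> ('a, 'b) zigzag \<Rightarrow> ('a, 'b) zigzag \<Rightarrow> ('a, 'b) zigzag" where
  "comp2cells P i f g = (if i = 0 then zz_comp0 P f g else zz_comp1 f g)"

fun esrc :: "('a, 'b, 'c) polygraph31 \<Rightarrow> ('a, 'b, 'c) expr3 \<Rightarrow> ('a, 'b) zigzag"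
and etgt :: "('a, 'b, 'c) polygraph31 \<Rightarrow> ('a, 'b, 'c) expr3 \<Rightarrow> ('a, 'b) zigzag" where
  "esrc Q (Gen3 A) = src3 Q A"
| "esrc Q (Unit3 f) = f"
| "esrc Q (Inv3 F) = etgt Q F"
| "esrc Q (Comp i F G) = (if i < 2 then comp2cells (base Q) i (esrc Q F) (esrc Q G) else esrc Q F)"
| "etgt Q (Gen3 A) = tgt3 Q A"
| "etgt Q (Unit3 f) = f"
| "etgt Q (Inv3 F) = esrc Q F"
| "etgt Q (Comp i F G) = (if i < 2 then comp2cells (base Q) i (etgt Q F) (etgt Q G) else etgt Q G)"

fun is_expr3 :: "('a, 'b, 'c) polygraph31 \<Rightarrow> ('a, 'b, 'c) expr3 \<Rightarrow> bool" where
  "is_expr3 Q (Gen3 A) \<longleftrightarrow> A \<in> gen3 Q"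
| "is_expr3 Q (Unit3 f) \<longleftrightarrow> is_zigzag (base Q) f"
| "is_expr3 Q (Inv3 F) \<longleftrightarrow> is_expr3 Q F"
| "is_expr3 Q (Comp i F G) \<longleftrightarrow> is_expr3 Q F \<and> is_expr3 Q G \<and>
     (i = 0
      \<or> i = 1 \<and> zz_tgt (base Q) (esrc Q F) = zz_src (esrc Q G)
      \<or> i = 2 \<and> zz_eq (base Q) (etgt Q F) (esrc Q G))"

definition src_unit3 ::
    "('a, 'b, 'c) polygraph31 \<Rightarrow> nat \<Rightarrow> ('a, 'b, 'c) expr3 \<Rightarrow> ('a, 'b, 'c) expr3" where
  "src_unit3 Q i F =
     Unit3 (if i = 0 then ([], []) else if i = 1 then (zz_src (esrc Q F), []) else esrc Q F)"

definition tgt_unit3 ::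
    "('a, 'b, 'c) polygraph31 \<Rightarrow> nat \<Rightarrow> ('a, 'b, 'c) expr3 \<Rightarrow> ('a, 'b, 'c) expr3" where
  "tgt_unit3 Q i F =
     Unit3 (if i = 0 then ([], []) else if i = 1 then (zz_tgt (base Q) (esrc Q F), []) else etgt Q F)"

inductive axiom3 ::
    "('a, 'b, 'c) polygraph31 \<Rightarrow> ('a, 'b, 'c) expr3 \<Rightarrow> ('a, 'b, 'c) expr3 \<Rightarrow> bool" for Q where
  unit_cong: "zz_eq (base Q) f g \<Longrightarrow> axiom3 Q (Unit3 f) (Unit3 g)"
| assoc: "axiom3 Q (Comp i (Comp i F G) H) (Comp i F (Comp i G H))"
| unit_left: "axiom3 Q (Comp i (src_unit3 Q i F) F) F"
| unit_right: "axiom3 Q (Comp i F (tgt_unit3 Q i F)) F"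
| unit_comp: "i < 2 \<Longrightarrow> axiom3 Q (Comp i (Unit3 f) (Unit3 g)) (Unit3 (comp2cells (base Q) i f g))"
| exchange: "i < j \<Longrightarrow>
    axiom3 Q (Comp i (Comp j F F') (Comp j G G')) (Comp j (Comp i F G) (Comp i F' G'))"
| inv_right: "axiom3 Q (Comp 2 F (Inv3 F)) (Unit3 (esrc Q F))"
| inv_left: "axiom3 Q (Comp 2 (Inv3 F) F) (Unit3 (etgt Q F))"

inductive eq3 ::
    "('a, 'b, 'c) polygraph31 \<Rightarrow> ('a, 'b, 'c) expr3 \<Rightarrow> ('a, 'b, 'c) expr3 \<Rightarrow> bool" for Q where
  axiom: "axiom3 Q F G \<Longrightarrow> is_expr3 Q F \<Longrightarrow> is_expr3 Q G \<Longrightarrow> eq3 Q F G"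
| refl: "is_expr3 Q F \<Longrightarrow> eq3 Q F F"
| sym: "eq3 Q F G \<Longrightarrow> eq3 Q G F"
| trans: "eq3 Q F G \<Longrightarrow> eq3 Q G H \<Longrightarrow> eq3 Q F H"
| inv: "eq3 Q F G \<Longrightarrow> eq3 Q (Inv3 F) (Inv3 G)"
| comp: "eq3 Q F F' \<Longrightarrow> eq3 Q G G' \<Longrightarrow> is_expr3 Q (Comp i F G) \<Longrightarrow> is_expr3 Q (Comp i F' G') \<Longrightarrow>
    eq3 Q (Comp i F G) (Comp i F' G')"

definition free3 :: "('a, 'b, 'c) polygraph31 \<Rightarrow> ('a, 'b, 'c) expr3 set set" where
  "free3 Q = Collect (is_expr3 Q) // {(F, G). eq3 Q F G}"

definition source3 :: "('a, 'b, 'c) polygraph31 \<Rightarrow> ('a, 'b, 'c) expr3 set \<Rightarrow> ('a, 'b) zigzag set" where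
  "source3 Q \<Phi> = (\<Union>F\<in>\<Phi>. track2 (base Q) (esrc Q F))"

definition target3 :: "('a, 'b, 'c) polygraph31 \<Rightarrow> ('a, 'b, 'c) expr3 set \<Rightarrow> ('a, 'b) zigzag set" where
  "target3 Q \<Phi> = (\<Union>F\<in>\<Phi>. track2 (base Q) (etgt Q F))"

definition homotopy_basis :: "('a, 'b, 'c) polygraph31 \<Rightarrow> bool" where
  "homotopy_basis Q \<longleftrightarrow>
     (\<forall>f g. is_zigzag (base Q) f \<longrightarrow> is_zigzag (base Q) g \<longrightarrow> parallel (base Q) f g \<longrightarrow>
        (\<exists>\<Phi>\<in>free3 Q. source3 Q \<Phi> = track2 (base Q) f \<and> target3 Q \<Phi> = track2 (base Q) g))"

definition coherent_presentation ::
    "('a, 'b, 'c) polygraph31 \<Rightarrow> ('m, 'k) monoid_scheme \<Rightarrow> bool" where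
  "coherent_presentation Q M \<longleftrightarrow>
     is_polygraph31 Q \<and> presents (base Q) M \<and> homotopy_basis Q"

definition finite_polygraph31 :: "('a, 'b, 'c) polygraph31 \<Rightarrow> bool" where
  "finite_polygraph31 Q \<longleftrightarrow> finite (gen1 (base Q)) \<and> finite (gen2 (base Q)) \<and> finite (gen3 Q)"

section \<open>The letter presentation and the stylic monoid\<close>

datatype styl2 = Eta nat | Kappa nat nat nat | Lambda nat nat nat

fun styl_src :: "styl2 \<Rightarrow> nat list" where
  "styl_src (Eta x) = [x, x]"
| "styl_src (Kappa x y z) = [z, x, y]"
| "styl_src (Lambda x y z) = [y, z, x]"

fun styl_tgt :: "styl2 \<Rightarrow> nat list" where
  "styl_tgt (Eta x) = [x]"
| "styl_tgt (Kappa x y z) = [x, z, y]"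
| "styl_tgt (Lambda x y z) = [y, x, z]"

definition styl :: "nat \<Rightarrow> (nat, styl2) polygraph2" where
  "styl n =
     \<lparr>gen1 = {1..n},
      gen2 = {Eta x |x. x \<in> {1..n}} \<union>
             {Kappa x y z |x y z. {x, y, z} \<subseteq> {1..n} \<and> x \<le> y \<and> y < z} \<union>
             {Lambda x y z |x y z. {x, y, z} \<subseteq> {1..n} \<and> x < y \<and> y \<le> z},
      src2 = styl_src,
      tgt2 = styl_tgt\<rparr>"

definition Styl :: "nat \<Rightarrow> nat list set monoid" where
  "Styl n = presented_monoid (styl n)"

section \<open>Rows and the row presentation\<close>

type_synonym row = "nat list"

definition rows :: "nat \<Rightarrow> row set" where
  "rows n = {u. u \<noteq> [] \<and> sorted_wrt (<) u \<and> set u \<subseteq> {1..n}}"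

definition rows2 :: "nat \<Rightarrow> row set" where
  "rows2 n = {u \<in> rows n. length u \<ge> 2}"

definition ntri :: "row \<Rightarrow> row \<Rightarrow> bool" (infix \<open>\<lhd>\<^sub>N\<close> 50) where
  "u \<lhd>\<^sub>N v \<longleftrightarrow> set u \<subseteq> set v \<and> Min (set v) < Min (set u)"

text \<open>Tableaux are lists of rows from bottom to top, so that their reading reverses the list.\<close>

fun n_insert :: "nat \<Rightarrow> row list \<Rightarrow> row list" where
  "n_insert x [] = [[x]]"
| "n_insert x (u # T) =
     sorted_list_of_set (insert x (set u)) #
       (if \<exists>y\<in>set u. x < y then n_insert (Min {y \<in> set u. x < y}) T else T)"

definition n_tableau :: "nat list \<Rightarrow> row list" where
  "n_tableau w = foldl (\<lambda>T x. n_insert x T) [] w"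

definition reading :: "row list \<Rightarrow> row list" where
  "reading T = rev T"

text \<open>The generator \<open>r\<^sub>u\<close> is the row \<open>u\<close> itself, and the cell \<open>\<alpha>\<^sub>u\<^sub>,\<^sub>v\<close> is the pair \<open>(u, v)\<close>.\<close>

type_synonym row2 = "row \<times> row"
type_synonym triple = "row \<times> row \<times> row"

definition row_pres :: "nat \<Rightarrow> (row, row2) polygraph2" where
  "row_pres n =
     \<lparr>gen1 = rows n,
      gen2 = {(u, v). u \<in> rows n \<and> v \<in> rows n \<and> \<not> u \<lhd>\<^sub>N v},
      src2 = (\<lambda>(u, v). [u, v]),
      tgt2 = (\<lambda>(u, v). reading (n_tableau (u @ v)))\<rparr>"

fun leftmost :: "row list \<Rightarrow> (row, row2) step option" where
  "leftmost (u # v # w) =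
     (if \<not> u \<lhd>\<^sub>N v then Some (Step [] (u, v) True w)
      else map_option (whisker [u] []) (leftmost (v # w)))"
| "leftmost w = None"

partial_function (option) normalize :: "nat \<Rightarrow> row list \<Rightarrow> (row, row2) step list option" where
  "normalize n w =
     (case leftmost w of
        None \<Rightarrow> Some []
      | Some s \<Rightarrow> Option.bind (normalize n (step_tgt (row_pres n) s)) (\<lambda>p. Some (s # p)))"

definition norm_path :: "nat \<Rightarrow> row list \<Rightarrow> (row, row2) step list" where
  "norm_path n w = the (normalize n w)"

definition triples_C :: "nat \<Rightarrow> triple set" where
  "triples_C n =
     {(u, v, t). u \<in> rows n \<and> v \<in> rows n \<and> t \<in> rows n \<and> \<not> u \<lhd>\<^sub>N v \<and> \<not> v \<lhd>\<^sub>N t}"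

definition triples_S :: "nat \<Rightarrow> triple set" where
  "triples_S n = {(u, v, t). (u, v, t) \<in> triples_C n \<and> length u \<ge> 2 \<and> \<not> tl u \<lhd>\<^sub>N v}"

definition triples_T1 :: "nat \<Rightarrow> triple set" where
  "triples_T1 n = triples_C n - triples_S n"

fun L_path :: "nat \<Rightarrow> triple \<Rightarrow> (row, row2) step list" where
  "L_path n (u, v, t) =
     Step [] (u, v) True [t] # norm_path n (reading (n_tableau (u @ v)) @ [t])"

fun R_path :: "nat \<Rightarrow> triple \<Rightarrow> (row, row2) step list" where
  "R_path n (u, v, t) =
     Step [u] (v, t) True [] # norm_path n (u # reading (n_tableau (v @ t)))"

fun triple_word :: "triple \<Rightarrow> row list" where
  "triple_word (u, v, t) = [u, v, t]"

subsection \<open>Selected row cells\<close>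

definition eligible :: "nat \<Rightarrow> (triple \<times> row2) set" where
  "eligible n =
     {(\<tau>, \<beta>). \<tau> \<in> triples_T1 n \<and>
        Step [] \<beta> True [] \<in> set (L_path n \<tau> @ R_path n \<tau>) \<and>
        length (filter (\<lambda>s. gen s = \<beta>) (L_path n \<tau> @ R_path n \<tau>)) = 1}"

definition S_steps :: "nat \<Rightarrow> triple \<Rightarrow> row2 \<Rightarrow> (row, row2) step list" where
  "S_steps n \<tau> \<beta> =
     (let (U, V) = (if \<beta> \<in> gen ` set (L_path n \<tau>) then (L_path n \<tau>, R_path n \<tau>)
                    else (R_path n \<tau>, L_path n \<tau>));
          f = takeWhile (\<lambda>s. gen s \<noteq> \<beta>) U;
          g = tl (dropWhile (\<lambda>s. gen s \<noteq> \<beta>) U)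
      in inv_steps f @ V @ inv_steps g)"

definition dependencies :: "nat \<Rightarrow> triple \<Rightarrow> row2 \<Rightarrow> row2 set" where
  "dependencies n \<tau> \<beta> = gen ` set (S_steps n \<tau> \<beta>)"

text \<open>Rows are compared by the lexicographic order on lists and tuples lexicographically.\<close>

fun row2_key :: "row2 \<Rightarrow> nat \<times> nat \<times> row \<times> row" where
  "row2_key (u, v) = (length u + length v, length u, u, v)"

fun pair_key :: "triple \<times> row2 \<Rightarrow> (nat \<times> nat \<times> row \<times> row) \<times> triple" where
  "pair_key (\<tau>, \<beta>) = (row2_key \<beta>, \<tau>)"

definition kept_pairs :: "nat \<Rightarrow> (triple \<times> row2) set" where
  "kept_pairs n =
     foldl (\<lambda>K (\<tau>, \<beta>). if \<tau> \<notin> fst ` K \<and> \<beta> \<notin> snd ` K then insert (\<tau>, \<beta>) K else K) {}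
       (sorted_key_list_of_set pair_key (eligible n))"

definition B_match :: "nat \<Rightarrow> row2 set" where
  "B_match n = snd ` kept_pairs n"

definition tau :: "nat \<Rightarrow> row2 \<Rightarrow> triple" where
  "tau n \<beta> = (THE \<tau>. (\<tau>, \<beta>) \<in> kept_pairs n)"

definition dep_graph :: "nat \<Rightarrow> (row2 \<times> row2) set" where
  "dep_graph n =
     {(\<beta>', \<beta>). \<beta>' \<in> B_match n \<and> \<beta> \<in> B_match n \<and> \<beta>' \<in> dependencies n (tau n \<beta>) \<beta>}"

definition B_acyc :: "nat \<Rightarrow> row2 set" where
  "B_acyc n =
     foldl (\<lambda>K \<beta>. if acyclic (dep_graph n \<inter> insert \<beta> K \<times> insert \<beta> K) then insert \<beta> K else K) {}
       (sorted_key_list_of_set row2_key (B_match n))"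

subsection \<open>The reduced row presentation\<close>

text \<open>The recursion \<open>Red \<beta> = Red S\<^sub>\<beta>\<close> runs along the dependencies of the eliminated cells. Surviving
  cells have no predecessor in the recursion relation, so acyclicity of the graph on the eliminated
  cells gives well-foundedness.\<close>

definition red_cell :: "nat \<Rightarrow> row2 \<Rightarrow> (row, row2) step list" where
  "red_cell n =
     wfrec {(\<beta>', \<beta>). \<beta> \<in> B_acyc n \<and> \<beta>' \<in> dependencies n (tau n \<beta>) \<beta>}
       (\<lambda>red \<beta>. if \<beta> \<in> B_acyc n
                then map_steps (\<lambda>u. [u]) red (S_steps n (tau n \<beta>) \<beta>)
                else [Step [] \<beta> True []])"

definition Red :: "nat \<Rightarrow> (row, row2) zigzag \<Rightarrow> (row, row2) zigzag" where
  "Red n = map_zigzag (\<lambda>u. [u]) (red_cell n)"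

definition row_red :: "nat \<Rightarrow> (row, row2, triple) polygraph31" where
  "row_red n =
     \<lparr>base = (row_pres n)\<lparr>gen2 := gen2 (row_pres n) - B_acyc n\<rparr>,
      gen3 = triples_T1 n - tau n ` B_acyc n,
      src3 = (\<lambda>\<tau>. Red n (triple_word \<tau>, L_path n \<tau>)),
      tgt3 = (\<lambda>\<tau>. Red n (triple_word \<tau>, R_path n \<tau>))\<rparr>"

section \<open>The pre-row presentation\<close>

datatype prerow2 = Letter (the_letter: styl2) | Gamma row

definition letters :: "nat list \<Rightarrow> row list" where
  "letters w = map (\<lambda>x. [x]) w"

fun prerow_src :: "prerow2 \<Rightarrow> row list" where
  "prerow_src (Letter c) = letters (styl_src c)"
| "prerow_src (Gamma u) = letters u"

fun prerow_tgt :: "prerow2 \<Rightarrow> row list" where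
  "prerow_tgt (Letter c) = letters (styl_tgt c)"
| "prerow_tgt (Gamma u) = [u]"

definition prerow :: "nat \<Rightarrow> (row, prerow2) polygraph2" where
  "prerow n =
     \<lparr>gen1 = rows n,
      gen2 = Letter ` gen2 (styl n) \<union> Gamma ` rows2 n,
      src2 = prerow_src,
      tgt2 = prerow_tgt\<rparr>"

text \<open>The order on elementary steps: position, then kind of the cell, then parameters.\<close>

fun styl2_kind :: "styl2 \<Rightarrow> nat" where
  "styl2_kind (Eta x) = 0"
| "styl2_kind (Kappa x y z) = 1"
| "styl2_kind (Lambda x y z) = 2"

fun styl2_params :: "styl2 \<Rightarrow> nat list" where
  "styl2_params (Eta x) = [x]"
| "styl2_params (Kappa x y z) = [x, y, z]"
| "styl2_params (Lambda x y z) = [x, y, z]"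

fun step_key :: "(row, prerow2) step \<Rightarrow> nat \<times> nat \<times> nat list" where
  "step_key (Step w \<beta> e w') =
     (length w, styl2_kind (the_letter \<beta>) + (if e then 0 else 3), styl2_params (the_letter \<beta>))"

definition Pi_path :: "nat \<Rightarrow> row list \<Rightarrow> row list \<Rightarrow> (row, prerow2) step list" where
  "Pi_path n U V =
     (ARG_MIN (\<lambda>p. (length p, map step_key p)) p.
        path (prerow n) U p V \<and> (\<forall>s\<in>set p. gen s \<in> range Letter))"

definition flat :: "row list \<Rightarrow> row list" where
  "flat w = concat (map letters w)"

fun E_path :: "row list \<Rightarrow> (row, prerow2) step list" where
  "E_path [] = []"
| "E_path (u # w) =
     (if length u = 1 then [] else [Step [] (Gamma u) False w]) @
     map (whisker (letters u) []) (E_path w)"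

definition P_path :: "nat \<Rightarrow> row2 \<Rightarrow> (row, prerow2) step list" where
  "P_path n \<beta> =
     (let s = src2 (row_pres n) \<beta>; t = tgt2 (row_pres n) \<beta>
      in E_path s @ Pi_path n (flat s) (flat t) @ inv_steps (E_path t))"

definition Q_cell :: "nat \<Rightarrow> prerow2 \<Rightarrow> (row, row2) zigzag" where
  "Q_cell n \<delta> =
     (let s = prerow_src \<delta>; t = prerow_tgt \<delta>
      in Red n (s, norm_path n s @ inv_steps (norm_path n t)))"

definition E_functor :: "nat \<Rightarrow> (row, row2) zigzag \<Rightarrow> (row, prerow2) zigzag" where
  "E_functor n = map_zigzag (\<lambda>u. [u]) (P_path n)"

datatype coh3 = RowCell triple | TransportCell prerow2

fun coh_src :: "nat \<Rightarrow> coh3 \<Rightarrow> (row, prerow2) zigzag" where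
  "coh_src n (RowCell \<tau>) = E_functor n (src3 (row_red n) \<tau>)"
| "coh_src n (TransportCell \<delta>) = E_functor n (Q_cell n \<delta>)"

fun coh_tgt :: "nat \<Rightarrow> coh3 \<Rightarrow> (row, prerow2) zigzag" where
  "coh_tgt n (RowCell \<tau>) = E_functor n (tgt3 (row_red n) \<tau>)"
| "coh_tgt n (TransportCell \<delta>) = (prerow_src \<delta>, [Step [] \<delta> True []])"

definition prerow_coh :: "nat \<Rightarrow> (row, prerow2, coh3) polygraph31" where
  "prerow_coh n =
     \<lparr>base = prerow n,
      gen3 = RowCell ` gen3 (row_red n) \<union> TransportCell ` gen2 (prerow n),
      src3 = coh_src n,
      tgt3 = coh_tgt n\<rparr>"

section \<open>The coherent letter presentation\<close>

fun contract_cell :: "prerow2 \<Rightarrow> (row, prerow2) step list" where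
  "contract_cell (Letter c) = [Step [] (Letter c) True []]"
| "contract_cell (Gamma u) = []"

definition contract :: "(row, prerow2) zigzag \<Rightarrow> (row, prerow2) zigzag" where
  "contract = map_zigzag letters contract_cell"

definition styl_coh :: "nat \<Rightarrow> (row, prerow2, coh3) polygraph31" where
  "styl_coh n =
     \<lparr>base = (prerow n)\<lparr>gen1 := gen1 (prerow n) - rows2 n,
                       gen2 := gen2 (prerow n) - Gamma ` rows2 n\<rparr>,
      gen3 = gen3 (prerow_coh n),
      src3 = contract \<circ> src3 (prerow_coh n),
      tgt3 = contract \<circ> tgt3 (prerow_coh n)\<rparr>"

text \<open>The identification of the generator \<open>r\<^sub>x = [x]\<close> with the letter \<open>x\<close>.\<close>

definition identify :: "(row, prerow2) zigzag \<Rightarrow> (nat, styl2) zigzag" where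
  "identify = map_zigzag (\<lambda>u. [hd u]) (\<lambda>\<beta>. [Step [] (the_letter \<beta>) True []])"

definition styl_coh_letters :: "nat \<Rightarrow> (nat, styl2, coh3) polygraph31" where
  "styl_coh_letters n =
     \<lparr>base = styl n,
      gen3 = gen3 (styl_coh n),
      src3 = identify \<circ> src3 (styl_coh n),
      tgt3 = identify \<circ> tgt3 (styl_coh n)\<rparr>"

section \<open>Effective computability\<close>

text \<open>The total recursive functions, with several arguments coded by the standard pairing function.
  Minimization is applied to regular functions only, which yields exactly the total recursive
  functions.\<close>

inductive total_recursive :: "(nat \<Rightarrow> nat) \<Rightarrow> bool" where
  zero: "total_recursive (\<lambda>x. 0)"
| suc: "total_recursive Suc"
| left: "total_recursive (\<lambda>x. fst (prod_decode x))"
| right: "total_recursive (\<lambda>x. snd (prod_decode x))"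
| pair: "total_recursive f \<Longrightarrow> total_recursive g \<Longrightarrow> total_recursive (\<lambda>x. prod_encode (f x, g x))"
| comp: "total_recursive f \<Longrightarrow> total_recursive g \<Longrightarrow> total_recursive (\<lambda>x. f (g x))"
| prec: "total_recursive f \<Longrightarrow> total_recursive g \<Longrightarrow>
    total_recursive (\<lambda>x. case prod_decode x of (a, m) \<Rightarrow>
      rec_nat (f a) (\<lambda>k r. g (prod_encode (a, prod_encode (k, r)))) m)"
| mu: "total_recursive f \<Longrightarrow> (\<And>a. \<exists>m. f (prod_encode (a, m)) = 0) \<Longrightarrow>
    total_recursive (\<lambda>a. LEAST m. f (prod_encode (a, m)) = 0)"

fun styl2_code :: "styl2 \<Rightarrow> nat" where
  "styl2_code c = list_encode (styl2_kind c # styl2_params c)"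

fun prerow2_code :: "prerow2 \<Rightarrow> nat" where
  "prerow2_code (Letter c) = prod_encode (0, styl2_code c)"
| "prerow2_code (Gamma u) = prod_encode (1, list_encode u)"

fun coh3_code :: "coh3 \<Rightarrow> nat" where
  "coh3_code (RowCell (u, v, t)) =
     prod_encode (0, list_encode [list_encode u, list_encode v, list_encode t])"
| "coh3_code (TransportCell \<delta>) = prod_encode (1, prerow2_code \<delta>)"

fun step_code :: "(nat, styl2) step \<Rightarrow> nat" where
  "step_code (Step w c e w') =
     list_encode [list_encode w, styl2_code c, of_bool e, list_encode w']"

fun zigzag_code :: "(nat, styl2) zigzag \<Rightarrow> nat" where
  "zigzag_code (u, p) = prod_encode (list_encode u, list_encode (map step_code p))"

fun entry_code :: "coh3 \<times> (nat, styl2) zigzag \<times> (nat, styl2) zigzag \<Rightarrow> nat" where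
  "entry_code (A, f, g) = list_encode [coh3_code A, zigzag_code f, zigzag_code g]"

text \<open>An algorithm lists, for every \<open>n \<ge> 1\<close>, the generating 3-cells together with formal 2-cells
  representing their source and target.\<close>

definition effectively_computable :: "(nat \<Rightarrow> (nat, styl2, coh3) polygraph31) \<Rightarrow> bool" where
  "effectively_computable Q \<longleftrightarrow>
     (\<exists>h. total_recursive h \<and>
        (\<forall>n\<ge>1. \<exists>es. h n = list_encode (map entry_code es) \<and>
           fst ` set es = gen3 (Q n) \<and>
           (\<forall>(A, f, g)\<in>set es.
              zz_eq (base (Q n)) f (src3 (Q n) A) \<and> zz_eq (base (Q n)) g (tgt3 (Q n) A))))"

end

theory Submission
  imports Defs
begin

text \<open>A path is determined up to homotopy once every local branching is closed. In the convergent row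
  presentation a triple \<open>(u, v, t)\<close> whose row \<open>u\<close> splits as a letter \<open>x\<close> followed by a row \<open>p\<close>
  that still rewrites with \<open>v\<close> is one face of the quadruple \<open>([x], p, v, t)\<close>; by well-founded
  induction the cells of the remaining triples suffice, which is Squier's theorem for the row
  presentation. Eliminating a selected cell along its own triple cell does not change the homotopy
  classes. Transport and contraction form a functor from the reduced row presentation to the letter
  presentation, and \<open>\<delta> \<mapsto> Q\<^sub>\<delta>\<close> a functor back; the transport cells connect the round trip to the
  identity. Hence parallel 2-cells of letters are homotopic, because their images in the row
  presentation are.

  For effectivity, all searches are bounded or regular minimizations: the search for a shortest path
  between two words terminates since N-insertion decides whether they are congruent, and the
  iterated substitution of the selected cells stops by acyclicity.\<close>

section \<open>Paths and homotopies\<close>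

text \<open>Formal 3-cells carry so many units and composites that all fillings are constructed in
  the relation \<open>hty\<close> on step lists; its derivations become expressions only at the end,
  and then boundaries must be shown independent of representatives. Confluence of the row rules does
  not come from critical pairs: the normal form is defined by inserting the flattened word, every
  rule preserves that tableau, and termination alone gives convergence. The obstacle to coherence is
  the missing cell of a triple whose first row still rewrites after losing its first letter. A
  single letter in front is harmless, since its reducible triples all have cells; moving a letter
  across three rows calls on the triple \<open>(x # p, b, c)\<close> exactly when \<open>p\<close>
  does not rewrite with \<open>b\<close>, and then that triple has a cell too. For computability,
  minimization must be regular on every code, including codes of meaningless inputs. Hence each
  search either has a stopping alternative for such inputs or terminates for all inputs.\<close>

lemma step_words:
  assumes "is_polygraph2 P" "is_step P s"
  shows "step_src P s \<in> lists (gen1 P)" "step_tgt P s \<in> lists (gen1 P)"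
  using assms by (cases s; simp add: is_polygraph2_def cell_src_def cell_tgt_def)+

text \<open>An empty path checks that its word lies over \<open>gen1 P\<close>, so splitting at the
  end of \<open>p\<close> requires the middle word to be well formed; this is where the polygraph
  axiom enters.\<close>

lemma path_append: "path P u (p @ q) v \<longleftrightarrow> (\<exists>w. path P u p w \<and> path P w q v)"
  if P: "is_polygraph2 P"
proof -
  have src: "x \<in> lists (gen1 P)" if "path P x r y" for x r y
    using that step_words(1)[OF P] by (cases r) auto
  show ?thesis
    by (induction p arbitrary: u) (auto dest: src)
qed

lemma path_det: "path P u p v \<Longrightarrow> path P u p w \<Longrightarrow> v = w"
  by (induction p arbitrary: u) auto

lemma zz_tgt_path: "path P u p v \<Longrightarrow> zz_tgt P (u, p) = v"
  by (induction p arbitrary: u) (auto split: if_splits)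

lemma inv_step_inv_step [simp]: "inv_step (inv_step s) = s"
  by (cases s) simp

lemma step_src_inv [simp]: "step_src P (inv_step s) = step_tgt P s"
  by (cases s) (simp add: cell_src_def cell_tgt_def)

lemma step_tgt_inv [simp]: "step_tgt P (inv_step s) = step_src P s"
  by (cases s) (simp add: cell_src_def cell_tgt_def)

lemma is_step_inv [simp]: "is_step P (inv_step s) = is_step P s"
  by (cases s) simp

lemma inv_steps_simps [simp]:
  "inv_steps [] = []" "inv_steps (s # p) = inv_steps p @ [inv_step s]"
  "inv_steps (p @ q) = inv_steps q @ inv_steps p"
  by (simp_all add: inv_steps_def)

lemma inv_steps_inv_steps [simp]: "inv_steps (inv_steps p) = p"
  by (simp add: inv_steps_def rev_map comp_def)

lemma whisker_whisker [simp]: "whisker l r (whisker l' r' s) = whisker (l @ l') (r' @ r) s"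
  by (cases s) simp

lemma whisker_whisker_comp [simp]: "whisker l r \<circ> whisker l' r' = whisker (l @ l') (r' @ r)"
  by (rule ext) simp

lemma whisker_Nil [simp]: "whisker [] [] s = s"
  by (cases s) simp

lemma whisker_Nil_id [simp]: "whisker [] [] = (\<lambda>s. s)"
  by (rule ext) simp

lemma whisker_inv_step: "whisker l r (inv_step s) = inv_step (whisker l r s)"
  by (cases s) simp

lemma map_whisker_inv_steps: "map (whisker l r) (inv_steps p) = inv_steps (map (whisker l r) p)"
  by (simp add: inv_steps_def rev_map whisker_inv_step)

lemma step_src_whisker [simp]: "step_src P (whisker l r s) = l @ step_src P s @ r"
  by (cases s) simp

lemma step_tgt_whisker [simp]: "step_tgt P (whisker l r s) = l @ step_tgt P s @ r"
  by (cases s) simp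

lemma is_step_whisker [simp]:
  "is_step P (whisker l r s) \<longleftrightarrow> is_step P s \<and> l \<in> lists (gen1 P) \<and> r \<in> lists (gen1 P)"
  by (cases s) auto

lemma path_words:
  assumes "is_polygraph2 P" "path P u p v"
  shows "u \<in> lists (gen1 P)" "v \<in> lists (gen1 P)"
proof -
  have "u \<in> lists (gen1 P) \<and> v \<in> lists (gen1 P)"
    using assms(2) step_words[OF assms(1)] by (induction p arbitrary: u) auto
  then show "u \<in> lists (gen1 P)" "v \<in> lists (gen1 P)" by auto
qed

lemma path_whisker:
  assumes "path P u p v" "l \<in> lists (gen1 P)" "r \<in> lists (gen1 P)"
  shows "path P (l @ u @ r) (map (whisker l r) p) (l @ v @ r)"
  using assms by (induction p arbitrary: u) auto

lemma path_inv:
  assumes "is_polygraph2 P" "path P u p v"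
  shows "path P v (inv_steps p) u"
  using assms(2)
proof (induction p arbitrary: u)
  case Nil
  then show ?case by auto
next
  case (Cons s p)
  then show ?case
    using step_words[OF assms(1)] by (auto simp: path_append[OF assms(1)])
qed

text \<open>The equality of 2-cells modulo a set \<open>X\<close> of 3-cells, on step lists with a common source.\<close>

inductive hty :: "('a, 'b) polygraph2 \<Rightarrow> (('a, 'b) zigzag \<times> ('a, 'b) zigzag) set \<Rightarrow> 'a list \<Rightarrow>
    ('a, 'b) step list \<Rightarrow> ('a, 'b) step list \<Rightarrow> bool" for P X where
  refl: "path P u p v \<Longrightarrow> hty P X u p p"
| sym: "hty P X u p q \<Longrightarrow> hty P X u q p"
| trans: "hty P X u p q \<Longrightarrow> hty P X u q r \<Longrightarrow> hty P X u p r"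
| cancel: "path P u (p @ [s, inv_step s] @ q) v \<Longrightarrow>
    hty P X u (p @ [s, inv_step s] @ q) (p @ q)"
| exchange: "path P u
      (p @ [Step w \<alpha> d (m @ cell_src P \<beta> e @ w'), Step (w @ cell_tgt P \<alpha> d @ m) \<beta> e w'] @ q) v \<Longrightarrow>
    hty P X u
      (p @ [Step w \<alpha> d (m @ cell_src P \<beta> e @ w'), Step (w @ cell_tgt P \<alpha> d @ m) \<beta> e w'] @ q)
      (p @ [Step (w @ cell_src P \<alpha> d @ m) \<beta> e w', Step w \<alpha> d (m @ cell_tgt P \<beta> e @ w')] @ q)"
| cell: "((a, p), (b, q)) \<in> X \<Longrightarrow> path P u (c @ map (whisker l r) p @ d) v \<Longrightarrow>
    l \<in> lists (gen1 P) \<Longrightarrow> r \<in> lists (gen1 P) \<Longrightarrow> path P u c (l @ a @ r) \<Longrightarrow>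
    hty P X u (c @ map (whisker l r) p @ d) (c @ map (whisker l r) q @ d)"

text \<open>The two sides of a cell must be parallel paths. This makes every rule of
  \<open>hty\<close> preserve endpoints, so that \<open>path\<close> conditions can be carried along
  homotopies.\<close>

locale track_cells =
  fixes P :: "('a, 'b) polygraph2" and X :: "(('a, 'b) zigzag \<times> ('a, 'b) zigzag) set"
  assumes poly: "is_polygraph2 P"
    and cells: "((a, p), (b, q)) \<in> X \<Longrightarrow> a = b \<and> (\<exists>v. path P a p v \<and> path P a q v)"
begin

lemmas path_app = path_append[OF poly]

lemma cell_words:
  assumes "\<beta> \<in> gen2 P"
  shows "cell_src P \<beta> e \<in> lists (gen1 P)" "cell_tgt P \<beta> e \<in> lists (gen1 P)"
  using assms poly by (simp_all add: is_polygraph2_def cell_src_def cell_tgt_def)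

lemma path_comp: "path P u c x \<Longrightarrow> path P x p y \<Longrightarrow> path P u (c @ p) y"
  using path_app by blast

lemma path_middle:
  assumes "path P u c x" "path P x p y"
  shows "path P u (c @ p @ d) v \<longleftrightarrow> path P y d v"
  using assms path_det by (metis path_app)

text \<open>Both orders of the two disjoint steps pass the same well-formedness tests once the
  boundaries of the generators are known to be words; if one generator lies outside
  \<open>gen2 P\<close>, neither side is a path.\<close>

lemma exchange_paths:
  "path P x [Step w \<alpha> d (m @ cell_src P \<beta> e @ w'), Step (w @ cell_tgt P \<alpha> d @ m) \<beta> e w'] y
   \<longleftrightarrow> path P x [Step (w @ cell_src P \<alpha> d @ m) \<beta> e w', Step w \<alpha> d (m @ cell_tgt P \<beta> e @ w')] y"
proof (cases "\<alpha> \<in> gen2 P \<and> \<beta> \<in> gen2 P")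
  case True
  then have "cell_src P \<alpha> d \<in> lists (gen1 P)" "cell_tgt P \<alpha> d \<in> lists (gen1 P)"
    "cell_src P \<beta> e \<in> lists (gen1 P)" "cell_tgt P \<beta> e \<in> lists (gen1 P)"
    using cell_words by blast+
  then show ?thesis
    apply simp
    apply (rule iffI)
     apply (elim conjE, intro conjI, assumption+)
    apply (elim conjE, intro conjI, assumption+)
    done
next
  case False
  then show ?thesis by auto
qed

text \<open>Every rule replaces a segment of the step list by another one with the same
  ends.\<close>

lemma hty_path_iff: "hty P X u p q \<Longrightarrow> path P u p v \<longleftrightarrow> path P u q v"
proof (induction arbitrary: v rule: hty.induct)
  case (cancel u p s q v0)
  then obtain x where x: "path P u p x" "is_step P s" "step_src P s = x"
    by (auto simp: path_app)
  then have "path P x [s, inv_step s] x"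
    using step_words[OF poly] by auto
  then show ?case
    using x path_middle by (metis path_app path_det)
next
  case (exchange u p w \<alpha> d m \<beta> e w' q v0)
  show ?case by (simp only: path_app exchange_paths)
next
  case (cell a p b q u c l r d v)
  obtain v' where v': "path P a p v'" "path P a q v'" using cells[OF cell(1)] by blast
  have 1: "path P (l @ a @ r) (map (whisker l r) p) (l @ v' @ r)"
    and 2: "path P (l @ a @ r) (map (whisker l r) q) (l @ v' @ r)"
    using v' path_whisker cell by blast+
  show ?case
    using path_middle[OF cell(5) 1] path_middle[OF cell(5) 2] by simp
qed auto

lemma hty_path: "hty P X u p q \<Longrightarrow> \<exists>v. path P u p v \<and> path P u q v"
proof (induction rule: hty.induct)
  case (trans u p q r)
  then show ?case using path_det by metis
next
  case (cancel u p s q v)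
  show ?case using hty_path_iff[OF hty.cancel[OF cancel]] cancel by blast
next
  case (exchange u p w \<alpha> d m \<beta> e w' q v)
  show ?case using hty_path_iff[OF hty.exchange[OF exchange]] exchange by blast
next
  case (cell a p b q u c l r d v)
  show ?case using hty_path_iff[OF hty.cell[OF cell]] cell by blast
qed auto

text \<open>The generating rules already have a free prefix and suffix, which absorb
  \<open>c\<close> and \<open>d\<close>; symmetry and transitivity only need the path condition on
  the other representative.\<close>

lemma hty_context:
  assumes "hty P X u p q" "path P u0 c u" "path P u (p @ d) w"
  shows "hty P X u0 (c @ p @ d) (c @ q @ d)"
  using assms
proof (induction rule: hty.induct)
  case (refl u p v')
  then show ?case by (metis hty.refl path_app)
next
  case (sym u p q)
  have "path P u (p @ d) w" using sym hty_path_iff by (metis path_app)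
  then show ?case using sym hty.sym by metis
next
  case (trans u p q r)
  have "path P u (q @ d) w" using trans hty_path_iff by (metis path_app)
  then show ?case using trans hty.trans by metis
next
  case (cancel u p s q v)
  have "path P u0 ((c @ p) @ [s, inv_step s] @ (q @ d)) w"
    using path_comp[OF cancel(2,3)] by simp
  from hty.cancel[OF this] show ?case by simp
next
  case (exchange u p w' \<alpha> e m \<beta> f w'' q v)
  have "path P u0 ((c @ p) @ [Step w' \<alpha> e (m @ cell_src P \<beta> f @ w''),
      Step (w' @ cell_tgt P \<alpha> e @ m) \<beta> f w''] @ (q @ d)) w"
    using path_comp[OF exchange(2,3)] by simp
  from hty.exchange[OF this] show ?case by simp
next
  case (cell a p b q u c' l r d' v)
  have 1: "path P u0 ((c @ c') @ map (whisker l r) p @ (d' @ d)) w"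
    using path_comp[OF cell(6,7)] by simp
  have 2: "path P u0 (c @ c') (l @ a @ r)"
    using path_comp[OF cell(6,5)] .
  from hty.cell[OF cell(1) 1 cell(3,4) 2] show ?case by simp
qed

lemma hty_whisker:
  assumes "hty P X u p q" "l \<in> lists (gen1 P)" "r \<in> lists (gen1 P)"
  shows "hty P X (l @ u @ r) (map (whisker l r) p) (map (whisker l r) q)"
  using assms(1)
proof (induction rule: hty.induct)
  case (refl u p v')
  then show ?case by (meson hty.refl path_whisker assms)
next
  case (sym u p q)
  then show ?case using hty.sym by metis
next
  case (trans u p q r)
  then show ?case using hty.trans by metis
next
  case (cancel u p s q v)
  have "path P (l @ u @ r) (map (whisker l r) p @ [whisker l r s, inv_step (whisker l r s)] @ map (whisker l r) q) (l @ v @ r)"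
    using path_whisker[OF cancel assms(2,3)] by (simp add: whisker_inv_step)
  from hty.cancel[OF this] show ?case by (simp add: whisker_inv_step)
next
  case (exchange u p w \<alpha> d m \<beta> e w' q v)
  have "path P (l @ u @ r) (map (whisker l r) p @ [Step (l @ w) \<alpha> d (m @ cell_src P \<beta> e @ (w' @ r)),
     Step ((l @ w) @ cell_tgt P \<alpha> d @ m) \<beta> e (w' @ r)] @ map (whisker l r) q) (l @ v @ r)"
    using path_whisker[OF exchange assms(2,3)] by simp
  from hty.exchange[OF this] show ?case by simp
next
  case (cell a p b q u c l' r' d v)
  have 1: "path P (l @ u @ r) (map (whisker l r) c @ map (whisker (l @ l') (r' @ r)) p @ map (whisker l r) d) (l @ v @ r)"
    using path_whisker[OF cell(2) assms(2,3)] by simp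
  have 2: "path P (l @ u @ r) (map (whisker l r) c) ((l @ l') @ a @ (r' @ r))"
    using path_whisker[OF cell(5) assms(2,3)] by simp
  have 3: "l @ l' \<in> lists (gen1 P)" "r' @ r \<in> lists (gen1 P)" using cell assms by auto
  from hty.cell[OF cell(1) 1 3 2] show ?case by simp
qed

lemma hty_append:
  assumes "hty P X u p p'" "hty P X v q q'" "path P u p v"
  shows "hty P X u (p @ q) (p' @ q')"
proof -
  obtain w where w: "path P v q w" using hty_path assms(2) by blast
  have p': "path P u p' v" using assms hty_path_iff by blast
  have "path P u (p @ q) w" using w assms path_app by blast
  then have 1: "hty P X u ([] @ p @ q) ([] @ p' @ q)"
    using path_words[OF poly assms(3)] by (intro hty_context[OF assms(1)]) auto
  have 2: "hty P X u (p' @ q @ []) (p' @ q' @ [])"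
    using w p' by (intro hty_context[OF assms(2)]) auto
  show ?thesis using hty.trans[OF 1[simplified] 2[simplified]] .
qed

lemma hty_refl: "path P u p v \<Longrightarrow> hty P X u p p"
  by (rule hty.refl)

lemma hty_append_left: "path P u p v \<Longrightarrow> hty P X v q q' \<Longrightarrow> hty P X u (p @ q) (p @ q')"
  using hty_append hty_refl by blast

lemma hty_append_right: "hty P X u p p' \<Longrightarrow> path P u (p @ q) v \<Longrightarrow> hty P X u (p @ q) (p' @ q)"
  using hty_append hty_refl path_app by metis

lemma hty_cancel_path: "path P u p v \<Longrightarrow> hty P X u (p @ inv_steps p) []"
proof (induction p arbitrary: u)
  case Nil
  then show ?case by (auto intro: hty.refl)
next
  case (Cons s p)
  then have s: "is_step P s" "step_src P s = u" and p: "path P (step_tgt P s) p v" by auto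
  have u: "u \<in> lists (gen1 P)" "step_tgt P s \<in> lists (gen1 P)" using s step_words[OF poly] by auto
  then have s1: "path P u [s] (step_tgt P s)" using s by simp
  have 0: "hty P X (step_tgt P s) (p @ inv_steps p) []" using Cons.IH p .
  have "path P (step_tgt P s) ((p @ inv_steps p) @ [inv_step s]) u"
    using p path_inv[OF poly p] s u by (auto simp: path_app)
  from hty_context[OF 0 s1 this]
  have 1: "hty P X u (s # (p @ inv_steps p) @ [inv_step s]) [s, inv_step s]" by simp
  have "hty P X u ([] @ [s, inv_step s] @ []) ([] @ [])"
    using s u by (intro hty.cancel) auto
  then show ?case using hty.trans[OF 1] by simp
qed

lemma hty_cancel_path': "path P u p v \<Longrightarrow> hty P X v (inv_steps p @ p) []"
  using hty_cancel_path[OF path_inv[OF poly]] by (metis inv_steps_inv_steps)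

lemma hty_inv:
  assumes "hty P X u p q" "path P u p v"
  shows "hty P X v (inv_steps p) (inv_steps q)"
proof -
  have q: "path P u q v" using assms hty_path_iff by blast
  have ip: "path P v (inv_steps p) u" using path_inv[OF poly assms(2)] .
  have iq: "path P v (inv_steps q) u" using path_inv[OF poly q] .
  have 1: "hty P X v (inv_steps p @ p @ inv_steps q) (inv_steps p @ q @ inv_steps q)"
    using assms iq by (intro hty_context[OF assms(1) ip]) (auto simp: path_app)
  have 2: "hty P X v (inv_steps p @ (q @ inv_steps q)) (inv_steps p @ [])"
    using hty_append_left[OF ip hty_cancel_path[OF q]] .
  have "path P v ((inv_steps p @ p) @ inv_steps q) u"
    using ip iq assms(2) path_app by metis
  from hty_append_right[OF hty_cancel_path'[OF assms(2)] this]
  have 3: "hty P X v ((inv_steps p @ p) @ inv_steps q) ([] @ inv_steps q)" .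
  show ?thesis using 1 2 3 by (simp) (metis hty.sym hty.trans)
qed

text \<open>2-cells are invertible, so composing with \<open>inv_steps r\<close> removes the common
  end. Coherence is concluded in this way, with a normalization path as \<open>r\<close>.\<close>

lemma hty_cancel_right:
  assumes "hty P X u (p @ r) (q @ r)" "path P u p v" "path P u q v" "path P v r w"
  shows "hty P X u p q"
proof -
  have ir: "path P w (inv_steps r) v" using path_inv[OF poly assms(4)] .
  have 0: "hty P X u ((p @ r) @ inv_steps r) ((q @ r) @ inv_steps r)"
    using assms ir by (intro hty_append_right[OF assms(1)]) (auto simp: path_app)
  have 1: "hty P X u (p @ (r @ inv_steps r)) (p @ [])"
    using hty_append_left[OF assms(2) hty_cancel_path[OF assms(4)]] .
  have 2: "hty P X u (q @ (r @ inv_steps r)) (q @ [])"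
    using hty_append_left[OF assms(3) hty_cancel_path[OF assms(4)]] .
  show ?thesis using 0 1 2 by simp (metis hty.sym hty.trans)
qed

lemma hty_exchange_steps:
  assumes s: "is_step P s" and t: "is_step P t" and m: "m \<in> lists (gen1 P)"
  shows "hty P X (step_src P s @ m @ step_src P t)
    [whisker [] (m @ step_src P t) s, whisker (step_tgt P s @ m) [] t]
    [whisker (step_src P s @ m) [] t, whisker [] (m @ step_tgt P t) s]"
proof -
  obtain w \<alpha> d w1 where s_eq: "s = Step w \<alpha> d w1" by (cases s)
  obtain w2 \<beta> e w' where t_eq: "t = Step w2 \<beta> e w'" by (cases t)
  have words: "w \<in> lists (gen1 P)" "w1 \<in> lists (gen1 P)" "w2 \<in> lists (gen1 P)" "w' \<in> lists (gen1 P)"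
      "\<alpha> \<in> gen2 P" "\<beta> \<in> gen2 P" using s t s_eq t_eq by auto
  have "path P (step_src P s @ m @ step_src P t) ([] @ [Step w \<alpha> d ((w1 @ m @ w2) @ cell_src P \<beta> e @ w'),
     Step (w @ cell_tgt P \<alpha> d @ (w1 @ m @ w2)) \<beta> e w'] @ []) (step_tgt P s @ m @ step_tgt P t)"
    using words m cell_words[of \<alpha> d] cell_words[of \<beta> e] s_eq t_eq by simp
  from hty.exchange[OF this] show ?thesis by (simp add: s_eq t_eq)
qed

lemma hty_exchange_step_path:
  assumes s: "is_step P s" and m: "m \<in> lists (gen1 P)" and q: "path P a q b"
  shows "hty P X (step_src P s @ m @ a)
    (whisker [] (m @ a) s # map (whisker (step_tgt P s @ m) []) q)
    (map (whisker (step_src P s @ m) []) q @ [whisker [] (m @ b) s])"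
  using q
proof (induction q arbitrary: a)
  case Nil
  then show ?case using s m step_words[OF poly s]
    by (auto intro!: hty.refl)
next
  case (Cons t q)
  then have t: "is_step P t" "step_src P t = a" and q: "path P (step_tgt P t) q b" by auto
  let ?c = "step_tgt P t"
  have sw: "step_src P s \<in> lists (gen1 P)" "step_tgt P s \<in> lists (gen1 P)" "b \<in> lists (gen1 P)"
      "a \<in> lists (gen1 P)" "?c \<in> lists (gen1 P)"
    using step_words[OF poly s] path_words[OF poly q] step_words[OF poly t(1)] t by auto
  have 1: "hty P X (step_src P s @ m @ a)
      [whisker [] (m @ a) s, whisker (step_tgt P s @ m) [] t]
      [whisker (step_src P s @ m) [] t, whisker [] (m @ ?c) s]"
    using hty_exchange_steps[OF s t(1) m] t by simp
  have pq: "path P (step_tgt P s @ m @ ?c) (map (whisker (step_tgt P s @ m) []) q) (step_tgt P s @ m @ b)"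
    using path_whisker[OF q, of "step_tgt P s @ m" "[]"] sw m by simp
  have "path P (step_src P s @ m @ a)
      ([whisker [] (m @ a) s, whisker (step_tgt P s @ m) [] t] @ map (whisker (step_tgt P s @ m) []) q)
      (step_tgt P s @ m @ b)"
    using s t sw m pq by simp
  from hty_append_right[OF 1 this]
  have 2: "hty P X (step_src P s @ m @ a)
    (whisker [] (m @ a) s # map (whisker (step_tgt P s @ m) []) (t # q))
    (whisker (step_src P s @ m) [] t # whisker [] (m @ ?c) s # map (whisker (step_tgt P s @ m) []) q)"
    by simp
  have "path P (step_src P s @ m @ a) [whisker (step_src P s @ m) [] t] (step_src P s @ m @ ?c)"
    using s t sw m by simp
  from hty_append_left[OF this Cons.IH[OF q]]
  show ?case using hty.trans[OF 2] by simp
qed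

text \<open>The interchange law, derived from single exchanges by moving one step of
  \<open>p\<close> at a time past all of \<open>q\<close>. Whole paths are needed because a functor
  sends a step to a path; \<open>m\<close> is the word between the two positions.\<close>

lemma hty_exchange_paths:
  assumes p: "path P u p v" and m: "m \<in> lists (gen1 P)" and q: "path P a q b"
  shows "hty P X (u @ m @ a)
    (map (whisker [] (m @ a)) p @ map (whisker (v @ m) []) q)
    (map (whisker (u @ m) []) q @ map (whisker [] (m @ b)) p)"
  using p
proof (induction p arbitrary: u)
  case Nil
  then show ?case using path_whisker[OF q, of "u @ m" "[]"] m by (auto intro!: hty.refl)
next
  case (Cons s p)
  then have s: "is_step P s" "step_src P s = u" and p: "path P (step_tgt P s) p v" by auto
  let ?c = "step_tgt P s"
  have sw: "u \<in> lists (gen1 P)" "v \<in> lists (gen1 P)" "?c \<in> lists (gen1 P)"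
     "a \<in> lists (gen1 P)" "b \<in> lists (gen1 P)"
    using step_words[OF poly s(1)] path_words[OF poly p] s path_words[OF poly q] by auto
  have "path P (u @ m @ a) [whisker [] (m @ a) s] (?c @ m @ a)" using s sw m by simp
  from hty_append_left[OF this Cons.IH[OF p]]
  have 1: "hty P X (u @ m @ a)
    (whisker [] (m @ a) s # map (whisker [] (m @ a)) p @ map (whisker (v @ m) []) q)
    (whisker [] (m @ a) s # map (whisker (?c @ m) []) q @ map (whisker [] (m @ b)) p)" by simp
  have 2: "hty P X (u @ m @ a)
    (whisker [] (m @ a) s # map (whisker (?c @ m) []) q)
    (map (whisker (u @ m) []) q @ [whisker [] (m @ b) s])"
    using hty_exchange_step_path[OF s(1) m q] s by simp
  have pp: "path P (?c @ m @ b) (map (whisker [] (m @ b)) p) (v @ m @ b)"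
    using path_whisker[OF p, of "[]" "m @ b"] sw m by simp
  have pq: "path P (u @ m @ a) (whisker [] (m @ a) s # map (whisker (?c @ m) []) q) (?c @ m @ b)"
    using path_whisker[OF q, of "?c @ m" "[]"] s sw m by simp
  have "path P (u @ m @ a) ((whisker [] (m @ a) s # map (whisker (?c @ m) []) q) @ map (whisker [] (m @ b)) p)
     (v @ m @ b)"
    using pp pq path_app by blast
  from hty_append_right[OF 2 this] show ?case using hty.trans[OF 1] by simp
qed

end

lemma track_cells_empty: "is_polygraph2 P \<Longrightarrow> track_cells P {}"
  by unfold_locales auto

section \<open>Functors\<close>

lemma map_word_simps [simp]:
  "map_word F [] = []" "map_word F (a # w) = F a @ map_word F w"
  "map_word F (v @ w) = map_word F v @ map_word F w"
  by (simp_all add: map_word_def)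

lemma map_steps_simps [simp]:
  "map_steps F G [] = []" "map_steps F G (s # p) = map_step F G s @ map_steps F G p"
  "map_steps F G (p @ q) = map_steps F G p @ map_steps F G q"
  by (simp_all add: map_steps_def)

lemma map_step_whisker:
  "map_step F G (whisker l r s) = map (whisker (map_word F l) (map_word F r)) (map_step F G s)"
  by (cases s) simp

lemma map_steps_whisker:
  "map_steps F G (map (whisker l r) p) = map (whisker (map_word F l) (map_word F r)) (map_steps F G p)"
  by (induction p) (auto simp: map_step_whisker)

lemma map_step_inv: "map_step F G (inv_step s) = inv_steps (map_step F G s)"
  by (cases s) (auto simp: map_whisker_inv_steps)

lemma map_steps_inv: "map_steps F G (inv_steps p) = inv_steps (map_steps F G p)"
  by (induction p) (auto simp: map_step_inv)

lemma map_word_map_word: "map_word F (map_word G w) = map_word (\<lambda>a. map_word F (G a)) w"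
  by (induction w) auto

lemma map_steps_map_step:
  "map_steps F1 F2 (map_step G1 G2 s) = map_step (\<lambda>a. map_word F1 (G1 a)) (\<lambda>b. map_steps F1 F2 (G2 b)) s"
  by (cases s) (auto simp: map_steps_whisker map_steps_inv map_word_map_word)

lemma map_steps_map_steps:
  "map_steps F1 F2 (map_steps G1 G2 p) = map_steps (\<lambda>a. map_word F1 (G1 a)) (\<lambda>b. map_steps F1 F2 (G2 b)) p"
  by (induction p) (auto simp: map_steps_map_step)

lemma map_word_singleton [simp]: "map_word (\<lambda>a. [a]) w = w"
  by (induction w) auto

definition track_functor :: "('a, 'b) polygraph2 \<Rightarrow> ('c, 'd) polygraph2 \<Rightarrow> ('a \<Rightarrow> 'c list) \<Rightarrow>
    ('b \<Rightarrow> ('c, 'd) step list) \<Rightarrow> bool" where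
  "track_functor P P' F1 F2 \<longleftrightarrow> is_polygraph2 P \<and> is_polygraph2 P' \<and>
    (\<forall>a\<in>gen1 P. F1 a \<in> lists (gen1 P')) \<and>
    (\<forall>\<beta>\<in>gen2 P. path P' (map_word F1 (src2 P \<beta>)) (F2 \<beta>) (map_word F1 (tgt2 P \<beta>)))"

lemma functor_word: "track_functor P P' F1 F2 \<Longrightarrow> w \<in> lists (gen1 P) \<Longrightarrow> map_word F1 w \<in> lists (gen1 P')"
  by (induction w) (auto simp: track_functor_def)

lemma functor_cell:
  assumes "track_functor P P' F1 F2" "\<beta> \<in> gen2 P"
  shows "path P' (map_word F1 (cell_src P \<beta> e)) (if e then F2 \<beta> else inv_steps (F2 \<beta>)) (map_word F1 (cell_tgt P \<beta> e))"
  using assms by (auto simp: track_functor_def cell_src_def cell_tgt_def intro: path_inv)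

lemma functor_step:
  assumes "track_functor P P' F1 F2" "is_step P s"
  shows "path P' (map_word F1 (step_src P s)) (map_step F1 F2 s) (map_word F1 (step_tgt P s))"
proof (cases s)
  case (Step w \<beta> e w')
  then show ?thesis
    using path_whisker[OF functor_cell[OF assms(1), of \<beta> e]] functor_word[OF assms(1)] assms(2) by simp
qed

lemma functor_path:
  assumes "track_functor P P' F1 F2" "path P u p v"
  shows "path P' (map_word F1 u) (map_steps F1 F2 p) (map_word F1 v)"
  using assms(2)
proof (induction p arbitrary: u)
  case Nil
  then show ?case using functor_word[OF assms(1)] by auto
next
  case (Cons s p)
  have "is_polygraph2 P'" using assms(1) by (simp add: track_functor_def)
  then show ?case using Cons functor_step[OF assms(1), of s] path_append by fastforce
qed

text \<open>Only the cells of \<open>X\<close> need attention: cancellation becomes cancellation of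
  a path against its inverse, and exchange becomes the interchange law for image paths.\<close>

lemma functor_hty:
  assumes F: "track_functor P P' F1 F2" and P': "track_cells P' X'"
    and X: "\<And>a p b q. ((a, p), (b, q)) \<in> X \<Longrightarrow>
      hty P' X' (map_word F1 a) (map_steps F1 F2 p) (map_steps F1 F2 q)"
    and "hty P X u p q"
  shows "hty P' X' (map_word F1 u) (map_steps F1 F2 p) (map_steps F1 F2 q)"
  using assms(4)
proof (induction rule: hty.induct)
  case (refl u p v)
  then show ?case using functor_path[OF F] hty.refl by blast
next
  case (sym u p q)
  then show ?case using hty.sym by metis
next
  case (trans u p q r)
  then show ?case using hty.trans by metis
next
  interpret track_cells P' X' by (rule P')
  have poly0: "is_polygraph2 P" using F by (simp add: track_functor_def)
  {
    case (cancel u p s q v)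
    then obtain x where x: "path P u p x" "path P x ([s, inv_step s] @ q) v"
      using path_append[OF poly0] by blast
    have s: "is_step P s" "step_src P s = x" using x by auto
    have 1: "hty P' X' (map_word F1 x) (map_step F1 F2 s @ inv_steps (map_step F1 F2 s)) []"
      using hty_cancel_path[OF functor_step[OF F s(1)]] s by simp
    have 2: "path P' (map_word F1 x) ((map_step F1 F2 s @ inv_steps (map_step F1 F2 s)) @ map_steps F1 F2 q) (map_word F1 v)"
      using functor_path[OF F x(2)] by (simp add: map_step_inv)
    from hty_context[OF 1 functor_path[OF F x(1)] 2] show ?case by (simp add: map_step_inv)
  next
    case (exchange u p w \<alpha> d m \<beta> e w' q v)
    let ?s = "Step w \<alpha> d (m @ cell_src P \<beta> e @ w')" and ?t = "Step (w @ cell_tgt P \<alpha> d @ m) \<beta> e w'"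
    obtain x where x: "path P u p x" "path P x ([?s, ?t] @ q) v"
      using exchange path_append[OF poly0] by blast
    have st: "is_step P ?s" "is_step P ?t" "x = w @ cell_src P \<alpha> d @ m @ cell_src P \<beta> e @ w'"
      using x(2) by auto
    have words: "map_word F1 w \<in> lists (gen1 P')" "map_word F1 w' \<in> lists (gen1 P')" "map_word F1 m \<in> lists (gen1 P')"
      using st functor_word[OF F] by auto
    have gens: "\<alpha> \<in> gen2 P" "\<beta> \<in> gen2 P" using st by auto
    have 0: "hty P' X' (map_word F1 (cell_src P \<alpha> d) @ map_word F1 m @ map_word F1 (cell_src P \<beta> e))
      (map (whisker [] (map_word F1 m @ map_word F1 (cell_src P \<beta> e))) (if d then F2 \<alpha> else inv_steps (F2 \<alpha>)) @
       map (whisker (map_word F1 (cell_tgt P \<alpha> d) @ map_word F1 m) []) (if e then F2 \<beta> else inv_steps (F2 \<beta>)))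
      (map (whisker (map_word F1 (cell_src P \<alpha> d) @ map_word F1 m) []) (if e then F2 \<beta> else inv_steps (F2 \<beta>)) @
       map (whisker [] (map_word F1 m @ map_word F1 (cell_tgt P \<beta> e))) (if d then F2 \<alpha> else inv_steps (F2 \<alpha>)))"
      using hty_exchange_paths[OF functor_cell[OF F gens(1)] words(3) functor_cell[OF F gens(2)]] .
    have 1: "hty P' X' (map_word F1 x)
        (map_steps F1 F2 [?s, ?t])
        (map_steps F1 F2 [Step (w @ cell_src P \<alpha> d @ m) \<beta> e w', Step w \<alpha> d (m @ cell_tgt P \<beta> e @ w')])"
      using hty_whisker[OF 0 words(1,2)] unfolding st(3) by (simp del: if_image_distrib)
    have 2: "path P' (map_word F1 x) (map_steps F1 F2 [?s, ?t] @ map_steps F1 F2 q) (map_word F1 v)"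
      using functor_path[OF F x(2)] by simp
    from hty_context[OF 1 functor_path[OF F x(1)] 2] show ?case by simp
  next
    case (cell a p b q u c l r d v)
    have words: "map_word F1 l \<in> lists (gen1 P')" "map_word F1 r \<in> lists (gen1 P')"
      using cell functor_word[OF F] by auto
    obtain x where x: "path P u c x" "path P x (map (whisker l r) p @ d) v"
      using cell path_append[OF poly0] by blast
    have xe: "x = l @ a @ r" using x cell path_det by metis
    have 1: "hty P' X' (map_word F1 x) (map_steps F1 F2 (map (whisker l r) p)) (map_steps F1 F2 (map (whisker l r) q))"
      using hty_whisker[OF X[OF cell(1)] words] xe by (simp add: map_steps_whisker)
    have 2: "path P' (map_word F1 x) (map_steps F1 F2 (map (whisker l r) p) @ map_steps F1 F2 d) (map_word F1 v)"
      using functor_path[OF F x(2)] by simp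
    from hty_context[OF 1 functor_path[OF F x(1)] 2] show ?case by simp
  }
qed

lemma functor_comp:
  assumes "track_functor P P' G1 G2" "track_functor P' P'' F1 F2"
  shows "track_functor P P'' (\<lambda>a. map_word F1 (G1 a)) (\<lambda>b. map_steps F1 F2 (G2 b))"
  using assms functor_word[OF assms(2)] functor_path[OF assms(2)]
  unfolding track_functor_def by (simp add: map_word_map_word[symmetric])

text \<open>Homotopies between generators and their images extend to inverses, whiskerings and
  composites. The transport cells provide such homotopies for the round trip through the
  rows.\<close>

lemma hty_functor_id:
  assumes P: "track_cells P X" and F: "track_functor P P F1 F2"
    and F1: "\<And>a. a \<in> gen1 P \<Longrightarrow> F1 a = [a]"
    and cell: "\<And>\<beta>. \<beta> \<in> gen2 P \<Longrightarrow> hty P X (src2 P \<beta>) (F2 \<beta>) [Step [] \<beta> True []]"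
    and p: "path P u p v"
  shows "hty P X u (map_steps F1 F2 p) p"
proof -
  interpret track_cells P X by (rule P)
  have word: "w \<in> lists (gen1 P) \<Longrightarrow> map_word F1 w = w" for w
    by (induction w) (simp_all add: F1)
  have step: "hty P X (step_src P s) (map_step F1 F2 s) [s]" if s: "is_step P s" for s
  proof (cases s)
    case (Step w \<beta> e w')
    then have g: "\<beta> \<in> gen2 P" "w \<in> lists (gen1 P)" "w' \<in> lists (gen1 P)" using s by auto
    have "path P (src2 P \<beta>) (F2 \<beta>) (tgt2 P \<beta>)"
    proof -
      have "src2 P \<beta> \<in> lists (gen1 P)" "tgt2 P \<beta> \<in> lists (gen1 P)"
        using poly g(1) by (simp_all add: is_polygraph2_def)
      moreover have "path P (map_word F1 (src2 P \<beta>)) (F2 \<beta>) (map_word F1 (tgt2 P \<beta>))"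
        using F g(1) by (simp add: track_functor_def)
      ultimately show ?thesis by (simp only: word)
    qed
    from hty_inv[OF cell[OF g(1)] this]
    have "hty P X (cell_src P \<beta> e) (if e then F2 \<beta> else inv_steps (F2 \<beta>)) [Step [] \<beta> e []]"
      using cell[OF g(1)] by (auto simp: cell_src_def)
    from hty_whisker[OF this g(2,3)] Step show ?thesis by (simp add: word g)
  qed
  show ?thesis using p
  proof (induction p arbitrary: u)
    case Nil
    then show ?case by (auto intro: hty.refl)
  next
    case (Cons s p)
    then have s: "is_step P s" "step_src P s = u" and p: "path P (step_tgt P s) p v" by auto
    have "path P u (map_step F1 F2 s) (step_tgt P s)"
      using functor_step[OF F s(1)] s word step_words[OF poly s(1)] by simp
    from hty_append[OF step[OF s(1), unfolded s(2)] Cons.IH[OF p] this] show ?case by simp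
  qed
qed

section \<open>The free (3,1)-category\<close>

lemma path_zigzag: "path P u p v \<Longrightarrow> is_zigzag P (u, p)"
  by auto

lemma zz_eq_hty: "zz_eq P f g \<Longrightarrow> fst f = fst g \<and> hty P X (fst f) (snd f) (snd g)"
proof (induction rule: zz_eq.induct)
  case (refl f)
  then show ?case by (cases f) (auto intro: hty.refl)
next
  case (cancel u p s q)
  then obtain v where "path P u (p @ [s, inv_step s] @ q) v" by auto
  from hty.cancel[OF this] show ?case by simp
next
  case (exchange u p w \<alpha> d m \<beta> e w' q)
  then obtain v where "path P u (p @ [Step w \<alpha> d (m @ cell_src P \<beta> e @ w'),
      Step (w @ cell_tgt P \<alpha> d @ m) \<beta> e w'] @ q) v" by auto
  from hty.exchange[OF this] show ?case by simp
qed (auto intro: hty.sym hty.trans)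

lemma hty_zz_eq:
  fixes P :: "('a, 'b) polygraph2"
  assumes "hty P {} u p q"
  shows "zz_eq P (u, p) (u, q)"
proof -
  have "X = {} \<Longrightarrow> zz_eq P (u, p) (u, q)" if "hty P X u p q" for X and u :: "'a list" and p q
    using that
  proof (induction rule: hty.induct)
    case (refl u p v)
    then show ?case by (blast intro: zz_eq.refl path_zigzag)
  next
    case (cancel u p s q v)
    then show ?case by (intro zz_eq.cancel) auto
  next
    case (exchange u p w \<alpha> d m \<beta> e w' q v)
    then show ?case by (intro zz_eq.exchange) auto
  qed (auto intro: zz_eq.sym zz_eq.trans)
  then show ?thesis using assms by simp
qed

text \<open>Without 3-cells, \<open>hty\<close> is equality in the track 2-category, so the homotopy
  lemmas also serve for \<open>zz_eq\<close>.\<close>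

lemma zz_eq_iff_hty: "zz_eq P f g \<longleftrightarrow> fst f = fst g \<and> hty P {} (fst f) (snd f) (snd g)"
  using zz_eq_hty[of P f g "{}"] hty_zz_eq[of P "fst f" "snd f" "snd g"] by (cases f; cases g) auto

definition boundaries :: "('a, 'b, 'c) polygraph31 \<Rightarrow> (('a, 'b) zigzag \<times> ('a, 'b) zigzag) set" where
  "boundaries Q = (\<lambda>A. (src3 Q A, tgt3 Q A)) ` gen3 Q"

lemma is_zigzag_path: "is_zigzag P (u, p) \<Longrightarrow> path P u p (zz_tgt P (u, p))"
  using zz_tgt_path by (metis is_zigzag.simps)

locale polygraph31 =
  fixes Q :: "('a, 'b, 'c) polygraph31"
  assumes Q: "is_polygraph31 Q"
begin

abbreviation "P \<equiv> base Q"

sublocale Q: track_cells "base Q" "boundaries Q"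
proof
  show "is_polygraph2 P" using Q by (simp add: is_polygraph31_def)
  fix a p b q assume "((a, p), (b, q)) \<in> boundaries Q"
  then show "a = b \<and> (\<exists>v. path P a p v \<and> path P a q v)"
  proof -
    obtain A where A: "A \<in> gen3 Q" "src3 Q A = (a, p)" "tgt3 Q A = (b, q)"
      using \<open>_ \<in> boundaries Q\<close> by (auto simp: boundaries_def)
    then have "is_zigzag P (a, p)" "is_zigzag P (b, q)" "parallel P (a, p) (b, q)"
      using Q unfolding is_polygraph31_def by (metis A)+
    then show ?thesis
      using is_zigzag_path[of P a p] is_zigzag_path[of P b q]
      by (auto simp: parallel_def simp del: is_zigzag.simps zz_tgt.simps)
  qed
qed

sublocale E: track_cells "base Q" "{}"
  using Q.poly track_cells_empty by blast

text \<open>Boundaries are taken up to \<open>zz_eq\<close>, because 3-cells connect 2-cells of the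
  track 2-category and not their representatives.\<close>

definition cell_between :: "('a, 'b) zigzag \<Rightarrow> ('a, 'b) zigzag \<Rightarrow> ('a, 'b, 'c) expr3 \<Rightarrow> bool" where
  "cell_between f g F \<longleftrightarrow> is_expr3 Q F \<and> zz_eq P (esrc Q F) f \<and> zz_eq P (etgt Q F) g"

lemma comp1_cong:
  assumes "zz_eq P f f'" "zz_eq P g g'" "zz_tgt P f = zz_src g"
  shows "zz_eq P (zz_comp1 f g) (zz_comp1 f' g')"
proof -
  obtain u p where f: "f = (u, p)" by (cases f) auto
  obtain u' p' where f': "f' = (u', p')" by (cases f') auto
  obtain v q where g: "g = (v, q)" by (cases g) auto
  obtain v' q' where g': "g' = (v', q')" by (cases g') auto
  obtain x where x: "path P u p x" using assms(1) f f' E.hty_path by (fastforce simp: zz_eq_iff_hty)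
  then have "x = v" using assms(3) zz_tgt_path f g by (metis zz_src.simps)
  then show ?thesis
    using E.hty_append[of u p p' v q q'] x assms(1,2) f f' g g' by (auto simp: zz_eq_iff_hty)
qed

lemma zz_eq_parallel:
  assumes "zz_eq P f g"
  shows "zz_src f = zz_src g" "zz_tgt P f = zz_tgt P g" "is_zigzag P f" "is_zigzag P g"
proof -
  have *: "fst f = fst g" "hty P {} (fst f) (snd f) (snd g)" using assms zz_eq_iff_hty by blast+
  then obtain v where v: "path P (fst f) (snd f) v" "path P (fst f) (snd g) v"
    using E.hty_path by blast
  show "zz_src f = zz_src g" using * by (cases f; cases g) auto
  show "zz_tgt P f = zz_tgt P g" using * v zz_tgt_path by (metis prod.collapse)
  show "is_zigzag P f" "is_zigzag P g" using * v by (cases f; cases g; auto)+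
qed

lemma comp0_cong:
  assumes "zz_eq P f f'" "zz_eq P g g'"
  shows "zz_eq P (zz_comp0 P f g) (zz_comp0 P f' g')"
proof -
  obtain u p where f: "f = (u, p)" by (cases f)
  obtain p' where f': "f' = (u, p')" using assms(1) f by (cases f') (auto simp: zz_eq_iff_hty)
  obtain v q where g: "g = (v, q)" by (cases g)
  obtain q' where g': "g' = (v, q')" using assms(2) g by (cases g') (auto simp: zz_eq_iff_hty)
  have hp: "hty P {} u p p'" and hq: "hty P {} v q q'"
    using assms f f' g g' by (auto simp: zz_eq_iff_hty)
  obtain x where x: "path P u p x" "path P u p' x" using E.hty_path[OF hp] by blast
  obtain y where y: "path P v q y" using E.hty_path[OF hq] by blast
  have words: "u \<in> lists (gen1 P)" "x \<in> lists (gen1 P)" "v \<in> lists (gen1 P)" "y \<in> lists (gen1 P)"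
    using path_words[OF Q.poly x(1)] path_words[OF Q.poly y] by auto
  have 1: "hty P {} (u @ v) (map (whisker [] v) p) (map (whisker [] v) p')"
    using E.hty_whisker[OF hp, of "[]" v] words by simp
  have 2: "hty P {} (x @ v) (map (whisker x []) q) (map (whisker x []) q')"
    using E.hty_whisker[OF hq, of x "[]"] words by simp
  have "path P (u @ v) (map (whisker [] v) p) (x @ v)"
    using path_whisker[OF x(1), of "[]" v] words by simp
  from E.hty_append[OF 1 2 this] zz_tgt_path[OF x(1)] zz_tgt_path[OF x(2)]
  show ?thesis using f f' g g' by (simp add: zz_eq_iff_hty del: zz_tgt.simps)
qed

lemma comp0_path:
  assumes "path P u p x" "path P v q y"
  shows "zz_comp0 P (u, p) (v, q) = (u @ v, map (whisker [] v) p @ map (whisker x []) q)"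
    "path P (u @ v) (map (whisker [] v) p @ map (whisker x []) q) (x @ y)"
proof -
  have words: "u \<in> lists (gen1 P)" "x \<in> lists (gen1 P)" "v \<in> lists (gen1 P)" "y \<in> lists (gen1 P)"
    using path_words[OF Q.poly assms(1)] path_words[OF Q.poly assms(2)] by auto
  show "zz_comp0 P (u, p) (v, q) = (u @ v, map (whisker [] v) p @ map (whisker x []) q)"
    using zz_tgt_path[OF assms(1)] by (simp del: zz_tgt.simps)
  show "path P (u @ v) (map (whisker [] v) p @ map (whisker x []) q) (x @ y)"
    using Q.path_comp path_whisker[OF assms(1), of "[]" v] path_whisker[OF assms(2), of x "[]"] words
    by simp
qed

lemma zigzagE:
  assumes "is_zigzag P f"
  obtains u p v where "f = (u, p)" "path P u p v" "zz_src f = u" "zz_tgt P f = v"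
  using assms is_zigzag_path zz_src.simps by (metis surj_pair)

lemma comp0_zigzag:
  assumes "is_zigzag P f" "is_zigzag P g"
  shows "is_zigzag P (zz_comp0 P f g)" "zz_src (zz_comp0 P f g) = zz_src f @ zz_src g"
    "zz_tgt P (zz_comp0 P f g) = zz_tgt P f @ zz_tgt P g"
proof -
  obtain u p x where f: "f = (u, p)" "path P u p x" "zz_src f = u" "zz_tgt P f = x" using zigzagE[OF assms(1)] .
  obtain v q y where g: "g = (v, q)" "path P v q y" "zz_src g = v" "zz_tgt P g = y" using zigzagE[OF assms(2)] .
  note * = comp0_path[OF f(2) g(2)]
  show "is_zigzag P (zz_comp0 P f g)" unfolding f(1) g(1) *(1) using *(2) by auto
  show "zz_src (zz_comp0 P f g) = zz_src f @ zz_src g" unfolding f(1) g(1) *(1) by simp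
  show "zz_tgt P (zz_comp0 P f g) = zz_tgt P f @ zz_tgt P g"
    using zz_tgt_path[OF *(2)] *(1) f g by (simp del: zz_tgt.simps)
qed

lemma comp1_zigzag:
  assumes "is_zigzag P f" "is_zigzag P g" "zz_tgt P f = zz_src g"
  shows "is_zigzag P (zz_comp1 f g)" "zz_src (zz_comp1 f g) = zz_src f"
    "zz_tgt P (zz_comp1 f g) = zz_tgt P g"
proof -
  obtain u p x where f: "f = (u, p)" "path P u p x" "zz_src f = u" "zz_tgt P f = x" using zigzagE[OF assms(1)] .
  obtain v q y where g: "g = (v, q)" "path P v q y" "zz_src g = v" "zz_tgt P g = y" using zigzagE[OF assms(2)] .
  have *: "path P u (p @ q) y" using Q.path_comp f g assms(3) by auto
  show "is_zigzag P (zz_comp1 f g)" unfolding f(1) g(1) using * by auto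
  show "zz_src (zz_comp1 f g) = zz_src f" unfolding f(1) g(1) by simp
  show "zz_tgt P (zz_comp1 f g) = zz_tgt P g"
    using zz_tgt_path[OF *] f g by (simp del: zz_tgt.simps)
qed

lemma expr3_boundary:
  "is_expr3 Q F \<Longrightarrow> is_zigzag P (esrc Q F) \<and> is_zigzag P (etgt Q F) \<and> parallel P (esrc Q F) (etgt Q F)"
proof (induction F)
  case (Gen3 A)
  then show ?case using Q by (auto simp: is_polygraph31_def)
next
  case (Comp i F G)
  then have z: "is_zigzag P (esrc Q F)" "is_zigzag P (etgt Q F)" "is_zigzag P (esrc Q G)" "is_zigzag P (etgt Q G)"
    and p: "parallel P (esrc Q F) (etgt Q F)" "parallel P (esrc Q G) (etgt Q G)" by auto
  consider "i = 0" | "i = 1" "zz_tgt P (esrc Q F) = zz_src (esrc Q G)"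
    | "i = 2" "zz_eq P (etgt Q F) (esrc Q G)" using Comp by auto
  then show ?case
  proof cases
    case 1
    then show ?thesis using p comp0_zigzag[OF z(1,3)] comp0_zigzag[OF z(2,4)]
      by (auto simp: parallel_def comp2cells_def)
  next
    case 2
    then have "zz_tgt P (etgt Q F) = zz_src (etgt Q G)" using p by (simp add: parallel_def)
    from comp1_zigzag[OF z(2,4) this] comp1_zigzag[OF z(1,3) 2(2)] 2 p
    show ?thesis by (auto simp: parallel_def comp2cells_def)
  next
    case 3
    then show ?thesis using z p zz_eq_parallel[OF 3(2)] by (auto simp: parallel_def)
  qed
qed (auto simp: parallel_def)

text \<open>The source of a class in \<open>free3 Q\<close> is a union over its representatives; it
  is a single 2-cell only if the axioms preserve boundaries up to \<open>zz_eq\<close>. Apart from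
  \<open>unit_cong\<close>, only the exchange of 0- with 1-composition changes the step
  lists.\<close>

lemma axiom3_boundary:
  assumes "axiom3 Q F G" "is_expr3 Q F" "is_expr3 Q G"
  shows "zz_eq P (esrc Q F) (esrc Q G) \<and> zz_eq P (etgt Q F) (etgt Q G)"
  using assms
proof (induction rule: axiom3.induct)
  case (assoc i F G H)
  note FGH = assoc
  have z: "is_zigzag P (esrc Q F)" "is_zigzag P (esrc Q G)" "is_zigzag P (esrc Q H)"
    "is_zigzag P (etgt Q F)" "is_zigzag P (etgt Q G)" "is_zigzag P (etgt Q H)"
    using assoc expr3_boundary by auto
  have c0: "zz_comp0 P (zz_comp0 P f g) h = zz_comp0 P f (zz_comp0 P g h)"
    if zz: "is_zigzag P f" "is_zigzag P g" "is_zigzag P h" for f g h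
  proof -
    obtain u p x where f: "f = (u, p)" "path P u p x" "zz_src f = u" "zz_tgt P f = x" by (rule zigzagE[OF zz(1)])
    obtain v q y where g: "g = (v, q)" "path P v q y" "zz_src g = v" "zz_tgt P g = y" by (rule zigzagE[OF zz(2)])
    obtain w r z where h: "h = (w, r)" "path P w r z" "zz_src h = w" "zz_tgt P h = z" by (rule zigzagE[OF zz(3)])
    note 1 = comp0_path[OF f(2) g(2)] note 2 = comp0_path[OF g(2) h(2)]
    show ?thesis unfolding f(1) g(1) h(1) 1(1) 2(1)
      unfolding comp0_path(1)[OF 1(2) h(2)] comp0_path(1)[OF f(2) 2(2)] by simp
  qed
  have c1: "zz_comp1 (zz_comp1 f g) h = zz_comp1 f (zz_comp1 g h)" for f g h :: "('a, 'b) zigzag"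
    by (cases f; cases g; cases h) simp
  have e: "esrc Q (Comp i (Comp i F G) H) = esrc Q (Comp i F (Comp i G H))"
    "etgt Q (Comp i (Comp i F G) H) = etgt Q (Comp i F (Comp i G H))"
    using c0 c1 z by (auto simp: comp2cells_def)
  then show ?case using expr3_boundary[OF assoc(1)] zz_eq.refl by metis
next
  case (unit_left i F)
  have F: "is_expr3 Q F" by fact
  have "zz_comp0 P ([], []) f = f" for f by (cases f) simp
  moreover have "zz_comp1 (zz_src f, []) f = f" for f :: "('a, 'b) zigzag" by (cases f) simp
  moreover have "zz_comp1 (zz_src (etgt Q F), []) (esrc Q F) = esrc Q F"
    using expr3_boundary[OF F] calculation by (simp add: parallel_def del: zz_comp1.simps) metis
  moreover have "zz_src (esrc Q F) = zz_src (etgt Q F)"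
    using expr3_boundary[OF F] by (simp add: parallel_def)
  moreover have "i \<le> 2" using unit_left by auto
  ultimately have "esrc Q (Comp i (src_unit3 Q i F) F) = esrc Q F"
    "etgt Q (Comp i (src_unit3 Q i F) F) = etgt Q F"
    by (auto simp: src_unit3_def comp2cells_def)
  then show ?case using expr3_boundary[OF F] zz_eq.refl by metis
next
  case (unit_right i F)
  have F: "is_expr3 Q F" by fact
  have "zz_comp0 P f ([], []) = f" for f by (cases f) simp
  moreover have "zz_comp1 f (v, []) = f" for f :: "('a, 'b) zigzag" and v by (cases f) simp
  moreover have "i \<le> 2" using unit_right by auto
  ultimately have "esrc Q (Comp i F (tgt_unit3 Q i F)) = esrc Q F"
    "etgt Q (Comp i F (tgt_unit3 Q i F)) = etgt Q F"
    by (auto simp: tgt_unit3_def comp2cells_def)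
  then show ?case using expr3_boundary[OF F] zz_eq.refl by metis
next
  case (unit_comp i f g)
  then show ?case by (auto intro!: zz_eq.refl)
next
  case (exchange i j F F' G G')
  have ex: "zz_eq P (zz_comp0 P (zz_comp1 f f') (zz_comp1 g g')) (zz_comp1 (zz_comp0 P f g) (zz_comp0 P f' g'))"
    if zz: "is_zigzag P f" "is_zigzag P f'" "is_zigzag P g" "is_zigzag P g'"
      "zz_tgt P f = zz_src f'" "zz_tgt P g = zz_src g'" for f f' g g'
  proof -
    obtain u p x where f: "f = (u, p)" "path P u p x" "zz_src f = u" "zz_tgt P f = x" by (rule zigzagE[OF zz(1)])
    obtain p' x' where f': "f' = (x, p')" "path P x p' x'" using zigzagE[OF zz(2)] f zz by metis
    obtain v q y where g: "g = (v, q)" "path P v q y" "zz_src g = v" "zz_tgt P g = y" by (rule zigzagE[OF zz(3)])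
    obtain q' y' where g': "g' = (y, q')" "path P y q' y'" using zigzagE[OF zz(4)] g zz by metis
    have pp: "path P u (p @ p') x'" and qq: "path P v (q @ q') y'" using Q.path_comp f f' g g' by blast+
    have words: "x \<in> lists (gen1 P)" "v \<in> lists (gen1 P)" "y \<in> lists (gen1 P)" "u \<in> lists (gen1 P)" "x' \<in> lists (gen1 P)"
      using path_words[OF Q.poly f(2)] path_words[OF Q.poly g(2)] path_words[OF Q.poly f'(2)] by auto
    \<comment> \<open>Only the two inner paths change places: \<open>p'\<close> acts on the left
      factor and \<open>q\<close> on the right one.\<close>
    have 0: "hty P {} (x @ v) (map (whisker [] v) p' @ map (whisker x' []) q)
        (map (whisker x []) q @ map (whisker [] y) p')"
      using E.hty_exchange_paths[OF f'(2) _ g(2), of "[]"] by simp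
    have 1: "path P (u @ v) (map (whisker [] v) p) (x @ v)"
      using path_whisker[OF f(2), of "[]" v] words by simp
    have 2: "path P (x @ v) ((map (whisker [] v) p' @ map (whisker x' []) q) @ map (whisker x' []) q') (x' @ y')"
      using comp0_path(2)[OF f'(2) qq] by simp
    show ?thesis
      unfolding f(1) f'(1) g(1) g'(1) zz_comp1.simps comp0_path(1)[OF pp qq]
        comp0_path(1)[OF f(2) g(2)] comp0_path(1)[OF f'(2) g'(2)]
      using E.hty_context[OF 0 1 2] by (simp add: zz_eq_iff_hty)
  qed
  have j: "j = 1 \<or> j = 2" "i = 0 \<or> i = 1" using exchange by auto
  show ?case
  proof (cases "j = 2")
    case True
    then have "esrc Q (Comp i (Comp j F F') (Comp j G G')) = esrc Q (Comp j (Comp i F G) (Comp i F' G'))"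
      "etgt Q (Comp i (Comp j F F') (Comp j G G')) = etgt Q (Comp j (Comp i F G) (Comp i F' G'))"
      using j by auto
    then show ?thesis using expr3_boundary[OF exchange(2)] zz_eq.refl by metis
  next
    case False
    then have ij: "i = 0" "j = 1" using j exchange(1) by auto
    have w: "is_expr3 Q F" "is_expr3 Q F'" "is_expr3 Q G" "is_expr3 Q G'"
      "zz_tgt P (esrc Q F) = zz_src (esrc Q F')" "zz_tgt P (esrc Q G) = zz_src (esrc Q G')"
      using exchange ij by auto
    have w': "zz_tgt P (etgt Q F) = zz_src (etgt Q F')" "zz_tgt P (etgt Q G) = zz_src (etgt Q G')"
      using w expr3_boundary by (metis parallel_def)+
    show ?thesis using ex w w' expr3_boundary ij by (simp add: comp2cells_def)
  qed
qed (auto intro: zz_eq.refl simp: expr3_boundary dest: zz_eq.sym)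

lemma eq3_expr3: "eq3 Q F G \<Longrightarrow> is_expr3 Q F \<and> is_expr3 Q G"
  by (induction rule: eq3.induct) auto

lemma eq3_boundary:
  "eq3 Q F G \<Longrightarrow> zz_eq P (esrc Q F) (esrc Q G) \<and> zz_eq P (etgt Q F) (etgt Q G)"
proof (induction rule: eq3.induct)
  case (axiom F G)
  then show ?case using axiom3_boundary by blast
next
  case (refl F)
  then show ?case using expr3_boundary zz_eq.refl by blast
next
  case (sym F G)
  then show ?case using zz_eq.sym by blast
next
  case (trans F G H)
  then show ?case using zz_eq.trans by blast
next
  case (inv F G)
  then show ?case by simp
next
  case (comp F F' G G' i)
  have e: "is_expr3 Q F" "is_expr3 Q G" using comp eq3_expr3 by auto
  have "i = 1 \<Longrightarrow> zz_tgt P (etgt Q F) = zz_src (etgt Q G)"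
    using comp expr3_boundary[OF e(1)] expr3_boundary[OF e(2)] by (auto simp: parallel_def)
  moreover have "i = 0 \<or> i = 1 \<and> zz_tgt P (esrc Q F) = zz_src (esrc Q G) \<or> i = 2" using comp by auto
  ultimately show ?case using comp comp0_cong[of "esrc Q F" "esrc Q F'" "esrc Q G" "esrc Q G'"]
     comp0_cong[of "etgt Q F" "etgt Q F'" "etgt Q G" "etgt Q G'"]
     comp1_cong[of "esrc Q F" "esrc Q F'" "esrc Q G" "esrc Q G'"]
     comp1_cong[of "etgt Q F" "etgt Q F'" "etgt Q G" "etgt Q G'"]
    by (auto simp: comp2cells_def simp del: zz_comp0.simps zz_comp1.simps)
qed

lemma cell_between_free3:
  assumes "cell_between f g F"
  shows "\<exists>\<Phi>\<in>free3 Q. source3 Q \<Phi> = track2 P f \<and> target3 Q \<Phi> = track2 P g"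
proof -
  let ?\<Phi> = "{(F, G). eq3 Q F G} `` {F}"
  have F: "is_expr3 Q F" "zz_eq P (esrc Q F) f" "zz_eq P (etgt Q F) g"
    using assms by (auto simp: cell_between_def)
  have "?\<Phi> \<in> free3 Q" unfolding free3_def using F(1) by (intro quotientI) simp
  moreover have "source3 Q ?\<Phi> = track2 P f"
    using F eq3_boundary eq3.refl[OF F(1)] unfolding source3_def track2_def
    by auto (meson zz_eq.sym zz_eq.trans)+
  moreover have "target3 Q ?\<Phi> = track2 P g"
    using F eq3_boundary eq3.refl[OF F(1)] unfolding target3_def track2_def
    by auto (meson zz_eq.sym zz_eq.trans)+
  ultimately show ?thesis by blast
qed

text \<open>Every rule has a formal composite. Cancellation and exchange already hold in the track
  2-category and give units; a whiskered generating cell needs the composite built in the last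
  case.\<close>

lemma hty_cell_between: "hty P (boundaries Q) u p q \<Longrightarrow> \<exists>F. cell_between (u, p) (u, q) F"
proof (induction rule: hty.induct)
  case (refl u p v)
  then have "cell_between (u, p) (u, p) (Unit3 (u, p))"
    by (auto simp: cell_between_def simp del: is_zigzag.simps intro: zz_eq.refl path_zigzag)
  then show ?case by blast
next
  case (sym u p q)
  then obtain F where "cell_between (u, p) (u, q) F" by blast
  then have "cell_between (u, q) (u, p) (Inv3 F)" by (auto simp: cell_between_def)
  then show ?case by blast
next
  case (trans u p q r)
  then obtain F G where "cell_between (u, p) (u, q) F" "cell_between (u, q) (u, r) G" by blast
  then have "cell_between (u, p) (u, r) (Comp 2 F G)"
    by (auto simp: cell_between_def) (meson zz_eq.sym zz_eq.trans)
  then show ?case by blast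
next
  case (cancel u p s q v)
  then have z: "zz_eq P (u, p @ [s, inv_step s] @ q) (u, p @ q)" by (intro zz_eq.cancel) auto
  then have "cell_between (u, p @ [s, inv_step s] @ q) (u, p @ q) (Unit3 (u, p @ q))"
    using zz_eq_parallel[OF z] by (auto simp: cell_between_def intro: zz_eq.refl zz_eq.sym simp del: is_zigzag.simps)
  then show ?case by blast
next
  case (exchange u p w \<alpha> d m \<beta> e w' q v)
  let ?r = "p @ [Step w \<alpha> d (m @ cell_src P \<beta> e @ w'), Step (w @ cell_tgt P \<alpha> d @ m) \<beta> e w'] @ q"
  let ?r' = "p @ [Step (w @ cell_src P \<alpha> d @ m) \<beta> e w', Step w \<alpha> d (m @ cell_tgt P \<beta> e @ w')] @ q"
  have z: "zz_eq P (u, ?r) (u, ?r')" using exchange by (intro zz_eq.exchange) auto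
  then have "cell_between (u, ?r) (u, ?r') (Unit3 (u, ?r'))"
    using zz_eq_parallel[OF z] by (auto simp: cell_between_def intro: zz_eq.refl zz_eq.sym simp del: is_zigzag.simps)
  then show ?case by blast
next
  case (cell a p b q u c l r d v)
  obtain A where A: "A \<in> gen3 Q" "src3 Q A = (a, p)" "tgt3 Q A = (b, q)"
    using cell(1) by (auto simp: boundaries_def)
  obtain y where y: "a = b" "path P a p y" "path P a q y" using Q.cells[OF cell(1)] by blast
  have words: "l \<in> lists (gen1 P)" "r \<in> lists (gen1 P)" "y \<in> lists (gen1 P)" "a \<in> lists (gen1 P)"
    using cell path_words[OF Q.poly y(2)] by auto
  \<comment> \<open>\<open>?G\<close> whiskers the generating cell by the words \<open>l\<close> and
    \<open>r\<close>; \<open>?F\<close> then composes it with the 2-cells \<open>c\<close> and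
    \<open>d\<close>.\<close>
  let ?G = "Comp 0 (Unit3 (l, [])) (Comp 0 (Gen3 A) (Unit3 (r, [])))"
  let ?F = "Comp 1 (Unit3 (u, c)) (Comp 1 ?G (Unit3 (l @ y @ r, d)))"
  have lr: "path P l [] l" "path P r [] r" using words by auto
  have s: "path P (l @ a @ r) (map (whisker l r) p) (l @ y @ r)"
    "path P (l @ a @ r) (map (whisker l r) q) (l @ y @ r)"
    using path_whisker y words by blast+
  have ar: "path P (a @ r) (map (whisker [] r) p) (y @ r)" "path P (a @ r) (map (whisker [] r) q) (y @ r)"
    using path_whisker[OF y(2), of "[]" r] path_whisker[OF y(3), of "[]" r] words by simp_all
  have sG: "esrc Q ?G = (l @ a @ r, map (whisker l r) p)"
    using comp0_path(1)[OF lr(1) ar(1)] comp0_path(1)[OF y(2) lr(2)]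
    by (simp add: comp2cells_def A del: zz_comp0.simps)
  have tG: "etgt Q ?G = (l @ a @ r, map (whisker l r) q)"
    using comp0_path(1)[OF lr(1) ar(2)] comp0_path(1)[OF y(3) lr(2)]
    by (simp add: comp2cells_def A y(1)[symmetric] del: zz_comp0.simps)
  have d: "path P (l @ y @ r) d v" using Q.path_middle[OF cell(5) s(1)] cell(2) by blast
  have 1: "esrc Q (Comp 1 ?G (Unit3 (l @ y @ r, d))) = (l @ a @ r, map (whisker l r) p @ d)"
    using sG by (simp add: comp2cells_def del: esrc.simps zz_comp0.simps add: esrc.simps(2,4))
  have 2: "etgt Q (Comp 1 ?G (Unit3 (l @ y @ r, d))) = (l @ a @ r, map (whisker l r) q @ d)"
    using tG by (simp add: comp2cells_def del: esrc.simps zz_comp0.simps)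
  have 3: "esrc Q ?F = (u, c @ map (whisker l r) p @ d)" "etgt Q ?F = (u, c @ map (whisker l r) q @ d)"
    using 1 2 by (auto simp: comp2cells_def simp del: zz_comp0.simps)
  have "is_expr3 Q ?G" using A words by auto
  moreover have "zz_tgt P (esrc Q ?G) = l @ y @ r" unfolding sG using zz_tgt_path[OF s(1)] .
  ultimately have "is_expr3 Q (Comp 1 ?G (Unit3 (l @ y @ r, d)))"
    using d by auto
  then have 4: "is_expr3 Q ?F" using 1 zz_tgt_path[OF cell(5)] cell(5) by auto
  have "path P u (c @ map (whisker l r) q @ d) v"
    using Q.path_middle[OF cell(5) s(2)] d by blast
  then have "cell_between (u, c @ map (whisker l r) p @ d) (u, c @ map (whisker l r) q @ d) ?F"
    unfolding cell_between_def 3 using 4 zz_eq.refl[OF path_zigzag[OF cell(2)]] zz_eq.refl[OF path_zigzag] by blast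
  then show ?case by blast
qed

text \<open>From here on coherence means connecting parallel step lists by \<open>hty\<close>, and
  formal 3-cells no longer appear.\<close>

theorem homotopy_basisI:
  assumes "\<And>u p q v. path P u p v \<Longrightarrow> path P u q v \<Longrightarrow> hty P (boundaries Q) u p q"
  shows "homotopy_basis Q"
  unfolding homotopy_basis_def
proof (intro allI impI)
  fix f g assume fg: "is_zigzag P f" "is_zigzag P g" "parallel P f g"
  obtain u p v where f: "f = (u, p)" "path P u p v" "zz_src f = u" "zz_tgt P f = v" using zigzagE[OF fg(1)] .
  obtain u' q v' where g: "g = (u', q)" "path P u' q v'" "zz_src g = u'" "zz_tgt P g = v'" using zigzagE[OF fg(2)] .
  have "u' = u" "v' = v" using fg f g by (auto simp: parallel_def)
  then have "hty P (boundaries Q) u p q" using assms f g by auto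
  from hty_cell_between[OF this] \<open>u' = u\<close>
  show "\<exists>\<Phi>\<in>free3 Q. source3 Q \<Phi> = track2 P f \<and> target3 Q \<Phi> = track2 P g"
    using cell_between_free3 f g by metis
qed

end

section \<open>N-insertion and the stylic congruence\<close>

declare sorted_list_of_set.sorted_key_list_of_set_insert_remove [simp del]

section \<open>Invariance of N-insertion under the stylic relations\<close>

definition n_inserts :: "nat list \<Rightarrow> row list \<Rightarrow> row list" where
  "n_inserts w T = foldl (\<lambda>T x. n_insert x T) T w"

lemma n_inserts_simps [simp]:
  "n_inserts [] T = T" "n_inserts (x # w) T = n_inserts w (n_insert x T)"
  "n_inserts (v @ w) T = n_inserts w (n_inserts v T)"
  by (simp_all add: n_inserts_def)

lemma n_tableau_inserts: "n_tableau w = n_inserts w []"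
  by (simp add: n_tableau_def n_inserts_def)

text \<open>A list with at most one letter, so that bumping nothing needs no separate case in
  \<open>n_inserts (bump A x) T\<close>.\<close>

definition bump :: "nat set \<Rightarrow> nat \<Rightarrow> nat list" where
  "bump A x = (if \<exists>y\<in>A. x < y then [Min {y \<in> A. x < y}] else [])"

text \<open>The word that the next row receives while a word is inserted into a row with support
  \<open>A\<close>.\<close>

fun bumps :: "nat set \<Rightarrow> nat list \<Rightarrow> nat list" where
  "bumps A [] = []"
| "bumps A (x # w) = bump A x @ bumps (insert x A) w"

definition hd_set :: "row list \<Rightarrow> nat set" where
  "hd_set T = (case T of [] \<Rightarrow> {} | u # _ \<Rightarrow> set u)"

lemma n_insert_bump: "n_insert x T = sorted_list_of_set (insert x (hd_set T)) # n_inserts (bump (hd_set T) x) (tl T)"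
  by (cases T) (auto simp: hd_set_def bump_def)

text \<open>The bottom row collects the whole word and the rows above receive the bumped word. Two
  insertions can therefore be compared through their bumped words, by induction on the rows.\<close>

lemma n_inserts_bumps:
  "w \<noteq> [] \<Longrightarrow> n_inserts w T = sorted_list_of_set (set w \<union> hd_set T) # n_inserts (bumps (hd_set T) w) (tl T)"
proof (induction w arbitrary: T)
  case (Cons x w)
  have h: "hd_set (n_insert x T) = insert x (hd_set T)"
    by (cases T) (auto simp: hd_set_def)
  have t: "tl (n_insert x T) = n_inserts (bump (hd_set T) x) (tl T)"
    by (simp add: n_insert_bump)
  show ?case
  proof (cases "w = []")
    case True
    then show ?thesis by (simp add: n_insert_bump)
  next
    case False
    from Cons.IH[OF this, of "n_insert x T"] show ?thesis by (simp add: h t)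
  qed
qed simp

lemma bump_empty [simp]: "bump {} x = []"
  by (simp add: bump_def)

lemma bump_Nil_iff: "bump A x = [] \<longleftrightarrow> (\<forall>y\<in>A. y \<le> x)"
  by (simp add: bump_def not_less) (meson not_le)

lemma bump_single_iff:
  "finite A \<Longrightarrow> bump A x = [a] \<longleftrightarrow> a \<in> A \<and> x < a \<and> (\<forall>y\<in>A. x < y \<longrightarrow> a \<le> y)"
proof -
  assume "finite A"
  then have f: "finite {y \<in> A. x < y}" by simp
  show ?thesis
  proof
    assume "bump A x = [a]"
    then have e: "{y \<in> A. x < y} \<noteq> {}" and a: "a = Min {y \<in> A. x < y}"
      by (auto simp: bump_def split: if_splits)
    then show "a \<in> A \<and> x < a \<and> (\<forall>y\<in>A. x < y \<longrightarrow> a \<le> y)"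
      using Min_in[OF f e] Min_le[OF f] by auto
  next
    assume a: "a \<in> A \<and> x < a \<and> (\<forall>y\<in>A. x < y \<longrightarrow> a \<le> y)"
    then have "Min {y \<in> A. x < y} = a" by (intro Min_eqI) (use f in auto)
    then show "bump A x = [a]" using a by (auto simp: bump_def)
  qed
qed

lemma bump_cases:
  assumes "finite A"
  obtains "bump A x = []" "\<forall>y\<in>A. y \<le> x"
  | a where "bump A x = [a]" "a \<in> A" "x < a" "\<forall>y\<in>A. x < y \<longrightarrow> a \<le> y"
proof (cases "bump A x = []")
  case True
  then show ?thesis using that(1) bump_Nil_iff by blast
next
  case False
  then obtain a where "bump A x = [a]" by (auto simp: bump_def split: if_splits)
  then show ?thesis using that(2) bump_single_iff[OF assms] by blast
qed

lemma bump_insert_le: "z \<le> x \<Longrightarrow> bump (insert z A) x = bump A x"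
proof -
  assume "z \<le> x"
  then have "{y \<in> insert z A. x < y} = {y \<in> A. x < y}" by auto
  then show ?thesis using \<open>z \<le> x\<close> by (auto simp: bump_def)
qed

lemma bump_insert_Nil: "finite A \<Longrightarrow> x < z \<Longrightarrow> bump A x = [] \<Longrightarrow> bump (insert z A) x = [z]"
  using bump_single_iff[of "insert z A" x z] by (auto simp: bump_Nil_iff)

lemma bump_insert_single:
  "finite A \<Longrightarrow> x < z \<Longrightarrow> bump A x = [a] \<Longrightarrow> bump (insert z A) x = [min a z]"
  using bump_single_iff[of "insert z A" x "min a z"] bump_single_iff[of A x a] by (auto simp: min_def)

lemma bump_mono: "finite A \<Longrightarrow> x \<le> y \<Longrightarrow> bump A y = [b] \<Longrightarrow> \<exists>a. bump A x = [a] \<and> a \<le> b"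
  by (cases rule: bump_cases[of A x]) (auto simp: bump_single_iff)

lemma hd_set_Nil [simp]: "hd_set [] = {}"
  by (simp add: hd_set_def)

lemma n_inserts_eta: "n_inserts [x, x] T = n_inserts [x] T"
proof (induction T arbitrary: x)
  case Nil
  show ?case by simp
next
  case (Cons u T)
  have "bumps (set u) [x, x] = bump (set u) x @ bump (set u) x"
    by (simp add: bump_insert_le)
  moreover have "n_inserts (bump (set u) x @ bump (set u) x) T = n_inserts (bump (set u) x) T"
  proof (cases rule: bump_cases[OF finite_set, of u x])
    case (2 a)
    then show ?thesis using Cons.IH[of a] by simp
  qed simp
  ultimately have "n_inserts (bumps (set u) [x, x]) T = n_inserts (bumps (set u) [x]) T"
    by simp
  then show ?case
    using n_inserts_bumps[of "[x, x]" "u # T"] n_inserts_bumps[of "[x]" "u # T"]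
    by (simp add: hd_set_def del: n_inserts_simps bumps.simps)
qed

lemma n_inserts_eqI:
  assumes "v \<noteq> []" "w \<noteq> []" "set v = set w"
    "n_inserts (bumps (hd_set T) v) (tl T) = n_inserts (bumps (hd_set T) w) (tl T)"
  shows "n_inserts v T = n_inserts w T"
  using n_inserts_bumps[of v T] n_inserts_bumps[of w T] assms by simp

lemma n_inserts_Cons_eqI:
  assumes "n_inserts (bumps (set u) v) T = n_inserts (bumps (set u) w) T"
    "v \<noteq> []" "w \<noteq> []" "set v = set w"
  shows "n_inserts v (u # T) = n_inserts w (u # T)"
  using n_inserts_eqI[of v w "u # T"] assms by (simp add: hd_set_def)

text \<open>Write \<open>a\<close>, \<open>b\<close>, \<open>c\<close> for what \<open>x\<close>,
  \<open>y\<close>, \<open>z\<close> bump from \<open>A\<close>. If \<open>x\<close> bumps nothing,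
  the new \<open>z\<close> is bumped instead, twice or once. If \<open>x\<close> bumps a letter and
  \<open>z\<close> does not, the words agree. If all bump and \<open>a \<le> z\<close>, they form a
  kappa pair with \<open>min b z\<close> in the role of \<open>y\<close>; if \<open>z < a\<close>,
  then \<open>a = b = c\<close> and the words differ only by repetitions.\<close>

lemma bumps_kappa:
  assumes A: "finite A" and xyz: "x \<le> y" "y < z"
  shows "bumps A [z, x, y] = bumps A [x, z, y] \<or>
    (\<exists>a b c. a \<le> b \<and> b < c \<and> bumps A [z, x, y] = [c, a, b] \<and> bumps A [x, z, y] = [a, c, b] \<and> A \<noteq> {}) \<or>
    (\<exists>c. bumps A [z, x, y] = [c, z, z] \<and> bumps A [x, z, y] = [c, c, z]) \<or>
    (bumps A [z, x, y] = [z, z] \<and> bumps A [x, z, y] = [z])"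
proof -
  have s: "bump (insert x A) z = bump A z" using xyz by (intro bump_insert_le) auto
  have y1: "bump (insert x (insert z A)) y = bump (insert z A) y"
    "bump (insert z (insert x A)) y = bump (insert z A) y"
    using xyz by (simp_all add: bump_insert_le insert_commute[of z])
  have e: "bumps A [z, x, y] = bump A z @ bump (insert z A) x @ bump (insert z A) y"
    "bumps A [x, z, y] = bump A x @ bump A z @ bump (insert z A) y"
    using s y1 by simp_all
  consider (N) "bump A x = []" | (S) a where "bump A x = [a]" "a \<in> A" "x < a" "\<forall>y\<in>A. x < y \<longrightarrow> a \<le> y"
    using bump_cases[OF A, of x] by metis
  then show ?thesis
  proof cases
    case N
    then have "bump A z = []" "bump A y = []" using xyz by (auto simp: bump_Nil_iff)
    then show ?thesis using e N A xyz by (simp add: bump_insert_Nil)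
  next
    case S
    note bx = bump_insert_single[OF A _ S(1), of z]
    show ?thesis
    proof (cases "bump A z = []")
      case True
      then have zmax: "\<forall>w\<in>A. w \<le> z" by (simp add: bump_Nil_iff)
      then have "a \<le> z" using S by auto
      then show ?thesis using e True bx xyz S(1) by simp
    next
      case False
      then obtain c where c: "bump A z = [c]" "c \<in> A" "z < c" "\<forall>y\<in>A. z < y \<longrightarrow> c \<le> y"
        using bump_cases[OF A, of z] by metis
      then obtain b where b: "bump A y = [b]" "b \<le> c" using bump_mono[OF A _ c(1), of y] xyz by auto
      then have ab: "a \<le> b" using bump_mono[OF A xyz(1) b(1)] S(1) by auto
      have by': "bump (insert z A) y = [min b z]" using bump_insert_single[OF A xyz(2) b(1)] .
      show ?thesis
      proof (cases "a \<le> z")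
        case True
        then have "bumps A [z, x, y] = [c, a, min b z]" "bumps A [x, z, y] = [a, c, min b z]"
          using e bx xyz c(1) by' S(1) by (simp_all add: min_def)
        moreover have "a \<le> min b z" "min b z < c" using True ab c by auto
        ultimately show ?thesis using c(2) by blast
      next
        case False
        then have "z < a" by simp
        then have "a = c" using c S xyz by (intro antisym) auto
        moreover have "b = c" using b ab \<open>a = c\<close> by simp
        ultimately have "bumps A [z, x, y] = [c, z, z]" "bumps A [x, z, y] = [c, c, z]"
          using e bx xyz c by' S(1) by (simp_all add: min_def)
        then show ?thesis by blast
      qed
    qed
  qed
qed

text \<open>The bumped words are equal, or again the two sides of a kappa relation, or equal up to
  repeated letters; the last two cases are settled by the induction on rows and by
  \<open>n_inserts_eta\<close>.\<close>

lemma n_inserts_kappa: "x \<le> y \<Longrightarrow> y < z \<Longrightarrow> n_inserts [z, x, y] T = n_inserts [x, z, y] T"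
proof (induction T arbitrary: x y z)
  case Nil
  have e: "bumps {} [z, x, y] = [z, z]" "bumps {} [x, z, y] = [z]"
    using Nil bump_insert_Nil[of "{}" x z] bump_insert_Nil[of "{}" y z]
    by (simp_all add: bump_insert_le insert_commute[of z])
  show ?case
  proof (rule n_inserts_eqI)
    show "n_inserts (bumps (hd_set []) [z, x, y]) (tl []) = n_inserts (bumps (hd_set []) [x, z, y]) (tl [])"
      unfolding hd_set_Nil e by (rule n_inserts_eta)
  qed auto
next
  case (Cons u T)
  have c: "n_inserts [c, z, z] T = n_inserts [c, c, z] T" for c
    using n_inserts_eta[of z "n_insert c T"] n_inserts_eta[of c T] by simp
  have "n_inserts (bumps (set u) [z, x, y]) T = n_inserts (bumps (set u) [x, z, y]) T"
    using bumps_kappa[OF finite_set Cons.prems, of u]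
  proof (elim disjE exE conjE)
    fix a b c assume "a \<le> b" "b < c" and e: "bumps (set u) [z, x, y] = [c, a, b]" "bumps (set u) [x, z, y] = [a, c, b]"
    then show ?thesis unfolding e by (intro Cons.IH)
  next
    fix d assume e: "bumps (set u) [z, x, y] = [d, z, z]" "bumps (set u) [x, z, y] = [d, d, z]"
    show ?thesis unfolding e by (rule c)
  next
    assume e: "bumps (set u) [z, x, y] = [z, z]" "bumps (set u) [x, z, y] = [z]"
    show ?thesis unfolding e by (rule n_inserts_eta)
  qed (rule arg_cong)
  then show ?case by (rule n_inserts_Cons_eqI) auto
qed

text \<open>Once \<open>y\<close> is present, \<open>x\<close> bumps the same letter
  \<open>d \<le> y\<close> whether or not \<open>z\<close> has been inserted. If \<open>z\<close>
  bumps \<open>c\<close>, then \<open>y\<close> bumps some \<open>b\<close> with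
  \<open>y < b \<le> c\<close>, so \<open>d\<close>, \<open>b\<close>, \<open>c\<close> satisfy the
  inequalities of a lambda relation.\<close>

lemma bumps_lambda:
  assumes A: "finite A" and xyz: "x < y" "y \<le> z"
  shows "bumps A [y, z, x] = bumps A [y, x, z] \<or>
    (\<exists>a b c. a < b \<and> b \<le> c \<and> bumps A [y, z, x] = [b, c, a] \<and> bumps A [y, x, z] = [b, a, c])"
proof -
  have z1: "bump (insert y A) z = bump A z" "bump (insert x (insert y A)) z = bump A z"
    using xyz by (simp_all add: bump_insert_le)
  define d where "d = (if bump A x = [] then y else min (hd (bump A x)) y)"
  have y1: "bump (insert y A) x = [d]"
    using bump_insert_Nil[OF A xyz(1)] bump_insert_single[OF A xyz(1)] unfolding d_def
    by (cases rule: bump_cases[OF A, of x]) auto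
  have dy: "d \<le> y" by (simp add: d_def)
  have x1: "bump (insert z (insert y A)) x = [d]"
    using bump_insert_single[OF _ _ y1, of z] A xyz dy by simp
  have e: "bumps A [y, z, x] = bump A y @ bump A z @ [d]" "bumps A [y, x, z] = bump A y @ [d] @ bump A z"
    using z1 x1 y1 by simp_all
  show ?thesis
  proof (cases rule: bump_cases[OF A, of z])
    case 1
    then show ?thesis using e by simp
  next
    case (2 c)
    then obtain b where b: "bump A y = [b]" "b \<le> c" using bump_mono[OF A xyz(2)] by blast
    then have "y < b" using bump_single_iff[OF A] by blast
    then show ?thesis using e 2(1) b dy by (intro disjI2) auto
  qed
qed

lemma n_inserts_lambda: "x < y \<Longrightarrow> y \<le> z \<Longrightarrow> n_inserts [y, z, x] T = n_inserts [y, x, z] T"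
proof (induction T arbitrary: x y z)
  case Nil
  have e: "bumps {} [y, z, x] = [y]" "bumps {} [y, x, z] = [y]"
    using Nil bump_insert_Nil[of "{}" x y] bump_insert_single[of "{y}" x z y]
    by (simp_all add: bump_insert_le)
  show ?case
  proof (rule n_inserts_eqI)
    show "n_inserts (bumps (hd_set []) [y, z, x]) (tl []) = n_inserts (bumps (hd_set []) [y, x, z]) (tl [])"
      unfolding hd_set_Nil e by (rule HOL.refl)
  qed auto
next
  case (Cons u T)
  have "n_inserts (bumps (set u) [y, z, x]) T = n_inserts (bumps (set u) [y, x, z]) T"
    using bumps_lambda[OF finite_set Cons.prems, of u]
  proof (elim disjE exE conjE)
    fix a b c assume "a < b" "b \<le> c" and e: "bumps (set u) [y, z, x] = [b, c, a]" "bumps (set u) [y, x, z] = [b, a, c]"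
    then show ?thesis unfolding e by (intro Cons.IH)
  qed (rule arg_cong)
  then show ?case by (rule n_inserts_Cons_eqI) auto
qed

lemma word_cong_n_inserts: "word_cong (styl n) v w \<Longrightarrow> n_inserts v T = n_inserts w T"
proof (induction arbitrary: T rule: word_cong.induct)
  case (cell \<beta>)
  then show ?case
    using n_inserts_eta n_inserts_kappa n_inserts_lambda
    by (auto simp: styl_def simp del: n_inserts_simps)
qed auto

lemma word_cong_n_tableau: "word_cong (styl n) v w \<Longrightarrow> n_tableau v = n_tableau w"
  using word_cong_n_inserts n_tableau_inserts by metis

section \<open>Insertion of whole rows and readings of tableaux\<close>

lemma n_inserts_remdups_adj: "n_inserts (remdups_adj w) T = n_inserts w T"
proof (induction w arbitrary: T rule: remdups_adj.induct)
  case (3 x y w)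
  then show ?case using n_inserts_eta[of x T] by (cases "x = y") auto
qed auto

lemma sorted_remdups_adj: "sorted w \<Longrightarrow> sorted_wrt (<) (remdups_adj w)"
  by (induction w rule: remdups_adj.induct) (auto simp: less_le)

lemma strict_sorted_list: "sorted_wrt (<) u \<Longrightarrow> sorted_list_of_set (set u) = u" for u :: "nat list"
  by (simp add: strict_sorted_iff sorted_list_of_set.idem_if_sorted_distinct)

lemma remdups_adj_sorted: "sorted w \<Longrightarrow> remdups_adj w = sorted_list_of_set (set w)" for w :: "nat list"
  using strict_sorted_list[OF sorted_remdups_adj, of w] by simp

text \<open>Earlier letters of a sorted word do not exceed later ones, so their presence in the row
  does not change what the later letters bump.\<close>

lemma bumps_sorted: "sorted w \<Longrightarrow> bumps A w = concat (map (bump A) w)"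
proof (induction w arbitrary: A)
  case (Cons x w)
  then have m: "map (bump (insert x A)) w = map (bump A) w"
    by (auto intro!: bump_insert_le)
  moreover have "bumps (insert x A) w = concat (map (bump (insert x A)) w)" using Cons by simp
  ultimately show ?case unfolding bumps.simps m by simp
qed simp

lemma sorted_bumps:
  assumes "finite A" "sorted w"
  shows "sorted (concat (map (bump A) w))"
  using assms(2)
proof (induction w)
  case (Cons x w)
  have "\<forall>a\<in>set (bump A x). \<forall>b\<in>set (bump A y). a \<le> b" if "y \<in> set w" for y
  proof (cases rule: bump_cases[OF assms(1), of y])
    case (2 b)
    then show ?thesis using bump_mono[OF assms(1), of x y b] Cons that by fastforce
  qed simp
  moreover have "sorted (bump A x)" by (simp add: bump_def)
  ultimately show ?case using Cons by (auto simp: sorted_append)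
qed simp

text \<open>The letters of \<open>u\<close> that are bumped by \<open>v\<close>. A set suffices for
  rows, since the bumped word is then sorted and eta makes its repetitions irrelevant.\<close>

definition bump_set :: "nat list \<Rightarrow> nat list \<Rightarrow> nat set" where
  "bump_set u v = {y \<in> set u. \<exists>x\<in>set v. x < y \<and> (\<forall>z\<in>set u. x < z \<longrightarrow> y \<le> z)}"

lemma set_bumps: "set (concat (map (bump (set u)) v)) = bump_set u v"
proof -
  have "y \<in> set (bump (set u) x) \<longleftrightarrow> bump (set u) x = [y]" for x y
    by (auto simp: bump_def split: if_splits)
  then show ?thesis by (auto simp: bump_set_def bump_single_iff)
qed

lemma n_inserts_bump_set:
  assumes "sorted v"
  shows "n_inserts (bumps (set u) v) T = n_inserts (sorted_list_of_set (bump_set u v)) T"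
proof -
  have b: "bumps (set u) v = concat (map (bump (set u)) v)" using bumps_sorted assms by blast
  have "sorted (bumps (set u) v)" "set (bumps (set u) v) = bump_set u v"
    using sorted_bumps[OF _ assms, of "set u"] set_bumps[of u v] by (simp_all add: b)
  then show ?thesis using n_inserts_remdups_adj remdups_adj_sorted by metis
qed

lemma n_inserts_row_Nil:
  assumes "sorted_wrt (<) u" "u \<noteq> []"
  shows "n_inserts u [] = [u]"
proof -
  have "bumps {} u = []" using assms by (simp add: bumps_sorted strict_sorted_iff)
  then show ?thesis using n_inserts_bumps[of u "[]"] assms strict_sorted_list by simp
qed

text \<open>There is no third row: inserting a strictly increasing word into the empty tableau bumps
  nothing.\<close>

lemma n_tableau_rows:
  assumes u: "sorted_wrt (<) u" "u \<noteq> []" and v: "sorted_wrt (<) v" "v \<noteq> []"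
  shows "n_tableau (u @ v) = sorted_list_of_set (set u \<union> set v) #
    (if bump_set u v = {} then [] else [sorted_list_of_set (bump_set u v)])"
proof -
  have "finite (bump_set u v)" by (simp add: bump_set_def)
  then have "n_inserts (sorted_list_of_set (bump_set u v)) [] =
     (if bump_set u v = {} then [] else [sorted_list_of_set (bump_set u v)])"
    using n_inserts_row_Nil by auto
  then show ?thesis
    using n_inserts_bumps[of v "[u]"] n_inserts_bump_set[of v u "[]"] v(2) n_inserts_row_Nil[OF u] v
    by (simp add: n_tableau_inserts hd_set_def strict_sorted_iff Un_commute)
qed

text \<open>Each letter of \<open>v\<close> other than the least is bumped by its predecessor in
  \<open>v\<close>, which also occurs in \<open>u\<close>; the least one is bumped by the least
  letter of \<open>u\<close>.\<close>

lemma bump_set_ntri: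
  assumes "u \<noteq> []" "v \<lhd>\<^sub>N u"
  shows "bump_set v u = set v"
proof -
  have "\<exists>x\<in>set u. x < y \<and> (\<forall>z\<in>set v. x < z \<longrightarrow> y \<le> z)" if y: "y \<in> set v" for y
  proof (cases "\<exists>x\<in>set v. x < y")
    case True
    then have ne: "{x \<in> set v. x < y} \<noteq> {}" by auto
    let ?x = "Max {x \<in> set v. x < y}"
    have "?x \<in> {x \<in> set v. x < y}" using Max_in[OF _ ne] by simp
    moreover have "y \<le> z" if "z \<in> set v" "?x < z" for z
    proof (rule ccontr)
      assume "\<not> y \<le> z"
      then have "z \<le> ?x" using that by (intro Max_ge) auto
      then show False using that by simp
    qed
    ultimately show ?thesis using assms(2) by (auto simp: ntri_def)
  next
    case False
    have "Min (set u) \<in> set u" using assms(1) by simp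
    moreover have "Min (set u) < y"
      using assms(2) Min_le[OF finite_set y] unfolding ntri_def by (meson le_less_trans not_le)
    ultimately show ?thesis using False by (meson not_less)
  qed
  then show ?thesis by (auto simp: bump_set_def)
qed

text \<open>The bottom row \<open>v\<close> of \<open>T\<close> has its support inside
  \<open>u\<close>, so it becomes \<open>u\<close> and is bumped as a whole into the next row, where
  the same happens again.\<close>

lemma n_inserts_ntri:
  assumes "sorted_wrt (<) u" "u \<noteq> []" "\<forall>v\<in>set T. sorted_wrt (<) v \<and> v \<noteq> []"
    "successively (\<lambda>u v. v \<lhd>\<^sub>N u) (u # T)"
  shows "n_inserts u T = u # T"
  using assms
proof (induction T arbitrary: u)
  case Nil
  then show ?case using n_inserts_row_Nil by simp
next
  case (Cons v T)
  have vu: "v \<lhd>\<^sub>N u" and v: "sorted_wrt (<) v" "v \<noteq> []" using Cons.prems by auto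
  have "n_inserts v T = v # T" using Cons by (intro Cons.IH) auto
  moreover have "n_inserts (bumps (set v) u) T = n_inserts v T"
    using n_inserts_bump_set[of u v T] bump_set_ntri[OF Cons.prems(2) vu] Cons.prems(1)
      strict_sorted_list[OF v(1)] by (simp add: strict_sorted_iff)
  moreover have "set u \<union> set v = set u" using vu by (auto simp: ntri_def)
  ultimately show ?case
    using n_inserts_bumps[OF Cons.prems(2), of "v # T"] strict_sorted_list[OF Cons.prems(1)]
    by (simp add: hd_set_def)
qed

lemma n_tableau_reading:
  assumes "\<forall>v\<in>set W. sorted_wrt (<) v \<and> v \<noteq> []" "successively (\<lhd>\<^sub>N) W"
  shows "n_tableau (concat W) = rev W"
proof -
  have "n_tableau (concat (rev T)) = T"
    if "\<forall>v\<in>set T. sorted_wrt (<) v \<and> v \<noteq> []" "successively (\<lambda>u v. v \<lhd>\<^sub>N u) T" for T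
    using that
  proof (induction T)
    case (Cons u T)
    then have "n_inserts u T = u # T" by (intro n_inserts_ntri) auto
    moreover have "successively (\<lambda>u v. v \<lhd>\<^sub>N u) T" using Cons.prems(2) by (cases T) auto
    ultimately show ?case using Cons by (simp add: n_tableau_inserts)
  qed (simp add: n_tableau_inserts)
  from this[of "rev W"] show ?thesis using assms by simp
qed

subsection \<open>Words and the readings of their tableaux\<close>

lemma word_cong_context:
  assumes "word_cong (styl n) v w" "p \<in> lists {1..n}" "q \<in> lists {1..n}"
  shows "word_cong (styl n) (p @ v @ q) (p @ w @ q)"
  using assms by (intro word_cong.append word_cong.refl) (auto simp: styl_def)

lemma word_cong_eta: "x \<in> {1..n} \<Longrightarrow> word_cong (styl n) [x, x] [x]"
  using word_cong.cell[of "Eta x" "styl n"] by (auto simp: styl_def)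

lemma word_cong_kappa: "{x, y, z} \<subseteq> {1..n} \<Longrightarrow> x \<le> y \<Longrightarrow> y < z \<Longrightarrow> word_cong (styl n) [z, x, y] [x, z, y]"
  using word_cong.cell[of "Kappa x y z" "styl n"] by (auto simp: styl_def)

lemma word_cong_lambda: "{x, y, z} \<subseteq> {1..n} \<Longrightarrow> x < y \<Longrightarrow> y \<le> z \<Longrightarrow> word_cong (styl n) [y, z, x] [y, x, z]"
  using word_cong.cell[of "Lambda x y z" "styl n"] by (auto simp: styl_def)

text \<open>Lambda lets \<open>x\<close> pass \<open>b\<close> to the left when some
  \<open>a\<close> with \<open>x < a \<le> b\<close> stands before \<open>b\<close>; hence
  \<open>x\<close> stops right behind the first letter of \<open>r\<close>.\<close>

lemma word_cong_left_past:
  assumes "r \<noteq> []" "sorted_wrt (<) r" "\<forall>a\<in>set r. x < a" "set r \<subseteq> {1..n}" "x \<in> {1..n}"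
  shows "word_cong (styl n) (r @ [x]) (hd r # x # tl r)"
  using assms
proof (induction r)
  case (Cons a r)
  show ?case
  proof (cases r)
    case Nil
    then show ?thesis using Cons by (auto intro!: word_cong.refl simp: styl_def)
  next
    case (Cons b s)
    have "word_cong (styl n) (r @ [x]) (b # x # s)"
      using Cons.IH Cons.prems Cons by auto
    then have 1: "word_cong (styl n) ([a] @ (r @ [x]) @ []) ([a] @ (b # x # s) @ [])"
      using Cons.prems by (intro word_cong_context) auto
    have 2: "word_cong (styl n) ([] @ [a, b, x] @ s) ([] @ [a, x, b] @ s)"
      using Cons.prems Cons by (intro word_cong_context word_cong_lambda) auto
    show ?thesis using word_cong.trans[OF 1] 2 Cons by simp
  qed
qed simp

text \<open>Inverse kappa moves \<open>y\<close> left across \<open>a\<close> when a letter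
  \<open>b\<close> with \<open>a \<le> b < y\<close> follows; the final \<open>x\<close> ensures
  that such a letter is always there.\<close>

lemma word_cong_right_past:
  assumes "sorted (p @ [x])" "x < y" "set p \<subseteq> {1..n}" "x \<in> {1..n}" "y \<in> {1..n}"
  shows "word_cong (styl n) (p @ [y, x]) (y # p @ [x])"
  using assms
proof (induction p)
  case Nil
  then show ?case by (auto intro!: word_cong.refl simp: styl_def)
next
  case (Cons a p)
  obtain b s where bs: "p @ [x] = b # s" by (cases p) auto
  then have b: "b \<in> set (p @ [x])" by simp
  have "word_cong (styl n) (p @ [y, x]) (y # b # s)" using Cons bs by auto
  then have 1: "word_cong (styl n) ([a] @ (p @ [y, x]) @ []) ([a] @ (y # b # s) @ [])"
    using Cons.prems by (intro word_cong_context) auto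
  have le: "a \<le> b" using b Cons.prems by auto
  have lt: "b < y" using b Cons.prems by (auto simp: sorted_append)
  have s: "set s \<subseteq> {1..n}" "b \<in> {1..n}"
  proof -
    have "set (b # s) = insert x (set p)" using bs[symmetric] by simp
    moreover have "insert x (set p) \<subseteq> {1..n}" using Cons.prems(3,4) by (simp del: atLeastAtMost_iff)
    ultimately have "set (b # s) \<subseteq> {1..n}" by simp
    then show "set s \<subseteq> {1..n}" "b \<in> {1..n}" by auto
  qed
  have 2: "word_cong (styl n) ([] @ [y, a, b] @ s) ([] @ [a, y, b] @ s)"
    using Cons.prems le lt s by (intro word_cong_context word_cong_kappa) auto
  show ?case using word_cong.trans[OF 1] word_cong.sym[OF 2] bs by simp
qed

text \<open>Split \<open>u\<close> at \<open>x\<close> into \<open>p\<close> and \<open>q\<close>,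
  with \<open>q = y # q'\<close> when something is bumped. The new letter moves left to just behind
  \<open>y\<close>; \<open>y\<close> is then duplicated, one copy staying behind \<open>x\<close>
  and the other moving left past \<open>p\<close> to become the bumped letter.\<close>

lemma word_cong_row_bump:
  assumes u: "sorted_wrt (<) u" "set u \<subseteq> {1..n}" and x: "x \<in> {1..n}"
  shows "word_cong (styl n) (u @ [x]) (bump (set u) x @ sorted_list_of_set (insert x (set u)))"
proof -
  define p q where "p = takeWhile (\<lambda>a. a \<le> x) u" and "q = dropWhile (\<lambda>a. a \<le> x) u"
  have upq: "u = p @ q" by (simp add: p_def q_def)
  have p: "\<forall>a\<in>set p. a \<le> x" by (auto simp: p_def dest: set_takeWhileD)
  have su: "sorted_wrt (<) p" "sorted_wrt (<) q" using u upq by (auto simp: sorted_wrt_append)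
  have q: "\<forall>a\<in>set q. x < a"
  proof (cases q)
    case (Cons y q')
    then have "x < y" using hd_dropWhile[of "\<lambda>a. a \<le> x" u] by (auto simp: q_def)
    then show ?thesis using su(2) Cons by auto
  qed simp
  define px where "px = (if x \<in> set p then p else p @ [x])"
  have spx: "sorted_wrt (<) px" "set px = insert x (set p)"
    using su p by (auto simp: px_def sorted_wrt_append le_less)
  have s: "sorted_list_of_set (insert x (set u)) = px @ q"
    using strict_sorted_list[of "px @ q"] spx su q p upq by (fastforce simp: sorted_wrt_append)
  have setn: "set p \<subseteq> {1..n}" "set q \<subseteq> {1..n}" using u upq by auto
  have px: "word_cong (styl n) (p @ [x]) px"
  proof (cases "x \<in> set p")
    case True
    then obtain p' p'' where pp: "p = p' @ x # p''" by (auto simp: in_set_conv_decomp)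
    then have "p'' = []" using su(1) p by (cases p'') (auto simp: sorted_wrt_append)
    then have "word_cong (styl n) (p' @ [x, x] @ []) (p' @ [x] @ [])"
      using setn pp x by (intro word_cong_context word_cong_eta) auto
    then show ?thesis using True \<open>p'' = []\<close> pp by (simp add: px_def)
  next
    case False
    then show ?thesis using setn x by (auto simp: px_def styl_def intro!: word_cong.refl)
  qed
  show ?thesis
  proof (cases q)
    case Nil
    then have "bump (set u) x = []" using p upq by (simp add: bump_Nil_iff)
    then show ?thesis using s Nil px upq by simp
  next
    case (Cons y q')
    have xy: "x < y" "y \<in> {1..n}" "set q' \<subseteq> {1..n}" using q Cons setn by auto
    have b: "bump (set u) x = [y]"
      using q p su(2) upq Cons by (auto simp: bump_single_iff)
    have 1: "word_cong (styl n) (p @ (q @ [x]) @ []) (p @ (y # x # q') @ [])"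
      using word_cong_left_past[of q x n] q su setn x Cons by (intro word_cong_context) auto
    have 2: "word_cong (styl n) ([] @ [y, y] @ [x]) ([] @ [y] @ [x])"
      using xy x by (intro word_cong_context word_cong_eta) auto
    \<comment> \<open>Eta read backwards doubles \<open>y\<close>; lambda with both larger letters
      equal to \<open>y\<close> turns \<open>y y x\<close> into \<open>y x y\<close>.\<close>
    have "word_cong (styl n) [y, x] [y, x, y]"
      using word_cong.trans[OF word_cong.sym[OF 2]] word_cong_lambda[of x y y n] xy x by simp
    then have 3: "word_cong (styl n) (p @ [y, x] @ q') (p @ [y, x, y] @ q')"
      using setn xy by (intro word_cong_context) auto
    have "sorted (p @ [x])" using p su by (auto simp: sorted_append strict_sorted_iff)
    then have 4: "word_cong (styl n) ([] @ (p @ [y, x]) @ y # q') ([] @ (y # p @ [x]) @ y # q')"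
      using word_cong_right_past[of p x y n] xy setn x by (intro word_cong_context) auto
    have 5: "word_cong (styl n) ([y] @ (p @ [x]) @ y # q') ([y] @ px @ y # q')"
      using px xy by (intro word_cong_context) auto
    have "word_cong (styl n) (u @ [x]) (y # px @ q)"
      using word_cong.trans[OF word_cong.trans[OF word_cong.trans[OF 1[simplified] 3[simplified]] 4[simplified]] 5[simplified]] upq Cons
      by simp
    then show ?thesis using s b by simp
  qed
qed

lemma n_insert_rows:
  "\<forall>u\<in>set T. sorted_wrt (<) u \<and> set u \<subseteq> {1..n} \<Longrightarrow> x \<in> {1..n} \<Longrightarrow>
    \<forall>u\<in>set (n_insert x T). sorted_wrt (<) u \<and> set u \<subseteq> {1..n}"
proof (induction T arbitrary: x)
  case Nil
  then show ?case by simp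
next
  case (Cons u T)
  have 1: "sorted_wrt (<) (sorted_list_of_set (insert x (set u))) \<and>
      set (sorted_list_of_set (insert x (set u))) \<subseteq> {1..n}"
    using Cons.prems by simp
  have 2: "\<forall>u\<in>set (n_inserts (bump (set u) x) T). sorted_wrt (<) u \<and> set u \<subseteq> {1..n}"
  proof (cases rule: bump_cases[OF finite_set, of u x])
    case 1
    then show ?thesis using Cons.prems by simp
  next
    case (2 a)
    have "a \<in> {1..n}" using 2(2) Cons.prems(1) by auto
    then have "\<forall>u\<in>set (n_insert a T). sorted_wrt (<) u \<and> set u \<subseteq> {1..n}"
      using Cons.prems(1) by (intro Cons.IH) auto
    then show ?thesis using 2(1) by simp
  qed
  have "n_insert x (u # T) = sorted_list_of_set (insert x (set u)) # n_inserts (bump (set u) x) T"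
    by (subst n_insert_bump) (simp add: hd_set_def)
  then show ?case using 1 2 by (metis set_ConsD)
qed

lemma word_cong_n_insert:
  "\<forall>u\<in>set T. sorted_wrt (<) u \<and> set u \<subseteq> {1..n} \<Longrightarrow> x \<in> {1..n} \<Longrightarrow>
    word_cong (styl n) (concat (rev T) @ [x]) (concat (rev (n_insert x T)))"
proof (induction T arbitrary: x)
  case Nil
  then show ?case by (auto intro!: word_cong.refl simp: styl_def)
next
  case (Cons u T)
  let ?u = "sorted_list_of_set (insert x (set u))"
  have l: "concat (rev T) \<in> lists {1..n}" using Cons.prems by fastforce
  have lu: "?u \<in> lists {1..n}" using Cons.prems by auto
  have 1: "word_cong (styl n) (concat (rev T) @ (u @ [x]) @ [])
      (concat (rev T) @ (bump (set u) x @ ?u) @ [])"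
    using word_cong_row_bump[of u n x] Cons.prems l by (intro word_cong_context) auto
  have "word_cong (styl n) (concat (rev T) @ bump (set u) x)
      (concat (rev (n_inserts (bump (set u) x) T)))"
  proof (cases rule: bump_cases[of "set u" x, OF finite_set])
    case 1
    then show ?thesis using l by (auto intro!: word_cong.refl simp: styl_def)
  next
    case (2 a)
    then show ?thesis using Cons by auto
  qed
  then have 2: "word_cong (styl n) ([] @ (concat (rev T) @ bump (set u) x) @ ?u)
      ([] @ (concat (rev (n_inserts (bump (set u) x) T))) @ ?u)"
    using lu by (intro word_cong_context) auto
  have "n_insert x (u # T) = ?u # n_inserts (bump (set u) x) T"
    by (subst n_insert_bump) (simp add: hd_set_def)
  then show ?case using word_cong.trans[OF 1] 2 by simp
qed

lemma word_cong_n_inserts_reading: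
  assumes "\<forall>u\<in>set T. sorted_wrt (<) u \<and> set u \<subseteq> {1..n}" "w \<in> lists {1..n}"
  shows "word_cong (styl n) (concat (rev T) @ w) (concat (rev (n_inserts w T)))"
  using assms
proof (induction w arbitrary: T)
  case Nil
  then have "concat (rev T) \<in> lists {1..n}" by fastforce
  then show ?case by (auto intro!: word_cong.refl simp: styl_def)
next
  case (Cons x w)
  have x: "x \<in> {1..n}" and w: "w \<in> lists {1..n}" using Cons.prems(2) by simp_all
  have "word_cong (styl n) ([] @ (concat (rev T) @ [x]) @ w) ([] @ (concat (rev (n_insert x T))) @ w)"
    using w by (intro word_cong_context word_cong_n_insert Cons.prems x) auto
  moreover have "word_cong (styl n) (concat (rev (n_insert x T)) @ w) (concat (rev (n_inserts w (n_insert x T))))"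
    using n_insert_rows[OF Cons.prems(1) x] w by (rule Cons.IH)
  ultimately show ?case using word_cong.trans by simp
qed

lemma word_cong_reading:
  "w \<in> lists {1..n} \<Longrightarrow> word_cong (styl n) w (concat (reading (n_tableau w)))"
  using word_cong_n_inserts_reading[of "[]" n w] by (simp add: reading_def n_tableau_inserts)

text \<open>Invariance of insertion gives one direction; for the other, each word is congruent to
  the reading of its tableau.\<close>

theorem word_cong_iff_n_tableau:
  assumes "v \<in> lists {1..n}" "w \<in> lists {1..n}"
  shows "word_cong (styl n) v w \<longleftrightarrow> n_tableau v = n_tableau w"
  using word_cong_n_tableau word_cong_reading assms word_cong.trans word_cong.sym by metis

section \<open>Rewriting in the row presentation\<close>

abbreviation N2 :: "row \<Rightarrow> row \<Rightarrow> row list" where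
  "N2 u v \<equiv> reading (n_tableau (u @ v))"

abbreviation normal :: "row list \<Rightarrow> bool" where
  "normal \<equiv> successively (\<lhd>\<^sub>N)"

text \<open>Defined by insertion instead of rewriting, so that invariance under the rules comes from
  the stylic congruence; \<open>norm_path\<close> shows that normalization ends there.\<close>

definition nf :: "row list \<Rightarrow> row list" where
  "nf W = reading (n_tableau (concat W))"

lemma rowsD:
  assumes "u \<in> rows n"
  shows "u \<noteq> []" "sorted_wrt (<) u" "set u \<subseteq> {1..n}" "sorted_list_of_set (set u) = u" "u \<in> lists {1..n}"
  using assms strict_sorted_list[of u] by (auto simp: rows_def)

lemma rows_sorted_list:
  assumes "A \<noteq> {}" "A \<subseteq> {1..n}"
  shows "sorted_list_of_set A \<in> rows n" "set (sorted_list_of_set A) = A"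
proof -
  have "finite A" using assms finite_subset by blast
  then show "set (sorted_list_of_set A) = A" by simp
  then show "sorted_list_of_set A \<in> rows n" using assms by (auto simp: rows_def)
qed

lemma N2_eq:
  assumes "u \<in> rows n" "v \<in> rows n"
  shows "N2 u v = (if bump_set u v = {} then [] else [sorted_list_of_set (bump_set u v)]) @
    [sorted_list_of_set (set u \<union> set v)]"
  using n_tableau_rows[of u v] rowsD[OF assms(1)] rowsD[OF assms(2)] by (simp add: reading_def)

lemma bump_set_subset: "bump_set u v \<subseteq> set u"
  by (auto simp: bump_set_def)

lemma N2_rows:
  assumes "u \<in> rows n" "v \<in> rows n"
  shows "N2 u v \<in> lists (rows n)"
proof -
  have "sorted_list_of_set (set u \<union> set v) \<in> rows n"
    using rowsD[OF assms(1)] rowsD[OF assms(2)] by (intro rows_sorted_list) auto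
  moreover have "bump_set u v \<noteq> {} \<Longrightarrow> sorted_list_of_set (bump_set u v) \<in> rows n"
    using rowsD[OF assms(1)] bump_set_subset[of u v] by (intro rows_sorted_list) auto
  ultimately show ?thesis by (simp add: N2_eq[OF assms])
qed

lemma N2_normal:
  assumes "u \<in> rows n" "v \<in> rows n"
  shows "normal (N2 u v)"
proof (cases "bump_set u v = {}")
  case False
  have f: "finite (bump_set u v)" using bump_set_subset finite_subset by blast
  then have "Min (bump_set u v) \<in> bump_set u v" using False by simp
  then obtain x where x: "x \<in> set v" "x < Min (bump_set u v)" by (auto simp: bump_set_def)
  have "Min (set u \<union> set v) \<le> x" using x by (intro Min_le) auto
  then have "sorted_list_of_set (bump_set u v) \<lhd>\<^sub>N sorted_list_of_set (set u \<union> set v)"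
    using f le_less_trans[OF _ x(2)] bump_set_subset[of u v] by (auto simp: ntri_def)
  then show ?thesis by (simp add: N2_eq[OF assms] False)
qed (simp add: N2_eq[OF assms])

lemma concat_rows: "W \<in> lists (rows n) \<Longrightarrow> concat W \<in> lists {1..n}"
  by (induction W) (auto dest: rowsD)

lemma word_cong_N2:
  assumes "u \<in> rows n" "v \<in> rows n"
  shows "word_cong (styl n) (u @ v) (concat (N2 u v))"
  using word_cong_reading[of "u @ v" n] rowsD(5) assms by simp

lemma nf_N2:
  assumes "l \<in> lists (rows n)" "u \<in> rows n" "v \<in> rows n" "r \<in> lists (rows n)"
  shows "nf (l @ N2 u v @ r) = nf (l @ [u, v] @ r)"
  using word_cong_n_tableau[OF word_cong_context[OF word_cong_N2[OF assms(2,3)] concat_rows[OF assms(1)]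
      concat_rows[OF assms(4)]]]
  by (simp add: nf_def)

lemma nf_normal:
  assumes "W \<in> lists (rows n)" "normal W"
  shows "nf W = W"
proof -
  have "\<forall>v\<in>set W. sorted_wrt (<) v \<and> v \<noteq> []" using assms(1) rowsD(1,2) by (auto simp: in_lists_conv_set)
  from n_tableau_reading[OF this assms(2)] show ?thesis by (simp add: nf_def reading_def)
qed

lemma nf_pair: "nf [u, v] = N2 u v"
  by (simp add: nf_def)

lemma row_pres_simps [simp]:
  "gen1 (row_pres n) = rows n" "src2 (row_pres n) (u, v) = [u, v]" "tgt2 (row_pres n) (u, v) = N2 u v"
  "(u, v) \<in> gen2 (row_pres n) \<longleftrightarrow> u \<in> rows n \<and> v \<in> rows n \<and> \<not> u \<lhd>\<^sub>N v"
  by (simp_all add: row_pres_def)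

lemma poly_row_pres: "is_polygraph2 (row_pres n)"
  unfolding is_polygraph2_def
proof
  fix \<beta> assume "\<beta> \<in> gen2 (row_pres n)"
  then show "src2 (row_pres n) \<beta> \<in> lists (gen1 (row_pres n)) \<and> tgt2 (row_pres n) \<beta> \<in> lists (gen1 (row_pres n))"
    using N2_rows by (cases \<beta>) simp
qed

subsection \<open>Termination\<close>

text \<open>Words are compared by length, then by minima from left to right, then by row lengths
  from right to left. Subtraction from \<open>n\<close> turns growth into decrease, and the reversal
  lets the lower row of a rewritten pair count before the upper one.\<close>

definition row_order :: "nat \<Rightarrow> (row list \<times> row list) set" where
  "row_order n = inv_image (less_than <*lex*> lex less_than <*lex*> lex less_than)
     (\<lambda>W. (length W, map (\<lambda>u. n - Min (set u)) W, rev (map (\<lambda>u. n - length u) W)))"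

lemma wf_row_order: "wf (row_order n)"
  unfolding row_order_def by (intro wf_inv_image wf_lex_prod wf_lex wf_less_than)

lemma length_row: "u \<in> rows n \<Longrightarrow> length u = card (set u)"
  using rowsD(2) by (metis distinct_card strict_sorted_iff)

text \<open>If \<open>min u \<le> min v\<close>, then \<open>u\<close> loses its minimum; otherwise all minima are kept and
  the lower row grows properly.\<close>

lemma N2_decreases:
  assumes u: "u \<in> rows n" and v: "v \<in> rows n" and uv: "\<not> u \<lhd>\<^sub>N v"
  shows "(l @ N2 u v @ r, l @ [u, v] @ r) \<in> row_order n"
proof (cases "bump_set u v = {}")
  case True
  then show ?thesis by (simp add: N2_eq[OF u v] row_order_def)
next
  case False
  let ?B = "bump_set u v" and ?U = "set u \<union> set v"
  let ?b = "sorted_list_of_set ?B" and ?w = "sorted_list_of_set ?U"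
  have e: "N2 u v = [?b, ?w]" using False by (simp add: N2_eq[OF u v])
  have f: "finite ?B" using bump_set_subset finite_subset by blast
  have Un: "?U \<subseteq> {1..n}" using rowsD(3)[OF u] rowsD(3)[OF v] by auto
  have ne: "set u \<noteq> {}" "set v \<noteq> {}" using rowsD(1) u v by auto
  have Bn: "Min ?B \<in> ?B" using f False by simp
  then obtain x where x: "x \<in> set v" "x < Min ?B" by (auto simp: bump_set_def)
  show ?thesis
  proof (cases "Min (set u) \<le> Min (set v)")
    case True
    have "Min (set v) \<le> x" using x by simp
    then have "Min (set u) < Min ?B" using le_less_trans[OF order_trans[OF True] x(2)] by simp
    moreover have "Min ?B \<le> n" using Bn bump_set_subset[of u v] rowsD(3)[OF u] by auto
    ultimately have "n - Min ?B < n - Min (set u)" by auto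
    then show ?thesis using e f by (auto simp: row_order_def intro!: lex_append_leftI)
  next
    case False
    then have lt: "Min (set v) < Min (set u)" by simp
    then have "\<not> set u \<subseteq> set v" using uv by (auto simp: ntri_def)
    then have "set v \<subset> ?U" by auto
    then have "card (set v) < card ?U" by (intro psubset_card_mono) auto
    moreover have "card ?U \<le> card {1..n}" using Un by (intro card_mono) auto
    ultimately have len: "n - length ?w < n - length v" using length_row[OF v] by simp
    have "Min (set u) \<in> ?B"
      using lt ne by (auto simp: bump_set_def intro!: bexI[of _ "Min (set v)"])
    then have m1: "Min ?B = Min (set u)"
      using f bump_set_subset[of u v] by (intro Min_eqI) auto
    have "Min (set v) \<le> y" if "y \<in> ?U" for y
      using that lt Min_le[OF finite_set, of y u] Min_le[OF finite_set, of y v]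
      by (auto simp del: Min_le)
    then have m2: "Min ?U = Min (set v)" using ne by (intro Min_eqI) auto
    have "(rev (map (\<lambda>u. n - length u) (l @ [?b, ?w] @ r)), rev (map (\<lambda>u. n - length u) (l @ [u, v] @ r)))
       \<in> lex less_than"
      using len by (auto intro!: lex_append_leftI)
    moreover have "map (\<lambda>u. n - Min (set u)) (l @ [?b, ?w] @ r) = map (\<lambda>u. n - Min (set u)) (l @ [u, v] @ r)"
      using m1 m2 f by simp
    ultimately show ?thesis unfolding e row_order_def by simp
  qed
qed

definition row_red_rel :: "nat \<Rightarrow> (row list \<times> row list) set" where
  "row_red_rel n = {(l @ N2 u v @ r, l @ [u, v] @ r) | l u v r.
     l \<in> lists (rows n) \<and> u \<in> rows n \<and> v \<in> rows n \<and> r \<in> lists (rows n) \<and> \<not> u \<lhd>\<^sub>N v}"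

lemma wf_row_red_rel: "wf (row_red_rel n)"
proof (rule wf_subset[OF wf_row_order[of n]])
  show "row_red_rel n \<subseteq> row_order n" using N2_decreases unfolding row_red_rel_def by blast
qed

lemma row_red_relI:
  "l \<in> lists (rows n) \<Longrightarrow> u \<in> rows n \<Longrightarrow> v \<in> rows n \<Longrightarrow> r \<in> lists (rows n) \<Longrightarrow> \<not> u \<lhd>\<^sub>N v \<Longrightarrow>
    (l @ N2 u v @ r, l @ [u, v] @ r) \<in> row_red_rel n"
  unfolding row_red_rel_def by blast

subsection \<open>Leftmost normalization\<close>

lemma leftmost_redex:
  "normal (l @ [u]) \<Longrightarrow> \<not> u \<lhd>\<^sub>N v \<Longrightarrow> leftmost (l @ [u, v] @ r) = Some (Step l (u, v) True r)"
proof (induction l)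
  case (Cons a l)
  then show ?case by (cases l) auto
qed simp

lemma leftmost_normal: "normal W \<Longrightarrow> leftmost W = None"
  by (induction W rule: leftmost.induct) auto

lemma not_normalE:
  assumes "\<not> normal W"
  obtains l u v r where "W = l @ [u, v] @ r" "normal (l @ [u])" "\<not> u \<lhd>\<^sub>N v"
proof -
  have "\<exists>l u v r. W = l @ [u, v] @ r \<and> normal (l @ [u]) \<and> \<not> u \<lhd>\<^sub>N v"
    using assms
  proof (induction W)
    case (Cons a W)
    then obtain b W' where W: "W = b # W'" by (cases W) auto
    show ?case
    proof (cases "a \<lhd>\<^sub>N b")
      case True
      then have "\<not> normal W" using Cons.prems W by simp
      then obtain l u v r where *: "W = l @ [u, v] @ r" "normal (l @ [u])" "\<not> u \<lhd>\<^sub>N v" using Cons.IH by blast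
      then have "normal ((a # l) @ [u])" using W True by (cases l) auto
      then show ?thesis using * by (intro exI[of _ "a # l"]) auto
    next
      case False
      then have "a # W = [] @ [a, b] @ W' \<and> normal ([] @ [a]) \<and> \<not> a \<lhd>\<^sub>N b" using W by simp
      then show ?thesis by blast
    qed
  qed simp
  then show ?thesis using that by blast
qed

text \<open>\<open>normalize\<close> is a partial function; well-foundedness of reduction shows that
  \<open>the\<close> in \<open>norm_path\<close> is applied to a defined value.\<close>

lemma normalize_Some: "W \<in> lists (rows n) \<Longrightarrow> \<exists>p. normalize n W = Some p"
proof (induction W rule: wf_induct_rule[OF wf_row_red_rel[of n]])
  case (1 W)
  show ?case
  proof (cases "normal W")
    case True
    then show ?thesis by (simp add: normalize.simps leftmost_normal)
  next
    case False
    then obtain l u v r where W: "W = l @ [u, v] @ r" "normal (l @ [u])" "\<not> u \<lhd>\<^sub>N v" by (rule not_normalE)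
    then have w: "l \<in> lists (rows n)" "u \<in> rows n" "v \<in> rows n" "r \<in> lists (rows n)" using 1(2) by auto
    then obtain p where "normalize n (l @ N2 u v @ r) = Some p"
      using 1(1)[of "l @ N2 u v @ r"] row_red_relI[OF w W(3)] W(1) N2_rows by auto
    then show ?thesis
      using leftmost_redex[OF W(2,3), of r] W(1) by (subst normalize.simps) (simp add: cell_tgt_def)
  qed
qed

lemma norm_path_normal: "normal W \<Longrightarrow> norm_path n W = []"
  by (simp add: norm_path_def normalize.simps leftmost_normal)

lemma norm_path_redex:
  assumes "l \<in> lists (rows n)" "u \<in> rows n" "v \<in> rows n" "r \<in> lists (rows n)"
    "normal (l @ [u])" "\<not> u \<lhd>\<^sub>N v"
  shows "norm_path n (l @ [u, v] @ r) = Step l (u, v) True r # norm_path n (l @ N2 u v @ r)"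
proof -
  obtain p where "normalize n (l @ N2 u v @ r) = Some p"
    using normalize_Some[of "l @ N2 u v @ r" n] N2_rows assms by auto
  then show ?thesis unfolding norm_path_def
    using leftmost_redex[OF assms(5,6), of r] by (subst normalize.simps) (simp add: cell_tgt_def)
qed

lemma row_step_path:
  assumes "l \<in> lists (rows n)" "u \<in> rows n" "v \<in> rows n" "r \<in> lists (rows n)" "\<not> u \<lhd>\<^sub>N v"
  shows "path (row_pres n) (l @ [u, v] @ r) [Step l (u, v) True r] (l @ N2 u v @ r)"
  using assms N2_rows by (simp add: cell_src_def cell_tgt_def)

text \<open>The rules preserve \<open>nf\<close> and normal words are fixed by it, so normalization
  can only end at \<open>nf W\<close>. Forwardness is recorded because paths are later compared by
  induction along decreasing words.\<close>

lemma norm_path: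
  "W \<in> lists (rows n) \<Longrightarrow> path (row_pres n) W (norm_path n W) (nf W) \<and> normal (nf W) \<and> nf W \<in> lists (rows n) \<and>
     (\<forall>s\<in>set (norm_path n W). fwd s)"
proof (induction W rule: wf_induct_rule[OF wf_row_red_rel[of n]])
  case (1 W)
  show ?case
  proof (cases "normal W")
    case True
    then show ?thesis using 1(2) by (simp add: norm_path_normal nf_normal)
  next
    case False
    then obtain l u v r where W: "W = l @ [u, v] @ r" "normal (l @ [u])" "\<not> u \<lhd>\<^sub>N v" by (rule not_normalE)
    then have w: "l \<in> lists (rows n)" "u \<in> rows n" "v \<in> rows n" "r \<in> lists (rows n)" using 1(2) by auto
    let ?W = "l @ N2 u v @ r"
    have "path (row_pres n) ?W (norm_path n ?W) (nf ?W) \<and> normal (nf ?W) \<and> nf ?W \<in> lists (rows n) \<and>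
     (\<forall>s\<in>set (norm_path n ?W). fwd s)"
      using 1(1)[of ?W] row_red_relI[OF w W(3)] W(1) N2_rows w by auto
    then show ?thesis
      using row_step_path[OF w W(3)] norm_path_redex[OF w W(2,3)] W(1) nf_N2[OF w] by simp
  qed
qed

lemmas norm_path_path = norm_path[THEN conjunct1]
  and nf_is_normal = norm_path[THEN conjunct2, THEN conjunct1]
  and nf_rows = norm_path[THEN conjunct2, THEN conjunct2, THEN conjunct1]
  and norm_path_fwd = norm_path[THEN conjunct2, THEN conjunct2, THEN conjunct2]

lemma nf_eqI: "W \<in> lists (rows n) \<Longrightarrow> path (row_pres n) W p V \<Longrightarrow> nf V = nf W"
proof (induction p arbitrary: W)
  case (Cons s p)
  obtain l u v e r where s: "s = Step l (u, v) e r" by (cases s) auto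
  have w: "l \<in> lists (rows n)" "u \<in> rows n" "v \<in> rows n" "r \<in> lists (rows n)" using Cons.prems s by auto
  have "nf (step_tgt (row_pres n) s) = nf W"
    using nf_N2[OF w] Cons.prems s by (auto simp: cell_src_def cell_tgt_def split: if_splits)
  then show ?case using Cons step_words(2)[OF poly_row_pres, of n s] by simp
qed simp

lemma nf_prefix: "W \<in> lists (rows n) \<Longrightarrow> V \<in> lists (rows n) \<Longrightarrow> l \<in> lists (rows n) \<Longrightarrow> nf (l @ nf W @ V) = nf (l @ W @ V)"
  using path_whisker[OF norm_path_path, of W n l V] nf_eqI[of "l @ W @ V" n] by simp

text \<open>A redex inside \<open>W\<close> lies to the left of every redex meeting
  \<open>V\<close>, so the leftmost strategy leaves \<open>V\<close> alone until \<open>W\<close> is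
  normal.\<close>

lemma norm_path_append:
  "V \<in> lists (rows n) \<Longrightarrow> W \<in> lists (rows n) \<Longrightarrow>
    norm_path n (W @ V) = map (whisker [] V) (norm_path n W) @ norm_path n (nf W @ V)"
proof (induction W rule: wf_induct_rule[OF wf_row_red_rel[of n]])
  case (1 W)
  show ?case
  proof (cases "normal W")
    case True
    then show ?thesis using 1(3) by (simp add: norm_path_normal nf_normal)
  next
    case False
    then obtain l u v r where W: "W = l @ [u, v] @ r" "normal (l @ [u])" "\<not> u \<lhd>\<^sub>N v" by (rule not_normalE)
    then have w: "l \<in> lists (rows n)" "u \<in> rows n" "v \<in> rows n" "r \<in> lists (rows n)" using 1(3) by auto
    have rV: "r @ V \<in> lists (rows n)" using w 1 by auto
    let ?W = "l @ N2 u v @ r"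
    have "norm_path n (?W @ V) = map (whisker [] V) (norm_path n ?W) @ norm_path n (nf ?W @ V)"
      using 1(1)[of ?W] row_red_relI[OF w W(3)] W(1) N2_rows w 1(2) by auto
    then show ?thesis
      using norm_path_redex[OF w W(2,3)] norm_path_redex[OF w(1-3) rV W(2,3)] nf_N2[OF w] W(1) by simp
  qed
qed

lemma norm_path_pair:
  assumes "u \<in> rows n" "v \<in> rows n" "\<not> u \<lhd>\<^sub>N v"
  shows "norm_path n [u, v] = [Step [] (u, v) True []]"
  using norm_path_redex[of "[]" n u v "[]"] norm_path_normal[OF N2_normal[OF assms(1,2)]] assms by simp

lemma norm_path_last:
  assumes "l \<in> lists (rows n)" "a \<in> rows n" "b \<in> rows n" "normal (l @ [a])"
  shows "norm_path n (l @ [a, b]) = map (whisker l []) (norm_path n [a, b]) @ norm_path n (l @ nf [a, b])"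
proof (cases "a \<lhd>\<^sub>N b")
  case True
  then show ?thesis using nf_normal[of "[a, b]" n] assms by (simp add: norm_path_normal)
next
  case False
  then show ?thesis
    using norm_path_redex[OF assms(1-3) _ assms(4) False, of "[]"] norm_path_pair[OF assms(2,3) False]
    by (simp add: nf_pair)
qed

subsection \<open>Coherence of the row presentation\<close>

definition row_cells :: "nat \<Rightarrow> ((row, row2) zigzag \<times> (row, row2) zigzag) set" where
  "row_cells n = (\<lambda>\<tau>. ((triple_word \<tau>, L_path n \<tau>), (triple_word \<tau>, R_path n \<tau>))) ` triples_T1 n"

text \<open>The pair \<open>u v\<close> is the leftmost redex, so the left boundary of a triple cell
  is the leftmost normalization itself. With \<open>R_path_eq\<close>, the cell takes the shape of
  \<open>compat\<close>.\<close>

lemma L_path_eq: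
  assumes "u \<in> rows n" "v \<in> rows n" "t \<in> rows n" "\<not> u \<lhd>\<^sub>N v"
  shows "L_path n (u, v, t) = norm_path n [u, v, t]"
  using norm_path_redex[of "[]" n u v "[t]"] assms by simp

lemma R_path_eq:
  assumes "u \<in> rows n" "v \<in> rows n" "t \<in> rows n" "\<not> v \<lhd>\<^sub>N t"
  shows "R_path n (u, v, t) = map (whisker [u] []) (norm_path n [v, t]) @ norm_path n (u # nf [v, t])"
  using norm_path_pair[of v n t] assms by (simp add: nf_pair)

lemma norm_path_right:
  assumes "l \<in> lists (rows n)" "W \<in> lists (rows n)"
  shows "path (row_pres n) (l @ W) (map (whisker l []) (norm_path n W) @ norm_path n (l @ nf W)) (nf (l @ W))"
proof -
  interpret track_cells "row_pres n" "{}" by (rule track_cells_empty[OF poly_row_pres])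
  have "path (row_pres n) (l @ W) (map (whisker l []) (norm_path n W)) (l @ nf W)"
    using path_whisker[OF norm_path_path[OF assms(2)], of l "[]"] assms by simp
  then show ?thesis
    using path_comp norm_path_path[of "l @ nf W" n] nf_rows[OF assms(2)] nf_prefix[OF assms(2), of "[]" l] assms
    by fastforce
qed

lemma triple_paths:
  assumes "(u, v, t) \<in> triples_C n"
  shows "path (row_pres n) [u, v, t] (L_path n (u, v, t)) (nf [u, v, t])"
    "path (row_pres n) [u, v, t] (R_path n (u, v, t)) (nf [u, v, t])"
proof -
  have w: "u \<in> rows n" "v \<in> rows n" "t \<in> rows n" "\<not> u \<lhd>\<^sub>N v" "\<not> v \<lhd>\<^sub>N t"
    using assms by (auto simp: triples_C_def)
  show "path (row_pres n) [u, v, t] (L_path n (u, v, t)) (nf [u, v, t])"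
    using norm_path_path[of "[u, v, t]" n] w by (simp add: L_path_eq del: L_path.simps)
  show "path (row_pres n) [u, v, t] (R_path n (u, v, t)) (nf [u, v, t])"
    using norm_path_right[of "[u]" n "[v, t]"] w by (simp add: R_path_eq del: R_path.simps)
qed

lemma track_cells_row: "track_cells (row_pres n) (row_cells n)"
proof
  show "is_polygraph2 (row_pres n)" by (rule poly_row_pres)
  fix a p b q assume "((a, p), (b, q)) \<in> row_cells n"
  then obtain u v t where "(u, v, t) \<in> triples_C n" "a = [u, v, t]" "b = [u, v, t]"
    "p = L_path n (u, v, t)" "q = R_path n (u, v, t)"
    by (auto simp: row_cells_def triples_T1_def simp del: L_path.simps R_path.simps)
  then show "a = b \<and> (\<exists>v. path (row_pres n) a p v \<and> path (row_pres n) a q v)"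
    using triple_paths by blast
qed

context
  fixes n :: nat
begin

interpretation track_cells "row_pres n" "row_cells n" by (rule track_cells_row)

abbreviation row_hty :: "row list \<Rightarrow> (row, row2) step list \<Rightarrow> (row, row2) step list \<Rightarrow> bool" where
  "row_hty \<equiv> hty (row_pres n) (row_cells n)"

text \<open>Normalizing \<open>l @ W\<close> from the left is homotopic to normalizing \<open>W\<close> first. For \<open>l = [u]\<close> and
  \<open>W = [v, t]\<close> this is the 3-cell of the triple \<open>(u, v, t)\<close>.\<close>

definition compat :: "row list \<Rightarrow> row list \<Rightarrow> bool" where
  "compat l W \<longleftrightarrow> row_hty (l @ W) (norm_path n (l @ W)) (map (whisker l []) (norm_path n W) @ norm_path n (l @ nf W))"

lemma hom_norm_path_refl: "W \<in> lists (rows n) \<Longrightarrow> row_hty W (norm_path n W) (norm_path n W)"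
  using norm_path_path hty.refl by blast

lemma compat_normal: "l \<in> lists (rows n) \<Longrightarrow> W \<in> lists (rows n) \<Longrightarrow> normal W \<Longrightarrow> compat l W"
  using hom_norm_path_refl[of "l @ W"] by (simp add: compat_def norm_path_normal nf_normal)

text \<open>If \<open>b c\<close> is normal, there is nothing to normalize first; if
  \<open>a b\<close> is normal, the leftmost strategy begins with \<open>b c\<close> anyway.
  Otherwise the hypothesis on the tail of \<open>a\<close> says that the triple has a generating
  cell.\<close>

lemma compat_triple:
  assumes "a \<in> rows n" "b \<in> rows n" "c \<in> rows n" "length a \<ge> 2 \<Longrightarrow> tl a \<lhd>\<^sub>N b"
  shows "compat [a] [b, c]"
proof (cases "b \<lhd>\<^sub>N c")
  case True
  then show ?thesis using assms by (intro compat_normal) auto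
next
  case bc: False
  show ?thesis
  proof (cases "a \<lhd>\<^sub>N b")
    case True
    then show ?thesis
      using norm_path_last[of "[a]" n b c] hom_norm_path_refl[of "[a, b, c]"] assms by (simp add: compat_def)
  next
    case False
    then have "(a, b, c) \<in> triples_T1 n"
      using bc assms by (auto simp: triples_T1_def triples_S_def triples_C_def)
    then have "((triple_word (a, b, c), L_path n (a, b, c)), (triple_word (a, b, c), R_path n (a, b, c))) \<in> row_cells n"
      unfolding row_cells_def by (rule imageI)
    then have 0: "(([a, b, c], L_path n (a, b, c)), ([a, b, c], R_path n (a, b, c))) \<in> row_cells n"
      by (simp del: L_path.simps R_path.simps)
    have p: "path (row_pres n) [a, b, c] (L_path n (a, b, c)) (nf [a, b, c])"
      using False bc assms by (intro triple_paths) (auto simp: triples_C_def)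
    have "row_hty [a, b, c] ([] @ map (whisker [] []) (L_path n (a, b, c)) @ [])
        ([] @ map (whisker [] []) (R_path n (a, b, c)) @ [])"
      using p assms by (intro hty.cell[OF 0]) (auto simp del: L_path.simps R_path.simps)
    then show ?thesis
      using False bc assms by (simp add: compat_def L_path_eq R_path_eq del: L_path.simps R_path.simps)
  qed
qed

text \<open>Two fillings are pasted: \<open>l\<close> against \<open>W\<close> in the right context
  \<open>V\<close>, then \<open>l\<close> against \<open>nf W\<close> followed by
  \<open>V\<close>.\<close>

lemma compat_append:
  assumes w: "l \<in> lists (rows n)" "W \<in> lists (rows n)" "V \<in> lists (rows n)"
    and 1: "compat l W" and 2: "compat l (nf W @ V)"
  shows "compat l (W @ V)"
proof -
  note lW = norm_path_append[of V n "l @ W"] note W = norm_path_append[of V n W]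
  have nfl: "nf W \<in> lists (rows n)" using w nf_rows by blast
  have a: "nf (l @ nf W) = nf (l @ W)" using nf_prefix[of W n "[]" l] w by simp
  have b: "nf (nf W @ V) = nf (W @ V)" using nf_prefix[of W n V "[]"] w by simp
  have lWp: "norm_path n (l @ W @ V) = map (whisker [] V) (norm_path n (l @ W)) @ norm_path n (nf (l @ W) @ V)"
    using lW w by simp
  have lWp': "norm_path n (l @ nf W @ V) = map (whisker [] V) (norm_path n (l @ nf W)) @ norm_path n (nf (l @ W) @ V)"
    using norm_path_append[of V n "l @ nf W"] w nfl a by simp
  have p1: "row_hty (l @ W @ V) (map (whisker [] V) (norm_path n (l @ W)))
      (map (whisker l V) (norm_path n W) @ map (whisker [] V) (norm_path n (l @ nf W)))"
    using hty_whisker[OF 1[unfolded compat_def], of "[]" V] w by simp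
  have "path (row_pres n) (l @ W @ V) (map (whisker [] V) (norm_path n (l @ W)) @ norm_path n (nf (l @ W) @ V)) (nf (l @ W @ V))"
    using norm_path_path[of "l @ W @ V" n] lWp w by simp
  from hty_append_right[OF p1 this]
  have 3: "row_hty (l @ W @ V) (norm_path n (l @ W @ V))
      (map (whisker l V) (norm_path n W) @ norm_path n (l @ nf W @ V))"
    unfolding lWp lWp' by simp
  have "path (row_pres n) (l @ W @ V) (map (whisker l V) (norm_path n W)) (l @ nf W @ V)"
    using path_whisker[OF norm_path_path[OF w(2)], of l V] w by simp
  from hty_append_left[OF this 2[unfolded compat_def]]
  have "row_hty (l @ W @ V) (map (whisker l V) (norm_path n W) @ norm_path n (l @ nf W @ V))
    (map (whisker l V) (norm_path n W) @ map (whisker l []) (norm_path n (nf W @ V)) @ norm_path n (l @ nf (W @ V)))"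
    by (simp add: b)
  from hty.trans[OF 3 this] show ?thesis unfolding compat_def using W w by simp
qed

lemma N2_min_Cons:
  assumes "[x] \<in> rows n" "p \<in> rows n" "x < Min (set p)"
  shows "N2 [x] p = [x # p]" "x # p \<in> rows n" "\<not> [x] \<lhd>\<^sub>N p"
proof -
  have x: "\<forall>y\<in>set p. x < y" using assms(3) by (auto intro: less_le_trans)
  then show r: "x # p \<in> rows n" using assms by (auto simp: rows_def)
  have "bump_set [x] p = {}" using x by (auto simp: bump_set_def)
  then show "N2 [x] p = [x # p]" using N2_eq[OF assms(1,2)] rowsD(4)[OF r] by simp
  show "\<not> [x] \<lhd>\<^sub>N p" using x by (auto simp: ntri_def)
qed

text \<open>The fusion of \<open>[x]\<close> and \<open>p\<close> into the row \<open>x # p\<close>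
  happens to the left of \<open>V\<close>, so it can be done before or after normalizing
  \<open>V\<close>.\<close>

lemma norm_path_exchange:
  assumes x: "[x] \<in> rows n" "p \<in> rows n" "x < Min (set p)" and V: "V \<in> lists (rows n)"
  shows "row_hty ([[x], p] @ V)
    (Step [] ([x], p) True V # map (whisker [x # p] []) (norm_path n V) @ norm_path n ((x # p) # nf V))
    (map (whisker [[x], p] []) (norm_path n V) @ norm_path n ([x] # p # nf V))"
proof -
  note xp = N2_min_Cons[OF x]
  have s: "path (row_pres n) [[x], p] [Step [] ([x], p) True []] [x # p]"
    using row_step_path[of "[]" n "[x]" p "[]"] x xp by simp
  have nfV: "nf V \<in> lists (rows n)" using nf_rows V by blast
  have 1: "row_hty ([[x], p] @ V)
      ([Step [] ([x], p) True V] @ map (whisker [x # p] []) (norm_path n V))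
      (map (whisker [[x], p] []) (norm_path n V) @ [Step [] ([x], p) True (nf V)])"
    using hty_exchange_paths[OF s, of "[]", OF _ norm_path_path[OF V]] by simp
  have "path (row_pres n) ([[x], p] @ V) ([Step [] ([x], p) True V] @ map (whisker [x # p] []) (norm_path n V)) ([x # p] @ nf V)"
    using path_whisker[OF s, of "[]" V] path_whisker[OF norm_path_path[OF V], of "[x # p]" "[]"] V xp
    by (intro path_comp) auto
  moreover have "path (row_pres n) ([x # p] @ nf V) (norm_path n ((x # p) # nf V)) (nf ((x # p) # nf V))"
    using norm_path_path[of "(x # p) # nf V" n] xp nfV by simp
  ultimately have "path (row_pres n) ([[x], p] @ V) (([Step [] ([x], p) True V] @ map (whisker [x # p] []) (norm_path n V))
      @ norm_path n ((x # p) # nf V)) (nf ((x # p) # nf V))"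
    by (rule path_comp)
  from hty_append_right[OF 1 this] norm_path_redex[of "[]" n "[x]" p "nf V"] x xp nfV
  show ?thesis by simp
qed

text \<open>Three rows are what remains of a quadruple behind its letter, and the condition on
  \<open>x\<close> lets it fuse with the first of them. If the first pair rewrites,
  \<open>compat_append\<close> reduces to a smaller word; if only the second one does, the
  comparison passes through the triple starting with \<open>x # p\<close>.\<close>

lemma compat_letter:
  assumes "[x] \<in> rows n" "W \<in> lists (rows n)" "length W \<le> 3" "length W = 3 \<Longrightarrow> x < Min (set (hd W))"
  shows "compat [[x]] W"
  using assms(2-4)
proof (induction W rule: wf_induct_rule[OF wf_row_red_rel[of n]])
  case (1 W)
  note x = assms(1)
  have two: "compat [[x]] [b, c]" if "b \<in> rows n" "c \<in> rows n" for b c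
    using that x by (intro compat_triple) auto
  consider "length W \<le> 1" | b c where "W = [b, c]" | p b c where "W = [p, b, c]"
    using 1(3) by (cases W; cases "tl W"; cases "tl (tl W)") auto
  then show ?case
  proof cases
    case 1
    then have "normal W" by (cases W) auto
    then show ?thesis using 1 "1.prems" x by (intro compat_normal) auto
  next
    case 2
    then show ?thesis using two 1 by simp
  next
    case (3 p b c)
    then have w: "p \<in> rows n" "b \<in> rows n" "c \<in> rows n" and xp: "x < Min (set p)" using 1 by auto
    note xp' = N2_min_Cons[OF x w(1) xp]
    have IH: "compat [[x]] (l @ N2 u v @ r)"
      if "W = l @ [u, v] @ r" "\<not> u \<lhd>\<^sub>N v" "length (l @ N2 u v @ r) = 3 \<Longrightarrow> x < Min (set (hd (l @ N2 u v @ r)))" for l u v r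
    proof -
      have w: "l \<in> lists (rows n)" "u \<in> rows n" "v \<in> rows n" "r \<in> lists (rows n)" using 1(2) that by auto
      have "length (N2 u v) \<le> 2" using N2_eq[OF w(2,3)] by simp
      moreover have "length l + length r + 2 = 3" using 3 arg_cong[OF that(1), of length] by simp
      ultimately have "length (l @ N2 u v @ r) \<le> 3" by simp
      moreover have "(l @ N2 u v @ r, W) \<in> row_red_rel n"
        unfolding that(1) by (rule row_red_relI[OF w that(2)])
      moreover have "l @ N2 u v @ r \<in> lists (rows n)" using N2_rows w by simp
      ultimately show ?thesis using "1.IH" that(3) by blast
    qed
    show ?thesis
    proof (cases "p \<lhd>\<^sub>N b")
      case False
      \<comment> \<open>If \<open>p b\<close> rewrites to two rows, the upper one consists of
        letters of \<open>p\<close>, so its minimum still exceeds \<open>x\<close>.\<close>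
      have m: "length (N2 p b @ [c]) = 3 \<Longrightarrow> x < Min (set (hd (N2 p b @ [c])))"
      proof -
        assume "length (N2 p b @ [c]) = 3"
        then have ne: "bump_set p b \<noteq> {}" using N2_eq[OF w(1,2)] by (auto split: if_splits)
        have f: "finite (bump_set p b)" using bump_set_subset finite_subset by blast
        have "Min (set p) \<le> Min (bump_set p b)" using Min_antimono[OF bump_set_subset ne] by simp
        then have "x < Min (bump_set p b)" using xp by simp
        then show ?thesis using ne f N2_eq[OF w(1,2)] by (simp del: Min_gr_iff)
      qed
      have "compat [[x]] ([] @ N2 p b @ [c])"
        using 3 False m by (intro IH) (simp_all only: append.simps not_False_eq_True)
      then have c2: "compat [[x]] (nf [p, b] @ [c])" by (simp add: nf_pair)
      have "compat [[x]] ([p, b] @ [c])"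
      proof (rule compat_append[OF _ _ _ two[OF w(1,2)] c2])
        show "[[x]] \<in> lists (rows n)" "[p, b] \<in> lists (rows n)" "[c] \<in> lists (rows n)"
          using x w by simp_all
      qed
      then show ?thesis using 3 by simp
    next
      case pb: True
      show ?thesis
      proof (cases "b \<lhd>\<^sub>N c")
        case True
        then show ?thesis using pb 3 w x by (intro compat_normal) auto
      next
        case False
        have "compat [[x]] ([p] @ N2 b c @ [])"
          using 3 False xp by (intro IH) (simp_all only: append.simps list.sel not_False_eq_True)
        then have "compat [[x]] (p # N2 b c)" by simp
        then have 5: "row_hty ([[x]] @ p # N2 b c) (norm_path n ([[x]] @ p # N2 b c))
           (map (whisker [[x]] []) (norm_path n (p # N2 b c)) @ norm_path n ([[x]] @ nf (p # N2 b c)))"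
          by (simp add: compat_def)
        \<comment> \<open>The tail of \<open>x # p\<close> is \<open>p\<close>, and \<open>p\<close>
          does not rewrite with \<open>b\<close>; hence this triple is not among the discarded
          ones.\<close>
        have "compat [x # p] [b, c]" using pb w xp' by (intro compat_triple) auto
        then have 6: "row_hty [x # p, b, c] (norm_path n [x # p, b, c])
            (map (whisker [x # p] []) (norm_path n [b, c]) @ norm_path n ((x # p) # nf [b, c]))"
          by (simp add: compat_def)
        have st: "path (row_pres n) [[x], p, b, c] [Step [] ([x], p) True [b, c]] [x # p, b, c]"
          using row_step_path[of "[]" n "[x]" p "[b, c]"] x w xp' by simp
        have L: "norm_path n ([[x]] @ [p, b, c]) = [Step [] ([x], p) True [b, c]] @ norm_path n [x # p, b, c]"
          using norm_path_redex[of "[]" n "[x]" p "[b, c]"] x w xp' by simp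
        have 7: "row_hty [[x], p, b, c] (norm_path n ([[x]] @ [p, b, c]))
           (map (whisker [[x], p] []) (norm_path n [b, c]) @ norm_path n ([x] # p # nf [b, c]))"
          using hty.trans[OF hty_append_left[OF st 6]] norm_path_exchange[OF x w(1) xp, of "[b, c]"] w
          unfolding L by simp
        have "path (row_pres n) ([[x], p] @ [b, c]) (map (whisker [[x], p] []) (norm_path n [b, c])) ([[x], p] @ nf [b, c])"
          using path_whisker[OF norm_path_path[of "[b, c]" n], of "[[x], p]" "[]"] w x by simp
        from hty_append_left[OF this, of "norm_path n ([x] # p # nf [b, c])"] 5
        have "row_hty [[x], p, b, c] (map (whisker [[x], p] []) (norm_path n [b, c]) @ norm_path n ([x] # p # nf [b, c]))
          (map (whisker [[x], p] []) (norm_path n [b, c]) @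
            map (whisker [[x]] []) (norm_path n (p # N2 b c)) @ norm_path n ([[x]] @ nf (p # N2 b c)))"
          by (simp add: nf_pair)
        note 8 = hty.trans[OF 7 this]
        have P: "norm_path n [p, b, c] = map (whisker [p] []) (norm_path n [b, c]) @ norm_path n (p # N2 b c)"
          using norm_path_last[of "[p]" n b c] pb w by (simp add: nf_pair)
        have "nf (p # N2 b c) = nf [p, b, c]" using nf_N2[of "[p]" n b c "[]"] w by simp
        then show ?thesis using 8 unfolding compat_def 3 P by simp
      qed
    qed
  qed
qed

text \<open>The 3-cell of \<open>(x # p, v, t)\<close> is a face of the quadruple \<open>([x], p, v, t)\<close>; the other
  faces either start with a letter or belong to the triple \<open>(p, v, t)\<close>.\<close>

lemma compat_rows:
  assumes "u \<in> rows n" "v \<in> rows n" "t \<in> rows n"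
  shows "compat [u] [v, t]"
  using assms(1)
proof (induction u)
  case Nil
  then show ?case using rowsD(1) by blast
next
  case (Cons x p)
  show ?case
  proof (cases "p = []")
    case True
    then show ?thesis using Cons assms by (intro compat_triple) auto
  next
    case False
    have p: "p \<in> rows n" and x: "[x] \<in> rows n" and xp: "x < Min (set p)"
      using False Cons.prems by (auto simp: rows_def)
    note xp' = N2_min_Cons[OF x p xp]
    note w = assms(2,3)
    have nfl: "nf [v, t] \<in> lists (rows n)" using nf_rows[of "[v, t]" n] w by auto
    have l2: "length (nf [v, t]) \<le> 2" using N2_eq[OF w] by (simp add: nf_pair)
    have A: "row_hty [[x], p, v, t] (norm_path n [[x], p, v, t])
        (map (whisker [[x]] []) (norm_path n [p, v, t]) @ norm_path n ([x] # nf [p, v, t]))"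
      using compat_letter[of x "[p, v, t]"] x p w xp by (simp add: compat_def)
    \<comment> \<open>Normalizing \<open>v t\<close> leaves at most two rows behind
      \<open>p\<close>, and the first row is still \<open>p\<close>, so the letter case applies
      again.\<close>
    have B: "row_hty ([x] # p # nf [v, t]) (norm_path n ([x] # p # nf [v, t]))
        (map (whisker [[x]] []) (norm_path n (p # nf [v, t])) @ norm_path n ([x] # nf [p, v, t]))"
      using compat_letter[of x "p # nf [v, t]"] x p nfl l2 xp nf_prefix[of "[v, t]" n "[]" "[p]"] w
      by (simp add: compat_def)
    have C: "row_hty [p, v, t] (norm_path n [p, v, t])
        (map (whisker [p] []) (norm_path n [v, t]) @ norm_path n (p # nf [v, t]))"
      using Cons.IH[OF p] by (simp add: compat_def)
    have st: "path (row_pres n) [[x], p, v, t] [Step [] ([x], p) True [v, t]] [x # p, v, t]"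
      using row_step_path[of "[]" n "[x]" p "[v, t]"] x w p xp' by simp
    have L: "norm_path n [[x], p, v, t] = [Step [] ([x], p) True [v, t]] @ norm_path n [x # p, v, t]"
      using norm_path_redex[of "[]" n "[x]" p "[v, t]"] x w p xp' by simp
    have vt: "path (row_pres n) [[x], p, v, t] (map (whisker [[x], p] []) (norm_path n [v, t])) ([x] # p # nf [v, t])"
      using path_whisker[OF norm_path_path[of "[v, t]" n], of "[[x], p]" "[]"] w x p by simp
    have "row_hty ([[x]] @ [p, v, t] @ []) (map (whisker [[x]] []) (norm_path n [p, v, t]))
        (map (whisker [[x]] []) (map (whisker [p] []) (norm_path n [v, t]) @ norm_path n (p # nf [v, t])))"
      using hty_whisker[OF C, of "[[x]]" "[]"] x by simp
    moreover have "path (row_pres n) ([[x]] @ [p, v, t] @ [])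
       (map (whisker [[x]] []) (norm_path n [p, v, t]) @ norm_path n ([x] # nf [p, v, t])) (nf [[x], p, v, t])"
      using norm_path_right[of "[[x]]" n "[p, v, t]"] x p w by simp
    ultimately have "row_hty ([[x]] @ [p, v, t] @ [])
       (map (whisker [[x]] []) (norm_path n [p, v, t]) @ norm_path n ([x] # nf [p, v, t]))
       (map (whisker [[x]] []) (map (whisker [p] []) (norm_path n [v, t]) @ norm_path n (p # nf [v, t])) @ norm_path n ([x] # nf [p, v, t]))"
      by (rule hty_append_right)
    then have D: "row_hty [[x], p, v, t] (norm_path n [[x], p, v, t])
       (map (whisker [[x], p] []) (norm_path n [v, t]) @ map (whisker [[x]] []) (norm_path n (p # nf [v, t])) @ norm_path n ([x] # nf [p, v, t]))"
      using hty.trans[OF A] by simp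
    have E: "row_hty [[x], p, v, t] (norm_path n [[x], p, v, t])
       (map (whisker [[x], p] []) (norm_path n [v, t]) @ norm_path n ([x] # p # nf [v, t]))"
      using hty.trans[OF D hty.sym[OF hty_append_left[OF vt B]]] by simp
    have F: "row_hty [[x], p, v, t] (norm_path n [[x], p, v, t])
       ([Step [] ([x], p) True [v, t]] @ map (whisker [x # p] []) (norm_path n [v, t]) @ norm_path n ((x # p) # nf [v, t]))"
      using hty.trans[OF E hty.sym[OF norm_path_exchange[OF x p xp, of "[v, t]", simplified]]] w by simp
    have Rp: "path (row_pres n) [x # p, v, t] (map (whisker [x # p] []) (norm_path n [v, t]) @ norm_path n ((x # p) # nf [v, t])) (nf [x # p, v, t])"
      using norm_path_right[of "[x # p]" n "[v, t]"] xp' w by simp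
    have inv: "path (row_pres n) [x # p, v, t] (inv_steps [Step [] ([x], p) True [v, t]]) [[x], p, v, t]"
      using path_inv[OF poly st] .
    let ?a = "[Step [] ([x], p) True [v, t]]"
    let ?R = "map (whisker [x # p] []) (norm_path n [v, t]) @ norm_path n ((x # p) # nf [v, t])"
    \<comment> \<open>Both paths compared in \<open>F\<close> begin with the fusion of
      \<open>[x]\<close> and \<open>p\<close>; composing with its inverse leaves a statement about
      \<open>x # p\<close>.\<close>
    have canc: "row_hty [x # p, v, t] (inv_steps ?a @ ?a @ q) q"
      if q: "path (row_pres n) [x # p, v, t] q z" for q z
    proof -
      have "path (row_pres n) [x # p, v, t] ((inv_steps ?a @ ?a) @ q) z"
        using path_comp[OF path_comp[OF inv st] q] .
      from hty_append_right[OF hty_cancel_path'[OF st] this] show ?thesis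
        by (simp only: append_assoc append_Nil)
    qed
    have Lp: "path (row_pres n) [x # p, v, t] (norm_path n [x # p, v, t]) (nf [x # p, v, t])"
      using norm_path_path[of "[x # p, v, t]" n] xp' w by simp
    have G: "row_hty [x # p, v, t] (inv_steps ?a @ ?a @ norm_path n [x # p, v, t]) (inv_steps ?a @ ?a @ ?R)"
      using hty_append_left[OF inv F[unfolded L]] .
    have "row_hty [x # p, v, t] (norm_path n [x # p, v, t]) ?R"
      using hty.trans[OF hty.sym[OF canc[OF Lp]] hty.trans[OF G canc[OF Rp]]] .
    then show ?thesis by (simp add: compat_def)
  qed
qed

text \<open>No redex lies left of the leftmost one, so any redex coincides with it, starts at its
  right row, or is disjoint from it on the right.\<close>

lemma redex_positions:
  assumes "l0 @ [u0, v0] @ r0 = l @ [u, v] @ r" "normal (l0 @ [u0])" "\<not> u \<lhd>\<^sub>N v"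
  obtains "l = l0" "u = u0" "v = v0" "r = r0"
  | "l = l0 @ [u0]" "u = v0" "r0 = v # r"
  | m where "l = l0 @ [u0, v0] @ m" "r0 = m @ [u, v] @ r"
proof -
  from assms(1) consider us where "l0 = l @ us" "us @ [u0, v0] @ r0 = [u, v] @ r"
    | us where "l0 @ us = l" "[u0, v0] @ r0 = us @ [u, v] @ r"
    by (auto simp: append_eq_append_conv2)
  then show ?thesis
  proof cases
    case 1
    show ?thesis
    proof (cases us)
      case Nil
      then show ?thesis using 1 that(1) by simp
    next
      case (Cons a us')
      then have "u \<lhd>\<^sub>N v" using 1 assms(2) by (cases us') (auto simp: successively_append_iff)
      then show ?thesis using assms(3) by simp
    qed
  next
    case 2
    show ?thesis
    proof (cases us)
      case Nil
      then show ?thesis using 2 that(1) by simp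
    next
      case (Cons a us')
      then show ?thesis using 2 that(2,3) by (cases us') auto
    qed
  qed
qed

text \<open>Newman's argument with homotopies: the given step is compared with the leftmost one. An
  overlap is closed by \<open>compat_rows\<close>, a disjoint pair by exchange, and the paths below
  are compared by induction.\<close>

lemma hom_step_norm_path:
  "l \<in> lists (rows n) \<Longrightarrow> u \<in> rows n \<Longrightarrow> v \<in> rows n \<Longrightarrow> r \<in> lists (rows n) \<Longrightarrow> \<not> u \<lhd>\<^sub>N v \<Longrightarrow> W = l @ [u, v] @ r \<Longrightarrow>
    row_hty W (Step l (u, v) True r # norm_path n (l @ N2 u v @ r)) (norm_path n W)"
\<comment> \<open>The transitive closure is used because the hypothesis is applied at every word of
  a path that starts below \<open>W\<close>, not only at one-step reducts.\<close>
proof (induction W arbitrary: l u v r rule: wf_induct_rule[OF wf_trancl[OF wf_row_red_rel[of n]]])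
  case (1 W)
  have W: "W \<in> lists (rows n)" using 1 by auto
  have "\<not> normal W" using 1(6,7) by (auto simp: successively_append_iff)
  then obtain l0 u0 v0 r0 where W0: "W = l0 @ [u0, v0] @ r0" "normal (l0 @ [u0])" "\<not> u0 \<lhd>\<^sub>N v0" by (rule not_normalE)
  then have w0: "l0 \<in> lists (rows n)" "u0 \<in> rows n" "v0 \<in> rows n" "r0 \<in> lists (rows n)" using W by auto
  note w = 1(2-5)
  let ?s = "Step l (u, v) True r" and ?sa = "Step l0 (u0, v0) True r0"
  let ?V = "l @ N2 u v @ r" and ?Va = "l0 @ N2 u0 v0 @ r0"
  have N: "norm_path n W = [?sa] @ norm_path n ?Va" using norm_path_redex[OF w0 W0(2,3)] W0(1) by simp
  have sp: "path (row_pres n) W [?s] ?V" using row_step_path[OF w 1(6)] unfolding 1(7)[symmetric] .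
  have sp0: "path (row_pres n) W [?sa] ?Va" using row_step_path[OF w0 W0(3)] unfolding W0(1)[symmetric] .
  have VW: "?V \<in> lists (rows n)" "?Va \<in> lists (rows n)" using w w0 N2_rows by auto
  have VWr: "(?V, W) \<in> (row_red_rel n)\<^sup>+" "(?Va, W) \<in> (row_red_rel n)\<^sup>+"
    using row_red_relI[OF w 1(6)] row_red_relI[OF w0 W0(3)] W0(1) 1(7) by auto
  \<comment> \<open>The induction hypothesis for single steps, applied successively, covers every
    forward path that starts below \<open>W\<close>.\<close>
  have fw: "row_hty Y (g @ norm_path n Z) (norm_path n Y)"
    if "path (row_pres n) Y g Z" "\<forall>s\<in>set g. fwd s" "(Y, W) \<in> (row_red_rel n)\<^sup>+" for Y g Z
    using that
  proof (induction g arbitrary: Y)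
    case Nil
    then show ?case using hom_norm_path_refl by auto
  next
    case (Cons t g)
    obtain l1 u1 v1 r1 where t: "t = Step l1 (u1, v1) True r1" using Cons.prems(2) by (cases t) auto
    have w1: "l1 \<in> lists (rows n)" "u1 \<in> rows n" "v1 \<in> rows n" "r1 \<in> lists (rows n)" "\<not> u1 \<lhd>\<^sub>N v1"
      and Y: "Y = l1 @ [u1, v1] @ r1" using Cons.prems(1) t by (auto simp: cell_src_def)
    let ?Y = "l1 @ N2 u1 v1 @ r1"
    have YW: "(?Y, W) \<in> (row_red_rel n)\<^sup>+" using row_red_relI[OF w1] Cons.prems(3) Y by (meson trancl_into_trancl2)
    have g: "path (row_pres n) ?Y g Z" using Cons.prems(1) t by (simp add: cell_tgt_def)
    have 2: "row_hty ?Y (g @ norm_path n Z) (norm_path n ?Y)" using Cons.IH[OF g _ YW] Cons.prems(2) by simp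
    have 3: "row_hty Y (t # norm_path n ?Y) (norm_path n Y)"
      unfolding t by (rule "1.IH"[OF Cons.prems(3) w1 Y])
    show ?case using hty.trans[OF hty_append_left[OF row_step_path[OF w1] 2]] 3 t Y by simp
  qed
  from W0(1) 1(7) have "l0 @ [u0, v0] @ r0 = l @ [u, v] @ r" by simp
  then show ?case using W0(2) 1(6)
  proof (cases rule: redex_positions)
    case 1
    then show ?thesis using N hom_norm_path_refl[OF W] by simp
  next
    case e: 2
    have wt: "u0 \<in> rows n" "u \<in> rows n" "v \<in> rows n" using w w0 by auto
    let ?Ga = "map (whisker l0 r) (norm_path n (N2 u0 u @ [v]))"
    let ?Gb = "map (whisker l0 r) (norm_path n (u0 # N2 u v))"
    let ?E = "l0 @ nf [u0, u, v] @ r"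
    have "row_hty ([u0] @ [u, v]) (norm_path n ([u0] @ [u, v]))
       (map (whisker [u0] []) (norm_path n [u, v]) @ norm_path n ([u0] @ nf [u, v]))"
      using compat_rows[OF wt] unfolding compat_def .
    then have "row_hty [u0, u, v] (Step [] (u0, u) True [v] # norm_path n (N2 u0 u @ [v]))
        (Step [u0] (u, v) True [] # norm_path n (u0 # N2 u v))"
      using norm_path_redex[of "[]" n u0 u "[v]"] norm_path_pair[OF wt(2,3) 1(6)] W0(3) e wt
      by (simp add: nf_pair)
    from hty_whisker[OF this, of l0 r]
    have a: "row_hty W ([?sa] @ ?Ga) ([?s] @ ?Gb)" using e 1(7) w0(1) w(4) by simp
    have N2w: "N2 u0 u @ [v] \<in> lists (rows n)" "u0 # N2 u v \<in> lists (rows n)" using N2_rows wt by auto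
    have "nf (N2 u0 u @ [v]) = nf [u0, u, v]" using nf_N2[of "[]" n u0 u "[v]"] wt by simp
    then have p0: "path (row_pres n) ?Va ?Ga ?E"
      using path_whisker[OF norm_path_path[OF N2w(1)], of l0 r] w0 w e by simp
    have "nf (u0 # N2 u v) = nf [u0, u, v]" using nf_N2[of "[u0]" n u v "[]"] wt by simp
    then have p1: "path (row_pres n) ?V ?Gb ?E"
      using path_whisker[OF norm_path_path[OF N2w(2)], of l0 r] w0 w e by simp
    have fwd_whisker: "fwd (whisker l r t) = fwd t" for l r t by (cases t) simp
    have f0: "row_hty ?Va (?Ga @ norm_path n ?E) (norm_path n ?Va)"
      using norm_path_fwd[OF N2w(1)] by (intro fw[OF p0 _ VWr(2)]) (auto simp: fwd_whisker)
    have f1: "row_hty ?V (?Gb @ norm_path n ?E) (norm_path n ?V)"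
      using norm_path_fwd[OF N2w(2)] by (intro fw[OF p1 _ VWr(1)]) (auto simp: fwd_whisker)
    have E: "?E \<in> lists (rows n)" using nf_rows[of "[u0, u, v]" n] wt w0 w by auto
    have "path (row_pres n) W (([?sa] @ ?Ga) @ norm_path n ?E) (nf ?E)"
      using path_comp[OF path_comp[OF sp0 p0] norm_path_path[OF E]] .
    from hty_append_right[OF a this]
    have b: "row_hty W ([?sa] @ ?Ga @ norm_path n ?E) ([?s] @ ?Gb @ norm_path n ?E)" by simp
    have "row_hty W ([?s] @ norm_path n ?V) ([?sa] @ norm_path n ?Va)"
      using hty.trans[OF hty.sym[OF hty_append_left[OF sp f1]] hty.trans[OF hty.sym[OF b] hty_append_left[OF sp0 f0]]] .
    then show ?thesis using N by simp
  next
    case (3 m)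
    let ?Vb = "l0 @ N2 u0 v0 @ m @ N2 u v @ r"
    have m: "m \<in> lists (rows n)" using 3 w by simp
    have s1: "path (row_pres n) [u0, v0] [Step [] (u0, v0) True []] (N2 u0 v0)"
      using row_step_path[of "[]" n u0 v0 "[]"] w0 W0(3) by (simp del: path.simps)
    have s2: "path (row_pres n) [u, v] [Step [] (u, v) True []] (N2 u v)"
      using row_step_path[of "[]" n u v "[]"] w 1(6) by (simp del: path.simps)
    have m': "m \<in> lists (gen1 (row_pres n))" using m by simp
    have "row_hty ([u0, v0] @ m @ [u, v]) [Step [] (u0, v0) True (m @ [u, v]), Step (N2 u0 v0 @ m) (u, v) True []]
       [Step ([u0, v0] @ m) (u, v) True [], Step [] (u0, v0) True (m @ N2 u v)]"
      using hty_exchange_paths[OF s1 m' s2] by simp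
    from hty_whisker[OF this, of l0 r]
    have a: "row_hty W [?sa, Step (l0 @ N2 u0 v0 @ m) (u, v) True r] [?s, Step l0 (u0, v0) True (m @ N2 u v @ r)]"
      using 3 1(7) w0 w by simp
    have w2: "l0 @ N2 u0 v0 @ m \<in> lists (rows n)" "m @ N2 u v @ r \<in> lists (rows n)" using w0 w m N2_rows by auto
    have q: "path (row_pres n) ?Va [Step (l0 @ N2 u0 v0 @ m) (u, v) True r] ?Vb"
      using row_step_path[OF w2(1) w(2,3,4) 1(6)] 3 by (simp del: path.simps)
    have V2: "?Vb \<in> lists (rows n)" using w0 w m N2_rows by auto
    have "path (row_pres n) W ([?sa, Step (l0 @ N2 u0 v0 @ m) (u, v) True r] @ norm_path n ?Vb) (nf ?Vb)"
      using path_comp[OF path_comp[OF sp0 q] norm_path_path[OF V2]] by simp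
    from hty_append_right[OF a this]
    have b: "row_hty W ([?sa] @ [Step (l0 @ N2 u0 v0 @ m) (u, v) True r] @ norm_path n ?Vb) ([?s] @ norm_path n ?V)"
      using norm_path_redex[OF w0(1-3) w2(2) W0(2,3)] 3 by simp
    have c: "row_hty ?Va ([Step (l0 @ N2 u0 v0 @ m) (u, v) True r] @ norm_path n ?Vb) (norm_path n ?Va)"
      using fw[OF q _ VWr(2)] by simp
    show ?thesis using hty.trans[OF hty.sym[OF b] hty_append_left[OF sp0 c]] N by simp
  qed
qed

text \<open>A backward step uses the homotopy of the corresponding forward step: composing that with
  the inverse step cancels the step itself.\<close>

lemma hom_path_norm_path:
  "path (row_pres n) W p V \<Longrightarrow> row_hty W (p @ norm_path n V) (norm_path n W)"
proof (induction p arbitrary: W)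
  case Nil
  then show ?case using hom_norm_path_refl by auto
next
  case (Cons s p)
  obtain l u v e r where s: "s = Step l (u, v) e r" by (cases s) auto
  have w: "l \<in> lists (rows n)" "u \<in> rows n" "v \<in> rows n" "r \<in> lists (rows n)" "\<not> u \<lhd>\<^sub>N v"
    using Cons.prems s by auto
  let ?Y = "step_tgt (row_pres n) s"
  have p: "path (row_pres n) ?Y p V" and sW: "path (row_pres n) W [s] ?Y"
    using Cons.prems step_words(2)[OF poly, of s] by auto
  have "row_hty W ([s] @ norm_path n ?Y) (norm_path n W)"
  proof (cases e)
    case True
    then show ?thesis using hom_step_norm_path[OF w HOL.refl] sW s by (simp add: cell_src_def cell_tgt_def)
  next
    case False
    let ?t = "Step l (u, v) True r"
    have st: "s = inv_step ?t" "?Y = l @ [u, v] @ r" "W = l @ N2 u v @ r"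
      using False s sW by (simp_all add: cell_src_def cell_tgt_def)
    have tY: "path (row_pres n) ?Y [?t] W" unfolding st(2,3) by (rule row_step_path[OF w])
    have 1: "row_hty ?Y ([?t] @ norm_path n W) (norm_path n ?Y)"
      using hom_step_norm_path[OF w HOL.refl] st(2,3) by simp
    have 2: "row_hty W ((inv_steps [?t] @ [?t]) @ norm_path n W) ([] @ norm_path n W)"
    proof (rule hty_append_right[OF hty_cancel_path'[OF tY]])
      have "W \<in> lists (rows n)" using path_words[OF poly sW] by simp
      then show "path (row_pres n) W ((inv_steps [?t] @ [?t]) @ norm_path n W) (nf W)"
        using path_comp[OF path_comp[OF path_inv[OF poly tY] tY] norm_path_path[of W n]] by blast
    qed
    have "row_hty W (inv_steps [?t] @ norm_path n ?Y) (inv_steps [?t] @ [?t] @ norm_path n W)"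
      using hty.sym[OF hty_append_left[OF path_inv[OF poly tY] 1]] .
    from hty.trans[OF this] 2 show ?thesis using st(1) by simp
  qed
  then show ?case using hty.trans[OF hty_append_left[OF sW Cons.IH[OF p]]] by simp
qed

text \<open>Followed by the normalization of \<open>V\<close>, both paths become homotopic to the
  normalization of \<open>W\<close>; the common end is then cancelled.\<close>

lemma hom_parallel:
  assumes "path (row_pres n) W p V" "path (row_pres n) W q V"
  shows "row_hty W p q"
proof -
  have V: "V \<in> lists (rows n)" using path_words[OF poly assms(1)] by simp
  have "row_hty W (p @ norm_path n V) (q @ norm_path n V)"
    using hty.trans[OF hom_path_norm_path[OF assms(1)] hty.sym[OF hom_path_norm_path[OF assms(2)]]] .
  from hty_cancel_right[OF this assms norm_path_path[OF V]] show ?thesis .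
qed

end

section \<open>Selected cells\<close>

declare L_path.simps [simp del] R_path.simps [simp del]

section \<open>The matching of triples with cells, and the elimination of its acyclic part\<close>

lemma finite_rows: "finite (rows n)"
proof (rule finite_subset)
  show "rows n \<subseteq> sorted_list_of_set ` Pow {1..n}"
  proof
    fix u assume "u \<in> rows n"
    then have "u = sorted_list_of_set (set u)" "set u \<in> Pow {1..n}" using rowsD by auto
    then show "u \<in> sorted_list_of_set ` Pow {1..n}" by blast
  qed
qed simp

lemma finite_triples_T1: "finite (triples_T1 n)"
proof (rule finite_subset)
  show "triples_T1 n \<subseteq> rows n \<times> rows n \<times> rows n"
    by (auto simp: triples_T1_def triples_C_def)
qed (simp add: finite_rows)

lemma inj_row2_key: "inj row2_key"
  by (rule injI) (auto elim!: row2_key.elims)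

lemma inj_pair_key: "inj pair_key"
  by (rule injI) (auto elim!: pair_key.elims dest: injD[OF inj_row2_key])

lemma finite_eligible: "finite (eligible n)"
proof (rule finite_subset)
  show "eligible n \<subseteq> Sigma (triples_T1 n) (\<lambda>\<tau>. gen ` set (L_path n \<tau> @ R_path n \<tau>))"
  proof
    fix x assume "x \<in> eligible n"
    then obtain \<tau> \<beta> where x: "x = (\<tau>, \<beta>)" "\<tau> \<in> triples_T1 n" "Step [] \<beta> True [] \<in> set (L_path n \<tau> @ R_path n \<tau>)"
      by (auto simp: eligible_def)
    have "\<beta> \<in> gen ` set (L_path n \<tau> @ R_path n \<tau>)" using imageI[OF x(3), of gen] by simp
    then show "x \<in> Sigma (triples_T1 n) (\<lambda>\<tau>. gen ` set (L_path n \<tau> @ R_path n \<tau>))" using x by blast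
  qed
qed (simp add: finite_triples_T1)

text \<open>An injective key makes the sorted enumeration unique, which later identifies the result
  of insertion sort with it.\<close>

lemma (in linorder) sorted_key_list_of_set_inj:
  assumes "inj f" "finite A"
  shows "set (sorted_key_list_of_set f A) = A"
    "sorted (map f xs) \<Longrightarrow> distinct xs \<Longrightarrow> set xs = A \<Longrightarrow> sorted_key_list_of_set f A = xs"
proof -
  interpret folding_insort_key "(\<le>)" "(<)" UNIV f
    by unfold_locales (rule assms(1))
  show "set (sorted_key_list_of_set f A) = A" by (rule set_sorted_key_list_of_set[OF subset_UNIV assms(2)])
  show "sorted (map f xs) \<Longrightarrow> distinct xs \<Longrightarrow> set xs = A \<Longrightarrow> sorted_key_list_of_set f A = xs"
    using idem_if_sorted_distinct[of xs] by simp
qed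

text \<open>The invariant of the scan: distinct kept pairs share neither triple nor cell. It makes
  the definite description in \<open>tau\<close> meaningful.\<close>

lemma kept_pairs_matching:
  "kept_pairs n \<subseteq> eligible n"
  "(\<tau>, \<beta>) \<in> kept_pairs n \<Longrightarrow> (\<tau>', \<beta>') \<in> kept_pairs n \<Longrightarrow> \<tau> = \<tau>' \<longleftrightarrow> \<beta> = \<beta>'"
proof -
  let ?f = "\<lambda>K (\<tau>, \<beta>). if \<tau> \<notin> fst ` K \<and> \<beta> \<notin> snd ` K then insert (\<tau>, \<beta>) K else K"
  have *: "foldl ?f K xs \<subseteq> K \<union> set xs \<and>
      (\<forall>(\<tau>, \<beta>)\<in>foldl ?f K xs. \<forall>(\<tau>', \<beta>')\<in>foldl ?f K xs. \<tau> = \<tau>' \<longleftrightarrow> \<beta> = \<beta>')"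
    if "\<forall>(\<tau>, \<beta>)\<in>K. \<forall>(\<tau>', \<beta>')\<in>K. \<tau> = \<tau>' \<longleftrightarrow> \<beta> = \<beta>'" for K :: "(triple \<times> row2) set" and xs
    using that
  proof (induction xs arbitrary: K)
    case (Cons x xs)
    obtain \<tau> \<beta> where x: "x = (\<tau>, \<beta>)" by (cases x)
    have "\<forall>(\<tau>, \<beta>)\<in>?f K x. \<forall>(\<tau>', \<beta>')\<in>?f K x. \<tau> = \<tau>' \<longleftrightarrow> \<beta> = \<beta>'"
      using Cons.prems x by (auto simp: image_iff split: if_splits)
    from Cons.IH[OF this] show ?case using x by (auto split: if_splits)
  qed auto
  have s: "set (sorted_key_list_of_set pair_key (eligible n)) = eligible n"
    by (rule sorted_key_list_of_set_inj(1)[OF inj_pair_key finite_eligible])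
  show "kept_pairs n \<subseteq> eligible n"
    using *[of "{}" "sorted_key_list_of_set pair_key (eligible n)"] s by (simp add: kept_pairs_def)
  show "(\<tau>, \<beta>) \<in> kept_pairs n \<Longrightarrow> (\<tau>', \<beta>') \<in> kept_pairs n \<Longrightarrow> \<tau> = \<tau>' \<longleftrightarrow> \<beta> = \<beta>'"
    using *[of "{}" "sorted_key_list_of_set pair_key (eligible n)"] unfolding kept_pairs_def by fastforce
qed

lemma tau_eq: "(\<tau>, \<beta>) \<in> kept_pairs n \<Longrightarrow> tau n \<beta> = \<tau>"
  unfolding tau_def by (rule the_equality) (auto dest: kept_pairs_matching(2))

lemma tau_eligible: "\<beta> \<in> B_match n \<Longrightarrow> (tau n \<beta>, \<beta>) \<in> eligible n"
  using tau_eq kept_pairs_matching(1) by (fastforce simp: B_match_def)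

lemma finite_B_match: "finite (B_match n)"
  using finite_subset[OF kept_pairs_matching(1) finite_eligible] by (simp add: B_match_def)

lemma B_acyc_subset: "B_acyc n \<subseteq> B_match n"
  and acyclic_B_acyc: "acyclic (dep_graph n \<inter> B_acyc n \<times> B_acyc n)"
proof -
  let ?f = "\<lambda>K \<beta>. if acyclic (dep_graph n \<inter> insert \<beta> K \<times> insert \<beta> K) then insert \<beta> K else K"
  have *: "foldl ?f K xs \<subseteq> K \<union> set xs \<and> acyclic (dep_graph n \<inter> foldl ?f K xs \<times> foldl ?f K xs)"
    if "acyclic (dep_graph n \<inter> K \<times> K)" for K xs
    using that
  proof (induction xs arbitrary: K)
    case (Cons x xs)
    have "acyclic (dep_graph n \<inter> ?f K x \<times> ?f K x)" using Cons.prems by auto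
    from Cons.IH[OF this] show ?case by (auto split: if_splits)
  qed auto
  have s: "set (sorted_key_list_of_set row2_key (B_match n)) = B_match n"
    by (rule sorted_key_list_of_set_inj(1)[OF inj_row2_key finite_B_match])
  show "B_acyc n \<subseteq> B_match n" "acyclic (dep_graph n \<inter> B_acyc n \<times> B_acyc n)"
    using *[of "{}" "sorted_key_list_of_set row2_key (B_match n)"] s
    by (simp_all add: B_acyc_def acyclic_def)
qed

definition red_rel :: "nat \<Rightarrow> (row2 \<times> row2) set" where
  "red_rel n = {(\<beta>', \<beta>). \<beta> \<in> B_acyc n \<and> \<beta>' \<in> dependencies n (tau n \<beta>) \<beta>}"

text \<open>Restricted to eliminated cells, the relation is finite and acyclic. A surviving cell has
  no predecessor, so a descent ends as soon as it reaches one.\<close>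

lemma wf_red_rel: "wf (red_rel n)"
proof -
  let ?B = "B_acyc n"
  let ?R = "red_rel n \<inter> ?B \<times> ?B"
  have "?R = dep_graph n \<inter> ?B \<times> ?B"
    using B_acyc_subset by (auto simp: red_rel_def dep_graph_def)
  moreover have "finite (dep_graph n \<inter> ?B \<times> ?B)"
    using finite_subset[OF B_acyc_subset finite_B_match] by auto
  ultimately have wf: "wf ?R" using finite_acyclic_wf acyclic_B_acyc by metis
  show ?thesis
  proof (rule wfI_pf)
    fix A assume A: "A \<subseteq> red_rel n `` A"
    have "x \<notin> A" for x
    proof (induction x rule: wf_induct_rule[OF wf])
      case (1 x)
      show ?case
      proof
        assume "x \<in> A"
        then obtain y where y: "y \<in> A" "(y, x) \<in> red_rel n" using A by blast
        have x: "x \<in> ?B" using y by (simp add: red_rel_def)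
        \<comment> \<open>Since \<open>y\<close> has a predecessor, it is an eliminated cell, and
          the induction over the restricted relation reaches it.\<close>
        obtain z where z: "(z, y) \<in> red_rel n" using y A by blast
        then have "y \<in> ?B" by (simp add: red_rel_def)
        then show False using 1 x y by blast
      qed
    qed
    then show "A = {}" by blast
  qed
qed

lemma map_step_cong:
  "F1 = G1 \<Longrightarrow> F2 (gen s) = G2 (gen s) \<Longrightarrow> map_step F1 F2 s = map_step G1 G2 s"
  by (cases s) simp

lemma map_steps_cong:
  "(\<And>s. s \<in> set p \<Longrightarrow> F2 (gen s) = G2 (gen s)) \<Longrightarrow> map_steps F1 F2 p = map_steps F1 G2 p"
  by (induction p) (auto intro: map_step_cong)

abbreviation red_steps :: "nat \<Rightarrow> (row, row2) step list \<Rightarrow> (row, row2) step list" where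
  "red_steps n \<equiv> map_steps (\<lambda>u. [u]) (red_cell n)"

text \<open>The function cut off by \<open>wfrec\<close> is evaluated only at generators of
  \<open>S_steps\<close>, that is at dependencies, where it agrees with
  \<open>red_cell n\<close>.\<close>

lemma red_cell_eq:
  "red_cell n \<beta> = (if \<beta> \<in> B_acyc n then red_steps n (S_steps n (tau n \<beta>) \<beta>) else [Step [] \<beta> True []])"
proof -
  let ?R = "red_rel n"
  let ?F = "\<lambda>red \<beta>. if \<beta> \<in> B_acyc n then map_steps (\<lambda>u. [u]) red (S_steps n (tau n \<beta>) \<beta>) else [Step [] \<beta> True []]"
  have r: "red_cell n = wfrec ?R ?F" by (simp add: red_cell_def red_rel_def)
  have "red_cell n \<beta> = ?F (cut (red_cell n) ?R \<beta>) \<beta>" unfolding r by (rule wfrec[OF wf_red_rel])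
  moreover have "map_steps (\<lambda>u. [u]) (cut (red_cell n) ?R \<beta>) (S_steps n (tau n \<beta>) \<beta>) =
      red_steps n (S_steps n (tau n \<beta>) \<beta>)" if "\<beta> \<in> B_acyc n"
    using that by (intro map_steps_cong) (auto simp: cut_def red_rel_def dependencies_def)
  ultimately show ?thesis by simp
qed

lemma map_steps_id: "map_steps (\<lambda>u. [u]) (\<lambda>\<beta>. [Step [] \<beta> True []]) p = p"
proof (induction p)
  case (Cons s p)
  then show ?case by (cases s) (auto simp: inv_steps_def)
qed simp

lemma red_steps_fixed:
  assumes "gen ` set p \<inter> B_acyc n = {}"
  shows "red_steps n p = p"
proof -
  have "red_steps n p = map_steps (\<lambda>u. [u]) (\<lambda>\<beta>. [Step [] \<beta> True []]) p"
  proof (rule map_steps_cong)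
    fix s assume "s \<in> set p"
    then have "gen s \<notin> B_acyc n" using assms by blast
    then show "red_cell n (gen s) = [Step [] (gen s) True []]" by (simp add: red_cell_eq)
  qed
  then show ?thesis by (simp add: map_steps_id)
qed

lemma gen_inv_step [simp]: "gen (inv_step s) = gen s"
  by (cases s) simp

lemma gen_inv_steps [simp]: "gen ` set (inv_steps p) = gen ` set p"
  unfolding inv_steps_def by (simp add: image_image)

subsection \<open>Eliminating the selected cells\<close>

text \<open>The occurrence located by \<open>takeWhile\<close> is the one with empty context,
  because an eligible cell occurs only once in both paths together.\<close>

lemma eligible_split:
  assumes "(\<tau>, \<beta>) \<in> eligible n"
  obtains U V f g where "U = f @ [Step [] \<beta> True []] @ g" "S_steps n \<tau> \<beta> = inv_steps f @ V @ inv_steps g"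
    "(U, V) = (L_path n \<tau>, R_path n \<tau>) \<or> (U, V) = (R_path n \<tau>, L_path n \<tau>)"
proof -
  let ?L = "L_path n \<tau>" and ?R = "R_path n \<tau>" and ?s = "Step [] \<beta> True []"
  define U V where "U = (if \<beta> \<in> gen ` set ?L then ?L else ?R)" and "V = (if \<beta> \<in> gen ` set ?L then ?R else ?L)"
  have s: "?s \<in> set (?L @ ?R)" and c: "length (filter (\<lambda>s. gen s = \<beta>) (?L @ ?R)) = 1"
    using assms by (simp_all add: eligible_def)
  have only: "t = ?s" if "t \<in> set (?L @ ?R)" "gen t = \<beta>" for t
  proof -
    obtain x where x: "filter (\<lambda>s. gen s = \<beta>) (?L @ ?R) = [x]" using c unfolding One_nat_def length_Suc_conv by auto
    have "t \<in> set (filter (\<lambda>s. gen s = \<beta>) (?L @ ?R))" "?s \<in> set (filter (\<lambda>s. gen s = \<beta>) (?L @ ?R))"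
      using s that by auto
    then show ?thesis unfolding x by simp
  qed
  have "\<beta> \<in> gen ` set (?L @ ?R)" using imageI[OF s, of gen] by simp
  then have "\<beta> \<in> gen ` set U" by (auto simp: U_def)
  then obtain t where t: "t \<in> set U" "gen t = \<beta>" by auto
  define f g where "f = takeWhile (\<lambda>s. gen s \<noteq> \<beta>) U" and "g = tl (dropWhile (\<lambda>s. gen s \<noteq> \<beta>) U)"
  have ne: "dropWhile (\<lambda>s. gen s \<noteq> \<beta>) U \<noteq> []" using t by auto
  have "gen (hd (dropWhile (\<lambda>s. gen s \<noteq> \<beta>) U)) = \<beta>" using hd_dropWhile[OF ne] by simp
  moreover have "hd (dropWhile (\<lambda>s. gen s \<noteq> \<beta>) U) \<in> set U" using ne by (meson hd_in_set set_dropWhileD)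
  ultimately have "hd (dropWhile (\<lambda>s. gen s \<noteq> \<beta>) U) = ?s" by (intro only) (auto simp: U_def split: if_splits)
  then have "dropWhile (\<lambda>s. gen s \<noteq> \<beta>) U = ?s # g" using ne by (metis g_def list.collapse)
  then have "U = f @ [?s] @ g" unfolding f_def by (metis append_Cons append_Nil takeWhile_dropWhile_id)
  moreover have "S_steps n \<tau> \<beta> = inv_steps f @ V @ inv_steps g"
    by (simp add: S_steps_def f_def g_def U_def V_def)
  moreover have "(U, V) = (?L, ?R) \<or> (U, V) = (?R, ?L)" by (simp add: U_def V_def)
  ultimately show ?thesis by (rule that)
qed

lemma poly_red: "is_polygraph2 (base (row_red n))"
  using poly_row_pres[of n] by (simp add: row_red_def is_polygraph2_def)

lemma step_boundary_gen2 [simp]: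
  "step_src (P\<lparr>gen2 := D\<rparr>) s = step_src P s" "step_tgt (P\<lparr>gen2 := D\<rparr>) s = step_tgt P s"
  by (cases s; simp add: cell_src_def cell_tgt_def)+

lemma is_step_iff:
  "is_step P s \<longleftrightarrow> gen s \<in> gen2 P \<and> lctx s \<in> lists (gen1 P) \<and> rctx s \<in> lists (gen1 P)"
  by (cases s) auto

text \<open>Separates the shape of a path from the generators allowed in it, so that paths move
  between polygraphs differing only in their 2-cells.\<close>

lemma path_gen2: "path (P\<lparr>gen2 := D\<rparr>) u p v \<longleftrightarrow> path (P\<lparr>gen2 := UNIV\<rparr>) u p v \<and> gen ` set p \<subseteq> D"
  by (induction p arbitrary: u) (auto simp: is_step_iff)

lemma path_UNIV: "path P u p v \<longleftrightarrow> path (P\<lparr>gen2 := UNIV\<rparr>) u p v \<and> gen ` set p \<subseteq> gen2 P"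
  by (induction p arbitrary: u) (auto simp: is_step_iff)

lemma S_steps_path:
  assumes "(\<tau>, \<beta>) \<in> eligible n"
  shows "path (row_pres n) (src2 (row_pres n) \<beta>) (S_steps n \<tau> \<beta>) (tgt2 (row_pres n) \<beta>)"
proof -
  interpret track_cells "row_pres n" "row_cells n" by (rule track_cells_row)
  obtain U V f g where UV: "U = f @ [Step [] \<beta> True []] @ g" "S_steps n \<tau> \<beta> = inv_steps f @ V @ inv_steps g"
    "(U, V) = (L_path n \<tau>, R_path n \<tau>) \<or> (U, V) = (R_path n \<tau>, L_path n \<tau>)"
    using eligible_split[OF assms] .
  have "\<tau> \<in> triples_C n" using assms by (auto simp: eligible_def triples_T1_def)
  then obtain w z where p: "path (row_pres n) w U z" "path (row_pres n) w V z"
    using UV(3) triple_paths by (cases \<tau>) fastforce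
  then obtain x where x: "path (row_pres n) w f x" "path (row_pres n) x ([Step [] \<beta> True []] @ g) z"
    using UV(1) path_app by blast
  then have "x = src2 (row_pres n) \<beta>" "path (row_pres n) (tgt2 (row_pres n) \<beta>) g z"
    by (auto simp: cell_src_def cell_tgt_def)
  then show ?thesis unfolding UV(2)
    using path_comp path_inv[OF poly] x p by blast
qed

lemma red_cell_path:
  "\<beta> \<in> gen2 (row_pres n) \<Longrightarrow>
    path (base (row_red n)) (src2 (row_pres n) \<beta>) (red_cell n \<beta>) (tgt2 (row_pres n) \<beta>)"
proof (induction \<beta> rule: wf_induct_rule[OF wf_red_rel[of n]])
  case (1 \<beta>)
  show ?case
  proof (cases "\<beta> \<in> B_acyc n")
    case False
    then show ?thesis using 1(2) poly_row_pres[of n]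
      by (simp add: red_cell_eq row_red_def cell_src_def cell_tgt_def is_polygraph2_def)
  next
    case True
    let ?D = "dependencies n (tau n \<beta>) \<beta>"
    \<comment> \<open>Restricting the 2-cells to the dependencies of \<beta> makes
      \<open>red_cell n\<close> a functor there by the induction hypothesis.\<close>
    let ?P = "(row_pres n)\<lparr>gen2 := gen2 (row_pres n) \<inter> ?D\<rparr>"
    have "(tau n \<beta>, \<beta>) \<in> eligible n" using True B_acyc_subset tau_eligible by blast
    note S = S_steps_path[OF this]
    have "path ?P (src2 (row_pres n) \<beta>) (S_steps n (tau n \<beta>) \<beta>) (tgt2 (row_pres n) \<beta>)"
      using S path_UNIV path_gen2 unfolding dependencies_def by (metis Int_greatest order_refl)
    moreover have "track_functor ?P (base (row_red n)) (\<lambda>u. [u]) (red_cell n)"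
      using poly_red poly_row_pres[of n] 1(1) True unfolding track_functor_def
      by (simp add: is_polygraph2_def red_rel_def) (simp add: row_red_def)
    ultimately have "path (base (row_red n)) (map_word (\<lambda>u. [u]) (src2 (row_pres n) \<beta>))
       (red_steps n (S_steps n (tau n \<beta>) \<beta>)) (map_word (\<lambda>u. [u]) (tgt2 (row_pres n) \<beta>))"
      by (intro functor_path)
    then show ?thesis using True by (simp add: red_cell_eq[of n \<beta>])
  qed
qed

lemma red_functor: "track_functor (row_pres n) (base (row_red n)) (\<lambda>u. [u]) (red_cell n)"
  using poly_red poly_row_pres red_cell_path by (auto simp: track_functor_def) (simp add: row_red_def)

lemma red_steps_path:
  "path (row_pres n) u p v \<Longrightarrow> path (base (row_red n)) u (red_steps n p) v"
  using functor_path[OF red_functor] by fastforce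

lemma row_red_simps:
  "gen3 (row_red n) = triples_T1 n - tau n ` B_acyc n"
  "src3 (row_red n) \<tau> = (triple_word \<tau>, red_steps n (L_path n \<tau>))"
  "tgt3 (row_red n) \<tau> = (triple_word \<tau>, red_steps n (R_path n \<tau>))"
  by (simp_all add: row_red_def Red_def)

lemma triple_T1_paths:
  assumes "\<tau> \<in> triples_T1 n"
  obtains v where "path (row_pres n) (triple_word \<tau>) (L_path n \<tau>) v" "path (row_pres n) (triple_word \<tau>) (R_path n \<tau>) v"
proof -
  have "\<tau> \<in> triples_C n" using assms by (simp add: triples_T1_def)
  then show ?thesis using triple_paths that by (cases \<tau>) (metis triple_word.simps)
qed

lemma parallelI: "path P u p v \<Longrightarrow> path P u q v \<Longrightarrow> parallel P (u, p) (u, q)"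
  by (simp add: parallel_def zz_tgt_path del: zz_tgt.simps)

lemma polygraph31_red: "polygraph31 (row_red n)"
proof
  show "is_polygraph31 (row_red n)"
    unfolding is_polygraph31_def
  proof (intro conjI ballI)
    show "is_polygraph2 (base (row_red n))" by (rule poly_red)
    fix \<tau> assume "\<tau> \<in> gen3 (row_red n)"
    then have "\<tau> \<in> triples_T1 n" by (simp add: row_red_simps)
    then obtain v where "path (base (row_red n)) (triple_word \<tau>) (red_steps n (L_path n \<tau>)) v"
      "path (base (row_red n)) (triple_word \<tau>) (red_steps n (R_path n \<tau>)) v"
      using triple_T1_paths red_steps_path by metis
    then show "is_zigzag (base (row_red n)) (src3 (row_red n) \<tau>)" "is_zigzag (base (row_red n)) (tgt3 (row_red n) \<tau>)"
      "parallel (base (row_red n)) (src3 (row_red n) \<tau>) (tgt3 (row_red n) \<tau>)"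
      using path_zigzag parallelI by (metis row_red_simps(2,3))+
  qed
qed

text \<open>A surviving triple has its own cell. If the triple is matched with an eliminated
  \<beta>, the path through \<beta> has the same image as
  \<open>f @ inv_steps f @ V @ inv_steps g @ g\<close>, and this cancels to the image of
  \<open>V\<close>.\<close>

lemma red_triple:
  assumes \<tau>: "\<tau> \<in> triples_T1 n"
  shows "hty (base (row_red n)) (boundaries (row_red n)) (triple_word \<tau>)
    (red_steps n (L_path n \<tau>)) (red_steps n (R_path n \<tau>))"
proof -
  interpret R: polygraph31 "row_red n" by (rule polygraph31_red)
  obtain z where z: "path (row_pres n) (triple_word \<tau>) (L_path n \<tau>) z" "path (row_pres n) (triple_word \<tau>) (R_path n \<tau>) z"
    using triple_T1_paths[OF \<tau>] .
  show ?thesis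
  proof (cases "\<tau> \<in> tau n ` B_acyc n")
    case False
    then have "\<tau> \<in> gen3 (row_red n)" using \<tau> by (simp add: row_red_simps)
    then have "((triple_word \<tau>, red_steps n (L_path n \<tau>)), (triple_word \<tau>, red_steps n (R_path n \<tau>))) \<in> boundaries (row_red n)"
      unfolding boundaries_def by (intro image_eqI[of _ _ \<tau>]) (simp_all add: row_red_simps)
    from hty.cell[OF this, of "base (row_red n)" "triple_word \<tau>" "[]" "[]" "[]" "[]" z]
    show ?thesis using red_steps_path[OF z(1)] path_words[OF poly_red red_steps_path[OF z(1)]] by simp
  next
    case True
    then obtain \<beta> where \<beta>: "\<beta> \<in> B_acyc n" "\<tau> = tau n \<beta>" by blast
    have "(\<tau>, \<beta>) \<in> eligible n" using \<beta> B_acyc_subset tau_eligible by blast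
    then obtain U V f g where UV: "U = f @ [Step [] \<beta> True []] @ g" "S_steps n \<tau> \<beta> = inv_steps f @ V @ inv_steps g"
      "(U, V) = (L_path n \<tau>, R_path n \<tau>) \<or> (U, V) = (R_path n \<tau>, L_path n \<tau>)"
      by (rule eligible_split)
    let ?F = "red_steps n f" and ?V = "red_steps n V" and ?G = "red_steps n g" and ?w = "triple_word \<tau>"
    have pU: "path (row_pres n) ?w U z" and pV: "path (row_pres n) ?w V z" using UV(3) z by auto
    obtain x y where f: "path (row_pres n) ?w f x" and s: "path (row_pres n) x [Step [] \<beta> True []] y" and g: "path (row_pres n) y g z"
      using pU unfolding UV(1) path_append[OF poly_row_pres] by blast
    note F = red_steps_path[OF f] note G = red_steps_path[OF g] note Vp = red_steps_path[OF pV]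
    have U: "red_steps n U = ?F @ (inv_steps ?F @ ?V @ inv_steps ?G) @ ?G"
      using \<beta> by (simp add: UV(1,2)[folded \<beta>(2)] red_cell_eq[of n \<beta>] UV(2)[unfolded \<beta>(2)] map_steps_inv)
    let ?H = "hty (base (row_red n)) (boundaries (row_red n))"
    have iG: "path (base (row_red n)) z (inv_steps ?G) y" and iF: "path (base (row_red n)) x (inv_steps ?F) ?w"
      using path_inv[OF poly_red] F G by blast+
    have 1: "?H ?w ((?F @ inv_steps ?F) @ ?V @ inv_steps ?G @ ?G) ([] @ ?V @ inv_steps ?G @ ?G)"
      by (rule R.Q.hty_append_right[OF R.Q.hty_cancel_path[OF F]])
        (rule R.Q.path_comp[OF R.Q.path_comp[OF F iF] R.Q.path_comp[OF Vp R.Q.path_comp[OF iG G]]])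
    have 2: "?H ?w (?V @ inv_steps ?G @ ?G) (?V @ [])"
      by (rule R.Q.hty_append_left[OF Vp R.Q.hty_cancel_path'[OF G]])
    have "?H ?w (red_steps n U) ?V" unfolding U using hty.trans[OF 1] 2 by simp
    then show ?thesis using UV(3) hty.sym by auto
  qed
qed

text \<open>Reduced paths are row paths, so coherence of the row presentation applies.
  \<open>Red\<close> brings the homotopy back and leaves both paths unchanged, as they contain no
  eliminated cell.\<close>

lemma row_red_parallel:
  assumes p: "path (base (row_red n)) u p v" and q: "path (base (row_red n)) u q v"
  shows "hty (base (row_red n)) (boundaries (row_red n)) u p q"
proof -
  interpret R: polygraph31 "row_red n" by (rule polygraph31_red)
  have b: "base (row_red n) = (row_pres n)\<lparr>gen2 := gen2 (row_pres n) - B_acyc n\<rparr>" by (simp add: row_red_def)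
  have g: "gen ` set r \<inter> B_acyc n = {}" "path (row_pres n) u r v" if "path (base (row_red n)) u r v" for r
    using that path_gen2[where P = "row_pres n" and D = "gen2 (row_pres n) - B_acyc n"]
      path_UNIV[of "row_pres n" u r v] unfolding b by blast+
  have "hty (row_pres n) (row_cells n) u p q" using hom_parallel g(2) p q by blast
  then have "hty (base (row_red n)) (boundaries (row_red n)) (map_word (\<lambda>u. [u]) u) (red_steps n p) (red_steps n q)"
  proof (rule functor_hty[OF red_functor R.Q.track_cells_axioms, rotated])
    fix a p b q assume "((a, p), (b, q)) \<in> row_cells n"
    then show "hty (base (row_red n)) (boundaries (row_red n)) (map_word (\<lambda>u. [u]) a) (red_steps n p) (red_steps n q)"
      using red_triple by (auto simp: row_cells_def)
  qed
  then show ?thesis using red_steps_fixed[OF g(1)[OF p]] red_steps_fixed[OF g(1)[OF q]] by simp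
qed

section \<open>Shortest paths between words of letters\<close>

lemma poly_styl: "is_polygraph2 (styl n)"
  by (auto simp: is_polygraph2_def styl_def)

lemma word_cong_path:
  assumes P: "is_polygraph2 P" and "word_cong P u v"
  shows "\<exists>p. path P u p v"
  using assms(2)
proof (induction rule: word_cong.induct)
  case (cell \<beta>)
  then have "path P (src2 P \<beta>) [Step [] \<beta> True []] (tgt2 P \<beta>)"
    using P by (simp add: cell_src_def cell_tgt_def is_polygraph2_def)
  then show ?case by blast
next
  case (refl u)
  then have "path P u [] u" by simp
  then show ?case by blast
next
  case (sym u v)
  then show ?case using path_inv[OF P] by blast
next
  case (trans u v w)
  then show ?case using path_append[OF P] by blast
next
  case (append u u' v v')
  then obtain p q where p: "path P u p u'" and q: "path P v q v'" by blast
  have w: "v \<in> lists (gen1 P)" "u' \<in> lists (gen1 P)" using path_words[OF P] p q by blast+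
  have "path P (u @ v) (map (whisker [] v) p) (u' @ v)" using path_whisker[OF p, of "[]" v] w by simp
  moreover have "path P (u' @ v) (map (whisker u' []) q) (u' @ v')" using path_whisker[OF q, of u' "[]"] w by simp
  ultimately show ?case using path_append[OF P] by blast
qed

definition letter_steps :: "nat \<Rightarrow> nat list \<Rightarrow> (nat, styl2) step set" where
  "letter_steps n w = {s. is_step (styl n) s \<and> step_src (styl n) s = w}"

lemma finite_styl: "finite (gen2 (styl n))"
proof (rule finite_subset)
  show "gen2 (styl n) \<subseteq> Eta ` {1..n} \<union> (\<lambda>(x, y, z). Kappa x y z) ` ({1..n} \<times> {1..n} \<times> {1..n}) \<union>
    (\<lambda>(x, y, z). Lambda x y z) ` ({1..n} \<times> {1..n} \<times> {1..n})"
  proof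
    fix c assume c: "c \<in> gen2 (styl n)"
    show "c \<in> Eta ` {1..n} \<union> (\<lambda>(x, y, z). Kappa x y z) ` ({1..n} \<times> {1..n} \<times> {1..n}) \<union>
      (\<lambda>(x, y, z). Lambda x y z) ` ({1..n} \<times> {1..n} \<times> {1..n})"
    proof (cases c)
      case (Kappa x y z)
      then show ?thesis using c by (intro UnI1 UnI2 image_eqI[of _ _ "(x, y, z)"]) (auto simp: styl_def)
    next
      case (Lambda x y z)
      then show ?thesis using c by (intro UnI2 image_eqI[of _ _ "(x, y, z)"]) (auto simp: styl_def)
    qed (use c in \<open>auto simp: styl_def\<close>)
  qed
qed auto

lemma finite_letter_steps: "finite (letter_steps n w)"
proof (rule finite_subset)
  let ?f = "\<lambda>(i, c, e). Step (take i w) c e (drop (i + length (cell_src (styl n) c e)) w)"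
  show "letter_steps n w \<subseteq> ?f ` ({..length w} \<times> gen2 (styl n) \<times> UNIV)"
  proof
    fix s assume s: "s \<in> letter_steps n w"
    obtain l c e r where [simp]: "s = Step l c e r" by (cases s)
    have "w = l @ cell_src (styl n) c e @ r" "c \<in> gen2 (styl n)" using s by (auto simp: letter_steps_def)
    then have "s = ?f (length l, c, e)" "(length l, c, e) \<in> {..length w} \<times> gen2 (styl n) \<times> UNIV" by auto
    then show "s \<in> ?f ` ({..length w} \<times> gen2 (styl n) \<times> UNIV)" by (rule image_eqI)
  qed
qed (simp add: finite_styl)

lemma finite_letter_paths: "finite {p. \<exists>v. path (styl n) w p v \<and> length p = k}"
proof (induction k arbitrary: w)
  case (Suc k)
  let ?Q = "\<lambda>w. {p. \<exists>v. path (styl n) w p v \<and> length p = k}"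
  have "{p. \<exists>v. path (styl n) w p v \<and> length p = Suc k} \<subseteq>
     (\<lambda>(s, p). s # p) ` Sigma (letter_steps n w) (\<lambda>s. ?Q (step_tgt (styl n) s))"
  proof
    fix p assume "p \<in> {p. \<exists>v. path (styl n) w p v \<and> length p = Suc k}"
    then obtain v s q where "path (styl n) w p v" "p = s # q" "length q = k" by (cases p) auto
    then have "p = (\<lambda>(s, p). s # p) (s, q)" "(s, q) \<in> Sigma (letter_steps n w) (\<lambda>s. ?Q (step_tgt (styl n) s))"
      by (auto simp: letter_steps_def)
    then show "p \<in> (\<lambda>(s, p). s # p) ` Sigma (letter_steps n w) (\<lambda>s. ?Q (step_tgt (styl n) s))" by (rule image_eqI)
  qed
  moreover have "finite (Sigma (letter_steps n w) (\<lambda>s. ?Q (step_tgt (styl n) s)))"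
    using Suc finite_letter_steps by auto
  ultimately show ?case using finite_subset by blast
next
  case 0
  have "{p. \<exists>v. path (styl n) w p v \<and> length p = 0} \<subseteq> {[]}" by auto
  then show ?case using finite_subset by blast
qed

fun letter_key :: "(nat, styl2) step \<Rightarrow> nat \<times> nat \<times> nat list" where
  "letter_key (Step w c e w') = (length w, styl2_kind c + (if e then 0 else 3), styl2_params c)"

lemma styl2_kind_less: "styl2_kind c < 3"
  by (cases c) auto

lemma styl2_eqI: "styl2_kind c = styl2_kind d \<Longrightarrow> styl2_params c = styl2_params d \<Longrightarrow> c = d"
  by (cases c; cases d) auto

text \<open>Kinds are below 3, so the offset 3 of inverse steps separates the two directions.
  Position, direction, kind and parameters determine a step once its source is known.\<close>

lemma letter_key_inj:
  assumes "path (styl n) u p v" "path (styl n) u q w" "map letter_key p = map letter_key q"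
  shows "p = q"
  using assms
proof (induction p arbitrary: u q)
  case (Cons s p)
  then obtain t q' where q: "q = t # q'" and k: "letter_key s = letter_key t" "map letter_key p = map letter_key q'" by auto
  obtain l c e r where s: "s = Step l c e r" by (cases s)
  obtain l' c' e' r' where t: "t = Step l' c' e' r'" by (cases t)
  have e: "e = e'" "styl2_kind c = styl2_kind c'"
    using k s t styl2_kind_less[of c] styl2_kind_less[of c'] by (auto split: if_splits)
  have "c = c'" using k s t e by (intro styl2_eqI) auto
  moreover have "l @ cell_src (styl n) c e @ r = l' @ cell_src (styl n) c' e' @ r'" "length l = length l'"
    using Cons.prems q s t k by auto
  ultimately have "s = t" using s t e by simp
  then show ?case using Cons q k by auto
qed simp

definition letter_path :: "nat \<Rightarrow> nat list \<Rightarrow> nat list \<Rightarrow> (nat, styl2) step list" where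
  "letter_path n U V = (ARG_MIN (\<lambda>p. (length p, map letter_key p)) p. path (styl n) U p V)"

text \<open>The lexicographic order on lists of keys is not well-founded, so the minimum is taken
  among the finitely many paths of least length. Injectivity of the keys identifies it with the
  value of \<open>ARG_MIN\<close>.\<close>

lemma letter_path_min:
  assumes "word_cong (styl n) U V"
  shows "path (styl n) U (letter_path n U V) V"
    "path (styl n) U q V \<Longrightarrow> (length (letter_path n U V), map letter_key (letter_path n U V)) \<le> (length q, map letter_key q)"
proof -
  let ?k = "\<lambda>p. (length p, map letter_key p)"
  obtain p where p: "path (styl n) U p V" using word_cong_path[OF poly_styl assms] by blast
  define m where "m = (LEAST m. \<exists>p. path (styl n) U p V \<and> length p = m)"
  let ?A = "{p. path (styl n) U p V \<and> length p = m}"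
  have "\<exists>p. path (styl n) U p V \<and> length p = m"
    unfolding m_def by (rule LeastI_ex) (use p in blast)
  moreover have "finite ?A" by (rule finite_subset[OF _ finite_letter_paths[of n U m]]) blast
  ultimately obtain a where a: "a \<in> ?A" "\<forall>y\<in>?A. ?k a \<le> ?k y"
    using ex_is_arg_min_if_finite[of ?A ?k] by (auto simp: is_arg_min_linorder)
  have min: "\<forall>y. path (styl n) U y V \<longrightarrow> ?k a \<le> ?k y"
  proof (intro allI impI)
    fix y assume y: "path (styl n) U y V"
    then have "m \<le> length y" unfolding m_def by (auto intro: Least_le)
    then show "?k a \<le> ?k y" using a y by (cases "length y = m") auto
  qed
  have inj: "inj_on ?k {p. path (styl n) U p V}" by (auto intro!: inj_onI dest: letter_key_inj)
  have "letter_path n U V = a"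
    unfolding letter_path_def by (rule arg_min_inj_eq[OF inj _ min]) (use a in simp)
  then show "path (styl n) U (letter_path n U V) V"
    "path (styl n) U q V \<Longrightarrow> (length (letter_path n U V), map letter_key (letter_path n U V)) \<le> (length q, map letter_key q)"
    using a min by auto
qed

section \<open>Transport to the letter presentation\<close>

lemma letters_simps [simp]: "letters [] = []" "letters (x # w) = [x] # letters w" "letters (v @ w) = letters v @ letters w"
  by (simp_all add: letters_def)

lemma letters_inj [simp]: "letters v = letters w \<longleftrightarrow> v = w"
  unfolding letters_def by (intro inj_map_eq_map) (simp add: inj_def)

lemma concat_letters [simp]: "concat (letters w) = w"
  by (induction w) auto

lemma flat_letters: "flat W = letters (concat W)"
  by (induction W) (auto simp: flat_def)

lemma letters_rows: "w \<in> lists {1..n} \<Longrightarrow> letters w \<in> lists (rows n)"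
  by (induction w) (auto simp: rows_def)

lemma prerow_simps [simp]:
  "gen1 (prerow n) = rows n" "src2 (prerow n) = prerow_src" "tgt2 (prerow n) = prerow_tgt"
  "Letter c \<in> gen2 (prerow n) \<longleftrightarrow> c \<in> gen2 (styl n)" "Gamma u \<in> gen2 (prerow n) \<longleftrightarrow> u \<in> rows2 n"
  by (auto simp: prerow_def)

lemma styl_simps [simp]: "gen1 (styl n) = {1..n}" "src2 (styl n) = styl_src" "tgt2 (styl n) = styl_tgt"
  by (simp_all add: styl_def)

lemma styl_words: "c \<in> gen2 (styl n) \<Longrightarrow> styl_src c \<in> lists {1..n} \<and> styl_tgt c \<in> lists {1..n}"
  using poly_styl[of n] by (simp add: is_polygraph2_def)

lemma rows2_rows: "u \<in> rows2 n \<Longrightarrow> u \<in> rows n"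
  by (simp add: rows2_def)

lemma prerow_gen2_cases:
  assumes "\<delta> \<in> gen2 (prerow n)"
  obtains c where "\<delta> = Letter c" "c \<in> gen2 (styl n)" | u where "\<delta> = Gamma u" "u \<in> rows2 n"
  using assms by (cases \<delta>) auto

lemma prerow_words: "\<delta> \<in> gen2 (prerow n) \<Longrightarrow> prerow_src \<delta> \<in> lists (rows n) \<and> prerow_tgt \<delta> \<in> lists (rows n)"
  by (elim prerow_gen2_cases) (use styl_words letters_rows rows2_rows rowsD(5) in \<open>simp; blast\<close>)+

lemma poly_prerow: "is_polygraph2 (prerow n)"
  using prerow_words by (simp add: is_polygraph2_def)

lemma prerow_nf:
  assumes "\<delta> \<in> gen2 (prerow n)"
  shows "nf (prerow_src \<delta>) = nf (prerow_tgt \<delta>)"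
  using assms
proof (cases rule: prerow_gen2_cases)
  case (1 c)
  then show ?thesis using word_cong_n_tableau[OF word_cong.cell[of c "styl n"]] by (simp add: nf_def)
next
  case (2 u)
  then show ?thesis by (simp add: nf_def)
qed

definition Q_steps :: "nat \<Rightarrow> prerow2 \<Rightarrow> (row, row2) step list" where
  "Q_steps n \<delta> = red_steps n (norm_path n (prerow_src \<delta>) @ inv_steps (norm_path n (prerow_tgt \<delta>)))"

lemma Q_cell_eq: "Q_cell n \<delta> = (prerow_src \<delta>, Q_steps n \<delta>)"
  by (simp add: Q_cell_def Q_steps_def Let_def Red_def)

text \<open>Both boundary words of a pre-row cell have the same normal form, so the normalization of
  one and the inverse normalization of the other compose.\<close>

lemma Q_functor: "track_functor (prerow n) (base (row_red n)) (\<lambda>u. [u]) (Q_steps n)"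
proof -
  interpret track_cells "row_pres n" "row_cells n" by (rule track_cells_row)
  have "path (base (row_red n)) (prerow_src \<delta>) (Q_steps n \<delta>) (prerow_tgt \<delta>)" if "\<delta> \<in> gen2 (prerow n)" for \<delta>
  proof -
    have "path (row_pres n) (prerow_src \<delta>) (norm_path n (prerow_src \<delta>)) (nf (prerow_src \<delta>))"
      "path (row_pres n) (nf (prerow_src \<delta>)) (inv_steps (norm_path n (prerow_tgt \<delta>))) (prerow_tgt \<delta>)"
      using norm_path_path[of "prerow_src \<delta>" n] path_inv[OF poly norm_path_path[of "prerow_tgt \<delta>" n]]
        prerow_words[OF that] prerow_nf[OF that] by auto
    from path_comp[OF this] show ?thesis unfolding Q_steps_def by (rule red_steps_path)
  qed
  then show ?thesis using poly_red poly_prerow by (auto simp: track_functor_def) (simp add: row_red_def)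
qed

fun embed_step :: "(nat, styl2) step \<Rightarrow> (row, prerow2) step" where
  "embed_step (Step w c e w') = Step (letters w) (Letter c) e (letters w')"

lemma cell_letters [simp]:
  "cell_src (prerow n) (Letter c) e = letters (cell_src (styl n) c e)"
  "cell_tgt (prerow n) (Letter c) e = letters (cell_tgt (styl n) c e)"
  by (simp_all add: cell_src_def cell_tgt_def)

lemma letters_eq_append:
  "letters u = X @ letters y @ Z \<Longrightarrow> \<exists>x z. u = x @ y @ z \<and> X = letters x \<and> Z = letters z"
proof -
  assume u: "letters u = X @ letters y @ Z"
  obtain x u' where x: "u = x @ u'" "X = letters x" "letters y @ Z = letters u'"
    using u unfolding letters_def map_eq_append_conv by metis
  obtain y' z where y: "u' = y' @ z" "letters y = letters y'" "Z = letters z"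
    using x(3)[symmetric] unfolding letters_def map_eq_append_conv by metis
  then show ?thesis using x by auto
qed

lemma letters_lists: "letters w \<in> lists (rows n) \<longleftrightarrow> w \<in> lists {1..n}"
  by (induction w) (auto simp: rows_def)

lemma embed_path: "path (prerow n) (letters u) (map embed_step p) (letters v) \<longleftrightarrow> path (styl n) u p v"
proof (induction p arbitrary: u)
  case Nil
  then show ?case by (simp add: letters_lists)
next
  case (Cons s p)
  obtain l c e r where s: "s = Step l c e r" by (cases s)
  have "letters l @ letters (cell_src (styl n) c e) @ letters r = letters u \<longleftrightarrow> l @ cell_src (styl n) c e @ r = u"
    by (metis letters_inj letters_simps(3))
  moreover have "path (prerow n) (letters l @ letters (cell_tgt (styl n) c e) @ letters r) (map embed_step p) (letters v) \<longleftrightarrow>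
     path (styl n) (l @ cell_tgt (styl n) c e @ r) p v"
    using Cons.IH[of "l @ cell_tgt (styl n) c e @ r"] by simp
  ultimately show ?case using s by (simp add: letters_lists)
qed

text \<open>A letter cell applied to a word of one-letter rows gives such a word again, so these
  paths stay inside the letter presentation although contexts could contain longer rows.\<close>

lemma letter_path_prerow:
  assumes "path (prerow n) (letters u) p X" "\<forall>s\<in>set p. gen s \<in> range Letter"
  shows "\<exists>q v. p = map embed_step q \<and> X = letters v"
  using assms
proof (induction p arbitrary: u)
  case Nil
  then show ?case by (metis list.map(1) path.simps(1))
next
  case (Cons s p)
  obtain W c e W' where s: "s = Step W (Letter c) e W'" using Cons.prems(2) by (cases s) auto
  have "letters u = W @ letters (cell_src (styl n) c e) @ W'" using Cons.prems(1) s by simp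
  then obtain w w' where w: "W = letters w" "W' = letters w'" using letters_eq_append by metis
  have "path (prerow n) (letters (w @ cell_tgt (styl n) c e @ w')) p X" using Cons.prems(1) s w by simp
  from Cons.IH[OF this] Cons.prems(2) obtain q v where "p = map embed_step q" "X = letters v" by auto
  then have "s # p = map embed_step (Step w c e w' # q) \<and> X = letters v" using s w by simp
  then show ?case by (intro exI)
qed

lemma step_key_embed [simp]: "step_key (embed_step s) = letter_key s"
  by (cases s) (simp add: letters_def)

text \<open>The embedding of letters keeps lengths and keys and reaches every competing path, hence
  it carries the minimizer to the minimizer.\<close>

lemma Pi_path_eq:
  assumes "word_cong (styl n) U V"
  shows "Pi_path n (letters U) (letters V) = map embed_step (letter_path n U V)"
proof -
  let ?k = "\<lambda>p. (length p, map step_key p)"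
  let ?P = "\<lambda>p. path (prerow n) (letters U) p (letters V) \<and> (\<forall>s\<in>set p. gen s \<in> range Letter)"
  have P: "\<exists>q. p = map embed_step q \<and> path (styl n) U q V" if "?P p" for p
    using letter_path_prerow that embed_path by blast
  have key: "?k (map embed_step q) = (length q, map letter_key q)" for q by simp
  have g: "gen (embed_step s) \<in> range Letter" for s by (cases s) simp
  note m = letter_path_min[OF assms]
  have "?P (map embed_step (letter_path n U V))" using m(1) embed_path g by auto
  moreover have "\<forall>y. ?P y \<longrightarrow> ?k (map embed_step (letter_path n U V)) \<le> ?k y"
    using P m(2) key by metis
  moreover have "inj_on ?k {p. ?P p}"
  proof (rule inj_onI)
    fix p p' assume "p \<in> {p. ?P p}" "p' \<in> {p. ?P p}" and k: "?k p = ?k p'"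
    then have "?P p" "?P p'" by simp_all
    obtain q where q: "p = map embed_step q" "path (styl n) U q V" using P[OF \<open>?P p\<close>] by blast
    obtain q' where q': "p' = map embed_step q'" "path (styl n) U q' V" using P[OF \<open>?P p'\<close>] by blast
    have "map letter_key q = map letter_key q'" using k q(1) q'(1) by (simp add: comp_def)
    from letter_key_inj[OF q(2) q'(2) this] show "p = p'" using q q' by simp
  qed
  ultimately show ?thesis unfolding Pi_path_def using arg_min_inj_eq[of ?k ?P] by blast
qed

lemma E_path_path: "W \<in> lists (rows n) \<Longrightarrow> path (prerow n) W (E_path W) (flat W)"
proof (induction W)
  case (Cons u W)
  interpret track_cells "prerow n" "{}" by (rule track_cells_empty[OF poly_prerow])
  have u: "u \<in> rows n" and W: "W \<in> lists (rows n)" using Cons.prems by auto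
  have lu: "letters u \<in> lists (rows n)" using rowsD(5)[OF u] letters_rows by blast
  have 1: "path (prerow n) (u # W) (if length u = 1 then [] else [Step [] (Gamma u) False W]) (letters u @ W)"
  proof (cases "length u = 1")
    case True
    then have "letters u = [u]" by (cases u) auto
    then show ?thesis using True u W by simp
  next
    case False
    then have "u \<in> rows2 n" using u rowsD(1)[OF u] by (cases u) (auto simp: rows2_def Suc_le_eq)
    then show ?thesis using False lu W by (simp add: cell_src_def cell_tgt_def)
  qed
  have 2: "path (prerow n) (letters u @ W) (map (whisker (letters u) []) (E_path W)) (letters u @ flat W)"
    using path_whisker[OF Cons.IH[OF W], of "letters u" "[]"] lu by simp
  show ?case using path_comp[OF 1 2] by (simp add: flat_def)
qed (simp add: flat_def)

lemma row2_word_cong: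
  assumes "(u, v) \<in> gen2 (row_pres n)"
  shows "word_cong (styl n) (concat [u, v]) (concat (N2 u v))"
  using word_cong_N2[of u n v] assms by simp

lemma P_path_path:
  assumes "\<beta> \<in> gen2 (row_pres n)"
  shows "path (prerow n) (src2 (row_pres n) \<beta>) (P_path n \<beta>) (tgt2 (row_pres n) \<beta>)"
proof -
  interpret track_cells "prerow n" "{}" by (rule track_cells_empty[OF poly_prerow])
  obtain u v where \<beta>: "\<beta> = (u, v)" by (cases \<beta>)
  let ?s = "[u, v]" and ?t = "N2 u v"
  have w: "?s \<in> lists (rows n)" "?t \<in> lists (rows n)" using assms N2_rows \<beta> by auto
  have c: "word_cong (styl n) (concat ?s) (concat ?t)" using row2_word_cong assms \<beta> by blast
  have 1: "path (prerow n) ?s (E_path ?s) (flat ?s)" using E_path_path[OF w(1)] .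
  have 2: "path (prerow n) (flat ?s) (Pi_path n (flat ?s) (flat ?t)) (flat ?t)"
    unfolding flat_letters Pi_path_eq[OF c] embed_path by (rule letter_path_min(1)[OF c])
  have 3: "path (prerow n) (flat ?t) (inv_steps (E_path ?t)) ?t" by (rule path_inv[OF poly E_path_path[OF w(2)]])
  from path_comp[OF 1 path_comp[OF 2 3]] show ?thesis using \<beta> by (simp add: P_path_def Let_def)
qed

lemma E_functor: "track_functor (base (row_red n)) (prerow n) (\<lambda>u. [u]) (P_path n)"
  using poly_red poly_prerow P_path_path by (auto simp: track_functor_def row_red_def)

abbreviation (input) letter_pres :: "nat \<Rightarrow> (row, prerow2) polygraph2" where
  "letter_pres n \<equiv> base (styl_coh n)"

lemma letter_pres_gen1: "gen1 (letter_pres n) = (\<lambda>x. [x]) ` {1..n}"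
proof -
  have "u \<in> (\<lambda>x. [x]) ` {1..n}" if "u \<in> rows n" "u \<notin> rows2 n" for u
    using that by (cases u) (auto simp: rows_def rows2_def not_le)
  moreover have "[x] \<in> rows n - rows2 n" if "x \<in> {1..n}" for x
    using that by (auto simp: rows_def rows2_def)
  ultimately show ?thesis by (auto simp: styl_coh_def)
qed

lemma letter_pres_gen2: "gen2 (letter_pres n) = Letter ` gen2 (styl n)"
  by (auto simp: styl_coh_def prerow_def)

lemma letter_pres_boundary [simp]: "src2 (letter_pres n) = prerow_src" "tgt2 (letter_pres n) = prerow_tgt"
  by (simp_all add: styl_coh_def prerow_def)

lemma letters_letter_pres: "w \<in> lists {1..n} \<Longrightarrow> letters w \<in> lists (gen1 (letter_pres n))"
  by (induction w) (auto simp: letter_pres_gen1)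

lemma poly_letter_pres: "is_polygraph2 (letter_pres n)"
  unfolding is_polygraph2_def letter_pres_gen2 using styl_words letters_letter_pres by auto

lemma map_word_letters: "map_word letters W = letters (concat W)"
  by (induction W) auto

lemma contract_functor: "track_functor (prerow n) (letter_pres n) letters contract_cell"
proof -
  have "path (letter_pres n) (map_word letters (prerow_src \<delta>)) (contract_cell \<delta>) (map_word letters (prerow_tgt \<delta>))"
    if "\<delta> \<in> gen2 (prerow n)" for \<delta>
    using that
  proof (cases rule: prerow_gen2_cases)
    case (1 c)
    then show ?thesis using styl_words letters_letter_pres
      by (simp add: map_word_letters letter_pres_gen2 cell_src_def cell_tgt_def)
  next
    case (2 u)
    then show ?thesis using letters_letter_pres[OF rowsD(5)[OF rows2_rows]] by (simp add: map_word_letters)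
  qed
  then show ?thesis using poly_prerow poly_letter_pres letters_letter_pres rowsD(5)
    by (simp add: track_functor_def)
qed

text \<open>The image of a row cell in the letter presentation: transport to the pre-row
  presentation, then contraction.\<close>

abbreviation KE_cell :: "nat \<Rightarrow> row2 \<Rightarrow> (row, prerow2) step list" where
  "KE_cell n \<beta> \<equiv> map_steps letters contract_cell (P_path n \<beta>)"

lemma KE_functor: "track_functor (base (row_red n)) (letter_pres n) letters (KE_cell n)"
  using functor_comp[OF E_functor contract_functor] by simp

lemma contract_E_functor: "contract (E_functor n (u, p)) = (map_word letters u, map_steps letters (KE_cell n) p)"
  by (simp add: contract_def E_functor_def map_steps_map_steps)

lemma styl_coh_simps:
  "gen3 (styl_coh n) = RowCell ` gen3 (row_red n) \<union> TransportCell ` gen2 (prerow n)"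
  "src3 (styl_coh n) (RowCell \<tau>) = (letters (concat (triple_word \<tau>)), map_steps letters (KE_cell n) (red_steps n (L_path n \<tau>)))"
  "tgt3 (styl_coh n) (RowCell \<tau>) = (letters (concat (triple_word \<tau>)), map_steps letters (KE_cell n) (red_steps n (R_path n \<tau>)))"
  "src3 (styl_coh n) (TransportCell \<delta>) = (letters (concat (prerow_src \<delta>)), map_steps letters (KE_cell n) (Q_steps n \<delta>))"
  "tgt3 (styl_coh n) (TransportCell \<delta>) = (letters (concat (prerow_src \<delta>)), contract_cell \<delta>)"
proof -
  have s: "src3 (styl_coh n) A = contract (coh_src n A)" "tgt3 (styl_coh n) A = contract (coh_tgt n A)" for A
    by (simp_all add: styl_coh_def prerow_coh_def)
  show "gen3 (styl_coh n) = RowCell ` gen3 (row_red n) \<union> TransportCell ` gen2 (prerow n)"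
    by (simp add: styl_coh_def prerow_coh_def)
  show "src3 (styl_coh n) (RowCell \<tau>) = (letters (concat (triple_word \<tau>)), map_steps letters (KE_cell n) (red_steps n (L_path n \<tau>)))"
    "tgt3 (styl_coh n) (RowCell \<tau>) = (letters (concat (triple_word \<tau>)), map_steps letters (KE_cell n) (red_steps n (R_path n \<tau>)))"
    "src3 (styl_coh n) (TransportCell \<delta>) = (letters (concat (prerow_src \<delta>)), map_steps letters (KE_cell n) (Q_steps n \<delta>))"
    unfolding s coh_src.simps coh_tgt.simps row_red_simps Q_cell_eq contract_E_functor map_word_letters
    by (rule HOL.refl)+
  have "map (whisker [] []) p = p" for p :: "(row, prerow2) step list" by simp
  then show "tgt3 (styl_coh n) (TransportCell \<delta>) = (letters (concat (prerow_src \<delta>)), contract_cell \<delta>)"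
    unfolding s coh_tgt.simps contract_def map_zigzag.simps map_word_letters by simp
qed

lemma contract_words:
  assumes "\<delta> \<in> gen2 (prerow n)"
  shows "path (letter_pres n) (letters (concat (prerow_src \<delta>))) (contract_cell \<delta>) (letters (concat (prerow_tgt \<delta>)))"
  using contract_functor[of n] assms by (simp add: track_functor_def map_word_letters)

lemma track_cells_gen3:
  assumes "is_polygraph2 (base Q)"
    and "\<And>A. A \<in> gen3 Q \<Longrightarrow> \<exists>u p q v. src3 Q A = (u, p) \<and> tgt3 Q A = (u, q) \<and> path (base Q) u p v \<and> path (base Q) u q v"
  shows "polygraph31 Q"
proof
  show "is_polygraph31 Q"
    unfolding is_polygraph31_def
  proof (intro conjI ballI assms(1))
    fix A assume "A \<in> gen3 Q"
    then obtain u p q v where A: "src3 Q A = (u, p)" "tgt3 Q A = (u, q)" "path (base Q) u p v" "path (base Q) u q v"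
      using assms(2) by blast
    show "is_zigzag (base Q) (src3 Q A)" "is_zigzag (base Q) (tgt3 Q A)" "parallel (base Q) (src3 Q A) (tgt3 Q A)"
      using path_zigzag[OF A(3)] path_zigzag[OF A(4)] parallelI[OF A(3,4)] by (simp_all only: A)
  qed
qed

lemma KE_path: "path (base (row_red n)) u p v \<Longrightarrow>
    path (letter_pres n) (letters (concat u)) (map_steps letters (KE_cell n) p) (letters (concat v))"
  using functor_path[OF KE_functor] by (fastforce simp: map_word_letters)

lemma styl_coh_paths:
  assumes "A \<in> gen3 (styl_coh n)"
  shows "\<exists>u p q v. src3 (styl_coh n) A = (u, p) \<and> tgt3 (styl_coh n) A = (u, q) \<and>
    path (letter_pres n) u p v \<and> path (letter_pres n) u q v"
proof (cases A)
  case (RowCell \<tau>)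
  then have "\<tau> \<in> triples_T1 n" using assms by (auto simp: styl_coh_simps row_red_simps)
  then obtain v where v: "path (row_pres n) (triple_word \<tau>) (L_path n \<tau>) v" "path (row_pres n) (triple_word \<tau>) (R_path n \<tau>) v"
    by (rule triple_T1_paths)
  show ?thesis unfolding RowCell styl_coh_simps
    using KE_path[OF red_steps_path[OF v(1)]] KE_path[OF red_steps_path[OF v(2)]] by blast
next
  case (TransportCell \<delta>)
  then have \<delta>: "\<delta> \<in> gen2 (prerow n)" using assms by (auto simp: styl_coh_simps)
  have "path (base (row_red n)) (prerow_src \<delta>) (Q_steps n \<delta>) (prerow_tgt \<delta>)"
    using Q_functor[of n] \<delta> by (simp add: track_functor_def)
  then show ?thesis unfolding TransportCell styl_coh_simps
    using KE_path contract_words[OF \<delta>] by blast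
qed

lemma polygraph31_styl_coh: "polygraph31 (styl_coh n)"
  by (rule track_cells_gen3[OF poly_letter_pres styl_coh_paths])

lemma styl_coh_parallel:
  assumes p: "path (letter_pres n) u p v" and q: "path (letter_pres n) u q v"
  shows "hty (letter_pres n) (boundaries (styl_coh n)) u p q"
proof -
  interpret S: polygraph31 "styl_coh n" by (rule polygraph31_styl_coh)
  let ?H = "hty (letter_pres n) (boundaries (styl_coh n))"
  let ?G = "map_steps (\<lambda>u. [u]) (Q_steps n)" and ?K = "map_steps letters (KE_cell n)"
  let ?F = "\<lambda>\<delta>. ?K (Q_steps n \<delta>)"
  \<comment> \<open>Letter cells are among the pre-row cells, so \<delta> \<mapsto>
    \<open>Q_steps n\<close> \<delta> restricts to the letter presentation.\<close>
  have incl: "track_functor (letter_pres n) (base (row_red n)) (\<lambda>u. [u]) (Q_steps n)"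
  proof -
    have "gen1 (letter_pres n) \<subseteq> rows n" by (auto simp: letter_pres_gen1 rows_def)
    moreover have "gen2 (letter_pres n) \<subseteq> gen2 (prerow n)" by (auto simp: letter_pres_gen2)
    ultimately show ?thesis using Q_functor[of n] poly_letter_pres[of n] unfolding track_functor_def by auto
  qed
  have KG: "track_functor (letter_pres n) (letter_pres n) (\<lambda>u. map_word letters [u]) ?F"
    using functor_comp[OF incl KE_functor] .
  have cell: "((letters (concat a), p), (letters (concat a), q)) \<in> boundaries (styl_coh n)"
    if "A \<in> gen3 (styl_coh n)" "src3 (styl_coh n) A = (letters (concat a), p)" "tgt3 (styl_coh n) A = (letters (concat a), q)" for A a p q
    unfolding boundaries_def using that by (intro image_eqI[of _ _ A]) auto
  have hcell: "?H a p q" if X: "((a, p), (a, q)) \<in> boundaries (styl_coh n)" for a p q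
  proof -
    obtain v where v: "path (letter_pres n) a p v" using S.Q.cells[OF X] by blast
    from hty.cell[OF X, of "letter_pres n" a "[]" "[]" "[]" "[]" v] v path_words[OF poly_letter_pres v]
    show ?thesis by simp
  qed
  \<comment> \<open>The transport cell of each letter cell joins its image under the round trip to
    the cell itself.\<close>
  have id: "?H u (map_steps (\<lambda>u. map_word letters [u]) ?F r) r" if "path (letter_pres n) u r v" for r
  proof (rule hty_functor_id[OF S.Q.track_cells_axioms KG _ _ that])
    show "a \<in> gen1 (letter_pres n) \<Longrightarrow> map_word letters [a] = [a]" for a by (auto simp: letter_pres_gen1)
    fix \<delta> assume "\<delta> \<in> gen2 (letter_pres n)"
    then obtain c where c: "\<delta> = Letter c" "c \<in> gen2 (styl n)" by (auto simp: letter_pres_gen2)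
    then have "TransportCell \<delta> \<in> gen3 (styl_coh n)" by (simp add: styl_coh_simps)
    from cell[OF this styl_coh_simps(4,5)]
    have "((prerow_src \<delta>, ?F \<delta>), (prerow_src \<delta>, [Step [] \<delta> True []])) \<in> boundaries (styl_coh n)"
      using c by simp
    then show "?H (src2 (letter_pres n) \<delta>) (?F \<delta>) [Step [] \<delta> True []]" by (simp add: hcell)
  qed
  have G: "path (base (row_red n)) u (?G r) v" if "path (letter_pres n) u r v" for r
    using functor_path[OF incl that] by simp
  have GG: "hty (base (row_red n)) (boundaries (row_red n)) u (?G p) (?G q)"
    using row_red_parallel[OF G[OF p] G[OF q]] .
  \<comment> \<open>Coherence of the reduced presentation is pushed forward; the required images of
    its 3-cells are the boundaries of the \<open>RowCell\<close> generators.\<close>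
  have "?H (map_word letters u) (?K (?G p)) (?K (?G q))"
  proof (rule functor_hty[OF KE_functor S.Q.track_cells_axioms _ GG])
    fix a p b q assume "((a, p), (b, q)) \<in> boundaries (row_red n)"
    then obtain \<tau> where \<tau>: "\<tau> \<in> gen3 (row_red n)" "a = triple_word \<tau>" "p = red_steps n (L_path n \<tau>)" "q = red_steps n (R_path n \<tau>)"
      by (auto simp: boundaries_def row_red_simps)
    then have "RowCell \<tau> \<in> gen3 (styl_coh n)" by (simp add: styl_coh_simps)
    from cell[OF this styl_coh_simps(2,3)]
    show "?H (map_word letters a) (?K p) (?K q)" unfolding \<tau>(2-4) map_word_letters by (rule hcell)
  qed
  moreover have "map_word letters u = u"
  proof -
    have "u \<in> lists (gen1 (letter_pres n))" using path_words[OF poly_letter_pres p] by blast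
    then show ?thesis by (induction u) (auto simp: letter_pres_gen1)
  qed
  ultimately have "?H u (?K (?G p)) (?K (?G q))" by simp
  then show ?thesis using id[OF p] id[OF q] unfolding map_steps_map_steps by (meson hty.sym hty.trans)
qed

lemma homotopy_basis_styl_coh: "homotopy_basis (styl_coh n)"
proof -
  interpret S: polygraph31 "styl_coh n" by (rule polygraph31_styl_coh)
  show ?thesis by (rule S.homotopy_basisI[OF styl_coh_parallel])
qed

subsection \<open>Identification with letters\<close>

lemma identify_functor:
  "track_functor (letter_pres n) (styl n) (\<lambda>u. [hd u]) (\<lambda>\<beta>. [Step [] (the_letter \<beta>) True []])"
proof -
  have l: "map_word (\<lambda>u. [hd u]) (letters w) = w" for w by (induction w) auto
  show ?thesis using poly_letter_pres poly_styl styl_words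
    by (auto simp: track_functor_def letter_pres_gen1 letter_pres_gen2 l cell_src_def cell_tgt_def)
qed

lemma embed_functor:
  "track_functor (styl n) (letter_pres n) (\<lambda>x. [[x]]) (\<lambda>c. [Step [] (Letter c) True []])"
proof -
  have l: "map_word (\<lambda>x. [[x]]) w = letters w" for w by (induction w) auto
  show ?thesis using poly_letter_pres poly_styl styl_words letters_letter_pres
    by (auto simp: track_functor_def letter_pres_gen1 letter_pres_gen2 l cell_src_def cell_tgt_def)
qed

lemma identify_embed:
  "map_steps (\<lambda>u. [hd u]) (\<lambda>\<beta>. [Step [] (the_letter \<beta>) True []])
     (map_steps (\<lambda>x. [[x]]) (\<lambda>c. [Step [] (Letter c) True []]) p) = p"
  "map_word (\<lambda>u. [hd u]) (map_word (\<lambda>x. [[x]]) w) = w"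
  using map_steps_id[of p] unfolding map_steps_map_steps map_word_map_word by simp_all

lemma styl_coh_letters_simps:
  "base (styl_coh_letters n) = styl n" "gen3 (styl_coh_letters n) = gen3 (styl_coh n)"
  "src3 (styl_coh_letters n) A = identify (src3 (styl_coh n) A)"
  "tgt3 (styl_coh_letters n) A = identify (tgt3 (styl_coh n) A)"
  by (simp_all add: styl_coh_letters_def)

lemma polygraph31_letters: "polygraph31 (styl_coh_letters n)"
proof (rule track_cells_gen3)
  show "is_polygraph2 (base (styl_coh_letters n))" using poly_styl by (simp add: styl_coh_letters_simps)
  fix A assume "A \<in> gen3 (styl_coh_letters n)"
  then have "A \<in> gen3 (styl_coh n)" by (simp add: styl_coh_letters_simps)
  from styl_coh_paths[OF this]
  obtain u p q v where A: "src3 (styl_coh n) A = (u, p)" "tgt3 (styl_coh n) A = (u, q)"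
    "path (letter_pres n) u p v" "path (letter_pres n) u q v" by blast
  show "\<exists>u p q v. src3 (styl_coh_letters n) A = (u, p) \<and> tgt3 (styl_coh_letters n) A = (u, q) \<and>
     path (base (styl_coh_letters n)) u p v \<and> path (base (styl_coh_letters n)) u q v"
    unfolding styl_coh_letters_simps A identify_def map_zigzag.simps
    using functor_path[OF identify_functor A(3)] functor_path[OF identify_functor A(4)] by blast
qed

text \<open>Identification undoes the embedding of letters, so a homotopy between embedded paths
  returns to one between the given paths.\<close>

lemma homotopy_basis_letters: "homotopy_basis (styl_coh_letters n)"
proof -
  interpret L: polygraph31 "styl_coh_letters n" by (rule polygraph31_letters)
  show ?thesis
  proof (rule L.homotopy_basisI)
    let ?J = "map_steps (\<lambda>x. [[x]]) (\<lambda>c. [Step [] (Letter c) True []])"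
    let ?I = "map_steps (\<lambda>u. [hd u]) (\<lambda>\<beta>. [Step [] (the_letter \<beta>) True []])"
    fix u p q v
    assume "path (base (styl_coh_letters n)) u p v" "path (base (styl_coh_letters n)) u q v"
    then have pq: "path (styl n) u p v" "path (styl n) u q v" by (simp_all add: styl_coh_letters_simps)
    have "hty (letter_pres n) (boundaries (styl_coh n)) (map_word (\<lambda>x. [[x]]) u) (?J p) (?J q)"
      using styl_coh_parallel functor_path[OF embed_functor] pq by blast
    then have "hty (styl n) (boundaries (styl_coh_letters n)) (map_word (\<lambda>u. [hd u]) (map_word (\<lambda>x. [[x]]) u)) (?I (?J p)) (?I (?J q))"
    proof (rule functor_hty[OF identify_functor L.Q.track_cells_axioms[unfolded styl_coh_letters_simps], rotated])
      fix a p b q assume "((a, p), (b, q)) \<in> boundaries (styl_coh n)"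
      then obtain A where A: "A \<in> gen3 (styl_coh n)" "src3 (styl_coh n) A = (a, p)" "tgt3 (styl_coh n) A = (b, q)"
        by (auto simp: boundaries_def)
      obtain v where ab: "a = b" and v: "path (letter_pres n) a p v" using styl_coh_paths[OF A(1)] A by auto
      have "((map_word (\<lambda>u. [hd u]) a, ?I p), (map_word (\<lambda>u. [hd u]) b, ?I q)) \<in> boundaries (styl_coh_letters n)"
        unfolding boundaries_def using A
        by (intro image_eqI[of _ _ A]) (simp_all add: styl_coh_letters_simps identify_def)
      from hty.cell[OF this, of "styl n" "map_word (\<lambda>u. [hd u]) a" "[]" "[]" "[]" "[]"]
        functor_path[OF identify_functor v] path_words[OF poly_styl functor_path[OF identify_functor v]]
      show "hty (styl n) (boundaries (styl_coh_letters n)) (map_word (\<lambda>u. [hd u]) a) (?I p) (?I q)" by simp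
    qed
    then show "hty (base (styl_coh_letters n)) (boundaries (styl_coh_letters n)) u p q"
      by (simp add: identify_embed styl_coh_letters_simps)
  qed
qed

lemma finite_gen3: "finite (gen3 (styl_coh n))"
proof -
  have "finite (rows2 n)" by (rule finite_subset[OF _ finite_rows[of n]]) (auto simp: rows2_def)
  then show ?thesis using finite_triples_T1 finite_styl by (simp add: styl_coh_simps row_red_simps prerow_def)
qed

lemma polygraph2_iso_letters: "polygraph2_iso (\<lambda>x. [x]) Letter (styl n) (letter_pres n)"
  by (auto simp: polygraph2_iso_def letter_pres_gen1 letter_pres_gen2 bij_betw_def inj_on_def letters_def)

subsection \<open>The presented monoid\<close>

lemma word_cong_words: "is_polygraph2 P \<Longrightarrow> word_cong P u v \<Longrightarrow> u \<in> lists (gen1 P) \<and> v \<in> lists (gen1 P)"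
proof -
  assume P: "is_polygraph2 P" and "word_cong P u v"
  from this(2) show ?thesis
    by (induction rule: word_cong.induct) (use P in \<open>auto simp: is_polygraph2_def simp del: in_lists_conv_set\<close>)
qed

lemma word_cong_map:
  assumes "word_cong P u v" "\<And>a. a \<in> gen1 P \<Longrightarrow> f a \<in> gen1 Q"
    "\<And>\<beta>. \<beta> \<in> gen2 P \<Longrightarrow> word_cong Q (map f (src2 P \<beta>)) (map f (tgt2 P \<beta>))"
  shows "word_cong Q (map f u) (map f v)"
  using assms(1)
proof (induction rule: word_cong.induct)
  case (refl u)
  then have "map f u \<in> lists (gen1 Q)" using assms(2) by (induction u) auto
  then show ?case by (rule word_cong.refl)
next
  case (append u u' v v')
  then show ?case by (simp add: word_cong.append)
qed (use assms(3) in \<open>auto intro: word_cong.sym word_cong.trans\<close>)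

lemma presented_monoid_iso:
  assumes iso: "polygraph2_iso f g P Q" and P: "is_polygraph2 P" and Q: "is_polygraph2 Q"
  shows "presented_monoid Q \<cong> presented_monoid P"
proof -
  define k where "k = inv_into (gen1 P) f"
  have f: "bij_betw f (gen1 P) (gen1 Q)" and g: "bij_betw g (gen2 P) (gen2 Q)"
    and b: "\<And>\<beta>. \<beta> \<in> gen2 P \<Longrightarrow> src2 Q (g \<beta>) = map f (src2 P \<beta>) \<and> tgt2 Q (g \<beta>) = map f (tgt2 P \<beta>)"
    using iso by (auto simp: polygraph2_iso_def)
  have kf: "k (f a) = a" if "a \<in> gen1 P" for a using that f by (simp add: k_def bij_betw_def)
  have fk: "f (k a) = a" if "a \<in> gen1 Q" for a
    using that f by (simp add: k_def f_inv_into_f bij_betw_def)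
  have kP: "k a \<in> gen1 P" if "a \<in> gen1 Q" for a
    using that f inv_into_into[of a f "gen1 P"] by (simp add: k_def bij_betw_def)
  have fQ: "f a \<in> gen1 Q" if "a \<in> gen1 P" for a using that f by (auto simp: bij_betw_def)
  have mkf: "map k (map f w) = w" if "w \<in> lists (gen1 P)" for w
    using that by (induction w) (auto simp: kf)
  have mfk: "map f (map k w) = w" if "w \<in> lists (gen1 Q)" for w
    using that by (induction w) (auto simp: fk)
  have mk: "map k w \<in> lists (gen1 P)" if "w \<in> lists (gen1 Q)" for w
    using that by (induction w) (auto simp: kP)
  have mf: "map f w \<in> lists (gen1 Q)" if "w \<in> lists (gen1 P)" for w
    using that by (induction w) (auto simp: fQ)
  have cf: "word_cong Q (map f u) (map f v)" if "word_cong P u v" for u v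
    using that by (rule word_cong_map) (use fQ b g word_cong.cell[of _ Q] in \<open>auto simp: bij_betw_def\<close>, metis b imageI)
  have ck: "word_cong P (map k u) (map k v)" if "word_cong Q u v" for u v
  proof (rule word_cong_map[OF that kP])
    fix \<beta>' assume "\<beta>' \<in> gen2 Q"
    then obtain \<beta> where \<beta>: "\<beta> \<in> gen2 P" "\<beta>' = g \<beta>" using g by (auto simp: bij_betw_def)
    have w: "src2 P \<beta> \<in> lists (gen1 P)" "tgt2 P \<beta> \<in> lists (gen1 P)" using P \<beta>(1) by (simp_all add: is_polygraph2_def)
    show "word_cong P (map k (src2 Q \<beta>')) (map k (tgt2 Q \<beta>'))"
      using word_cong.cell[OF \<beta>(1)] b[OF \<beta>(1)] mkf[OF w(1)] mkf[OF w(2)] \<beta>(2) by simp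
  qed
  let ?R = "{(u, v). word_cong P u v}" and ?S = "{(u, v). word_cong Q u v}"
  \<comment> \<open>Pulling a class back along \<open>map f\<close> avoids choosing representatives;
    the class of \<open>w\<close> goes to the class of \<open>map k w\<close>.\<close>
  define h where "h B = {w \<in> lists (gen1 P). map f w \<in> B}" for B
  have h: "h (?S `` {w}) = ?R `` {map k w}" if w: "w \<in> lists (gen1 Q)" for w
  proof -
    have "word_cong Q w (map f x) \<longleftrightarrow> word_cong P (map k w) x" if "x \<in> lists (gen1 P)" for x
      using cf[of "map k w" x] ck[of w "map f x"] mfk[OF w] mkf[OF that] by auto
    then show ?thesis using word_cong_words[OF P] by (auto simp: h_def simp del: in_lists_conv_set)
  qed
  have mult: "(\<Union>u\<in>T `` {a}. \<Union>v\<in>T `` {b}. T `` {u @ v}) = T `` {a @ b}"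
    if "T = {(u, v). word_cong X u v}" "a \<in> lists (gen1 X)" "b \<in> lists (gen1 X)" for X :: "('x, 'y) polygraph2" and T a b
    unfolding that(1) using word_cong.refl[OF that(2)] word_cong.refl[OF that(3)]
    by (auto intro: word_cong.append word_cong.trans)
  have pm_mult: "A \<otimes>\<^bsub>presented_monoid X\<^esub> B = (\<Union>u\<in>A. \<Union>v\<in>B. {(u, v). word_cong X u v} `` {u @ v})"
    for X :: "('x, 'y) polygraph2" and A B by (simp add: presented_monoid_def Let_def)
  have car: "carrier (presented_monoid Q) = (\<lambda>w. ?S `` {w}) ` lists (gen1 Q)"
    "carrier (presented_monoid P) = (\<lambda>w. ?R `` {w}) ` lists (gen1 P)"
    by (auto simp: presented_monoid_def Let_def quotient_def)
  have "h \<in> iso (presented_monoid Q) (presented_monoid P)"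
  proof (rule isoI)
    show "h \<in> hom (presented_monoid Q) (presented_monoid P)"
    proof (rule homI)
      fix A assume "A \<in> carrier (presented_monoid Q)"
      then obtain a where a: "a \<in> lists (gen1 Q)" "A = ?S `` {a}" using car by auto
      show "h A \<in> carrier (presented_monoid P)" unfolding a(2) h[OF a(1)] car using mk[OF a(1)] by blast
      fix B assume "B \<in> carrier (presented_monoid Q)"
      then obtain b where b: "b \<in> lists (gen1 Q)" "B = ?S `` {b}" using car by auto
      have ab: "a @ b \<in> lists (gen1 Q)" using a b by simp
      show "h (A \<otimes>\<^bsub>presented_monoid Q\<^esub> B) = h A \<otimes>\<^bsub>presented_monoid P\<^esub> h B"
        unfolding pm_mult a(2) b(2) h[OF a(1)] h[OF b(1)] mult[OF HOL.refl a(1) b(1)]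
          mult[OF HOL.refl mk[OF a(1)] mk[OF b(1)]] h[OF ab] by simp
    qed
    show "bij_betw h (carrier (presented_monoid Q)) (carrier (presented_monoid P))"
    proof (rule bij_betw_imageI)
      show "inj_on h (carrier (presented_monoid Q))"
      proof (rule inj_onI)
        fix A B assume "A \<in> carrier (presented_monoid Q)" "B \<in> carrier (presented_monoid Q)" and e: "h A = h B"
        then obtain a b where a: "a \<in> lists (gen1 Q)" "A = ?S `` {a}" and b: "b \<in> lists (gen1 Q)" "B = ?S `` {b}"
          using car by auto
        have "word_cong P (map k a) (map k b)"
          using e word_cong.refl[OF mk[OF b(1)]] unfolding a(2) b(2) h[OF a(1)] h[OF b(1)] by auto
        from cf[OF this] have "word_cong Q a b" using mfk a(1) b(1) by simp
        then show "A = B" unfolding a(2) b(2) by (auto intro: word_cong.trans word_cong.sym)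
      qed
      have "h ` carrier (presented_monoid Q) = (\<lambda>w. ?R `` {map k w}) ` lists (gen1 Q)"
        unfolding car image_image by (intro image_cong HOL.refl h)
      also have "\<dots> = (\<lambda>w. ?R `` {w}) ` (map k ` lists (gen1 Q))" by (simp add: image_image)
      also have "map k ` lists (gen1 Q) = lists (gen1 P)"
        using mk mkf mf by (metis (no_types, lifting) image_eqI image_subset_iff subset_antisym subsetI)
      finally show "h ` carrier (presented_monoid Q) = carrier (presented_monoid P)" using car by simp
    qed
  qed
  then show ?thesis by (auto simp: is_iso_def)
qed

theorem styl_coh_coherent:
  "finite_polygraph31 (styl_coh n) \<and> coherent_presentation (styl_coh n) (Styl n) \<and>
   polygraph2_iso (\<lambda>x. [x]) Letter (styl n) (base (styl_coh n)) \<and>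
   is_polygraph31 (styl_coh_letters n) \<and>
   finite (gen3 (styl_coh_letters n)) \<and> homotopy_basis (styl_coh_letters n)"
proof -
  have "finite_polygraph31 (styl_coh n)"
    using finite_gen3 finite_styl by (simp add: finite_polygraph31_def letter_pres_gen1 letter_pres_gen2)
  moreover have "presents (letter_pres n) (Styl n)"
    unfolding presents_def Styl_def by (rule presented_monoid_iso[OF polygraph2_iso_letters poly_styl poly_letter_pres])
  then have "coherent_presentation (styl_coh n) (Styl n)"
    using polygraph31.Q[OF polygraph31_styl_coh] homotopy_basis_styl_coh by (simp add: coherent_presentation_def)
  ultimately show ?thesis
    using polygraph2_iso_letters polygraph31.Q[OF polygraph31_letters] homotopy_basis_letters finite_gen3
    by (simp add: styl_coh_letters_simps)
qed

section \<open>Computable functions on encodable types\<close>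

text \<open>\<open>dec\<close> is defined on all numbers, and several codes may denote one value.
  Recursiveness of \<open>enc\<close> after \<open>dec\<close>, the passage to the canonical code,
  is what makes the identity computable and lets products and lists inherit the class.\<close>

class encodable =
  fixes enc :: "'a \<Rightarrow> nat" and dec :: "nat \<Rightarrow> 'a"
  assumes dec_enc [simp]: "dec (enc x) = x"
    and total_recursive_enc_dec: "total_recursive (\<lambda>c. enc (dec c))"

definition computable :: "('a::encodable \<Rightarrow> 'b::encodable) \<Rightarrow> bool" where
  "computable f \<longleftrightarrow> total_recursive (\<lambda>c. enc (f (dec c)))"

named_theorems computable_rules

lemma total_recursive_id: "total_recursive (\<lambda>x. x)"
  using total_recursive.pair[OF total_recursive.left total_recursive.right] by simp

lemma total_recursive_const: "total_recursive (\<lambda>x. k)"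
proof (induction k)
  case 0
  show ?case by (rule total_recursive.zero)
next
  case (Suc k)
  show ?case using total_recursive.comp[OF total_recursive.suc Suc] .
qed

lemma computable_const [computable_rules]: "computable (\<lambda>x. k)"
  unfolding computable_def by (rule total_recursive_const)

lemma computable_id [computable_rules]: "computable (\<lambda>x. x)"
  unfolding computable_def by (rule total_recursive_enc_dec)

lemma computable_comp: "computable f \<Longrightarrow> computable g \<Longrightarrow> computable (\<lambda>x. f (g x))"
  unfolding computable_def using total_recursive.comp[of "\<lambda>c. enc (f (dec c))" "\<lambda>c. enc (g (dec c))"] by simp

instantiation nat :: encodable
begin
definition enc_nat :: "nat \<Rightarrow> nat" where [simp]: "enc_nat x = x"
definition dec_nat :: "nat \<Rightarrow> nat" where [simp]: "dec_nat x = x"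
instance by standard (simp_all add: total_recursive_id)
end

instantiation prod :: (encodable, encodable) encodable
begin
definition enc_prod :: "'a \<times> 'b \<Rightarrow> nat" where "enc_prod p = prod_encode (enc (fst p), enc (snd p))"
definition dec_prod :: "nat \<Rightarrow> 'a \<times> 'b" where "dec_prod c = (dec (fst (prod_decode c)), dec (snd (prod_decode c)))"
instance
proof
  show "dec (enc x) = x" for x :: "'a \<times> 'b" by (simp add: enc_prod_def dec_prod_def)
  have "total_recursive (\<lambda>c. prod_encode (enc (dec (fst (prod_decode c)) :: 'a), enc (dec (snd (prod_decode c)) :: 'b)))"
    by (intro total_recursive.pair total_recursive.comp[OF total_recursive_enc_dec] total_recursive.left total_recursive.right)
  then show "total_recursive (\<lambda>c. enc (dec c :: 'a \<times> 'b))" by (simp add: enc_prod_def dec_prod_def)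
qed
end

lemma computable_Pair [computable_rules]: "computable f \<Longrightarrow> computable g \<Longrightarrow> computable (\<lambda>x. (f x, g x))"
  unfolding computable_def by (simp add: enc_prod_def total_recursive.pair)

lemma computable_fst [computable_rules]:
  fixes f :: "'a::encodable \<Rightarrow> 'b::encodable \<times> 'c::encodable"
  assumes "computable f"
  shows "computable (\<lambda>x. fst (f x))"
proof -
  have "computable (fst :: 'b \<times> 'c \<Rightarrow> 'b)"
    using total_recursive.comp[OF total_recursive_enc_dec[where 'a = 'b] total_recursive.left]
    by (simp add: computable_def dec_prod_def)
  from computable_comp[OF this assms] show ?thesis .
qed

lemma computable_snd [computable_rules]:
  fixes f :: "'a::encodable \<Rightarrow> 'b::encodable \<times> 'c::encodable"
  assumes "computable f"
  shows "computable (\<lambda>x. snd (f x))"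
proof -
  have "computable (snd :: 'b \<times> 'c \<Rightarrow> 'c)"
    using total_recursive.comp[OF total_recursive_enc_dec[where 'a = 'c] total_recursive.right]
    by (simp add: computable_def dec_prod_def)
  from computable_comp[OF this assms] show ?thesis .
qed

lemma computable_Let [computable_rules]:
  "computable (\<lambda>x. F x (g x)) \<Longrightarrow> computable (\<lambda>x. Let (g x) (F x))"
  by simp

lemma computable_enc [computable_rules]: "computable f \<Longrightarrow> computable (\<lambda>x. enc (f x))"
  unfolding computable_def by simp

lemma computable_dec [computable_rules]: "computable f \<Longrightarrow> computable (\<lambda>x. dec (f x))"
  using computable_comp[of dec f] total_recursive_enc_dec by (simp add: computable_def)

lemma computable_Suc [computable_rules]: "computable f \<Longrightarrow> computable (\<lambda>x. Suc (f x))"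
  using computable_comp[of Suc f] total_recursive.suc by (simp add: computable_def)

lemma computable_prod_encode [computable_rules]: "computable f \<Longrightarrow> computable (\<lambda>x. prod_encode (f x))"
  using computable_comp[of prod_encode f] total_recursive_id by (simp add: computable_def dec_prod_def)

lemma computable_prod_decode [computable_rules]: "computable f \<Longrightarrow> computable (\<lambda>x. prod_decode (f x))"
  using computable_comp[of prod_decode f] total_recursive_id by (simp add: computable_def enc_prod_def)

lemma computable_rec_nat [computable_rules]:
  assumes z: "computable z" and g: "computable (\<lambda>p. g (fst p) (fst (snd p)) (snd (snd p)))" and m: "computable m"
  shows "computable (\<lambda>x. rec_nat (z x) (g x) (m x))"
proof -
  let ?f = "\<lambda>a. enc (z (dec a))" and ?g = "\<lambda>q. enc ((\<lambda>p. g (fst p) (fst (snd p)) (snd (snd p))) (dec q))"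
  let ?r = "\<lambda>x. case prod_decode x of (a, m) \<Rightarrow> rec_nat (?f a) (\<lambda>k r. ?g (prod_encode (a, prod_encode (k, r)))) m"
  have "total_recursive ?r"
    using z g unfolding computable_def by (rule total_recursive.prec)
  moreover have "total_recursive (\<lambda>c. prod_encode (c, enc (m (dec c))))"
    using total_recursive.pair[OF total_recursive_id m[unfolded computable_def]] .
  ultimately have 1: "total_recursive (\<lambda>c. ?r (prod_encode (c, enc (m (dec c)))))"
    by (rule total_recursive.comp)
  have "rec_nat (?f a) (\<lambda>k r. ?g (prod_encode (a, prod_encode (k, r)))) i = enc (rec_nat (z (dec a)) (g (dec a)) i)" for a i
    by (induction i) (simp_all add: dec_prod_def)
  then show ?thesis using 1 by (simp add: computable_def)
qed

instantiation bool :: encodable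
begin
definition enc_bool :: "bool \<Rightarrow> nat" where "enc_bool b = of_bool b"
definition dec_bool :: "nat \<Rightarrow> bool" where "dec_bool c \<longleftrightarrow> c \<noteq> 0"
instance
proof
  show "dec (enc x) = x" for x :: bool by (simp add: enc_bool_def dec_bool_def)
  have "computable (\<lambda>c :: nat. rec_nat (0 :: nat) (\<lambda>k r. 1) c)" by (intro computable_rules)
  moreover have "rec_nat 0 (\<lambda>k r. 1) c = (of_bool (c \<noteq> 0) :: nat)" for c by (cases c) auto
  ultimately show "total_recursive (\<lambda>c. enc (dec c :: bool))"
    by (simp add: enc_bool_def dec_bool_def computable_def)
qed
end

lemma computable_of_bool [computable_rules]: "computable b \<Longrightarrow> computable (\<lambda>x. of_bool (b x) :: nat)"
  using computable_enc[of b] by (simp add: enc_bool_def)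

lemma computable_If [computable_rules]:
  "computable b \<Longrightarrow> computable f \<Longrightarrow> computable g \<Longrightarrow> computable (\<lambda>x. if b x then f x else g x)"
proof -
  assume b: "computable b" and f: "computable f" and g: "computable g"
  then have "computable (\<lambda>x. rec_nat (g x) (\<lambda>k r. f x) (of_bool (b x)))"
    by (intro computable_rules computable_comp[OF f, of fst] b g)
  moreover have "rec_nat (g x) (\<lambda>k r. f x) (of_bool (b x)) = (if b x then f x else g x)" for x by simp
  ultimately show ?thesis by simp
qed

lemma computable_not [computable_rules]: "computable b \<Longrightarrow> computable (\<lambda>x. \<not> b x)"
proof -
  have "(\<lambda>x. \<not> b x) = (\<lambda>x. if b x then False else True)" by auto
  then show "computable b \<Longrightarrow> ?thesis"
    by (simp only:) (intro computable_rules)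
qed

lemma computable_conj [computable_rules]: "computable a \<Longrightarrow> computable b \<Longrightarrow> computable (\<lambda>x. a x \<and> b x)"
proof -
  have "(\<lambda>x. a x \<and> b x) = (\<lambda>x. if a x then b x else False)" by auto
  then show "computable a \<Longrightarrow> computable b \<Longrightarrow> ?thesis"
    by (simp only:) (intro computable_rules)
qed

lemma computable_disj [computable_rules]: "computable a \<Longrightarrow> computable b \<Longrightarrow> computable (\<lambda>x. a x \<or> b x)"
proof -
  have "(\<lambda>x. a x \<or> b x) = (\<lambda>x. if a x then True else b x)" by auto
  then show "computable a \<Longrightarrow> computable b \<Longrightarrow> ?thesis"
    by (simp only:) (intro computable_rules)
qed

lemma computable_pred: "computable f \<Longrightarrow> computable (\<lambda>x. f x - Suc 0)"
proof -
  assume "computable f"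
  then have "computable (\<lambda>x. rec_nat 0 (\<lambda>k r. k) (f x))" by (intro computable_rules)
  moreover have "rec_nat 0 (\<lambda>k r. k) i = i - Suc 0" for i by (cases i) auto
  ultimately show ?thesis by simp
qed

lemma computable_add [computable_rules]: "computable f \<Longrightarrow> computable g \<Longrightarrow> computable (\<lambda>x. f x + g x :: nat)"
proof -
  assume "computable f" "computable g"
  then have "computable (\<lambda>x. rec_nat (f x) (\<lambda>k r. Suc r) (g x))" by (intro computable_rules)
  moreover have "rec_nat a (\<lambda>k r. Suc r) i = a + i" for a i by (induction i) auto
  ultimately show ?thesis by simp
qed

lemma computable_diff [computable_rules]: "computable f \<Longrightarrow> computable g \<Longrightarrow> computable (\<lambda>x. f x - g x :: nat)"
proof -
  assume "computable f" "computable g"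
  then have "computable (\<lambda>x. rec_nat (f x) (\<lambda>k r. r - Suc 0) (g x))" by (intro computable_rules computable_pred)
  moreover have "rec_nat a (\<lambda>k r. r - Suc 0) i = a - i" for a i by (induction i) auto
  ultimately show ?thesis by simp
qed

lemma computable_eq [computable_rules]: "computable f \<Longrightarrow> computable g \<Longrightarrow> computable (\<lambda>x. f x = g x)"
proof -
  assume "computable f" "computable g"
  then have "computable (\<lambda>x. rec_nat True (\<lambda>k r. False) ((enc (f x) - enc (g x)) + (enc (g x) - enc (f x))))"
    by (intro computable_rules)
  moreover have "rec_nat True (\<lambda>k r. False) i \<longleftrightarrow> i = 0" for i by (cases i) auto
  moreover have "(enc (f x) - enc (g x)) + (enc (g x) - enc (f x)) = 0 \<longleftrightarrow> f x = g x" for x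
    using dec_enc[of "f x"] dec_enc[of "g x"] by (metis add_is_0 diff_is_0_eq' diffs0_imp_equal order_refl)
  ultimately show ?thesis by simp
qed

lemma computable_le [computable_rules]: "computable f \<Longrightarrow> computable g \<Longrightarrow> computable (\<lambda>x. f x \<le> (g x :: nat))"
proof -
  assume "computable f" "computable g"
  then have "computable (\<lambda>x. f x - g x = 0)" by (intro computable_rules)
  then show ?thesis by simp
qed

lemma computable_less [computable_rules]: "computable f \<Longrightarrow> computable g \<Longrightarrow> computable (\<lambda>x. f x < (g x :: nat))"
  unfolding Suc_le_eq[symmetric] by (intro computable_rules)

lemma computable_min [computable_rules]: "computable f \<Longrightarrow> computable g \<Longrightarrow> computable (\<lambda>x. min (f x) (g x :: nat))"
  unfolding min_def by (intro computable_rules)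

text \<open>\<open>mu\<close> searches for a zero while truth has code 1, hence the negation. The
  witness demanded for every \<open>x\<close> is the regularity condition.\<close>

lemma computable_Least:
  fixes P :: "'a::encodable \<Rightarrow> nat \<Rightarrow> bool"
  assumes "computable (\<lambda>p. P (fst p) (snd p))" "\<And>x. \<exists>m. P x m"
  shows "computable (\<lambda>x. LEAST m. P x m)"
proof -
  let ?f = "\<lambda>c. enc (\<not> P (fst (dec c :: 'a \<times> nat)) (snd (dec c :: 'a \<times> nat)))"
  have f: "?f (prod_encode (a, m)) = 0 \<longleftrightarrow> P (dec a) m" for a m
    by (simp add: dec_prod_def enc_bool_def)
  have "total_recursive ?f" using computable_not[OF assms(1)] by (simp add: computable_def)
  then have "total_recursive (\<lambda>a. LEAST m. ?f (prod_encode (a, m)) = 0)"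
    by (rule total_recursive.mu) (use f assms(2) in blast)
  then show ?thesis by (simp add: f computable_def)
qed

subsection \<open>Lists\<close>

lemma length_list_decode: "length (list_decode c) \<le> c"
proof (induction c rule: less_induct)
  case (less c)
  show ?case
  proof (cases c)
    case (Suc m)
    obtain x y where xy: "prod_decode m = (x, y)" by (cases "prod_decode m")
    then have "m = prod_encode (x, y)" by (metis prod_decode_inverse)
    then have "y \<le> m" by (simp add: le_prod_encode_2)
    then show ?thesis using less[of y] Suc xy by simp
  qed simp
qed

text \<open>The state holds the code of the remaining list and the accumulator. Code 0, the empty
  list, is a fixed point, so the code itself, which bounds the length, can serve as the number of
  rounds.\<close>

lemma computable_foldl_code:
  fixes F :: "'a::encodable \<Rightarrow> nat \<Rightarrow> 'b::encodable \<Rightarrow> 'b"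
  assumes F: "computable (\<lambda>p. F (fst p) (fst (snd p)) (snd (snd p)))" and l: "computable l" and z: "computable z"
  shows "computable (\<lambda>x. foldl (\<lambda>acc y. F x y acc) (z x) (list_decode (l x)))"
proof -
  define step where "step x s = (if fst s = 0 then s else (snd (prod_decode (fst s - Suc 0)),
    F x (fst (prod_decode (fst s - Suc 0))) (snd s)))" for x s
  have step: "computable (\<lambda>p. step (fst p) (snd (snd p)))"
    unfolding step_def
    by (intro computable_rules computable_pred
        computable_comp[OF F, of "\<lambda>p. (fst p, fst (prod_decode (fst (snd (snd p)) - Suc 0)), snd (snd (snd p)))", simplified])
  have "snd (rec_nat (c, a) (\<lambda>k. step x) i) = foldl (\<lambda>acc y. F x y acc) a (list_decode c)"
    if "length (list_decode c) \<le> i" for x i c a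
  proof -
    have pow: "rec_nat s (\<lambda>k. step x) i = (step x ^^ i) s" for s i by (induction i) auto
    have "snd ((step x ^^ i) (c, a)) = foldl (\<lambda>acc y. F x y acc) a (list_decode c)"
      using that
    proof (induction i arbitrary: c a)
      case 0
      then show ?case by simp
    next
      case (Suc i)
      show ?case
      proof (cases c)
        case 0
        have "step x (0, a) = (0, a)" by (simp add: step_def)
        then have "(step x ^^ k) (0, a) = (0, a)" for k by (induction k) auto
        from this[of "Suc i"] show ?thesis using 0 by simp
      next
        case (Suc m)
        obtain y ys where y: "prod_decode m = (y, ys)" by (cases "prod_decode m")
        have "(step x ^^ Suc i) (c, a) = (step x ^^ i) (ys, F x y a)"
          using Suc y by (simp add: funpow_Suc_right step_def del: funpow.simps)
        then show ?thesis using Suc.IH[of ys "F x y a"] Suc.prems Suc y by simp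
      qed
    qed
    then show ?thesis by (simp add: pow)
  qed
  note e = this[OF length_list_decode]
  have "computable (\<lambda>x. snd (rec_nat (l x, z x) (\<lambda>k. step x) (l x)))"
    by (intro computable_rules l z step)
  then show ?thesis by (simp add: e)
qed

instantiation list :: (encodable) encodable
begin
definition enc_list :: "'a list \<Rightarrow> nat" where "enc_list xs = list_encode (map enc xs)"
definition dec_list :: "nat \<Rightarrow> 'a list" where "dec_list c = map dec (list_decode c)"
instance
proof
  show "dec (enc x) = x" for x :: "'a list" by (simp add: enc_list_def dec_list_def comp_def)
  \<comment> \<open>Folding produces the code of the reversed list, so a second fold restores the
    order.\<close>
  let ?r = "\<lambda>f c. foldl (\<lambda>acc y. Suc (prod_encode (f y, acc))) 0 (list_decode c)"
  have r: "foldl (\<lambda>acc y. Suc (prod_encode (f y, acc))) (list_encode ys) xs = list_encode (rev (map f xs) @ ys)" for f xs ys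
    by (induction xs arbitrary: ys) (simp_all flip: list_encode.simps(2))
  have r0: "?r f c = list_encode (rev (map f (list_decode c)))" for f c
    using r[of f "[]" "list_decode c"] by simp
  have "computable (\<lambda>c. ?r (\<lambda>y. y) (?r (\<lambda>y. enc (dec y :: 'a)) c))"
    by (intro computable_rules computable_foldl_code)
  moreover have "?r (\<lambda>y. y) (?r (\<lambda>y. enc (dec y :: 'a)) c) = enc (dec c :: 'a list)" for c
    unfolding r0 by (simp add: enc_list_def dec_list_def comp_def)
  ultimately show "total_recursive (\<lambda>c. enc (dec c :: 'a list))" by (simp add: computable_def)
qed
end

lemma computable_foldl [computable_rules]:
  fixes F :: "'a::encodable \<Rightarrow> 'b::encodable \<Rightarrow> 'c::encodable \<Rightarrow> 'b"
  assumes "computable (\<lambda>p. F (fst p) (fst (snd p)) (snd (snd p)))" and z: "computable z" and "computable l"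
  shows "computable (\<lambda>x. foldl (F x) (z x) (l x))"
proof -
  have F: "computable (\<lambda>p. F (fst p) (snd (snd p)) (dec (fst (snd p))))"
  proof -
    have "computable (\<lambda>p :: 'a \<times> nat \<times> 'b. (fst p, snd (snd p), dec (fst (snd p)) :: 'c))"
      by (intro computable_rules)
    from computable_comp[OF assms(1) this] show ?thesis by simp
  qed
  have "computable (\<lambda>x. foldl (\<lambda>acc y. F x acc (dec y)) (z x) (list_decode (enc (l x))))"
    by (rule computable_foldl_code[OF F computable_enc[OF assms(3)] z])
  then show ?thesis by (simp add: enc_list_def foldl_map)
qed

lemma foldl_Cons_rev: "foldl (\<lambda>acc y. y # acc) ys xs = rev xs @ ys"
  by (induction xs arbitrary: ys) auto

lemma foldl_snoc_map: "foldl (\<lambda>acc y. acc @ [g y]) ys xs = ys @ map g xs"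
  by (induction xs arbitrary: ys) auto

lemma foldl_append_concat: "foldl (\<lambda>acc y. acc @ y) ys xs = ys @ concat xs"
  by (induction xs arbitrary: ys) auto

lemma foldl_Suc_length: "foldl (\<lambda>acc y. Suc acc) n xs = n + length xs"
  by (induction xs arbitrary: n) auto

lemma foldl_takeWhile:
  "fst (foldl (\<lambda>s y. if snd s \<and> P y then (fst s @ [y], True) else (fst s, False)) (ys, b) xs) =
      (if b then ys @ takeWhile P xs else ys)"
  by (induction xs arbitrary: ys b) auto

lemma rec_nat_tl: "rec_nat xs (\<lambda>i r. tl r) k = drop k xs"
  by (induction k) (auto simp: tl_drop drop_Suc)

lemma rec_nat_funpow: "rec_nat s (\<lambda>i. f) k = (f ^^ k) s"
  by (induction k) auto

lemma rev_drop_rev: "rev (drop (length xs - k) (rev xs)) = take k xs"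
  by (cases "k \<le> length xs") (simp_all add: rev_drop)

lemma concat_map_filter: "concat (map (\<lambda>y. if P y then [y] else []) xs) = filter P xs"
  by (induction xs) auto

lemma enc_tl: "enc (tl xs) = (if enc xs = 0 then 0 else snd (prod_decode (enc xs - Suc 0)))"
  for xs :: "'a::encodable list"
  by (cases xs) (simp_all add: enc_list_def)

text \<open>On the empty list \<open>hd\<close> has an unspecified but fixed value, and constants
  are computable.\<close>

lemma hd_enc: "hd xs = (if enc xs = 0 then hd [] else dec (fst (prod_decode (enc xs - Suc 0))))"
  for xs :: "'a::encodable list"
  by (cases xs) (simp_all add: enc_list_def)

lemma computable_Cons [computable_rules]: "computable f \<Longrightarrow> computable g \<Longrightarrow> computable (\<lambda>x. f x # g x)"
proof -
  assume "computable f" "computable g"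
  then have "computable (\<lambda>x. Suc (prod_encode (enc (f x), enc (g x))))" by (intro computable_rules)
  then show ?thesis by (simp add: computable_def enc_list_def)
qed

lemma computable_rev [computable_rules]: "computable l \<Longrightarrow> computable (\<lambda>x. rev (l x))"
proof -
  assume "computable l"
  then have "computable (\<lambda>x. foldl (\<lambda>acc y. y # acc) [] (l x))" by (intro computable_rules)
  then show ?thesis by (simp add: foldl_Cons_rev)
qed

lemma computable_append [computable_rules]: "computable f \<Longrightarrow> computable g \<Longrightarrow> computable (\<lambda>x. f x @ g x)"
proof -
  assume "computable f" "computable g"
  then have "computable (\<lambda>x. foldl (\<lambda>acc y. y # acc) (g x) (rev (f x)))" by (intro computable_rules)
  then show ?thesis by (simp add: foldl_Cons_rev)
qed

lemma computable_map [computable_rules]: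
  "computable (\<lambda>p. f (fst p) (snd p)) \<Longrightarrow> computable l \<Longrightarrow> computable (\<lambda>x. map (f x) (l x))"
proof -
  assume f: "computable (\<lambda>p. f (fst p) (snd p))" and l: "computable l"
  have "computable (\<lambda>x. foldl (\<lambda>acc y. acc @ [f x y]) [] (l x))"
    by (intro computable_rules l computable_comp[OF f, of "\<lambda>p. (fst p, snd (snd p))", simplified])
  then show ?thesis by (simp add: foldl_snoc_map foldl_append_concat)
qed

lemma computable_concat [computable_rules]: "computable l \<Longrightarrow> computable (\<lambda>x. concat (l x))"
proof -
  assume "computable l"
  then have "computable (\<lambda>x. foldl (\<lambda>acc y. acc @ y) [] (l x))" by (intro computable_rules)
  then show ?thesis by (simp add: foldl_snoc_map foldl_append_concat)
qed

lemma computable_filter [computable_rules]: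
  "computable (\<lambda>p. P (fst p) (snd p)) \<Longrightarrow> computable l \<Longrightarrow> computable (\<lambda>x. filter (P x) (l x))"
proof -
  assume P: "computable (\<lambda>p. P (fst p) (snd p))" and l: "computable l"
  have "computable (\<lambda>x. concat (map (\<lambda>y. if P x y then [y] else []) (l x)))"
    by (intro computable_rules l P)
  then show ?thesis by (simp add: concat_map_filter)
qed

lemma computable_ball [computable_rules]:
  "computable (\<lambda>p. P (fst p) (snd p)) \<Longrightarrow> computable l \<Longrightarrow> computable (\<lambda>x. \<forall>y\<in>set (l x). P x y)"
proof -
  assume P: "computable (\<lambda>p. P (fst p) (snd p))" and l: "computable l"
  have "computable (\<lambda>x. filter (\<lambda>y. \<not> P x y) (l x) = [])"
    by (intro computable_rules l P)
  then show ?thesis by (simp add: filter_empty_conv)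
qed

lemma computable_bex [computable_rules]:
  "computable (\<lambda>p. P (fst p) (snd p)) \<Longrightarrow> computable l \<Longrightarrow> computable (\<lambda>x. \<exists>y\<in>set (l x). P x y)"
proof -
  assume P: "computable (\<lambda>p. P (fst p) (snd p))" and l: "computable l"
  have "computable (\<lambda>x. filter (P x) (l x) \<noteq> [])"
    by (intro computable_rules l P)
  then show ?thesis by (simp add: filter_empty_conv)
qed

lemma computable_member [computable_rules]:
  "computable f \<Longrightarrow> computable l \<Longrightarrow> computable (\<lambda>x. f x \<in> set (l x))"
proof -
  assume f: "computable f" and l: "computable l"
  have "computable (\<lambda>x. \<exists>y\<in>set (l x). y = f x)"
    by (intro computable_rules l computable_comp[OF f])
  then show ?thesis by simp
qed

lemma computable_length [computable_rules]: "computable l \<Longrightarrow> computable (\<lambda>x. length (l x))"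
proof -
  assume "computable l"
  then have "computable (\<lambda>x. foldl (\<lambda>acc y. Suc acc) 0 (l x))" by (intro computable_rules)
  then show ?thesis by (simp add: foldl_Suc_length)
qed

lemma computable_tl [computable_rules]: "computable l \<Longrightarrow> computable (\<lambda>x. tl (l x))"
proof -
  assume l: "computable l"
  then have "computable (\<lambda>x. if enc (l x) = 0 then 0 else snd (prod_decode (enc (l x) - Suc 0)))"
    by (intro computable_rules computable_pred)
  then show ?thesis by (simp add: computable_def enc_tl)
qed

lemma computable_hd [computable_rules]: "computable l \<Longrightarrow> computable (\<lambda>x. hd (l x))"
proof -
  assume l: "computable l"
  then have "computable (\<lambda>x. if enc (l x) = 0 then hd [] else dec (fst (prod_decode (enc (l x) - Suc 0))))"
    by (intro computable_rules computable_pred)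
  then show ?thesis by (simp only: hd_enc[of "l x" for x])
qed

lemma computable_drop [computable_rules]: "computable k \<Longrightarrow> computable l \<Longrightarrow> computable (\<lambda>x. drop (k x) (l x))"
proof -
  assume "computable k" "computable l"
  then have "computable (\<lambda>x. rec_nat (l x) (\<lambda>i r. tl r) (k x))" by (intro computable_rules)
  then show ?thesis by (simp only: rec_nat_tl)
qed

lemma computable_take [computable_rules]: "computable k \<Longrightarrow> computable l \<Longrightarrow> computable (\<lambda>x. take (k x) (l x))"
proof -
  assume "computable k" "computable l"
  then have "computable (\<lambda>x. rev (drop (length (l x) - k x) (rev (l x))))" by (intro computable_rules)
  then show ?thesis by (simp only: rev_drop_rev)
qed

lemma computable_upt [computable_rules]: "computable k \<Longrightarrow> computable (\<lambda>x. [0..<k x])"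
proof -
  assume "computable k"
  then have "computable (\<lambda>x. rec_nat [] (\<lambda>i r. r @ [i]) (k x))" by (intro computable_rules)
  moreover have "rec_nat [] (\<lambda>i r. r @ [i]) i = [0..<i]" for i by (induction i) auto
  ultimately show ?thesis by simp
qed

lemma computable_takeWhile [computable_rules]:
  "computable (\<lambda>p. P (fst p) (snd p)) \<Longrightarrow> computable l \<Longrightarrow> computable (\<lambda>x. takeWhile (P x) (l x))"
proof -
  assume P: "computable (\<lambda>p. P (fst p) (snd p))" and l: "computable l"
  have "computable (\<lambda>x. fst (foldl (\<lambda>s y. if snd s \<and> P x y then (fst s @ [y], True) else (fst s, False)) ([], True) (l x)))"
    by (intro computable_rules l computable_comp[OF P, of "\<lambda>p. (fst p, snd (snd p))", simplified])
  then show ?thesis by (simp add: foldl_takeWhile)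
qed

lemma computable_dropWhile [computable_rules]:
  "computable (\<lambda>p. P (fst p) (snd p)) \<Longrightarrow> computable l \<Longrightarrow> computable (\<lambda>x. dropWhile (P x) (l x))"
  unfolding dropWhile_eq_drop by (intro computable_rules)

lemma computable_iterate [computable_rules]:
  fixes f :: "'a::encodable \<Rightarrow> 'b::encodable \<Rightarrow> 'b"
  assumes f: "computable (\<lambda>p. f (fst p) (snd p))" and k: "computable k" and z: "computable z"
  shows "computable (\<lambda>x. (f x ^^ k x) (z x))"
proof -
  have "computable (\<lambda>x. rec_nat (z x) (\<lambda>i. f x) (k x))"
    by (intro computable_rules k z computable_comp[OF f, of "\<lambda>p. (fst p, snd (snd p))", simplified])
  then show ?thesis by (simp only: rec_nat_funpow)
qed

subsection \<open>Sorting\<close>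

definition computable_order :: "'a::{encodable, linorder} itself \<Rightarrow> bool" where
  "computable_order t \<longleftrightarrow> computable (\<lambda>p :: 'a \<times> 'a. fst p \<le> snd p)"

lemma computable_order_le:
  fixes f g :: "'b::encodable \<Rightarrow> 'a::{encodable, linorder}"
  assumes "computable_order TYPE('a)" "computable f" "computable g"
  shows "computable (\<lambda>x. f x \<le> g x)"
  using computable_comp[OF assms(1)[unfolded computable_order_def] computable_Pair[OF assms(2,3)]] by simp

lemma computable_order_less:
  fixes f g :: "'b::encodable \<Rightarrow> 'a::{encodable, linorder}"
  assumes "computable_order TYPE('a)" "computable f" "computable g"
  shows "computable (\<lambda>x. f x < g x)"
  unfolding not_le[symmetric] by (intro computable_rules computable_order_le assms)

lemma computable_order_nat: "computable_order TYPE(nat)"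
  unfolding computable_order_def by (intro computable_rules)

lemma computable_order_prod:
  assumes "computable_order TYPE('a::{encodable, linorder})" "computable_order TYPE('b::{encodable, linorder})"
  shows "computable_order TYPE('a \<times> 'b)"
  unfolding computable_order_def less_eq_prod_def
  by (intro computable_rules computable_order_le computable_order_less assms)

text \<open>The first difference is sought among finitely many positions, which turns the
  lexicographic order into a bounded quantifier.\<close>

lemma computable_order_list:
  assumes "computable_order TYPE('a::{encodable, linorder})"
  shows "computable_order TYPE('a list)"
proof -
  have less: "xs < ys \<longleftrightarrow> (length xs < length ys \<and> take (length xs) ys = xs) \<or>
    (\<exists>i\<in>set [0..<min (length xs) (length ys)]. take i xs = take i ys \<and> hd (drop i xs) < hd (drop i ys))" for xs ys :: "'a list"
    unfolding list_less_def lexord_take_index_conv by (auto simp: hd_drop_conv_nth)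
  have "computable (\<lambda>p :: 'a list \<times> 'a list. fst p = snd p \<or> fst p < snd p)"
    unfolding less by (intro computable_rules computable_order_less assms)
  then show ?thesis unfolding computable_order_def by (simp add: le_less disj_commute)
qed

text \<open>Insertion sort that drops repeated elements; for an injective key it computes
  \<open>sorted_key_list_of_set\<close>.\<close>

definition sort_set :: "('a \<Rightarrow> 'b::linorder) \<Rightarrow> 'a list \<Rightarrow> 'a list" where
  "sort_set f xs = foldl (\<lambda>acc y. if y \<in> set acc then acc else
     takeWhile (\<lambda>z. f z < f y) acc @ y # dropWhile (\<lambda>z. f z < f y) acc) [] xs"

lemma insort_key_takeWhile:
  "insort_key f y xs = takeWhile (\<lambda>z. f z < f y) xs @ y # dropWhile (\<lambda>z. f z < f y) xs"
  by (induction xs) auto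

lemma sort_set_eq:
  fixes f :: "'a \<Rightarrow> 'b::linorder"
  assumes "inj f"
  shows "sort_set f xs = sorted_key_list_of_set f (set xs)"
proof -
  let ?F = "\<lambda>acc y. if y \<in> set acc then acc else insort_key f y acc"
  have "sorted (map f (foldl ?F acc xs)) \<and> distinct (foldl ?F acc xs) \<and> set (foldl ?F acc xs) = set acc \<union> set xs"
    if "sorted (map f acc)" "distinct acc" for acc
    using that
  proof (induction xs arbitrary: acc)
    case (Cons y xs)
    have "sorted (map f (?F acc y))" "distinct (?F acc y)" "set (?F acc y) = insert y (set acc)"
      using Cons.prems by (auto simp: sorted_insort_key distinct_insort_key set_insort_key distinct_insort)
    then show ?case using Cons.IH[of "?F acc y"] by auto
  qed simp
  from this[of "[]"] show ?thesis
    unfolding sort_set_def insort_key_takeWhile[symmetric]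
    by (intro sorted_key_list_of_set_inj(2)[OF assms, symmetric]) auto
qed

lemma computable_sort_set:
  fixes f :: "'a::encodable \<Rightarrow> 'c::encodable \<Rightarrow> 'b::{encodable, linorder}"
  assumes "computable_order TYPE('b)" and f: "computable (\<lambda>p. f (fst p) (snd p))" and "computable l"
  shows "computable (\<lambda>x. sort_set (f x) (l x))"
  unfolding sort_set_def
  by (intro computable_rules computable_order_less assms
      computable_comp[OF f, of "\<lambda>p. (fst (fst p), snd p)", simplified]
      computable_comp[OF f, of "\<lambda>p. (fst (fst p), snd (snd (fst p)))", simplified])

lemma computable_sorted_list [computable_rules]:
  "computable l \<Longrightarrow> computable (\<lambda>x. sorted_list_of_set (set (l x) :: nat set))"
proof -
  assume "computable l"
  then have "computable (\<lambda>x. sort_set (\<lambda>y. y) (l x))"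
    by (intro computable_sort_set computable_order_nat computable_rules)
  then show ?thesis by (simp add: sort_set_eq sorted_list_of_set_def)
qed

section \<open>Computing the coherent letter presentation\<close>

instantiation step :: (encodable, encodable) encodable
begin
definition enc_step :: "('a, 'b) step \<Rightarrow> nat" where "enc_step s = enc (lctx s, gen s, fwd s, rctx s)"
definition dec_step :: "nat \<Rightarrow> ('a, 'b) step" where "dec_step c = (case dec c of (w, b, e, w') \<Rightarrow> Step w b e w')"
instance
proof
  show "dec (enc x) = x" for x :: "('a, 'b) step" by (simp add: enc_step_def dec_step_def)
  show "total_recursive (\<lambda>c. enc (dec c :: ('a, 'b) step))"
    using total_recursive_enc_dec[where 'a = "'a list \<times> 'b \<times> bool \<times> 'a list"]
    by (simp add: enc_step_def dec_step_def case_prod_beta)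
qed
end

lemma computable_step_parts:
  "computable (\<lambda>s :: ('a::encodable, 'b::encodable) step. (lctx s, gen s, fwd s, rctx s))"
  using total_recursive_enc_dec[where 'a = "('a, 'b) step"] by (simp add: computable_def enc_step_def)

lemma computable_Step [computable_rules]:
  fixes w w' :: "'c::encodable \<Rightarrow> 'a::encodable list" and b :: "'c \<Rightarrow> 'b::encodable"
  assumes "computable w" "computable b" "computable e" "computable w'"
  shows "computable (\<lambda>x. Step (w x) (b x) (e x) (w' x))"
proof -
  have "computable (\<lambda>x. (w x, b x, e x, w' x))" by (intro computable_rules assms)
  then show ?thesis by (simp add: computable_def enc_step_def)
qed

lemma computable_step_selectors [computable_rules]:
  fixes f :: "'c::encodable \<Rightarrow> ('a::encodable, 'b::encodable) step"
  assumes "computable f"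
  shows "computable (\<lambda>x. lctx (f x))" "computable (\<lambda>x. gen (f x))" "computable (\<lambda>x. fwd (f x))" "computable (\<lambda>x. rctx (f x))"
proof -
  have p: "computable (\<lambda>x. (lctx (f x), gen (f x), fwd (f x), rctx (f x)))"
    using computable_comp[OF computable_step_parts assms] .
  show "computable (\<lambda>x. lctx (f x))" using computable_fst[OF p] by simp
  show "computable (\<lambda>x. gen (f x))" using computable_fst[OF computable_snd[OF p]] by simp
  show "computable (\<lambda>x. fwd (f x))" using computable_fst[OF computable_snd[OF computable_snd[OF p]]] by simp
  show "computable (\<lambda>x. rctx (f x))" using computable_snd[OF computable_snd[OF computable_snd[OF p]]] by simp
qed

text \<open>The inverse of kind and parameters, made total: every kind above 1 is read as
  lambda.\<close>

definition styl2_of :: "nat \<times> nat list \<Rightarrow> styl2" where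
  "styl2_of p = (if fst p = 0 then Eta (hd (snd p))
     else if fst p = 1 then Kappa (hd (snd p)) (hd (tl (snd p))) (hd (tl (tl (snd p))))
     else Lambda (hd (snd p)) (hd (tl (snd p))) (hd (tl (tl (snd p)))))"

instantiation styl2 :: encodable
begin
definition enc_styl2 :: "styl2 \<Rightarrow> nat" where "enc_styl2 c = enc (styl2_kind c, styl2_params c)"
definition dec_styl2 :: "nat \<Rightarrow> styl2" where "dec_styl2 c = styl2_of (dec c)"
instance
proof
  show "dec (enc x) = x" for x :: styl2
    by (cases x) (simp_all add: enc_styl2_def dec_styl2_def styl2_of_def)
  have "computable (\<lambda>p :: nat \<times> nat list. (styl2_kind (styl2_of p), styl2_params (styl2_of p)))"
  proof -
    have "(\<lambda>p. (styl2_kind (styl2_of p), styl2_params (styl2_of p))) = (\<lambda>p. if fst p = 0 then (0, [hd (snd p)])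
      else (if fst p = 1 then 1 else 2, [hd (snd p), hd (tl (snd p)), hd (tl (tl (snd p)))]))"
      by (auto simp: styl2_of_def fun_eq_iff)
    then show ?thesis by (simp only:) (intro computable_rules)
  qed
  then show "total_recursive (\<lambda>c. enc (dec c :: styl2))"
    by (simp add: computable_def enc_styl2_def dec_styl2_def)
qed
end

lemma computable_styl2_parts [computable_rules]:
  assumes "computable f"
  shows "computable (\<lambda>x. styl2_kind (f x))" "computable (\<lambda>x. styl2_params (f x))"
proof -
  have "computable (\<lambda>c. (styl2_kind c, styl2_params c))"
    using total_recursive_enc_dec[where 'a = styl2] by (simp add: computable_def enc_styl2_def)
  from computable_comp[OF this assms]
  have p: "computable (\<lambda>x. (styl2_kind (f x), styl2_params (f x)))" .
  show "computable (\<lambda>x. styl2_kind (f x))" "computable (\<lambda>x. styl2_params (f x))"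
    using computable_fst[OF p] computable_snd[OF p] by simp_all
qed

lemma computable_Eta [computable_rules]:
  assumes "computable f"
  shows "computable (\<lambda>x. Eta (f x))"
proof -
  have "computable (\<lambda>x. (0 :: nat, [f x]))" by (intro computable_rules assms)
  then show ?thesis by (simp add: computable_def enc_styl2_def)
qed

lemma computable_Kappa_Lambda [computable_rules]:
  assumes "computable f" "computable g" "computable h"
  shows "computable (\<lambda>x. Kappa (f x) (g x) (h x))" "computable (\<lambda>x. Lambda (f x) (g x) (h x))"
proof -
  have "computable (\<lambda>x. (1 :: nat, [f x, g x, h x]))" "computable (\<lambda>x. (2 :: nat, [f x, g x, h x]))"
    by (intro computable_rules assms)+
  then show "computable (\<lambda>x. Kappa (f x) (g x) (h x))" "computable (\<lambda>x. Lambda (f x) (g x) (h x))"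
    by (simp_all add: computable_def enc_styl2_def)
qed

lemma styl_src_parts:
  "styl_src c = (if styl2_kind c = 0 then [hd (styl2_params c), hd (styl2_params c)]
    else if styl2_kind c = 1 then [hd (tl (tl (styl2_params c))), hd (styl2_params c), hd (tl (styl2_params c))]
    else [hd (tl (styl2_params c)), hd (tl (tl (styl2_params c))), hd (styl2_params c)])"
  by (cases c) simp_all

lemma styl_tgt_parts:
  "styl_tgt c = (if styl2_kind c = 0 then [hd (styl2_params c)]
    else if styl2_kind c = 1 then [hd (styl2_params c), hd (tl (tl (styl2_params c))), hd (tl (styl2_params c))]
    else [hd (tl (styl2_params c)), hd (styl2_params c), hd (tl (tl (styl2_params c)))])"
  by (cases c) simp_all

lemma computable_styl_boundary [computable_rules]:
  assumes c: "computable c"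
  shows "computable (\<lambda>x. styl_src (c x))" "computable (\<lambda>x. styl_tgt (c x))"
  unfolding styl_src_parts styl_tgt_parts by (intro computable_rules c)+

subsection \<open>Insertion\<close>

lemma Min_foldl: "Min (set u) = (if u = [] then Min {} else foldl (\<lambda>m y. min y m) (hd u) (tl u))" for u :: "nat list"
  by (cases u) (simp_all only: Min.set_eq_fold foldl_conv_fold list.sel list.distinct if_False, simp)

lemma computable_Min [computable_rules]:
  assumes l: "computable l"
  shows "computable (\<lambda>x. Min (set (l x)) :: nat)"
  unfolding Min_foldl[of "l x" for x] by (intro computable_rules l)

lemma computable_ntri [computable_rules]:
  assumes f: "computable f" and g: "computable g"
  shows "computable (\<lambda>x. f x \<lhd>\<^sub>N g x)"
  unfolding ntri_def subset_eq by (intro computable_rules f g computable_comp[OF g])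

lemma bump_filter: "bump (set u) x = (if filter ((<) x) u = [] then [] else [Min (set (filter ((<) x) u))])"
  by (auto simp: bump_def filter_empty_conv)

lemma computable_bump [computable_rules]:
  assumes u: "computable u" and f: "computable f"
  shows "computable (\<lambda>x. bump (set (u x)) (f x))"
  unfolding bump_filter by (intro computable_rules u f computable_comp[OF f])

text \<open>The state consists of the letter still moving upwards, as a list with at most one entry,
  and the rows already passed. A letter left at the end becomes the new top row.\<close>

definition insert_step :: "nat list \<times> row list \<Rightarrow> row \<Rightarrow> nat list \<times> row list" where
  "insert_step s u = (if fst s = [] then ([], snd s @ [u])
     else (bump (set u) (hd (fst s)), snd s @ [sorted_list_of_set (set (hd (fst s) # u))]))"

lemma n_insert_foldl:
  "n_insert x T = (let s = foldl insert_step ([x], []) T in snd s @ map (\<lambda>y. [y]) (fst s))"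
proof -
  have 0: "foldl insert_step ([], acc) T = ([], acc @ T)" for acc T
    by (induction T arbitrary: acc) (auto simp: insert_step_def)
  have "(let s = foldl insert_step ([x], acc) T in snd s @ map (\<lambda>y. [y]) (fst s)) = acc @ n_insert x T" for acc
  proof (induction T arbitrary: x acc)
    case (Cons u T)
    have n: "n_insert x (u # T) = sorted_list_of_set (insert x (set u)) # n_inserts (bump (set u) x) T"
      by (subst n_insert_bump) (simp add: hd_set_def)
    show ?case unfolding n
    proof (cases rule: bump_cases[OF finite_set, of u x])
      case 1
      then show "(let s = foldl insert_step ([x], acc) (u # T) in snd s @ map (\<lambda>y. [y]) (fst s)) =
          acc @ sorted_list_of_set (insert x (set u)) # n_inserts (bump (set u) x) T"
        using 0 by (simp add: insert_step_def[of _ u])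
    next
      case (2 a)
      then show "(let s = foldl insert_step ([x], acc) (u # T) in snd s @ map (\<lambda>y. [y]) (fst s)) =
          acc @ sorted_list_of_set (insert x (set u)) # n_inserts (bump (set u) x) T"
        using Cons.IH[of a "acc @ [sorted_list_of_set (insert x (set u))]"] by (simp add: insert_step_def[of _ u])
    qed
  qed simp
  from this[of "[]"] show ?thesis by simp
qed

lemma computable_n_insert [computable_rules]:
  assumes f: "computable f" and T: "computable T"
  shows "computable (\<lambda>x. n_insert (f x) (T x))"
  unfolding n_insert_foldl insert_step_def by (intro computable_rules f T)

lemma computable_n_tableau [computable_rules]:
  assumes w: "computable w"
  shows "computable (\<lambda>x. n_tableau (w x))"
  unfolding n_tableau_def by (intro computable_rules w)

lemma computable_reading [computable_rules]: "computable T \<Longrightarrow> computable (\<lambda>x. reading (T x))"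
  unfolding reading_def by (intro computable_rules)

subsection \<open>Normalization\<close>

definition redexes :: "row list \<Rightarrow> nat list" where
  "redexes W = filter (\<lambda>i. \<not> hd (drop i W) \<lhd>\<^sub>N hd (drop (Suc i) W)) [0..<length W - 1]"

lemma computable_redexes [computable_rules]:
  assumes W: "computable W"
  shows "computable (\<lambda>x. redexes (W x))"
  unfolding redexes_def by (intro computable_rules W computable_comp[OF W])

lemma redexes_normal: "normal W \<longleftrightarrow> redexes W = []"
  by (auto simp: redexes_def filter_empty_conv successively_conv_nth hd_drop_conv_nth)

lemma redexes_hd:
  assumes "normal (l @ [u])" "\<not> u \<lhd>\<^sub>N v"
  shows "redexes (l @ [u, v] @ r) \<noteq> []" "hd (redexes (l @ [u, v] @ r)) = length l"
proof -
  let ?W = "l @ [u, v] @ r"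
  let ?P = "\<lambda>i. \<not> hd (drop i ?W) \<lhd>\<^sub>N hd (drop (Suc i) ?W)"
  have s: "[0..<length ?W - 1] = [0..<length l] @ length l # [Suc (length l)..<length ?W - 1]"
    using upt_add_eq_append[of 0 "length l" "Suc (length r)"] by (simp add: upt_conv_Cons del: upt_Suc)
  have tri: "(l @ [u]) ! i \<lhd>\<^sub>N (l @ [u]) ! Suc i" if "i < length l" for i
    using assms(1) that by (simp add: successively_conv_nth)
  have hd: "hd (drop i ?W) = (l @ [u]) ! i" if "i \<le> length l" for i
  proof -
    have "hd (drop i ?W) = ?W ! i" using that by (intro hd_drop_conv_nth) simp
    then show ?thesis using that by (auto simp: nth_append)
  qed
  have "\<not> ?P i" if "i < length l" for i
    using tri[OF that] hd[of i] hd[of "Suc i"] that by (simp only: not_not less_imp_le_nat Suc_le_eq)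
  then have "filter ?P [0..<length l] = []" by (auto simp: filter_empty_conv)
  moreover have "?P (length l)" using assms(2) by simp
  ultimately have "redexes ?W = length l # filter ?P [Suc (length l)..<length ?W - 1]"
    unfolding redexes_def s by simp
  then show "redexes ?W \<noteq> []" "hd (redexes ?W) = length l" by simp_all
qed

text \<open>Normal words are fixed points, so different stopping times give the same result.\<close>

definition norm_step :: "row list \<times> (row, row2) step list \<Rightarrow> row list \<times> (row, row2) step list" where
  "norm_step s = (if redexes (fst s) = [] then s else
     let i = hd (redexes (fst s)); u = hd (drop i (fst s)); v = hd (drop (Suc i) (fst s));
         l = take i (fst s); r = drop (Suc (Suc i)) (fst s)
     in (l @ N2 u v @ r, snd s @ [Step l (u, v) True r]))"

lemma computable_norm_step [computable_rules]:
  assumes s: "computable s"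
  shows "computable (\<lambda>x. norm_step (s x))"
  unfolding norm_step_def by (intro computable_rules s)

lemma norm_step_iterate:
  "W \<in> lists (rows n) \<Longrightarrow> \<exists>k. (norm_step ^^ k) (W, p) = (nf W, p @ norm_path n W)"
proof (induction W arbitrary: p rule: wf_induct_rule[OF wf_row_red_rel[of n]])
  case (1 W)
  show ?case
  proof (cases "normal W")
    case True
    then have "(norm_step ^^ 0) (W, p) = (nf W, p @ norm_path n W)"
      using 1(2) by (simp add: norm_path_normal nf_normal)
    then show ?thesis by blast
  next
    case False
    then obtain l u v r where W: "W = l @ [u, v] @ r" "normal (l @ [u])" "\<not> u \<lhd>\<^sub>N v" by (rule not_normalE)
    then have w: "l \<in> lists (rows n)" "u \<in> rows n" "v \<in> rows n" "r \<in> lists (rows n)" using 1(2) by auto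
    let ?W = "l @ N2 u v @ r"
    have r: "(?W, W) \<in> row_red_rel n" unfolding W(1) by (rule row_red_relI[OF w W(3)])
    have rw: "?W \<in> lists (rows n)" using N2_rows w by simp
    obtain k where k: "(norm_step ^^ k) (?W, p @ [Step l (u, v) True r]) = (nf ?W, (p @ [Step l (u, v) True r]) @ norm_path n ?W)"
      using 1(1)[OF r rw] by blast
    have "norm_step (W, p) = (?W, p @ [Step l (u, v) True r])"
      using redexes_hd[OF W(2,3), of r] unfolding W(1) norm_step_def Let_def by simp
    then have "(norm_step ^^ Suc k) (W, p) = (nf W, p @ norm_path n W)"
      using k norm_path_redex[OF w W(2,3)] nf_N2[OF w] W(1) by (simp add: funpow_Suc_right del: funpow.simps)
    then show ?thesis by blast
  qed
qed

lemma iterate_fixed: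
  assumes "f ((f ^^ i) s) = (f ^^ i) s" "f ((f ^^ j) s) = (f ^^ j) s"
  shows "(f ^^ i) s = (f ^^ j) s"
proof -
  have "(f ^^ (m + i)) s = (f ^^ i) s" if "f ((f ^^ i) s) = (f ^^ i) s" for m i
    using that by (induction m) auto
  from this[OF assms(1), of j] this[OF assms(2), of i] show ?thesis by (simp add: add.commute)
qed

definition rows_list :: "nat \<Rightarrow> row list" where
  "rows_list n = filter (\<lambda>u. u \<noteq> []) (rec_nat [[]] (\<lambda>k R. R @ map (\<lambda>u. u @ [Suc k]) R) n)"

lemma set_rows_list: "set (rows_list n) = rows n"
proof -
  let ?S = "\<lambda>n. {u. sorted_wrt (<) u \<and> set u \<subseteq> {1..n}}"
  have S_Suc: "?S (Suc n) = ?S n \<union> (\<lambda>u. u @ [Suc n]) ` ?S n" for n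
  proof (intro equalityI subsetI)
    fix u assume u: "u \<in> ?S (Suc n)"
    show "u \<in> ?S n \<union> (\<lambda>u. u @ [Suc n]) ` ?S n"
    proof (cases "Suc n \<in> set u")
      case True
      then obtain v w where vw: "u = v @ Suc n # w" by (auto simp: in_set_conv_decomp)
      then have "w = []" using u by (cases w) (auto simp: sorted_wrt_append)
      then have "u = v @ [Suc n]" "v \<in> ?S n" using u vw by (auto simp: sorted_wrt_append subset_eq)
      then show ?thesis by blast
    next
      case False
      then have "set u \<subseteq> {1..n}" using u by (auto simp: subset_eq le_Suc_eq)
      then show ?thesis using u by blast
    qed
  next
    fix u assume "u \<in> ?S n \<union> (\<lambda>u. u @ [Suc n]) ` ?S n"
    then show "u \<in> ?S (Suc n)" by (auto simp: sorted_wrt_append subset_eq le_SucI less_Suc_eq_le)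
  qed
  have "set (rec_nat [[]] (\<lambda>k R. R @ map (\<lambda>u. u @ [Suc k]) R) n) = ?S n"
  proof (induction n)
    case (Suc n)
    then show ?case unfolding S_Suc by simp
  qed auto
  then show ?thesis by (auto simp: rows_list_def rows_def)
qed

lemma computable_rows_list [computable_rules]:
  assumes n: "computable n"
  shows "computable (\<lambda>x. rows_list (n x))"
  unfolding rows_list_def by (intro computable_rules n)

text \<open>The second alternative stops the search at once when some entry of \<open>W\<close> is
  not a row; termination is established only for words over \<open>rows n\<close>, but the
  minimization must succeed for all arguments.\<close>

definition norm_steps :: "nat \<Rightarrow> row list \<Rightarrow> (row, row2) step list" where
  "norm_steps n W = snd ((norm_step ^^ (LEAST k. redexes (fst ((norm_step ^^ k) (W, []))) = [] \<or>
     \<not> (\<forall>u\<in>set W. u \<in> set (rows_list n)))) (W, []))"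

lemma norm_steps_ex:
  "\<exists>k. redexes (fst ((norm_step ^^ k) (W, []))) = [] \<or> \<not> (\<forall>u\<in>set W. u \<in> set (rows_list n))"
proof (cases "\<forall>u\<in>set W. u \<in> set (rows_list n)")
  case True
  then have W: "W \<in> lists (rows n)" by (auto simp: set_rows_list)
  then obtain k where "(norm_step ^^ k) (W, []) = (nf W, [] @ norm_path n W)" using norm_step_iterate by blast
  then have "redexes (fst ((norm_step ^^ k) (W, []))) = []" using nf_is_normal[OF W] by (simp add: redexes_normal)
  then show ?thesis by blast
qed simp

lemma norm_steps_eq:
  assumes W: "W \<in> lists (rows n)"
  shows "norm_steps n W = norm_path n W"
proof -
  let ?k = "LEAST k. redexes (fst ((norm_step ^^ k) (W, []))) = [] \<or> \<not> (\<forall>u\<in>set W. u \<in> set (rows_list n))"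
  have "\<forall>u\<in>set W. u \<in> set (rows_list n)" using W by (auto simp: set_rows_list)
  then have r: "redexes (fst ((norm_step ^^ ?k) (W, []))) = []" using LeastI_ex[OF norm_steps_ex[of W n]] by blast
  obtain k where k: "(norm_step ^^ k) (W, []) = (nf W, [] @ norm_path n W)" using norm_step_iterate[OF W] by blast
  have fixed: "norm_step s = s" if "redexes (fst s) = []" for s using that by (simp add: norm_step_def)
  have "redexes (fst ((norm_step ^^ k) (W, []))) = []" using nf_is_normal[OF W] k by (simp add: redexes_normal)
  then have "(norm_step ^^ ?k) (W, []) = (norm_step ^^ k) (W, [])" using r by (intro iterate_fixed fixed)
  then show ?thesis using k by (simp add: norm_steps_def)
qed

lemma computable_norm_steps [computable_rules]:
  assumes n: "computable n" and W: "computable W"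
  shows "computable (\<lambda>x. norm_steps (n x) (W x))"
proof -
  have "computable (\<lambda>x. LEAST k. redexes (fst ((norm_step ^^ k) (W x, []))) = [] \<or> \<not> (\<forall>u\<in>set (W x). u \<in> set (rows_list (n x))))"
    by (intro computable_Least norm_steps_ex computable_rules computable_comp[OF n] computable_comp[OF W])
  then show ?thesis unfolding norm_steps_def by (intro computable_rules W)
qed

subsection \<open>Selected cells\<close>

definition triples_list :: "nat \<Rightarrow> triple list" where
  "triples_list n = filter (\<lambda>\<tau>. \<not> fst \<tau> \<lhd>\<^sub>N fst (snd \<tau>) \<and> \<not> fst (snd \<tau>) \<lhd>\<^sub>N snd (snd \<tau>) \<and>
      \<not> (2 \<le> length (fst \<tau>) \<and> \<not> tl (fst \<tau>) \<lhd>\<^sub>N fst (snd \<tau>)))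
    (concat (map (\<lambda>u. concat (map (\<lambda>v. map (\<lambda>t. (u, v, t)) (rows_list n)) (rows_list n))) (rows_list n)))"

lemma set_triples_list: "set (triples_list n) = triples_T1 n"
  by (auto simp: triples_list_def triples_T1_def triples_S_def triples_C_def set_rows_list)

lemma computable_triples_list [computable_rules]:
  assumes n: "computable n"
  shows "computable (\<lambda>x. triples_list (n x))"
  unfolding triples_list_def by (intro computable_rules n computable_comp[OF n])

definition L_steps :: "nat \<Rightarrow> triple \<Rightarrow> (row, row2) step list" where
  "L_steps n \<tau> = Step [] (fst \<tau>, fst (snd \<tau>)) True [snd (snd \<tau>)] #
     norm_steps n (N2 (fst \<tau>) (fst (snd \<tau>)) @ [snd (snd \<tau>)])"

definition R_steps :: "nat \<Rightarrow> triple \<Rightarrow> (row, row2) step list" where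
  "R_steps n \<tau> = Step [fst \<tau>] (snd \<tau>) True [] # norm_steps n (fst \<tau> # N2 (fst (snd \<tau>)) (snd (snd \<tau>)))"

lemma LR_steps_eq:
  assumes "\<tau> \<in> triples_T1 n"
  shows "L_steps n \<tau> = L_path n \<tau>" "R_steps n \<tau> = R_path n \<tau>"
proof -
  obtain u v t where \<tau>: "\<tau> = (u, v, t)" by (cases \<tau>)
  then have "u \<in> rows n" "v \<in> rows n" "t \<in> rows n" using assms by (auto simp: triples_T1_def triples_C_def)
  then show "L_steps n \<tau> = L_path n \<tau>" "R_steps n \<tau> = R_path n \<tau>"
    using N2_rows \<tau> by (simp_all add: L_steps_def R_steps_def L_path.simps R_path.simps norm_steps_eq)
qed

lemma computable_L_steps [computable_rules]:
  assumes n: "computable n" and f: "computable f"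
  shows "computable (\<lambda>x. L_steps (n x) (f x))"
  unfolding L_steps_def by (intro computable_rules n f)

lemma computable_R_steps [computable_rules]:
  assumes n: "computable n" and f: "computable f"
  shows "computable (\<lambda>x. R_steps (n x) (f x))"
  unfolding R_steps_def by (intro computable_rules n f)

definition eligible_list :: "nat \<Rightarrow> (triple \<times> row2) list" where
  "eligible_list n = concat (map (\<lambda>\<tau>. map (\<lambda>s. (\<tau>, gen s)) (filter (\<lambda>s. lctx s = [] \<and> rctx s = [] \<and> fwd s \<and>
     length (filter (\<lambda>t. gen t = gen s) (L_steps n \<tau> @ R_steps n \<tau>)) = 1) (L_steps n \<tau> @ R_steps n \<tau>))) (triples_list n))"

lemma set_eligible_list: "set (eligible_list n) = eligible n"
proof -
  have s: "s = Step [] \<beta> True [] \<longleftrightarrow> lctx s = [] \<and> rctx s = [] \<and> fwd s \<and> gen s = \<beta>" for s :: "(row, row2) step" and \<beta>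
    by (cases s) auto
  have "(\<tau>, \<beta>) \<in> set (eligible_list n) \<longleftrightarrow> (\<tau>, \<beta>) \<in> eligible n" for \<tau> \<beta>
  proof (cases "\<tau> \<in> triples_T1 n")
    case True
    have "(\<tau>, \<beta>) \<in> set (eligible_list n) \<longleftrightarrow> (\<exists>s\<in>set (L_path n \<tau> @ R_path n \<tau>). s = Step [] \<beta> True [] \<and>
      length (filter (\<lambda>t. gen t = gen s) (L_path n \<tau> @ R_path n \<tau>)) = 1)"
      unfolding s using True by (auto simp: eligible_list_def set_triples_list LR_steps_eq)
    also have "\<dots> \<longleftrightarrow> (\<tau>, \<beta>) \<in> eligible n" using True by (auto simp: eligible_def)
    finally show ?thesis .
  next
    case False
    then show ?thesis by (auto simp: eligible_list_def set_triples_list eligible_def)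
  qed
  then show ?thesis by auto
qed

lemma computable_eligible_list [computable_rules]:
  assumes n: "computable n"
  shows "computable (\<lambda>x. eligible_list (n x))"
  unfolding eligible_list_def by (intro computable_rules n computable_comp[OF n])

lemma inv_step_parts: "inv_step s = Step (lctx s) (gen s) (\<not> fwd s) (rctx s)"
  by (cases s) simp

lemma computable_inv_steps [computable_rules]: "computable p \<Longrightarrow> computable (\<lambda>x. inv_steps (p x))"
  unfolding inv_steps_def inv_step_parts[abs_def] by (intro computable_rules)

definition S_cell :: "nat \<Rightarrow> triple \<Rightarrow> row2 \<Rightarrow> (row, row2) step list" where
  "S_cell n \<tau> \<beta> = (let b = (\<exists>s\<in>set (L_steps n \<tau>). gen s = \<beta>);
     U = (if b then L_steps n \<tau> else R_steps n \<tau>); V = (if b then R_steps n \<tau> else L_steps n \<tau>)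
     in inv_steps (takeWhile (\<lambda>s. gen s \<noteq> \<beta>) U) @ V @ inv_steps (tl (dropWhile (\<lambda>s. gen s \<noteq> \<beta>) U)))"

lemma S_cell_eq:
  assumes "\<tau> \<in> triples_T1 n"
  shows "S_cell n \<tau> \<beta> = S_steps n \<tau> \<beta>"
proof -
  have "(\<exists>s\<in>set (L_path n \<tau>). gen s = \<beta>) \<longleftrightarrow> \<beta> \<in> gen ` set (L_path n \<tau>)" by auto
  then show ?thesis using assms by (simp add: S_cell_def S_steps_def LR_steps_eq Let_def)
qed

lemma computable_S_cell [computable_rules]:
  assumes n: "computable n" and f: "computable f" and b: "computable b"
  shows "computable (\<lambda>x. S_cell (n x) (f x) (b x))"
  unfolding S_cell_def Let_def
  by (intro computable_rules n f b computable_comp[OF b])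

definition kept_list :: "nat \<Rightarrow> (triple \<times> row2) list" where
  "kept_list n = foldl (\<lambda>K x. if fst x \<notin> set (map fst K) \<and> snd x \<notin> set (map snd K) then x # K else K) []
     (sort_set pair_key (eligible_list n))"

lemma set_kept_list: "set (kept_list n) = kept_pairs n"
proof -
  have "set (foldl (\<lambda>K x. if fst x \<notin> set (map fst K) \<and> snd x \<notin> set (map snd K) then x # K else K) K xs) =
     foldl (\<lambda>K (\<tau>, \<beta>). if \<tau> \<notin> fst ` K \<and> \<beta> \<notin> snd ` K then insert (\<tau>, \<beta>) K else K) (set K) xs" for K :: "(triple \<times> row2) list" and xs
    by (induction xs arbitrary: K) (auto simp: case_prod_beta)
  from this[of "[]"] show ?thesis
    by (simp add: kept_list_def kept_pairs_def sort_set_eq[OF inj_pair_key] set_eligible_list)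
qed

lemma row2_key_parts: "row2_key \<beta> = (length (fst \<beta>) + length (snd \<beta>), length (fst \<beta>), fst \<beta>, snd \<beta>)"
  by (cases \<beta>) simp

lemma pair_key_parts: "pair_key x = (row2_key (snd x), fst x)"
  by (cases x) simp

lemma computable_row2_key [computable_rules]: "computable f \<Longrightarrow> computable (\<lambda>x. row2_key (f x))"
  unfolding row2_key_parts by (intro computable_rules)

lemma computable_kept_list [computable_rules]:
  assumes n: "computable n"
  shows "computable (\<lambda>x. kept_list (n x))"
proof -
  have "computable (\<lambda>x. sort_set pair_key (eligible_list (n x)))"
    unfolding pair_key_parts[abs_def]
    by (intro computable_sort_set computable_order_prod computable_order_list computable_order_nat computable_rules n)
  then show ?thesis unfolding kept_list_def by (intro computable_rules)
qed

text \<open>The definite description in \<open>tau\<close> becomes a search in the kept pairs, at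
  most one of which contains a given cell.\<close>

definition tau_in :: "(triple \<times> row2) list \<Rightarrow> row2 \<Rightarrow> triple" where
  "tau_in K \<beta> = fst (hd (filter (\<lambda>x. snd x = \<beta>) K))"

lemma tau_in_eq:
  assumes "\<beta> \<in> B_match n"
  shows "tau_in (kept_list n) \<beta> = tau n \<beta>" "tau n \<beta> \<in> triples_T1 n"
proof -
  let ?l = "filter (\<lambda>x. snd x = \<beta>) (kept_list n)"
  have "?l \<noteq> []" using assms by (auto simp: filter_empty_conv set_kept_list B_match_def)
  then have "hd ?l \<in> set ?l" by (rule hd_in_set)
  then have "hd ?l \<in> kept_pairs n" "snd (hd ?l) = \<beta>" by (auto simp: set_kept_list)
  then have "(fst (hd ?l), \<beta>) \<in> kept_pairs n" by (metis prod.collapse)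
  then show "tau_in (kept_list n) \<beta> = tau n \<beta>" using tau_eq by (simp add: tau_in_def)
  show "tau n \<beta> \<in> triples_T1 n" using tau_eligible[OF assms] by (auto simp: eligible_def)
qed

lemma computable_tau_in [computable_rules]:
  assumes K: "computable K" and b: "computable b"
  shows "computable (\<lambda>x. tau_in (K x) (b x))"
  unfolding tau_in_def by (intro computable_rules K computable_comp[OF b])

text \<open>Edges are restricted to \<open>S\<close>, because the scan tests acyclicity of induced
  subgraphs only.\<close>

definition dep_edges :: "nat \<Rightarrow> row2 list \<Rightarrow> (row2 \<times> row2) list" where
  "dep_edges n S = concat (map (\<lambda>\<beta>. map (\<lambda>\<beta>'. (\<beta>', \<beta>)) (filter (\<lambda>\<beta>'. \<exists>s\<in>set (S_cell n (tau_in (kept_list n) \<beta>) \<beta>). gen s = \<beta>') S)) S)"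

lemma set_concat_map_filter:
  "set (concat (map (\<lambda>y. map (\<lambda>x. (x, y)) (filter (P y) S)) S)) = {(x, y). y \<in> set S \<and> x \<in> set S \<and> P y x}"
  by auto

lemma image_bex_iff: "(\<exists>x\<in>A. f x = y) \<longleftrightarrow> y \<in> f ` A"
  by blast

lemma set_dep_edges:
  assumes "set S \<subseteq> B_match n"
  shows "set (dep_edges n S) = dep_graph n \<inter> set S \<times> set S"
proof -
  have "S_cell n (tau_in (kept_list n) \<beta>) \<beta> = S_steps n (tau n \<beta>) \<beta>" if "\<beta> \<in> set S" for \<beta>
  proof -
    have "\<beta> \<in> B_match n" using that assms by blast
    from tau_in_eq(1)[OF this] S_cell_eq[OF tau_in_eq(2)[OF this]] show ?thesis by simp
  qed
  then have S: "{(\<beta>', \<beta>). \<beta> \<in> set S \<and> \<beta>' \<in> set S \<and> \<beta>' \<in> gen ` set (S_cell n (tau_in (kept_list n) \<beta>) \<beta>)} =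
      {(\<beta>', \<beta>). \<beta> \<in> set S \<and> \<beta>' \<in> set S \<and> \<beta>' \<in> gen ` set (S_steps n (tau n \<beta>) \<beta>)}" by (simp cong: conj_cong)
  have "set (dep_edges n S) = {(\<beta>', \<beta>). \<beta> \<in> set S \<and> \<beta>' \<in> set S \<and> \<beta>' \<in> gen ` set (S_cell n (tau_in (kept_list n) \<beta>) \<beta>)}"
    unfolding dep_edges_def set_concat_map_filter by (simp only: image_bex_iff)
  moreover have "dep_graph n \<inter> set S \<times> set S = {(\<beta>', \<beta>). \<beta> \<in> set S \<and> \<beta>' \<in> set S \<and> \<beta>' \<in> gen ` set (S_steps n (tau n \<beta>) \<beta>)}"
    unfolding dep_graph_def dependencies_def using assms by blast
  ultimately show ?thesis using S by simp
qed

lemma computable_dep_edges [computable_rules]: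
  assumes n: "computable n" and S: "computable S"
  shows "computable (\<lambda>x. dep_edges (n x) (S x))"
  unfolding dep_edges_def by (intro computable_rules S computable_comp[OF n] computable_comp[OF S])

text \<open>After \<open>k\<close> rounds the list holds the powers of the relation up to
  \<open>Suc k\<close>; powers beyond the number of edges add nothing to a finite relation.\<close>

definition trancl_list :: "('a \<times> 'a) list \<Rightarrow> ('a \<times> 'a) list" where
  "trancl_list E = rec_nat E (\<lambda>k T. T @ concat (map (\<lambda>x. map (\<lambda>y. (fst x, snd y)) (filter (\<lambda>y. fst y = snd x) E)) T)) (length E)"

lemma set_trancl_list: "set (trancl_list E) = (set E)\<^sup>+"
proof -
  have n: "set (rec_nat E (\<lambda>k T. T @ concat (map (\<lambda>x. map (\<lambda>y. (fst x, snd y)) (filter (\<lambda>y. fst y = snd x) E)) T)) k) = ntrancl k (set E)" for k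
  proof (induction k)
    case (Suc k)
    have "ntrancl (Suc k) (set E) = ntrancl k (set E) \<union> ntrancl k (set E) O set E" by auto
    then show ?case using Suc by force
  qed simp
  have "card (set E) - 1 \<le> length E" using card_length[of E] by simp
  then have "ntrancl (card (set E) - 1) (set E) \<subseteq> ntrancl (length E) (set E)"
    unfolding ntrancl_def by fastforce
  moreover have "ntrancl (length E) (set E) \<subseteq> (set E)\<^sup>+"
    unfolding ntrancl_def using trancl_power[of _ "set E"] by blast
  ultimately show ?thesis unfolding trancl_list_def n using finite_trancl_ntranl[of "set E"] by auto
qed

lemma computable_trancl_list [computable_rules]:
  fixes E :: "'a::encodable \<Rightarrow> ('b::encodable \<times> 'b) list"
  assumes E: "computable E"
  shows "computable (\<lambda>x. trancl_list (E x))"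
  unfolding trancl_list_def by (intro computable_rules E computable_comp[OF E])

definition acyclic_list :: "nat \<Rightarrow> row2 list" where
  "acyclic_list n = foldl (\<lambda>S \<beta>. if \<forall>x\<in>set (trancl_list (dep_edges n (\<beta> # S))). fst x \<noteq> snd x then \<beta> # S else S) []
     (sort_set row2_key (map snd (kept_list n)))"

lemma set_acyclic_list: "set (acyclic_list n) = B_acyc n"
proof -
  let ?c = "\<lambda>S \<beta>. \<forall>x\<in>set (trancl_list (dep_edges n (\<beta> # S))). fst x \<noteq> snd x"
  have c: "?c S \<beta> \<longleftrightarrow> acyclic (dep_graph n \<inter> insert \<beta> (set S) \<times> insert \<beta> (set S))"
    if "set S \<subseteq> B_match n" "\<beta> \<in> B_match n" for S \<beta>
    using set_dep_edges[of "\<beta> # S" n] that by (auto simp: set_trancl_list acyclic_def)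
  have "set (foldl (\<lambda>S \<beta>. if ?c S \<beta> then \<beta> # S else S) S xs) =
    foldl (\<lambda>K \<beta>. if acyclic (dep_graph n \<inter> insert \<beta> K \<times> insert \<beta> K) then insert \<beta> K else K) (set S) xs"
    if "set S \<subseteq> B_match n" "set xs \<subseteq> B_match n" for S xs
    using that
  proof (induction xs arbitrary: S)
    case (Cons \<beta> xs)
    then have S: "set S \<subseteq> B_match n" "\<beta> \<in> B_match n" "set xs \<subseteq> B_match n" by auto
    show ?case
    proof (cases "?c S \<beta>")
      case True
      then show ?thesis using c[OF S(1,2)] Cons.IH[of "\<beta> # S"] S by (simp only: foldl_Cons if_True) simp
    next
      case False
      then show ?thesis using c[OF S(1,2)] Cons.IH[OF S(1,3)] by (simp only: foldl_Cons if_False)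
    qed
  qed simp
  note foldl = this[of "[]"]
  have B: "set (map snd (kept_list n)) = B_match n" by (simp add: set_kept_list B_match_def)
  have "set (sorted_key_list_of_set row2_key (B_match n)) \<subseteq> B_match n"
    using sorted_key_list_of_set_inj(1)[OF inj_row2_key finite_B_match] by blast
  from foldl[OF _ this] show ?thesis
    unfolding acyclic_list_def B_acyc_def sort_set_eq[OF inj_row2_key] B by simp
qed

lemma computable_acyclic_list [computable_rules]:
  assumes n: "computable n"
  shows "computable (\<lambda>x. acyclic_list (n x))"
proof -
  have "computable (\<lambda>x. sort_set row2_key (map snd (kept_list (n x))))"
    by (intro computable_sort_set computable_order_prod computable_order_list computable_order_nat computable_rules n)
  then show ?thesis unfolding acyclic_list_def by (intro computable_rules computable_comp[OF n])
qed

subsection \<open>Reduction\<close>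

lemma computable_map_word [computable_rules]:
  assumes F: "computable (\<lambda>p. F (fst p) (snd p))" and w: "computable w"
  shows "computable (\<lambda>x. map_word (F x) (w x))"
  unfolding map_word_def by (intro computable_rules F w)

lemma whisker_parts: "whisker l r s = Step (l @ lctx s) (gen s) (fwd s) (rctx s @ r)"
  by (cases s) simp

lemma map_step_parts:
  "map_step F G s = map (whisker (map_word F (lctx s)) (map_word F (rctx s))) (if fwd s then G (gen s) else inv_steps (G (gen s)))"
  by (cases s) simp

lemma computable_map_steps [computable_rules]:
  assumes F: "computable (\<lambda>p. F (fst p) (snd p))" and G: "computable (\<lambda>p. G (fst p) (snd p))" and p: "computable p"
  shows "computable (\<lambda>x. map_steps (F x) (G x) (p x))"
proof -
  have F': "computable (\<lambda>x. F (f x) (g x))" if "computable f" "computable g" for f g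
    using computable_comp[OF F computable_Pair[OF that]] by simp
  have G': "computable (\<lambda>x. G (f x) (g x))" if "computable f" "computable g" for f g
    using computable_comp[OF G computable_Pair[OF that]] by simp
  show ?thesis unfolding map_steps_def map_step_parts[abs_def] whisker_parts[abs_def]
    by (intro computable_rules F' G' p)
qed

text \<open>A single round of elimination. Iterated rounds replace the well-founded recursion of
  \<open>red_cell\<close>, because iteration is directly computable.\<close>

definition subst_cell :: "nat \<Rightarrow> row2 \<Rightarrow> (row, row2) step list" where
  "subst_cell n \<beta> = (if \<beta> \<in> set (acyclic_list n) then S_cell n (tau_in (kept_list n) \<beta>) \<beta> else [Step [] \<beta> True []])"

abbreviation subst_steps :: "nat \<Rightarrow> (row, row2) step list \<Rightarrow> (row, row2) step list" where
  "subst_steps n \<equiv> map_steps (\<lambda>u. [u]) (subst_cell n)"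

lemma subst_cell_eq:
  "subst_cell n \<beta> = (if \<beta> \<in> B_acyc n then S_steps n (tau n \<beta>) \<beta> else [Step [] \<beta> True []])"
  using tau_in_eq[of \<beta> n] S_cell_eq[of "tau n \<beta>" n \<beta>] B_acyc_subset[of n] by (auto simp: subst_cell_def set_acyclic_list)

lemma computable_subst_cell [computable_rules]:
  assumes n: "computable n" and b: "computable b"
  shows "computable (\<lambda>x. subst_cell (n x) (b x))"
  unfolding subst_cell_def by (intro computable_rules n b)

text \<open>\<open>Red\<close> of an eliminated cell is \<open>Red\<close> of its substitute, so a
  round of substitution does not change the value of \<open>Red\<close>.\<close>

lemma red_subst: "red_steps n (subst_steps n p) = red_steps n p"
proof -
  have "red_steps n (subst_cell n \<beta>) = red_cell n \<beta>" for \<beta>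
    using red_cell_eq[of n \<beta>] by (simp add: subst_cell_eq)
  then show ?thesis unfolding map_steps_map_steps by simp
qed

lemma red_subst_iterate: "red_steps n ((subst_steps n ^^ k) p) = red_steps n p"
  by (induction k) (simp_all add: red_subst)

lemma gen_map_steps: "gen ` set (map_steps F G p) = (\<Union>s\<in>set p. gen ` set (G (gen s)))"
proof -
  have w: "gen (whisker l r s) = gen s" for l r s by (cases s) simp
  have "gen ` set (map_step F G s) = gen ` set (G (gen s))" for s
    unfolding map_step_parts using gen_inv_steps[of "G (gen s)"] by (auto simp: w image_image)
  then show ?thesis by (induction p) (auto simp: image_Un)
qed

lemma subst_iterate:
  "(subst_steps n ^^ k) p = map_steps (\<lambda>u. [u]) (\<lambda>\<beta>. (subst_steps n ^^ k) [Step [] \<beta> True []]) p"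
proof (induction k arbitrary: p)
  case 0
  show ?case by (simp add: map_steps_id)
next
  case (Suc k)
  let ?G = "\<lambda>\<beta>. (subst_steps n ^^ k) [Step [] \<beta> True []]"
  have "(subst_steps n ^^ Suc k) p = subst_steps n (map_steps (\<lambda>u. [u]) ?G p)" using Suc[of p] by simp
  also have "\<dots> = map_steps (\<lambda>u. [u]) (\<lambda>\<beta>. subst_steps n (?G \<beta>)) p" by (simp add: map_steps_map_steps)
  finally show ?case by simp
qed

text \<open>Well-founded induction on cells: one round replaces \<beta> by its dependencies, each
  resolved after finitely many rounds. Further rounds change nothing, so a maximum serves all steps
  of a path at once.\<close>

lemma subst_terminates: "\<exists>k. gen ` set ((subst_steps n ^^ k) p) \<inter> B_acyc n = {}"
proof -
  let ?g = "\<lambda>k p. gen ` set ((subst_steps n ^^ k) p)"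
  let ?B = "B_acyc n"
  have stop: "?g m p \<inter> ?B = {}" if "?g k p \<inter> ?B = {}" "k \<le> m" for k m p
  proof -
    have fixed: "subst_steps n q = q" if "gen ` set q \<inter> ?B = {}" for q
    proof -
      have "subst_steps n q = map_steps (\<lambda>u. [u]) (\<lambda>\<beta>. [Step [] \<beta> True []]) q"
        using that by (intro map_steps_cong) (auto simp: subst_cell_eq)
      then show ?thesis by (simp add: map_steps_id)
    qed
    have "(subst_steps n ^^ (i + k)) p = (subst_steps n ^^ k) p" for i
      using fixed that(1) by (induction i) simp_all
    from this[of "m - k"] that show ?thesis by simp
  qed
  have all: "\<exists>k. ?g k p \<inter> ?B = {}" if "\<And>s. s \<in> set p \<Longrightarrow> \<exists>k. ?g k [Step [] (gen s) True []] \<inter> ?B = {}" for p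
    using that
  proof (induction p)
    case Nil
    then show ?case by (intro exI[of _ 0]) simp
  next
    case (Cons s p)
    then obtain i where i: "?g i p \<inter> ?B = {}" by auto
    obtain j where j: "?g j [Step [] (gen s) True []] \<inter> ?B = {}" using Cons.prems[of s] by auto
    let ?k = "max i j"
    have "?g k q = (\<Union>s\<in>set q. ?g k [Step [] (gen s) True []])" for k q
      by (subst subst_iterate) (rule gen_map_steps)
    from this[of ?k "s # p"] this[of ?k p]
    have "?g ?k (s # p) = ?g ?k [Step [] (gen s) True []] \<union> ?g ?k p" by simp
    then show ?case using stop[OF i, of ?k] stop[OF j, of ?k] by (intro exI[of _ ?k]) auto
  qed
  have "\<exists>k. ?g k [Step [] \<beta> True []] \<inter> ?B = {}" for \<beta>
  proof (induction \<beta> rule: wf_induct_rule[OF wf_red_rel[of n]])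
    case (1 \<beta>)
    show ?case
    proof (cases "\<beta> \<in> ?B")
      case False
      then show ?thesis by (intro exI[of _ 0]) simp
    next
      case True
      let ?S = "S_steps n (tau n \<beta>) \<beta>"
      obtain k where "?g k ?S \<inter> ?B = {}"
        using all[of ?S] 1 True by (auto simp: red_rel_def dependencies_def)
      moreover have "subst_steps n [Step [] \<beta> True []] = ?S" using True by (simp add: subst_cell_eq)
      ultimately have "?g (Suc k) [Step [] \<beta> True []] \<inter> ?B = {}"
        by (simp add: funpow_Suc_right del: funpow.simps map_steps_simps)
      then show ?thesis by blast
    qed
  qed
  then show ?thesis by (rule all)
qed

text \<open>The search needs no stopping alternative, since substitution terminates for every step
  list, composable or not.\<close>

definition reduce_steps :: "nat \<Rightarrow> (row, row2) step list \<Rightarrow> (row, row2) step list" where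
  "reduce_steps n p = (subst_steps n ^^ (LEAST k. \<forall>s\<in>set ((subst_steps n ^^ k) p). gen s \<notin> set (acyclic_list n))) p"

lemma reduce_steps_ex: "\<exists>k. \<forall>s\<in>set ((subst_steps n ^^ k) p). gen s \<notin> set (acyclic_list n)"
proof -
  obtain k where "gen ` set ((subst_steps n ^^ k) p) \<inter> B_acyc n = {}" using subst_terminates by blast
  then have "\<forall>s\<in>set ((subst_steps n ^^ k) p). gen s \<notin> B_acyc n" by blast
  then show ?thesis unfolding set_acyclic_list by blast
qed

lemma reduce_steps_eq: "reduce_steps n p = red_steps n p"
proof -
  let ?k = "LEAST k. \<forall>s\<in>set ((subst_steps n ^^ k) p). gen s \<notin> set (acyclic_list n)"
  have "\<forall>s\<in>set ((subst_steps n ^^ ?k) p). gen s \<notin> set (acyclic_list n)" by (rule LeastI_ex[OF reduce_steps_ex])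
  then have "gen ` set ((subst_steps n ^^ ?k) p) \<inter> B_acyc n = {}" unfolding set_acyclic_list by blast
  from red_steps_fixed[OF this] red_subst_iterate[of n ?k p] show ?thesis by (simp add: reduce_steps_def)
qed

lemma computable_subst_iterate:
  assumes n: "computable n" and k: "computable k" and p: "computable p"
  shows "computable (\<lambda>x. (subst_steps (n x) ^^ k x) (p x))"
proof -
  have "computable (\<lambda>p. subst_steps (n (fst p)) (snd p))"
    by (intro computable_rules computable_comp[OF n])
  from computable_iterate[OF this k p] show ?thesis .
qed

lemma computable_reduce_steps [computable_rules]:
  assumes n: "computable n" and p: "computable p"
  shows "computable (\<lambda>x. reduce_steps (n x) (p x))"
proof -
  have "computable (\<lambda>q. \<forall>s\<in>set ((subst_steps (n (fst q)) ^^ snd q) (p (fst q))). gen s \<notin> set (acyclic_list (n (fst q))))"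
    by (intro computable_ball computable_subst_iterate computable_not computable_member computable_acyclic_list
        computable_step_selectors computable_comp[OF n] computable_comp[OF p] computable_fst computable_snd computable_id)
  from computable_subst_iterate[OF n computable_Least[OF this reduce_steps_ex] p]
  show ?thesis unfolding reduce_steps_def .
qed

subsection \<open>Letter paths\<close>

definition alphabet :: "nat \<Rightarrow> nat list" where
  "alphabet n = map Suc [0..<n]"

lemma set_alphabet [simp]: "set (alphabet n) = {1..n}"
  by (simp add: alphabet_def image_Suc_atLeastLessThan atLeastLessThanSuc_atLeastAtMost)

lemma computable_alphabet [computable_rules]: "computable n \<Longrightarrow> computable (\<lambda>x. alphabet (n x))"
  unfolding alphabet_def by (intro computable_rules)

definition styl2_list :: "nat \<Rightarrow> styl2 list" where
  "styl2_list n = map Eta (alphabet n) @ concat (map (\<lambda>x. concat (map (\<lambda>y. concat (map (\<lambda>z.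
     (if x \<le> y \<and> y < z then [Kappa x y z] else []) @ (if x < y \<and> y \<le> z then [Lambda x y z] else []))
     (alphabet n))) (alphabet n))) (alphabet n))"

lemma set_styl2_list: "set (styl2_list n) = gen2 (styl n)"
proof -
  have "c \<in> set (styl2_list n) \<longleftrightarrow> c \<in> gen2 (styl n)" for c
    by (cases c) (auto simp: styl2_list_def styl_def split: if_splits)
  then show ?thesis by blast
qed

lemma computable_styl2_list [computable_rules]:
  assumes n: "computable n"
  shows "computable (\<lambda>x. styl2_list (n x))"
  unfolding styl2_list_def by (intro computable_rules n computable_comp[OF n])

definition letter_step_list :: "nat \<Rightarrow> nat list \<Rightarrow> (nat, styl2) step list" where
  "letter_step_list n w = concat (map (\<lambda>i. concat (map (\<lambda>c. concat (map (\<lambda>e.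
     let m = (if e then styl_src c else styl_tgt c)
     in if take (length m) (drop i w) = m then [Step (take i w) c e (drop (i + length m) w)] else [])
     [True, False])) (styl2_list n))) [0..<Suc (length w)])"

lemma in_set_concat_map: "y \<in> set (concat (map f xs)) \<longleftrightarrow> (\<exists>x\<in>set xs. y \<in> set (f x))"
  by auto

lemma set_letter_step_list:
  assumes w: "w \<in> lists {1..n}"
  shows "set (letter_step_list n w) = letter_steps n w"
proof -
  have m: "(if e then styl_src c else styl_tgt c) = cell_src (styl n) c e" for c e
    by (simp add: cell_src_def)
  have list: "s \<in> set (letter_step_list n w) \<longleftrightarrow> (\<exists>i c e. i \<le> length w \<and> c \<in> gen2 (styl n) \<and>
      take (length (cell_src (styl n) c e)) (drop i w) = cell_src (styl n) c e \<and>
      s = Step (take i w) c e (drop (i + length (cell_src (styl n) c e)) w))" for s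
  proof -
    have "i \<in> set [0..<Suc (length w)] \<longleftrightarrow> i \<le> length w" "e \<in> set [True, False]"
      "s \<in> set (if b then [a] else []) \<longleftrightarrow> b \<and> s = a" for i e b and a :: "(nat, styl2) step"
      by auto
    then show ?thesis unfolding letter_step_list_def m Let_def in_set_concat_map set_styl2_list by blast
  qed
  have "s \<in> set (letter_step_list n w)" if s: "s \<in> letter_steps n w" for s
  proof -
    obtain l c e r where sc: "s = Step l c e r" by (cases s)
    then have "w = l @ cell_src (styl n) c e @ r" "c \<in> gen2 (styl n)" using s by (auto simp: letter_steps_def)
    then show ?thesis unfolding list sc by (intro exI[of _ "length l"] exI[of _ c] exI[of _ e]) simp
  qed
  moreover have "s \<in> letter_steps n w" if s: "s \<in> set (letter_step_list n w)" for s
  proof -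
    obtain i c e where c: "c \<in> gen2 (styl n)"
      and t: "take (length (cell_src (styl n) c e)) (drop i w) = cell_src (styl n) c e"
      and sc: "s = Step (take i w) c e (drop (i + length (cell_src (styl n) c e)) w)"
      using s unfolding list by blast
    have "cell_src (styl n) c e @ drop (length (cell_src (styl n) c e)) (drop i w) = drop i w"
      using append_take_drop_id[of "length (cell_src (styl n) c e)" "drop i w"] unfolding t .
    then have "take i w @ cell_src (styl n) c e @ drop (i + length (cell_src (styl n) c e)) w = w"
      by (simp add: add.commute)
    moreover have "take i w \<in> lists {1..n}" "drop (i + length (cell_src (styl n) c e)) w \<in> lists {1..n}"
      using w by (auto dest: in_set_takeD in_set_dropD)
    ultimately show ?thesis using c sc by (simp add: letter_steps_def)
  qed
  ultimately show ?thesis by blast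
qed

lemma computable_letter_step_list [computable_rules]:
  assumes n: "computable n" and w: "computable w"
  shows "computable (\<lambda>x. letter_step_list (n x) (w x))"
  unfolding letter_step_list_def Let_def by (intro computable_rules w computable_comp[OF n] computable_comp[OF w])

lemma styl_step_tgt: "step_tgt (styl n) s = lctx s @ (if fwd s then styl_tgt (gen s) else styl_src (gen s)) @ rctx s"
  by (cases s) (simp add: cell_tgt_def)

text \<open>Each path is stored with its end word, so the next layer of the search needs no
  recomputation.\<close>

definition extend_paths :: "nat \<Rightarrow> ((nat, styl2) step list \<times> nat list) list \<Rightarrow> ((nat, styl2) step list \<times> nat list) list" where
  "extend_paths n L = concat (map (\<lambda>x. map (\<lambda>s. (fst x @ [s],
     lctx s @ (if fwd s then styl_tgt (gen s) else styl_src (gen s)) @ rctx s)) (letter_step_list n (snd x))) L)"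

lemma set_extend_paths:
  "set (extend_paths n L) = (\<Union>x\<in>set L. (\<lambda>s. (fst x @ [s], step_tgt (styl n) s)) ` set (letter_step_list n (snd x)))"
  by (simp add: extend_paths_def styl_step_tgt)

lemma computable_extend_paths [computable_rules]:
  assumes n: "computable n" and L: "computable L"
  shows "computable (\<lambda>x. extend_paths (n x) (L x))"
  unfolding extend_paths_def by (intro computable_rules L computable_comp[OF n])

lemma set_extend_paths_iterate:
  assumes U: "U \<in> lists {1..n}"
  shows "set ((extend_paths n ^^ k) [([], U)]) = {(p, v). path (styl n) U p v \<and> length p = k}"
proof (induction k)
  case 0
  show ?case using U by auto
next
  case (Suc k)
  have w: "w \<in> lists {1..n}" if "path (styl n) U p w" for p w
    using path_words(2)[OF poly_styl that] by simp
  have "(q, v) \<in> set ((extend_paths n ^^ Suc k) [([], U)]) \<longleftrightarrow> path (styl n) U q v \<and> length q = Suc k" for q v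
  proof
    assume "(q, v) \<in> set ((extend_paths n ^^ Suc k) [([], U)])"
    then obtain p w s where p: "(p, w) \<in> set ((extend_paths n ^^ k) [([], U)])"
      and s: "s \<in> set (letter_step_list n w)" "q = p @ [s]" "v = step_tgt (styl n) s"
      by (auto simp: set_extend_paths)
    have pw: "path (styl n) U p w" "length p = k" using p Suc by auto
    have st: "is_step (styl n) s" "step_src (styl n) s = w"
      using s(1) set_letter_step_list[OF w[OF pw(1)]] by (auto simp: letter_steps_def)
    have "path (styl n) w [s] v" using st s(3) step_words(2)[OF poly_styl st(1)] by simp
    then show "path (styl n) U q v \<and> length q = Suc k"
      using pw s(2) path_append[OF poly_styl, of n U p "[s]" v] by auto
  next
    assume q: "path (styl n) U q v \<and> length q = Suc k"
    then obtain p s where ps: "q = p @ [s]" "length p = k" by (metis length_Suc_conv_rev)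
    then obtain x where x: "path (styl n) U p x" "path (styl n) x [s] v"
      using q path_append[OF poly_styl] by blast
    have "(p, x) \<in> set ((extend_paths n ^^ k) [([], U)])" using Suc x ps by blast
    moreover have "s \<in> set (letter_step_list n x)"
      using x(2) set_letter_step_list[OF w[OF x(1)]] by (simp add: letter_steps_def)
    moreover have "v = step_tgt (styl n) s" using x(2) by simp
    ultimately show "(q, v) \<in> set ((extend_paths n ^^ Suc k) [([], U)])"
      using ps by (force simp: set_extend_paths)
  qed
  then show ?case by auto
qed

text \<open>Comparing tableaux decides whether a path exists. If there is none, or a letter lies
  outside the alphabet, the second alternative holds and the search stops at 0.\<close>

definition letter_path_length :: "nat \<Rightarrow> nat list \<Rightarrow> nat list \<Rightarrow> nat" where
  "letter_path_length n U V = (LEAST k. (\<exists>x\<in>set ((extend_paths n ^^ k) [([], U)]). snd x = V) \<or>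
     \<not> ((\<forall>a\<in>set U. a \<in> set (alphabet n)) \<and> (\<forall>a\<in>set V. a \<in> set (alphabet n)) \<and> n_tableau U = n_tableau V))"

lemma letter_path_length_ex:
  "\<exists>k. (\<exists>x\<in>set ((extend_paths n ^^ k) [([], U)]). snd x = V) \<or>
     \<not> ((\<forall>a\<in>set U. a \<in> set (alphabet n)) \<and> (\<forall>a\<in>set V. a \<in> set (alphabet n)) \<and> n_tableau U = n_tableau V)"
proof (cases "(\<forall>a\<in>set U. a \<in> set (alphabet n)) \<and> (\<forall>a\<in>set V. a \<in> set (alphabet n)) \<and> n_tableau U = n_tableau V")
  case True
  then have UV: "U \<in> lists {1..n}" "V \<in> lists {1..n}" "n_tableau U = n_tableau V" by auto
  then obtain p where "path (styl n) U p V"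
    using word_cong_path[OF poly_styl] word_cong_iff_n_tableau by blast
  then have "(p, V) \<in> set ((extend_paths n ^^ length p) [([], U)])"
    using set_extend_paths_iterate[OF UV(1)] by blast
  then show ?thesis by force
qed blast

definition find_letter_path :: "nat \<Rightarrow> nat list \<Rightarrow> nat list \<Rightarrow> (nat, styl2) step list" where
  "find_letter_path n U V =
     (let L = map fst (filter (\<lambda>x. snd x = V) ((extend_paths n ^^ letter_path_length n U V) [([], U)]))
      in hd (filter (\<lambda>p. \<forall>q\<in>set L. map letter_key p \<le> map letter_key q) L))"

text \<open>All candidates have the least length, so only keys remain to be compared; their
  injectivity makes the minimum unique, and \<open>hd\<close> returns it.\<close>

lemma find_letter_path_eq:
  assumes c: "word_cong (styl n) U V"
  shows "find_letter_path n U V = letter_path n U V"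
proof -
  have U: "U \<in> lists {1..n}" and V: "V \<in> lists {1..n}"
    using word_cong_words[OF poly_styl c] by simp_all
  define m where "m = letter_path n U V"
  have m: "path (styl n) U m V" and min: "\<And>q. path (styl n) U q V \<Longrightarrow> (length m, map letter_key m) \<le> (length q, map letter_key q)"
    unfolding m_def using letter_path_min[OF c] by blast+
  have len_min: "length m \<le> length q" if "path (styl n) U q V" for q
    using min[OF that] by (auto simp: less_eq_prod_def)
  have key_min: "map letter_key m \<le> map letter_key q" if "path (styl n) U q V" "length q = length m" for q
    using min[OF that(1)] that(2) by (auto simp: less_eq_prod_def)
  note it = set_extend_paths_iterate[OF U]
  have "(\<forall>a\<in>set U. a \<in> set (alphabet n)) \<and> (\<forall>a\<in>set V. a \<in> set (alphabet n)) \<and> n_tableau U = n_tableau V"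
    using U V word_cong_n_tableau[OF c] by auto
  then have "letter_path_length n U V = (LEAST k. \<exists>x\<in>set ((extend_paths n ^^ k) [([], U)]). snd x = V)"
    unfolding letter_path_length_def by simp
  also have "\<dots> = length m"
  proof (rule Least_equality)
    show "\<exists>x\<in>set ((extend_paths n ^^ length m) [([], U)]). snd x = V" using m unfolding it by auto
    show "length m \<le> k" if "\<exists>x\<in>set ((extend_paths n ^^ k) [([], U)]). snd x = V" for k
      using that len_min unfolding it by auto
  qed
  finally have len: "letter_path_length n U V = length m" .
  let ?L = "map fst (filter (\<lambda>x. snd x = V) ((extend_paths n ^^ length m) [([], U)]))"
  let ?M = "filter (\<lambda>p. \<forall>q\<in>set ?L. map letter_key p \<le> map letter_key q) ?L"
  have L: "set ?L = {p. path (styl n) U p V \<and> length p = length m}"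
    using it[of "length m"] by (auto simp: image_iff)
  have "m \<in> set ?M" using m key_min unfolding set_filter L by auto
  then have "hd ?M \<in> set ?M" by (intro hd_in_set length_pos_if_in_set[THEN length_greater_0_conv[THEN iffD1]])
  then have h: "path (styl n) U (hd ?M) V" "length (hd ?M) = length m" "map letter_key (hd ?M) \<le> map letter_key m"
    using m unfolding set_filter L by auto
  then have "map letter_key (hd ?M) = map letter_key m" using key_min[OF h(1,2)] by simp
  from letter_key_inj[OF h(1) m this] show ?thesis
    by (simp add: find_letter_path_def len m_def[symmetric] Let_def)
qed

lemma letter_key_parts:
  "letter_key s = (length (lctx s), styl2_kind (gen s) + (if fwd s then 0 else 3), styl2_params (gen s))"
  by (cases s) simp

lemma computable_letter_path_length [computable_rules]:
  assumes n: "computable n" and U: "computable U" and V: "computable V"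
  shows "computable (\<lambda>x. letter_path_length (n x) (U x) (V x))"
  unfolding letter_path_length_def
  by (intro computable_Least letter_path_length_ex computable_rules computable_comp[OF n] computable_comp[OF U] computable_comp[OF V])

lemma computable_find_letter_path [computable_rules]:
  assumes n: "computable n" and U: "computable U" and V: "computable V"
  shows "computable (\<lambda>x. find_letter_path (n x) (U x) (V x))"
proof -
  define L where "L x = map fst (filter (\<lambda>y. snd y = V x) ((extend_paths (n x) ^^ letter_path_length (n x) (U x) (V x)) [([], U x)]))" for x
  have L: "computable L" unfolding L_def
    by (intro computable_rules n U V computable_comp[OF n] computable_comp[OF V])
  have "computable (\<lambda>x. hd (filter (\<lambda>p. \<forall>q\<in>set (L x). map letter_key p \<le> map letter_key q) (L x)))"
    unfolding letter_key_parts[abs_def]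
    by (intro computable_hd computable_filter computable_ball computable_order_le
        computable_order_list computable_order_prod computable_order_nat computable_rules L computable_comp[OF L])
  then show ?thesis unfolding find_letter_path_def Let_def L_def .
qed

subsection \<open>The generating 3-cells\<close>

definition letter_cell :: "nat \<Rightarrow> row2 \<Rightarrow> (nat, styl2) step list" where
  "letter_cell n \<beta> = find_letter_path n (fst \<beta> @ snd \<beta>) (concat (N2 (fst \<beta>) (snd \<beta>)))"

lemma computable_letter_cell [computable_rules]:
  assumes n: "computable n" and b: "computable b"
  shows "computable (\<lambda>x. letter_cell (n x) (b x))"
  unfolding letter_cell_def by (intro computable_rules n b)

text \<open>A row is already the word of its letters, so \<open>\<lambda>u. u\<close> is the action
  on 1-cells.\<close>

abbreviation letter_functor :: "nat \<Rightarrow> (row, row2) step list \<Rightarrow> (nat, styl2) step list" where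
  "letter_functor n \<equiv> map_steps (\<lambda>u. u) (letter_cell n)"

lemma contract_E_path: "map_steps letters contract_cell (E_path W) = []"
  by (induction W) (auto simp: map_steps_whisker)

lemma contract_embed: "map_steps letters contract_cell (map embed_step p) = map embed_step p"
proof (induction p)
  case (Cons s p)
  then show ?case by (cases s) (auto simp: map_word_letters inv_steps_def)
qed simp

lemma map_word_hd_letters: "map_word (\<lambda>u. [hd u]) (letters w) = w"
  by (induction w) auto

lemma identify_embed_step: "map_steps (\<lambda>u. [hd u]) (\<lambda>\<beta>. [Step [] (the_letter \<beta>) True []]) (map embed_step p) = p"
proof (induction p)
  case (Cons s p)
  then show ?case by (cases s) (auto simp: map_word_hd_letters inv_steps_def)
qed simp

text \<open>Contraction deletes the two \<open>E_path\<close> parts, which consist of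
  \<open>Gamma\<close> cells only; identification then undoes the embedding of the shortest letter
  path.\<close>

lemma identify_KE_cell:
  assumes "\<beta> \<in> gen2 (row_pres n)"
  shows "map_steps (\<lambda>u. [hd u]) (\<lambda>\<beta>. [Step [] (the_letter \<beta>) True []]) (KE_cell n \<beta>) = letter_cell n \<beta>"
proof -
  obtain u v where \<beta>: "\<beta> = (u, v)" by (cases \<beta>)
  have c: "word_cong (styl n) (concat [u, v]) (concat (N2 u v))" using row2_word_cong assms \<beta> by blast
  have "P_path n \<beta> = E_path [u, v] @ map embed_step (letter_path n (concat [u, v]) (concat (N2 u v))) @ inv_steps (E_path (N2 u v))"
    using Pi_path_eq[OF c] \<beta> by (simp add: P_path_def Let_def flat_letters)
  then have "KE_cell n \<beta> = map embed_step (letter_path n (concat [u, v]) (concat (N2 u v)))"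
    by (simp only: map_steps_simps map_steps_inv contract_E_path contract_embed inv_steps_simps append_Nil append_Nil2)
  then show ?thesis using find_letter_path_eq[OF c] \<beta> by (simp add: identify_embed_step letter_cell_def)
qed

lemma identify_KE:
  assumes "path (base (row_red n)) W p v"
  shows "identify (letters (concat w), map_steps letters (KE_cell n) p) = (concat w, letter_functor n p)"
proof -
  have "gen ` set p \<subseteq> gen2 (row_pres n)" using assms path_UNIV[of "base (row_red n)" W p v] by (auto simp: row_red_def)
  then have g: "gen s \<in> gen2 (row_pres n)" if "s \<in> set p" for s using that by blast
  have "map_steps (\<lambda>u. u) (\<lambda>\<beta>. map_steps (\<lambda>u. [hd u]) (\<lambda>\<beta>. [Step [] (the_letter \<beta>) True []]) (KE_cell n \<beta>)) p = letter_functor n p"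
    by (rule map_steps_cong) (rule identify_KE_cell[OF g])
  then show ?thesis
    by (simp add: identify_def map_steps_map_steps map_word_hd_letters)
qed

definition row_entry :: "nat \<Rightarrow> triple \<Rightarrow> coh3 \<times> (nat, styl2) zigzag \<times> (nat, styl2) zigzag" where
  "row_entry n \<tau> = (RowCell \<tau>, (concat (triple_word \<tau>), letter_functor n (reduce_steps n (L_steps n \<tau>))),
     (concat (triple_word \<tau>), letter_functor n (reduce_steps n (R_steps n \<tau>))))"

definition transport_steps :: "nat \<Rightarrow> row list \<Rightarrow> row list \<Rightarrow> (nat, styl2) step list" where
  "transport_steps n v w = letter_functor n (reduce_steps n (norm_steps n v @ inv_steps (norm_steps n w)))"

definition letter_entry :: "nat \<Rightarrow> styl2 \<Rightarrow> coh3 \<times> (nat, styl2) zigzag \<times> (nat, styl2) zigzag" where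
  "letter_entry n c = (TransportCell (Letter c),
     (styl_src c, transport_steps n (letters (styl_src c)) (letters (styl_tgt c))), (styl_src c, [Step [] c True []]))"

definition gamma_entry :: "nat \<Rightarrow> row \<Rightarrow> coh3 \<times> (nat, styl2) zigzag \<times> (nat, styl2) zigzag" where
  "gamma_entry n u = (TransportCell (Gamma u), (u, transport_steps n (letters u) [u]), (u, []))"

definition entries :: "nat \<Rightarrow> (coh3 \<times> (nat, styl2) zigzag \<times> (nat, styl2) zigzag) list" where
  "entries n = map (row_entry n) (filter (\<lambda>\<tau>. \<tau> \<notin> set (map (tau_in (kept_list n)) (acyclic_list n))) (triples_list n)) @
     map (letter_entry n) (styl2_list n) @ map (gamma_entry n) (filter (\<lambda>u. 2 \<le> length u) (rows_list n))"

lemma row_entry_eq: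
  assumes "\<tau> \<in> triples_T1 n"
  shows "row_entry n \<tau> = (RowCell \<tau>, src3 (styl_coh_letters n) (RowCell \<tau>), tgt3 (styl_coh_letters n) (RowCell \<tau>))"
proof -
  obtain v where v: "path (row_pres n) (triple_word \<tau>) (L_path n \<tau>) v" "path (row_pres n) (triple_word \<tau>) (R_path n \<tau>) v"
    using assms by (rule triple_T1_paths)
  show ?thesis
    unfolding row_entry_def styl_coh_letters_simps styl_coh_simps
      identify_KE[OF red_steps_path[OF v(1)]] identify_KE[OF red_steps_path[OF v(2)]] LR_steps_eq[OF assms] reduce_steps_eq
    by (rule HOL.refl)
qed

lemma transport_eq:
  assumes "\<delta> \<in> gen2 (prerow n)"
  shows "src3 (styl_coh_letters n) (TransportCell \<delta>) = (concat (prerow_src \<delta>), transport_steps n (prerow_src \<delta>) (prerow_tgt \<delta>))"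
proof -
  have "path (base (row_red n)) (prerow_src \<delta>) (Q_steps n \<delta>) (prerow_tgt \<delta>)"
    using Q_functor[of n] assms by (simp add: track_functor_def)
  moreover have "norm_steps n (prerow_src \<delta>) = norm_path n (prerow_src \<delta>)" "norm_steps n (prerow_tgt \<delta>) = norm_path n (prerow_tgt \<delta>)"
    using prerow_words[OF assms] norm_steps_eq by blast+
  ultimately show ?thesis
    by (simp add: styl_coh_letters_simps styl_coh_simps identify_KE transport_steps_def reduce_steps_eq Q_steps_def del: map_steps_simps)
qed

lemma letter_entry_eq:
  assumes "c \<in> gen2 (styl n)"
  shows "letter_entry n c = (TransportCell (Letter c), src3 (styl_coh_letters n) (TransportCell (Letter c)), tgt3 (styl_coh_letters n) (TransportCell (Letter c)))"
  using transport_eq[of "Letter c" n] assms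
  by (simp add: letter_entry_def styl_coh_letters_simps(4) styl_coh_simps identify_def map_word_hd_letters)

lemma gamma_entry_eq:
  assumes "u \<in> rows2 n"
  shows "gamma_entry n u = (TransportCell (Gamma u), src3 (styl_coh_letters n) (TransportCell (Gamma u)), tgt3 (styl_coh_letters n) (TransportCell (Gamma u)))"
  using transport_eq[of "Gamma u" n] assms
  by (simp add: gamma_entry_def styl_coh_letters_simps(4) styl_coh_simps identify_def map_word_hd_letters)

text \<open>The listed boundaries are the defining zigzags themselves, so in the final statement
  \<open>zz_eq\<close> is needed only through reflexivity.\<close>

lemma set_entries:
  "set (entries n) = (\<lambda>A. (A, src3 (styl_coh_letters n) A, tgt3 (styl_coh_letters n) A)) ` gen3 (styl_coh_letters n)"
proof -
  let ?e = "\<lambda>A. (A, src3 (styl_coh_letters n) A, tgt3 (styl_coh_letters n) A)"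
  have "tau_in (kept_list n) \<beta> = tau n \<beta>" if "\<beta> \<in> B_acyc n" for \<beta>
    using tau_in_eq(1) B_acyc_subset that by blast
  then have "tau_in (kept_list n) ` B_acyc n = tau n ` B_acyc n" by (rule image_cong[OF HOL.refl])
  then have 1: "set (filter (\<lambda>\<tau>. \<tau> \<notin> set (map (tau_in (kept_list n)) (acyclic_list n))) (triples_list n)) = gen3 (row_red n)"
    by (auto simp: set_acyclic_list set_triples_list row_red_simps)
  have 2: "set (filter (\<lambda>u. 2 \<le> length u) (rows_list n)) = rows2 n"
    by (auto simp: set_rows_list rows2_def)
  have "row_entry n ` gen3 (row_red n) = ?e ` RowCell ` gen3 (row_red n)"
    unfolding image_image by (rule image_cong[OF HOL.refl row_entry_eq]) (simp add: row_red_simps)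
  moreover have "letter_entry n ` gen2 (styl n) = ?e ` TransportCell ` Letter ` gen2 (styl n)"
    unfolding image_image by (rule image_cong[OF HOL.refl letter_entry_eq])
  moreover have "gamma_entry n ` rows2 n = ?e ` TransportCell ` Gamma ` rows2 n"
    unfolding image_image by (rule image_cong[OF HOL.refl gamma_entry_eq])
  moreover have "gen3 (styl_coh_letters n) = RowCell ` gen3 (row_red n) \<union> TransportCell ` Letter ` gen2 (styl n) \<union> TransportCell ` Gamma ` rows2 n"
    by (simp add: styl_coh_letters_simps styl_coh_simps prerow_def image_Un Un_assoc)
  ultimately show ?thesis
    unfolding entries_def set_append set_map[of "row_entry n"] set_map[of "letter_entry n"] set_map[of "gamma_entry n"] 1 2 set_styl2_list
    by (simp only: image_Un Un_assoc)
qed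

lemma list_encode_enc: "list_encode xs = enc xs"
  by (simp add: enc_list_def map_idI)

lemma computable_list_encode [computable_rules]: "computable l \<Longrightarrow> computable (\<lambda>x. list_encode (l x))"
  unfolding list_encode_enc by (intro computable_rules)

lemma step_code_parts:
  "step_code s = list_encode [list_encode (lctx s), list_encode (styl2_kind (gen s) # styl2_params (gen s)), of_bool (fwd s), list_encode (rctx s)]"
  by (cases s) simp

lemma computable_zigzag_code [computable_rules]:
  assumes u: "computable u" and p: "computable p"
  shows "computable (\<lambda>x. zigzag_code (u x, p x))"
  unfolding zigzag_code.simps step_code_parts[abs_def] by (intro computable_rules u p)

lemma computable_transport_steps [computable_rules]:
  assumes n: "computable n" and v: "computable v" and w: "computable w"
  shows "computable (\<lambda>x. transport_steps (n x) (v x) (w x))"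
  unfolding transport_steps_def by (intro computable_rules n v w computable_comp[OF n])

lemma computable_letters [computable_rules]:
  assumes w: "computable w"
  shows "computable (\<lambda>x. letters (w x))"
  unfolding letters_def by (intro computable_rules w)

lemma coh3_code_RowCell:
  "coh3_code (RowCell \<tau>) = prod_encode (0, list_encode [list_encode (fst \<tau>), list_encode (fst (snd \<tau>)), list_encode (snd (snd \<tau>))])"
  by (cases \<tau>) simp

lemma concat_triple_word: "concat (triple_word \<tau>) = fst \<tau> @ fst (snd \<tau>) @ snd (snd \<tau>)"
  by (cases \<tau>) simp

lemma computable_row_entry:
  assumes n: "computable n" and t: "computable t"
  shows "computable (\<lambda>x. entry_code (row_entry (n x) (t x)))"
  unfolding row_entry_def entry_code.simps coh3_code_RowCell concat_triple_word
  by (intro computable_rules n t computable_comp[OF n])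

lemma computable_letter_entry:
  assumes n: "computable n" and c: "computable c"
  shows "computable (\<lambda>x. entry_code (letter_entry (n x) (c x)))"
  unfolding letter_entry_def entry_code.simps coh3_code.simps prerow2_code.simps styl2_code.simps
  by (intro computable_rules n c)

lemma computable_gamma_entry:
  assumes n: "computable n" and u: "computable u"
  shows "computable (\<lambda>x. entry_code (gamma_entry (n x) (u x)))"
  unfolding gamma_entry_def entry_code.simps coh3_code.simps prerow2_code.simps
  by (intro computable_rules n u)

lemma computable_entries: "computable (\<lambda>n. list_encode (map entry_code (entries n)))"
  unfolding entries_def map_append map_map comp_def
  by (intro computable_rules computable_row_entry computable_letter_entry computable_gamma_entry)

theorem effectively_computable_styl_coh_letters: "effectively_computable styl_coh_letters"
  unfolding effectively_computable_def
proof (intro exI[of _ "\<lambda>n. list_encode (map entry_code (entries n))"] conjI allI impI)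
  show "total_recursive (\<lambda>n. list_encode (map entry_code (entries n)))"
    using computable_entries by (simp add: computable_def)
  fix n :: nat
  let ?Q = "styl_coh_letters n"
  have "is_polygraph31 ?Q" using styl_coh_coherent by blast
  then have "is_zigzag (base ?Q) (src3 ?Q A)" "is_zigzag (base ?Q) (tgt3 ?Q A)" if "A \<in> gen3 ?Q" for A
    using that by (auto simp: is_polygraph31_def)
  then have "\<forall>(A, f, g)\<in>set (entries n). zz_eq (base ?Q) f (src3 ?Q A) \<and> zz_eq (base ?Q) g (tgt3 ?Q A)"
    unfolding set_entries by (auto intro: zz_eq.refl)
  moreover have "fst ` set (entries n) = gen3 ?Q" unfolding set_entries by (simp add: image_image)
  ultimately show "\<exists>es. list_encode (map entry_code (entries n)) = list_encode (map entry_code es) \<and>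
      fst ` set es = gen3 ?Q \<and> (\<forall>(A, f, g)\<in>set es. zz_eq (base ?Q) f (src3 ?Q A) \<and> zz_eq (base ?Q) g (tgt3 ?Q A))"
    by blast
qed

theorem theorem4p4p5:
  shows "(\<forall>n\<ge>1.
            finite_polygraph31 (styl_coh n) \<and> coherent_presentation (styl_coh n) (Styl n) \<and>
            polygraph2_iso (\<lambda>x. [x]) Letter (styl n) (base (styl_coh n)) \<and>
            is_polygraph31 (styl_coh_letters n) \<and>
            finite (gen3 (styl_coh_letters n)) \<and> homotopy_basis (styl_coh_letters n)) \<and>
         effectively_computable styl_coh_letters"
  using styl_coh_coherent effectively_computable_styl_coh_letters by blast

end
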